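(* For $n\ge2$, choose $N$ points $X_1,\dots,X_N$ independently with respect to the uniform probability measure $\sigma$ on the unit sphere $\mathbb{S}^{n-1}\subset\mathbb{R}^n$, and let $P_N:=\mathrm{conv}\{X_1,\dots,X_N\}$. Then for every $j\in\{1,\dots,n\}$, $$\limsup_{N\to\infty}\frac{\mathbb{E}\,\Delta_j(D_n,P_N)}{\Delta_j(D_n,\mathscr{P}_N^i)}=1+O\Big(\frac{\ln n}{n}\Big),$$ where $O(\cdot)$ refers to $n\to\infty$ with an absolute implied constant (independent of $j$).
   Context: $D_n$ is the closed Euclidean unit ball in $\mathbb{R}^n$ and $|\cdot|$ is volume. The intrinsic volumes $V_0,\dots,V_n$ of a compact convex set $K\subset\mathbb{R}^n$ are defined by Steiner's formula $|K+rD_n|=\sum_{j=0}^nr^j|D_j|V_{n-j}(K)$ for all $r\ge0$. The $j$th intrinsic volume deviation is $\Delta_j(K,L)=V_j(K)+V_j(L)-2V_j(K\cap L)$, and $\Delta_j(D_n,\mathscr{P}_N^i)=\min\Delta_j(D_n,P)$ over all convex polytopes $P\subset D_n$ with at most $N$ vertices. *)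

theory Defs
  imports "HOL-Analysis.Analysis" "HOL-Probability.Probability" "HOL-Library.Function_Algebras"
begin

text \<open>
  The dimension is quantified inside the statement (the implied constant must not depend on it), so
  it cannot be a type. As in \<^const>\<open>Euclidean_space\<close>, the space of dimension \<open>n\<close> is the set of
  sequences that vanish from index \<open>n\<close> on. The pointwise vector space structure on functions makes
  the library notions of convex hull, extreme point and polytope available for such sequences.
  The metric that the library puts on \<^typ>\<open>nat \<Rightarrow> real\<close> is not the Euclidean one and is not used.
\<close>

instantiation "fun" :: (type, real_vector) real_vector
begin

definition scaleR_fun :: "real \<Rightarrow> ('a \<Rightarrow> 'b) \<Rightarrow> 'a \<Rightarrow> 'b" where
  "scaleR_fun r f = (\<lambda>x. r *\<^sub>R f x)"

instance
  by standard (simp_all add: scaleR_fun_def fun_eq_iff scaleR_add_right scaleR_add_left)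

end

definition eucl_norm :: "nat \<Rightarrow> (nat \<Rightarrow> real) \<Rightarrow> real" where
  "eucl_norm n x = L2_set x {..<n}"

definition unit_ball :: "nat \<Rightarrow> (nat \<Rightarrow> real) set" where
  "unit_ball n = {x \<in> topspace (Euclidean_space n). eucl_norm n x \<le> 1}"

text \<open>
  Lebesgue measure of dimension \<open>n\<close>, carried by \<^term>\<open>topspace (Euclidean_space n)\<close>; for \<open>n = 0\<close> it
  is the point mass at the origin, so that \<open>volume 0 (unit_ball 0) = 1\<close>.
\<close>

definition eucl_lborel :: "nat \<Rightarrow> (nat \<Rightarrow> real) measure" where
  "eucl_lborel n = distr (Pi\<^sub>M {..<n} (\<lambda>_. lborel)) borel (\<lambda>x i. if i < n then x i else 0)"

definition volume :: "nat \<Rightarrow> (nat \<Rightarrow> real) set \<Rightarrow> real" where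
  "volume n A = measure (eucl_lborel n) A"

text \<open>
  Steiner's formula determines the numbers \<open>V 0, \<dots>, V n\<close>, since both sides are polynomials in \<open>r\<close> and
  the volumes of the unit balls are positive. Requiring \<open>V i = 0\<close> beyond \<open>n\<close> makes the function \<open>V\<close>
  itself unique. The value is meaningful for compact convex \<open>K\<close>.
\<close>

definition intrinsic_volume :: "nat \<Rightarrow> nat \<Rightarrow> (nat \<Rightarrow> real) set \<Rightarrow> real" where
  "intrinsic_volume n j K =
    (THE V. (\<forall>i>n. V i = 0) \<and>
       (\<forall>r\<ge>0. volume n {x + r *\<^sub>R y | x y. x \<in> K \<and> y \<in> unit_ball n} =
               (\<Sum>i\<le>n. r ^ i * volume i (unit_ball i) * V (n - i)))) j"

definition deviation :: "nat \<Rightarrow> nat \<Rightarrow> (nat \<Rightarrow> real) set \<Rightarrow> (nat \<Rightarrow> real) set \<Rightarrow> real" where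
  "deviation n j K L =
    intrinsic_volume n j K + intrinsic_volume n j L - 2 * intrinsic_volume n j (K \<inter> L)"

definition inscribed_polytopes :: "nat \<Rightarrow> nat \<Rightarrow> (nat \<Rightarrow> real) set set" where
  "inscribed_polytopes n N =
    {P. polytope P \<and> P \<noteq> {} \<and> P \<subseteq> unit_ball n \<and> card {v. v extreme_point_of P} \<le> N}"

text \<open>The minimum is attained for \<open>N \<ge> 1\<close> by compactness, so it is the infimum.\<close>

definition best_deviation :: "nat \<Rightarrow> nat \<Rightarrow> nat \<Rightarrow> real" where
  "best_deviation n j N = (INF P\<in>inscribed_polytopes n N. deviation n j (unit_ball n) P)"

definition unit_sphere :: "nat \<Rightarrow> (nat \<Rightarrow> real) set" where
  "unit_sphere n = {x \<in> topspace (Euclidean_space n). eucl_norm n x = 1}"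

text \<open>
  The uniform probability measure on the unit sphere, as the normalized cone measure: the radial
  projection of a uniformly distributed point of the ball. The projection sends the origin, a null
  set for \<open>n \<ge> 1\<close>, to itself, so the image measure is concentrated on the sphere; restricting it
  makes the sphere the underlying space.
\<close>

definition sphere_measure :: "nat \<Rightarrow> (nat \<Rightarrow> real) measure" where
  "sphere_measure n =
    restrict_space
      (distr (uniform_measure (eucl_lborel n) (unit_ball n)) borel (\<lambda>x. (1 / eucl_norm n x) *\<^sub>R x))
      (unit_sphere n)"

definition expected_deviation :: "nat \<Rightarrow> nat \<Rightarrow> nat \<Rightarrow> real" where
  "expected_deviation n j N =
    (\<integral>X. deviation n j (unit_ball n) (convex hull (X ` {..<N}))
       \<partial>(Pi\<^sub>M {..<N} (\<lambda>_. sphere_measure n)))"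

end

theory Submission
  imports Defs
begin

text \<open>
Let \<open>P\<close> be a polytope in the unit ball \<open>B\<close>, with support function \<open>h\<close> and radial function
\<open>\<rho>\<close> on the sphere. By Kubota's principle (here: Cauchy's formula applied recursively) \<open>V\<^sub>j(P) / V\<^sub>j(B)\<close> is the
mean, over \<open>j\<close>-dimensional projections of \<open>P\<close>, of the normalized volume of the projection, and the
latter lies between the means of \<open>\<rho>\<^sup>j\<close> and of \<open>h\<^sup>j\<close>. No formula for \<open>V\<^sub>j\<close> finer than this is needed.

For the best polytope, \<open>h\<close> exceeds the height \<open>\<eta>\<close> of a cap only on the \<open>N\<close> caps around the
vertices. Choosing the caps of measure \<open>1 / (n N)\<close> gives a lower bound for the deviation, of order
\<open>j (n N)\<^bsup>-2/(n-1)\<^esup>\<close> up to the same constants as in the upper bound.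

For the random polytope, \<open>x \<notin> P\<^sub>N\<close> means that a half space with \<open>x\<close> on its boundary contains all
the points. Splitting each point into its component along \<open>x\<close> and a symmetric remaining direction, a
count of sign patterns in the manner of Wendel bounds the probability by
\<open>2\<^bsup>n+1\<^esup> (1 - p)\<^sup>N\<close>, where \<open>p\<close> is the measure of a cap of comparable size.

Upper and lower bound thus correspond to caps whose measures differ by a factor polynomial in \<open>n\<close>. The
deviation depends on the cap measure through its power \<open>2 / (n - 1)\<close>, so this factor costs only
\<open>(n\<^bsup>O(1)\<^esup>)\<^bsup>2/(n-1)\<^esup> = 1 + O(ln n / n)\<close>.
\<close>

section \<open>Coordinate spaces\<close>

text \<open>\<open>intrinsic_volume\<close> is a definite description, so Steiner's formula must be
  proved before anything is known about it. It comes from Cauchy's formula integrated over the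
  radius: sweeping a parallel body along a short segment adds the length of the segment times the
  volume of the shadow, and the mean of this gain over all directions is compared with the volume of
  the shell around the body. The shadow has one dimension less, hence is polynomial in the radius by
  induction, and integration keeps it polynomial.

  Both estimates are stated so that they survive the recursion over projections: the mean of the cap
  measures seen in the projections is again a cap measure, and a projection covers the image of
  every point that is covered.

  Origin of the constants, with d = n - 1: caps are measured by the tangent of their angular radius.
  The best polytope is tested with caps of measure about 1 / (n N), the random one with caps 16 n^2
  times larger, large enough to beat the factor 2^n of the pattern count. The tilted chord in the
  counting argument costs a further factor 3. Depths behave like squared tangents, so they differ by
  the d-th root of 3 (16 n^2)^2.\<close>

definition espace :: "nat \<Rightarrow> (nat \<Rightarrow> real) set" where
  "espace n = {x. \<forall>i\<ge>n. x i = 0}"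

definition ip :: "nat \<Rightarrow> (nat \<Rightarrow> real) \<Rightarrow> (nat \<Rightarrow> real) \<Rightarrow> real" where
  "ip n x y = (\<Sum>i<n. x i * y i)"

lemma topspace_espace: "topspace (Euclidean_space n) = espace n"
  by (simp add: topspace_Euclidean_space espace_def)

text \<open>As simplification rules these would also rewrite unapplied sums into abstractions.\<close>

declare plus_fun_apply [simp del] zero_fun_apply [simp del]

lemma fun_app:
  fixes f g :: "nat \<Rightarrow> real"
  shows "(f + g) x = f x + g x" "(f - g) x = f x - g x" "(- f) x = - f x"
    "(r *\<^sub>R f) x = r * f x" "(0 :: nat \<Rightarrow> real) x = 0"
  by (simp_all add: plus_fun_apply fun_diff_def fun_Compl_def scaleR_fun_def zero_fun_apply)

lemma espace_add: "x \<in> espace n \<Longrightarrow> y \<in> espace n \<Longrightarrow> x + y \<in> espace n"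
  and espace_diff: "x \<in> espace n \<Longrightarrow> y \<in> espace n \<Longrightarrow> x - y \<in> espace n"
  and espace_scaleR: "x \<in> espace n \<Longrightarrow> c *\<^sub>R x \<in> espace n"
  and espace_uminus: "x \<in> espace n \<Longrightarrow> - x \<in> espace n"
  and espace_zero [simp]: "0 \<in> espace n"
  by (auto simp: espace_def fun_app)

lemma espace_upd: "x \<in> espace n \<Longrightarrow> x(n := h) \<in> espace (Suc n)"
  by (auto simp: espace_def)

lemma espace_upd0: "x \<in> espace (Suc n) \<Longrightarrow> x(n := 0) \<in> espace n"
  by (auto simp: espace_def dest: le_neq_implies_less Suc_leI)

lemma espace_0: "espace 0 = {0}"
  by (auto simp: espace_def fun_eq_iff fun_app)

lemma espace_Suc_mono: "x \<in> espace n \<Longrightarrow> x \<in> espace (Suc n)"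
  by (auto simp: espace_def)

lemma ip_simps:
  "ip n (x + y) z = ip n x z + ip n y z"
  "ip n z (x + y) = ip n z x + ip n z y"
  "ip n (x - y) z = ip n x z - ip n y z"
  "ip n z (x - y) = ip n z x - ip n z y"
  "ip n (c *\<^sub>R x) z = c * ip n x z"
  "ip n z (c *\<^sub>R x) = c * ip n z x"
  "ip n (- x) z = - ip n x z"
  "ip n z (- x) = - ip n z x"
  "ip n 0 z = 0"
  "ip n z 0 = 0"
  by (simp_all add: ip_def fun_app algebra_simps sum.distrib sum_subtractf sum_negf sum_distrib_left)

lemma sum_fun_apply: "(\<Sum>a\<in>A. f a) i = (\<Sum>a\<in>A. f a i :: 'b :: comm_monoid_add)"
  by (induction A rule: infinite_finite_induct) (simp_all add: zero_fun_def plus_fun_def)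

lemma ip_sum_left: "ip n (\<Sum>a\<in>A. f a) z = (\<Sum>a\<in>A. ip n (f a) z)"
  unfolding ip_def sum_fun_apply sum_distrib_right by (rule sum.swap)

lemma ip_commute: "ip n x y = ip n y x"
  by (simp add: ip_def mult.commute)

lemma ip_Suc: "ip (Suc n) x y = ip n x y + x n * y n"
  by (simp add: ip_def)

lemma ip_upd: "ip n (x(n := h)) y = ip n x y" "ip n y (x(n := h)) = ip n y x"
  by (auto simp: ip_def intro!: sum.cong)

lemma ip_nonneg [simp]: "0 \<le> ip n x x"
  by (simp add: ip_def sum_nonneg)

lemma norm_eq_ip: "eucl_norm n x = sqrt (ip n x x)"
  by (simp add: eucl_norm_def L2_set_def ip_def power2_eq_square)

lemma norm_ge_0 [simp]: "0 \<le> eucl_norm n x"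
  by (simp add: norm_eq_ip)

lemma norm_sq: "(eucl_norm n x)\<^sup>2 = ip n x x"
  by (simp add: norm_eq_ip)

lemma norm_0 [simp]: "eucl_norm n 0 = 0"
  by (simp add: norm_eq_ip ip_simps)

lemma norm_scaleR: "eucl_norm n (c *\<^sub>R x) = \<bar>c\<bar> * eucl_norm n x"
  by (simp add: norm_eq_ip ip_simps real_sqrt_mult flip: mult.assoc)

lemma norm_uminus: "eucl_norm n (- x) = eucl_norm n x"
  by (simp add: norm_eq_ip ip_simps)

lemma norm_triangle: "eucl_norm n (x + y) \<le> eucl_norm n x + eucl_norm n y"
  using L2_set_triangle_ineq[of x y "{..<n}"] by (simp add: eucl_norm_def plus_fun_def)

lemma ip_le_norm: "ip n x y \<le> eucl_norm n x * eucl_norm n y"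
proof -
  have "ip n x y \<le> (\<Sum>i<n. \<bar>x i\<bar> * \<bar>y i\<bar>)"
    unfolding ip_def by (intro sum_mono) (simp add: flip: abs_mult)
  also have "\<dots> \<le> eucl_norm n x * eucl_norm n y"
    using L2_set_mult_ineq[of x y "{..<n}"] by (simp add: eucl_norm_def)
  finally show ?thesis .
qed

lemma norm_eq_0: "x \<in> espace n \<Longrightarrow> eucl_norm n x = 0 \<longleftrightarrow> x = 0"
  by (auto simp: eucl_norm_def espace_def fun_eq_iff fun_app L2_set_eq_0_iff not_less[symmetric])

lemma norm_upd: "eucl_norm n (x(n := h)) = eucl_norm n x"
  by (simp add: norm_eq_ip ip_upd)

lemma norm_Suc_upd: "eucl_norm (Suc n) (x(n := h)) = sqrt ((eucl_norm n x)\<^sup>2 + h\<^sup>2)"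
  by (simp add: norm_eq_ip ip_Suc ip_upd power2_eq_square)

lemma abs_le_norm: "i < n \<Longrightarrow> \<bar>x i\<bar> \<le> eucl_norm n x"
  unfolding eucl_norm_def using member_le_L2_set[of "{..<n}" i "\<lambda>i. \<bar>x i\<bar>"] by (simp add: L2_set_def)

lemma unit_ball_eq: "unit_ball n = {x \<in> espace n. eucl_norm n x \<le> 1}"
  by (simp add: unit_ball_def topspace_espace)

lemma unit_sphere_eq: "unit_sphere n = {x \<in> espace n. eucl_norm n x = 1}"
  by (simp add: unit_sphere_def topspace_espace)

subsection \<open>Measurability\<close>

lemma borel_measurable_fun_coord:
  fixes f :: "'a \<Rightarrow> nat \<Rightarrow> real"
  shows "f \<in> borel_measurable M \<Longrightarrow> (\<lambda>x. f x i) \<in> borel_measurable M"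
  by (rule measurable_product_then_coordinatewise)

lemma borel_measurable_funI:
  fixes f :: "'a \<Rightarrow> nat \<Rightarrow> real"
  shows "(\<And>i. (\<lambda>x. f x i) \<in> borel_measurable M) \<Longrightarrow> f \<in> borel_measurable M"
  by (rule measurable_coordinatewise_then_product)

lemma borel_measurable_fun_add [measurable (raw)]:
  fixes f g :: "'a \<Rightarrow> nat \<Rightarrow> real"
  assumes "f \<in> borel_measurable M" "g \<in> borel_measurable M"
  shows "(\<lambda>x. f x + g x) \<in> borel_measurable M"
  by (rule borel_measurable_funI) (simp add: fun_app assms borel_measurable_fun_coord borel_measurable_add)

lemma borel_measurable_fun_diff [measurable (raw)]:
  fixes f g :: "'a \<Rightarrow> nat \<Rightarrow> real"
  assumes "f \<in> borel_measurable M" "g \<in> borel_measurable M"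
  shows "(\<lambda>x. f x - g x) \<in> borel_measurable M"
  by (rule borel_measurable_funI) (simp add: fun_app assms borel_measurable_fun_coord borel_measurable_diff)

lemma borel_measurable_fun_scaleR [measurable (raw)]:
  fixes f :: "'a \<Rightarrow> nat \<Rightarrow> real"
  assumes "h \<in> borel_measurable M" "f \<in> borel_measurable M"
  shows "(\<lambda>x. h x *\<^sub>R f x) \<in> borel_measurable M"
  by (rule borel_measurable_funI) (simp add: fun_app assms borel_measurable_fun_coord borel_measurable_times)

lemma borel_measurable_fun_uminus [measurable (raw)]:
  fixes f :: "'a \<Rightarrow> nat \<Rightarrow> real"
  assumes "f \<in> borel_measurable M"
  shows "(\<lambda>x. - f x) \<in> borel_measurable M"
  by (rule borel_measurable_funI) (simp add: fun_app assms borel_measurable_fun_coord borel_measurable_uminus)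

lemma borel_measurable_fun_upd [measurable (raw)]:
  fixes f :: "'a \<Rightarrow> nat \<Rightarrow> real"
  assumes "f \<in> borel_measurable M" "h \<in> borel_measurable M"
  shows "(\<lambda>x. (f x)(n := h x)) \<in> borel_measurable M"
proof (rule borel_measurable_funI)
  fix i show "(\<lambda>x. ((f x)(n := h x)) i) \<in> borel_measurable M"
    by (cases "i = n") (simp_all add: assms borel_measurable_fun_coord)
qed

lemma borel_measurable_fun_sum [measurable (raw)]:
  fixes f :: "'b \<Rightarrow> 'a \<Rightarrow> nat \<Rightarrow> real"
  assumes "\<And>a. a \<in> A \<Longrightarrow> f a \<in> borel_measurable M"
  shows "(\<lambda>x. \<Sum>a\<in>A. f a x) \<in> borel_measurable M"
  using assms by (induction A rule: infinite_finite_induct) (simp_all add: zero_fun_def borel_measurable_fun_add[unfolded plus_fun_def] plus_fun_def)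

lemma borel_measurable_ip [measurable (raw)]:
  assumes "f \<in> borel_measurable M" "g \<in> borel_measurable M"
  shows "(\<lambda>x. ip n (f x) (g x)) \<in> borel_measurable M"
  unfolding ip_def
  by (intro borel_measurable_sum borel_measurable_times borel_measurable_fun_coord assms)

lemma borel_measurable_eucl_norm [measurable (raw)]:
  assumes [measurable]: "f \<in> borel_measurable M"
  shows "(\<lambda>x. eucl_norm n (f x)) \<in> borel_measurable M"
  unfolding norm_eq_ip by measurable

lemma continuous_on_ip [continuous_intros]:
  assumes "continuous_on S f" "continuous_on S g"
  shows "continuous_on S (\<lambda>x. ip n (f x) (g x))"
  unfolding ip_def
  by (intro continuous_on_sum continuous_on_mult continuous_on_product_then_coordinatewise[where f = f]
      continuous_on_product_then_coordinatewise[where f = g] assms)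

lemma continuous_on_eucl_norm [continuous_intros]:
  assumes "continuous_on S f"
  shows "continuous_on S (\<lambda>x. eucl_norm n (f x))"
  unfolding norm_eq_ip by (intro continuous_intros assms)

lemma continuous_on_fun_add [continuous_intros]:
  fixes f g :: "'a::topological_space \<Rightarrow> nat \<Rightarrow> real"
  assumes "continuous_on S f" "continuous_on S g"
  shows "continuous_on S (\<lambda>x. f x + g x)"
  by (rule continuous_on_coordinatewise_then_product)
    (simp add: fun_app assms continuous_on_product_then_coordinatewise continuous_on_add)

lemma continuous_on_fun_diff [continuous_intros]:
  fixes f g :: "'a::topological_space \<Rightarrow> nat \<Rightarrow> real"
  assumes "continuous_on S f" "continuous_on S g"
  shows "continuous_on S (\<lambda>x. f x - g x)"
  by (rule continuous_on_coordinatewise_then_product)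
    (simp add: fun_app assms continuous_on_product_then_coordinatewise continuous_on_diff)

lemma continuous_on_fun_scaleR [continuous_intros]:
  fixes f :: "'a::topological_space \<Rightarrow> nat \<Rightarrow> real"
  assumes "continuous_on S h" "continuous_on S f"
  shows "continuous_on S (\<lambda>x. h x *\<^sub>R f x)"
  by (rule continuous_on_coordinatewise_then_product)
    (simp add: fun_app assms continuous_on_product_then_coordinatewise continuous_on_mult)

lemma continuous_on_fun_upd [continuous_intros]:
  fixes f :: "'a::topological_space \<Rightarrow> nat \<Rightarrow> real"
  assumes "continuous_on S f" "continuous_on S h"
  shows "continuous_on S (\<lambda>x. (f x)(n := h x))"
proof (rule continuous_on_coordinatewise_then_product)
  fix i show "continuous_on S (\<lambda>x. ((f x)(n := h x)) i)"
    by (cases "i = n") (auto intro: continuous_on_product_then_coordinatewise assms)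
qed

lemma measurable_espace [measurable]: "espace n \<in> sets borel"
  unfolding espace_def by measurable

lemma measurable_unit_ball [measurable]: "unit_ball n \<in> sets borel"
  unfolding unit_ball_eq by measurable

lemma measurable_unit_sphere [measurable]: "unit_sphere n \<in> sets borel"
  unfolding unit_sphere_eq by measurable

section \<open>Lebesgue measure on coordinate spaces\<close>

interpretation lborel_product: product_sigma_finite "\<lambda>_::nat. lborel :: real measure"
  by standard

abbreviation "L n \<equiv> eucl_lborel n"

lemma sets_L [measurable_cong]: "sets (L n) = sets borel"
  by (simp add: eucl_lborel_def)

lemma space_L [simp]: "space (L n) = UNIV"
  by (simp add: eucl_lborel_def)

lemma measurable_trunc:
  "(\<lambda>x i. if i < (n::nat) then x i else (0::real)) \<in> borel_measurable (Pi\<^sub>M {..<n} (\<lambda>_. lborel))"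
proof (rule borel_measurable_funI)
  fix i
  show "(\<lambda>x. if i < n then x i else 0) \<in> borel_measurable (Pi\<^sub>M {..<n} (\<lambda>_. lborel))"
    by (cases "i < n") simp_all
qed

lemma nn_integral_L:
  assumes "f \<in> borel_measurable borel"
  shows "(\<integral>\<^sup>+x. f x \<partial>L n) = (\<integral>\<^sup>+x. f (\<lambda>i. if i < n then x i else 0) \<partial>Pi\<^sub>M {..<n} (\<lambda>_. lborel))"
  unfolding eucl_lborel_def using assms by (simp add: nn_integral_distr measurable_trunc)

lemma nn_integral_L_0:
  assumes "f \<in> borel_measurable borel"
  shows "(\<integral>\<^sup>+x. f x \<partial>L 0) = f 0"
  by (simp add: nn_integral_L assms PiM_empty nn_integral_count_space_finite zero_fun_def)

text \<open>Every later induction on the dimension splits off the last coordinate through this form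
  of Fubini's theorem.\<close>

lemma nn_integral_L_Suc:
  assumes [measurable]: "f \<in> borel_measurable borel"
  shows "(\<integral>\<^sup>+x. f x \<partial>L (Suc n)) = (\<integral>\<^sup>+x. (\<integral>\<^sup>+h. f (x(n := h)) \<partial>lborel) \<partial>L n)"
proof -
  have m: "(\<lambda>x. f (\<lambda>i. if i < Suc n then x i else 0)) \<in> borel_measurable (Pi\<^sub>M {..<Suc n} (\<lambda>_. lborel))"
    using measurable_compose[OF measurable_trunc assms] .
  have "(\<integral>\<^sup>+x. f x \<partial>L (Suc n)) =
      (\<integral>\<^sup>+x. (\<integral>\<^sup>+h. f (\<lambda>i. if i < Suc n then (x(n := h)) i else 0) \<partial>lborel) \<partial>Pi\<^sub>M {..<n} (\<lambda>_. lborel))"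
    using m by (simp add: nn_integral_L lessThan_Suc lborel_product.product_nn_integral_insert)
  also have "\<dots> = (\<integral>\<^sup>+x. (\<integral>\<^sup>+h. f ((\<lambda>i. if i < n then x i else 0)(n := h)) \<partial>lborel) \<partial>Pi\<^sub>M {..<n} (\<lambda>_. lborel))"
    by (intro nn_integral_cong arg_cong[where f = f]) (auto simp: fun_eq_iff)
  also have "\<dots> = (\<integral>\<^sup>+x. (\<integral>\<^sup>+h. f (x(n := h)) \<partial>lborel) \<partial>L n)"
    by (rule nn_integral_L[symmetric]) measurable
  finally show ?thesis .
qed

lemma emeasure_L_cube:
  "emeasure (L n) {x. \<forall>i<n. \<bar>x i\<bar> \<le> r} = ennreal (2 * r) ^ n" if "r \<ge> 0"
proof -
  have "emeasure (L n) {x. \<forall>i<n. \<bar>x i\<bar> \<le> r} =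
     emeasure (Pi\<^sub>M {..<n} (\<lambda>_. lborel)) (Pi\<^sub>E {..<n} (\<lambda>_. {-r..r}))"
    unfolding eucl_lborel_def
    by (subst emeasure_distr) (auto intro!: measurable_trunc arg_cong[where f = "emeasure _"]
        simp: space_PiM PiE_def Pi_def abs_le_iff)
  also have "\<dots> = (\<Prod>i<n. emeasure lborel {-r..r})"
    by (rule lborel_product.emeasure_PiM) auto
  also have "\<dots> = ennreal (2 * r) ^ n"
    using that by simp
  finally show ?thesis .
qed

lemma sigma_finite_L: "sigma_finite_measure (L n)"
proof
  let ?A = "range (\<lambda>k::nat. {x. \<forall>i<n. \<bar>x i\<bar> \<le> real k})"
  have "\<Union> ?A = UNIV"
  proof (intro equalityI subset_UNIV subsetI)
    fix x :: "nat \<Rightarrow> real"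
    obtain k where "(\<Sum>i<n. \<bar>x i\<bar>) \<le> real k"
      using real_arch_simple by blast
    moreover have "\<bar>x i\<bar> \<le> (\<Sum>i<n. \<bar>x i\<bar>)" if "i < n" for i
      using that by (intro member_le_sum) auto
    ultimately have "\<forall>i<n. \<bar>x i\<bar> \<le> real k"
      by (blast intro: order_trans)
    then show "x \<in> \<Union> ?A" by blast
  qed
  moreover have "\<forall>a\<in>?A. emeasure (L n) a \<noteq> \<infinity>"
    by (auto simp: emeasure_L_cube power_eq_top_ennreal)
  moreover have "?A \<subseteq> sets (L n)"
    by (auto simp: sets_L)
  ultimately show "\<exists>A. countable A \<and> A \<subseteq> sets (L n) \<and> \<Union> A = space (L n) \<and> (\<forall>a\<in>A. emeasure (L n) a \<noteq> \<infinity>)"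
    by (intro exI[of _ ?A]) auto
qed

interpretation L: sigma_finite_measure "L n" for n
  by (rule sigma_finite_L)

interpretation LL: pair_sigma_finite "L n" "L m" for n m ..
interpretation Ll: pair_sigma_finite "L n" "lborel :: real measure" for n ..

lemma nn_integral_L_Suc':
  assumes [measurable]: "f \<in> borel_measurable borel"
  shows "(\<integral>\<^sup>+x. f x \<partial>L (Suc n)) = (\<integral>\<^sup>+h. (\<integral>\<^sup>+x. f (x(n := h)) \<partial>L n) \<partial>lborel)"
  unfolding nn_integral_L_Suc[OF assms] by (rule Ll.Fubini'[symmetric]) measurable

lemma AE_L_espace: "AE x in L n. x \<in> espace n"
proof -
  have "(\<lambda>x i. if i < n then x i else 0) -` (- espace n) = {}"
    by (auto simp: espace_def)
  then have "emeasure (L n) (- espace n) = 0"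
    unfolding eucl_lborel_def by (subst emeasure_distr) (auto simp: measurable_trunc intro!: borel_comp)
  then show ?thesis
    by (intro AE_I'[of "- espace n"]) (auto simp: null_sets_def sets_L)
qed

lemma nn_integral_L_cong:
  "(\<And>x. x \<in> espace n \<Longrightarrow> f x = g x) \<Longrightarrow> (\<integral>\<^sup>+x. f x \<partial>L n) = (\<integral>\<^sup>+x. g x \<partial>L n)"
  using AE_L_espace[of n] by (intro nn_integral_cong_AE) auto

subsection \<open>Invariance properties\<close>

lemma fun_upd_add: "(x(n := h)) + y = (x + y)(n := h + y n)" for x y :: "nat \<Rightarrow> real"
  by (auto simp: fun_eq_iff fun_app)

lemma fun_upd_scaleR: "c *\<^sub>R (x(n := h)) = (c *\<^sub>R x)(n := c * h)" for x :: "nat \<Rightarrow> real"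
  by (auto simp: fun_eq_iff fun_app)

lemma nn_integral_lborel_affine:
  fixes c :: real
  assumes "f \<in> borel_measurable borel" "c \<noteq> 0"
  shows "(\<integral>\<^sup>+h. f h \<partial>lborel) = ennreal \<bar>c\<bar> * (\<integral>\<^sup>+h. f (t + c * h) \<partial>lborel)"
  using nn_integral_real_affine[OF assms] by simp

lemma nn_integral_L_translate:
  assumes "f \<in> borel_measurable borel" "a \<in> espace n"
  shows "(\<integral>\<^sup>+x. f (x + a) \<partial>L n) = (\<integral>\<^sup>+x. f x \<partial>L n)"
  using assms
proof (induction n arbitrary: f a)
  case 0
  then show ?case by (simp add: nn_integral_L_0 espace_0)
next
  case (Suc n)
  note [measurable] = Suc.prems(1)
  define a' where "a' = a(n := 0)"
  have a': "a' \<in> espace n" "\<And>x. (x + a')(n := h) = (x + a)(n := h)" for h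
    using Suc.prems(2) by (auto simp: a'_def fun_eq_iff fun_app intro: espace_upd0)
  have "(\<integral>\<^sup>+x. f (x + a) \<partial>L (Suc n)) = (\<integral>\<^sup>+x. (\<integral>\<^sup>+h. f ((x + a')(n := h + a n)) \<partial>lborel) \<partial>L n)"
    by (subst nn_integral_L_Suc) (simp_all add: fun_upd_add a')
  also have "\<dots> = (\<integral>\<^sup>+x. (\<integral>\<^sup>+h. f ((x + a')(n := h)) \<partial>lborel) \<partial>L n)"
    by (subst (2) nn_integral_lborel_affine[where c = 1 and t = "a n"]) (simp_all add: add.commute)
  also have "\<dots> = (\<integral>\<^sup>+x. (\<integral>\<^sup>+h. f (x(n := h)) \<partial>lborel) \<partial>L n)"
    by (rule Suc.IH) (use a' in measurable)
  finally show ?case unfolding nn_integral_L_Suc[OF Suc.prems(1)] .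
qed

lemma nn_integral_L_scale:
  assumes "f \<in> borel_measurable borel" "c \<noteq> 0"
  shows "(\<integral>\<^sup>+x. f x \<partial>L n) = ennreal (\<bar>c\<bar> ^ n) * (\<integral>\<^sup>+x. f (c *\<^sub>R x) \<partial>L n)"
  using assms
proof (induction n arbitrary: f)
  case 0
  note [measurable] = 0(1)
  have "(\<integral>\<^sup>+x. f (c *\<^sub>R x) \<partial>L 0) = f (c *\<^sub>R 0)"
    by (rule nn_integral_L_0) simp
  then show ?case by (simp add: nn_integral_L_0)
next
  case (Suc n)
  note [measurable] = Suc.prems(1)
  have "(\<integral>\<^sup>+x. f x \<partial>L (Suc n)) = (\<integral>\<^sup>+x. (\<integral>\<^sup>+h. f (x(n := h)) \<partial>lborel) \<partial>L n)"
    by (rule nn_integral_L_Suc) simp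
  also have "\<dots> = (\<integral>\<^sup>+x. ennreal \<bar>c\<bar> * (\<integral>\<^sup>+h. f (x(n := c * h)) \<partial>lborel) \<partial>L n)"
    by (subst nn_integral_lborel_affine[where c = c and t = 0]) (simp_all add: Suc.prems)
  also have "\<dots> = ennreal \<bar>c\<bar> * (\<integral>\<^sup>+x. (\<integral>\<^sup>+h. f (x(n := c * h)) \<partial>lborel) \<partial>L n)"
    by (rule nn_integral_cmult) measurable
  also have "(\<integral>\<^sup>+x. (\<integral>\<^sup>+h. f (x(n := c * h)) \<partial>lborel) \<partial>L n) =
     ennreal (\<bar>c\<bar> ^ n) * (\<integral>\<^sup>+x. (\<integral>\<^sup>+h. f ((c *\<^sub>R x)(n := c * h)) \<partial>lborel) \<partial>L n)"
    by (rule Suc.IH) (use Suc.prems in measurable)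
  also have "(\<integral>\<^sup>+x. (\<integral>\<^sup>+h. f ((c *\<^sub>R x)(n := c * h)) \<partial>lborel) \<partial>L n) = (\<integral>\<^sup>+x. f (c *\<^sub>R x) \<partial>L (Suc n))"
    by (subst nn_integral_L_Suc) (simp_all only: fun_upd_scaleR, measurable)
  finally show ?case
    by (simp only: ennreal_mult' abs_ge_zero power_Suc mult.assoc)
qed

text \<open>For fixed first coordinates this is an affine substitution in one variable. Together
  with the shear below it supplies the factors of a reflection.\<close>

lemma nn_integral_L_update_last:
  assumes [measurable]: "f \<in> borel_measurable borel" and c: "c \<noteq> 0"
  shows "(\<integral>\<^sup>+x. f x \<partial>L (Suc n)) = ennreal \<bar>c\<bar> * (\<integral>\<^sup>+x. f (x(n := ip n b x + c * x n)) \<partial>L (Suc n))"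
proof -
  have "(\<integral>\<^sup>+x. f x \<partial>L (Suc n)) = (\<integral>\<^sup>+x. (\<integral>\<^sup>+h. f (x(n := h)) \<partial>lborel) \<partial>L n)"
    by (rule nn_integral_L_Suc) simp
  also have "\<dots> = (\<integral>\<^sup>+x. ennreal \<bar>c\<bar> * (\<integral>\<^sup>+h. f (x(n := ip n b x + c * h)) \<partial>lborel) \<partial>L n)"
  proof (rule nn_integral_cong)
    fix x
    show "(\<integral>\<^sup>+h. f (x(n := h)) \<partial>lborel) = ennreal \<bar>c\<bar> * (\<integral>\<^sup>+h. f (x(n := ip n b x + c * h)) \<partial>lborel)"
      by (rule nn_integral_lborel_affine) (simp_all add: c)
  qed
  also have "\<dots> = ennreal \<bar>c\<bar> * (\<integral>\<^sup>+x. (\<integral>\<^sup>+h. f (x(n := ip n b x + c * h)) \<partial>lborel) \<partial>L n)"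
    by (rule nn_integral_cmult) measurable
  also have "(\<integral>\<^sup>+x. (\<integral>\<^sup>+h. f (x(n := ip n b x + c * h)) \<partial>lborel) \<partial>L n) =
     (\<integral>\<^sup>+x. f (x(n := ip n b x + c * x n)) \<partial>L (Suc n))"
    by (subst nn_integral_L_Suc) (simp_all add: ip_upd)
  finally show ?thesis .
qed

lemma nn_integral_L_shear:
  assumes [measurable]: "f \<in> borel_measurable borel" and a: "a \<in> espace n"
  shows "(\<integral>\<^sup>+x. f (x + x n *\<^sub>R a) \<partial>L (Suc n)) = (\<integral>\<^sup>+x. f x \<partial>L (Suc n))"
proof -
  have an: "a n = 0" using a by (simp add: espace_def)
  have "(\<integral>\<^sup>+x. f (x + x n *\<^sub>R a) \<partial>L (Suc n)) = (\<integral>\<^sup>+h. (\<integral>\<^sup>+x. f ((x + h *\<^sub>R a)(n := h)) \<partial>L n) \<partial>lborel)"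
    by (subst nn_integral_L_Suc') (simp_all add: fun_upd_add an fun_app(4))
  also have "\<dots> = (\<integral>\<^sup>+h. (\<integral>\<^sup>+x. f (x(n := h)) \<partial>L n) \<partial>lborel)"
  proof (rule nn_integral_cong)
    fix h
    show "(\<integral>\<^sup>+x. f ((x + h *\<^sub>R a)(n := h)) \<partial>L n) = (\<integral>\<^sup>+x. f (x(n := h)) \<partial>L n)"
      by (rule nn_integral_L_translate) (use a in \<open>auto intro: espace_scaleR\<close>)
  qed
  finally show ?thesis by (simp add: nn_integral_L_Suc')
qed

subsection \<open>Householder reflections\<close>

definition unitv :: "nat \<Rightarrow> nat \<Rightarrow> real" where
  "unitv n = 0(n := 1)"

text \<open>The reflection of dimension \<open>n + 1\<close> that exchanges the unit vector \<open>u\<close> and the last coordinate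
  vector. For \<open>u = unitv n\<close> the division by zero makes it the identity.\<close>

definition refl :: "nat \<Rightarrow> (nat \<Rightarrow> real) \<Rightarrow> (nat \<Rightarrow> real) \<Rightarrow> (nat \<Rightarrow> real)" where
  "refl n u x = x - (ip (Suc n) x (u - unitv n) / (1 - u n)) *\<^sub>R (u - unitv n)"

lemma unitv_app: "unitv n i = (if i = n then 1 else 0)"
  by (simp add: unitv_def fun_app)

lemma unitv_espace: "unitv n \<in> espace (Suc n)"
  by (simp add: espace_def unitv_app)

lemma ip_unitv: "ip (Suc n) x (unitv n) = x n" "ip (Suc n) (unitv n) x = x n" 
  by (simp_all add: ip_def unitv_app if_distrib[of "\<lambda>a. a * b" for b] if_distrib[of "\<lambda>a. b * a" for b] cong: if_cong)

lemma unitv_sphere: "unitv n \<in> unit_sphere (Suc n)"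
  by (simp add: unit_sphere_eq unitv_espace norm_eq_ip ip_unitv unitv_app)

lemma sphere_ip: "u \<in> unit_sphere n \<Longrightarrow> ip n u u = 1"
  by (metis (mono_tags, lifting) mem_Collect_eq norm_sq one_power2 unit_sphere_eq)

lemma sphere_last_1:
  assumes "u \<in> unit_sphere (Suc n)" "u n = 1"
  shows "u = unitv n"
proof -
  have "ip (Suc n) (u - unitv n) (u - unitv n) = 0"
    using sphere_ip[OF assms(1)] assms(2) by (simp add: ip_simps ip_unitv unitv_app)
  then have "u - unitv n = 0"
    using assms(1) unitv_espace[of n] by (subst norm_eq_0[symmetric, of _ "Suc n"])
      (auto simp: unit_sphere_eq norm_eq_ip intro: espace_diff)
  then show ?thesis by simp
qed

lemma refl_unitv_id: "u n = 1 \<Longrightarrow> refl n u x = x"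
  by (simp add: refl_def)

lemma refl_espace: "u \<in> espace (Suc n) \<Longrightarrow> x \<in> espace (Suc n) \<Longrightarrow> refl n u x \<in> espace (Suc n)"
  unfolding refl_def by (intro espace_diff espace_scaleR unitv_espace)

lemma refl_linear:
  "refl n u (x + y) = refl n u x + refl n u y"
  "refl n u (c *\<^sub>R x) = c *\<^sub>R refl n u x"
  "refl n u (x - y) = refl n u x - refl n u y"
  "refl n u 0 = 0"
  by (simp_all add: refl_def ip_simps fun_eq_iff fun_app algebra_simps add_divide_distrib diff_divide_distrib)

lemma refl_sum: "refl n u (\<Sum>a\<in>A. f a) = (\<Sum>a\<in>A. refl n u (f a))"
  by (induction A rule: infinite_finite_induct) (simp_all add: refl_linear)

context
  fixes n :: nat and u :: "nat \<Rightarrow> real"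
  assumes u: "u \<in> unit_sphere (Suc n)"
begin

lemma ip_diff_unitv: "ip (Suc n) (u - unitv n) (u - unitv n) = 2 * (1 - u n)"
  using sphere_ip[OF u] by (simp add: ip_simps ip_unitv unitv_app)

lemma refl_last: "refl n u x n = ip (Suc n) x u"
proof (cases "u n = 1")
  case True
  then show ?thesis using sphere_last_1[OF u] by (simp add: refl_unitv_id ip_unitv)
next
  case False
  then have "a / (1 - u n) * (u n - 1) = - a" for a by (simp add: field_simps)
  then show ?thesis by (simp add: refl_def fun_app ip_simps ip_unitv unitv_app)
qed

lemma ip_refl: "ip (Suc n) (refl n u x) (refl n u y) = ip (Suc n) x y"
proof (cases "u n = 1")
  case True
  then show ?thesis by (simp add: refl_unitv_id)
next
  case False
  define w where "w = u - unitv n"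
  define t where "t = 1 - u n"
  have t: "t \<noteq> 0" using False by (simp add: t_def)
  have ww: "ip (Suc n) w w = 2 * t" unfolding w_def t_def by (rule ip_diff_unitv)
  have "ip (Suc n) (refl n u x) (refl n u y) = ip (Suc n) x y
     - ip (Suc n) y w / t * ip (Suc n) x w - ip (Suc n) x w / t * ip (Suc n) y w
     + ip (Suc n) x w / t * (ip (Suc n) y w / t) * ip (Suc n) w w"
    by (simp add: refl_def ip_simps algebra_simps flip: w_def t_def) (simp add: ip_commute)
  then show ?thesis using t by (simp add: ww field_simps)
qed

lemma norm_refl: "eucl_norm (Suc n) (refl n u x) = eucl_norm (Suc n) x"
  by (simp add: norm_eq_ip ip_refl)

lemma refl_refl: "refl n u (refl n u x) = x"
proof (cases "u n = 1")
  case True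
  then show ?thesis by (simp add: refl_unitv_id)
next
  case False
  define w where "w = u - unitv n"
  define t where "t = 1 - u n"
  have t: "t \<noteq> 0" using False by (simp add: t_def)
  have ww: "ip (Suc n) w w = 2 * t" unfolding w_def t_def by (rule ip_diff_unitv)
  have "ip (Suc n) (refl n u x) w = - ip (Suc n) x w"
    using t by (simp add: refl_def ip_simps ww flip: w_def t_def)
  then have "refl n u (refl n u x) = refl n u x + (ip (Suc n) x w / t) *\<^sub>R w"
    by (subst refl_def) (simp add: fun_eq_iff fun_app flip: w_def t_def)
  then show ?thesis by (simp add: refl_def flip: w_def t_def)
qed

lemma refl_self: "refl n u u = unitv n"
proof (cases "u n = 1")
  case True
  then show ?thesis using sphere_last_1[OF u] by (simp add: refl_unitv_id)
next
  case False
  have "ip (Suc n) u (u - unitv n) = 1 - u n"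
    using sphere_ip[OF u] by (simp add: ip_simps ip_unitv)
  then show ?thesis using False by (simp add: refl_def)
qed

lemma refl_unitv: "refl n u (unitv n) = u"
  using refl_refl[of u] by (simp add: refl_self)

text \<open>Reflections are the only rotations of the development. Their invariance follows from a
  factorization into three elementary maps, each of which preserves the measure by a substitution in
  a single variable or by a translation.\<close>

lemma nn_integral_L_refl:
  assumes f [measurable]: "f \<in> borel_measurable borel"
  shows "(\<integral>\<^sup>+x. f (refl n u x) \<partial>L (Suc n)) = (\<integral>\<^sup>+x. f x \<partial>L (Suc n))"
proof (cases "u n = 1")
  case True
  then show ?thesis by (simp add: refl_unitv_id)
next
  case False
  define t where "t = 1 - u n"
  have t: "t \<noteq> 0" using False by (simp add: t_def)
  define w where "w = u - unitv n"
  define b where "b = (1 / t) *\<^sub>R w"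
  define w' where "w' = - w(n := 0)"
  have wn: "w n = - t" by (simp add: w_def t_def fun_app unitv_app)
  have w': "w' \<in> espace n"
    unfolding w'_def using u unitv_espace[of n]
    by (intro espace_uminus espace_upd0) (auto simp: w_def unit_sphere_eq intro: espace_diff)
  have "ip (Suc n) w w = 2 * t" using ip_diff_unitv by (simp add: w_def t_def)
  then have "ip n w w = 2 * t - t * t" by (simp add: ip_Suc wn)
  then have bw: "ip n b w' = t - 2"
    using t by (simp add: b_def w'_def ip_simps ip_upd field_simps)
  \<comment> \<open>\<open>T1\<close> stores the reflection coefficient \<beta> of \<open>x\<close>
    in the last coordinate, \<open>T2\<close> uses it to subtract \<beta> times \<open>w\<close>
    from the other coordinates, and \<open>T3\<close> rebuilds the last coordinate, whose old value
    can be recovered from \<beta> and the new coordinates because \<open>ip n b w'\<close> is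
    \<open>t - 2\<close>.\<close>
  define T1 where "T1 x = x(n := ip n b x + (- 1) * x n)" for x
  define T2 where "T2 x = x + x n *\<^sub>R w'" for x
  define T3 where "T3 x = x(n := ip n b x + 1 * x n)" for x
  have [measurable]: "T2 \<in> borel_measurable borel" "T3 \<in> borel_measurable borel"
    unfolding T2_def T3_def by measurable
  have eq: "refl n u x = T3 (T2 (T1 x))" for x
  proof -
    define \<beta> where "\<beta> = ip n b x - x n"
    have \<beta>: "ip (Suc n) x w / t = \<beta>"
      using t by (simp add: \<beta>_def ip_Suc b_def ip_simps wn field_simps ip_commute)
    have T1: "T1 x = x(n := \<beta>)" by (simp add: T1_def \<beta>_def)
    have w'n: "w' n = 0" using w' by (simp add: espace_def)
    have T2: "T2 (T1 x) = (x - \<beta> *\<^sub>R w)(n := \<beta>)"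
      using w'n by (auto simp: T2_def T1 fun_eq_iff fun_app w'_def)
    have "ip n b (x - \<beta> *\<^sub>R w) = ip n b x + \<beta> * ip n b w'"
      by (simp add: ip_simps w'_def ip_upd)
    moreover have "ip n b x = \<beta> + x n" by (simp add: \<beta>_def)
    ultimately have "ip n b (x - \<beta> *\<^sub>R w) + \<beta> = x n + \<beta> * t"
      by (simp add: bw algebra_simps)
    then have "T3 (T2 (T1 x)) = (x - \<beta> *\<^sub>R w)(n := x n + \<beta> * t)"
      by (simp add: T3_def T2 ip_upd)
    also have "\<dots> = x - \<beta> *\<^sub>R w"
      by (auto simp: fun_eq_iff fun_app wn)
    finally show ?thesis by (simp add: refl_def \<beta> flip: w_def t_def)
  qed
  have "(\<integral>\<^sup>+x. f (refl n u x) \<partial>L (Suc n)) = (\<integral>\<^sup>+x. f (T3 (T2 (T1 x))) \<partial>L (Suc n))"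
    by (simp add: eq)
  also have "\<dots> = (\<integral>\<^sup>+x. f (T3 (T2 x)) \<partial>L (Suc n))"
    unfolding T1_def by (subst (2) nn_integral_L_update_last[where c = "- 1" and b = b]) simp_all
  also have "\<dots> = (\<integral>\<^sup>+x. f (T3 x) \<partial>L (Suc n))"
    unfolding T2_def by (rule nn_integral_L_shear) (use w' in measurable)
  also have "\<dots> = (\<integral>\<^sup>+x. f x \<partial>L (Suc n))"
    unfolding T3_def by (subst (2) nn_integral_L_update_last[where c = 1 and b = b]) simp_all
  finally show ?thesis .
qed

end

lemma borel_measurable_refl [measurable (raw)]:
  assumes [measurable]: "f \<in> borel_measurable M" "g \<in> borel_measurable M"
  shows "(\<lambda>x. refl n (f x) (g x)) \<in> borel_measurable M"
  unfolding refl_def using borel_measurable_fun_coord[OF assms(1)] by measurable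

lemma continuous_on_refl:
  assumes "continuous_on S f"
  shows "continuous_on S (\<lambda>x. refl n u (f x))"
  unfolding refl_def divide_inverse using assms
  by (intro continuous_on_fun_diff continuous_on_fun_scaleR continuous_on_ip continuous_on_mult continuous_on_const)

subsection \<open>The unit ball\<close>

definition kap :: "nat \<Rightarrow> real" where
  "kap n = volume n (unit_ball n)"

lemma emeasure_unit_ball: "emeasure (L n) (unit_ball n) = ennreal (kap n)"
proof -
  have "emeasure (L n) (unit_ball n) \<le> emeasure (L n) {x. \<forall>i<n. \<bar>x i\<bar> \<le> 1}"
    by (rule emeasure_mono) (auto simp: unit_ball_eq sets_L intro: order_trans[OF abs_le_norm])
  also have "\<dots> < \<infinity>" by (simp add: emeasure_L_cube power_less_top_ennreal)
  finally show ?thesis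
    by (simp add: kap_def volume_def emeasure_eq_ennreal_measure)
qed

lemma kap_pos: "0 < kap n"
proof -
  define r where "r = 1 / real (Suc n)"
  have r: "0 < r" "real n * r \<le> 1" by (auto simp: r_def)
  have "0 < emeasure (L n) {x. \<forall>i<n. \<bar>x i\<bar> \<le> r}"
    using r by (simp add: emeasure_L_cube ennreal_power)
  also have "\<dots> \<le> emeasure (L n) (unit_ball n)"
  proof (rule emeasure_mono_AE)
    show "AE x in L n. x \<in> {x. \<forall>i<n. \<bar>x i\<bar> \<le> r} \<longrightarrow> x \<in> unit_ball n"
      using AE_L_espace
    proof eventually_elim
      case (elim x)
      have "eucl_norm n x \<le> 1" if "\<forall>i<n. \<bar>x i\<bar> \<le> r"
      proof -
        have "eucl_norm n x \<le> (\<Sum>i<n. \<bar>x i\<bar>)" by (simp add: eucl_norm_def L2_set_le_sum_abs)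
        also have "\<dots> \<le> (\<Sum>i<n. r)" using that by (intro sum_mono) auto
        finally show ?thesis using r by simp
      qed
      with elim show ?case by (auto simp: unit_ball_eq)
    qed
  qed (simp add: sets_L)
  finally show ?thesis by (simp add: emeasure_unit_ball)
qed

lemma AE_L_last_nonzero: "AE x in L (Suc n). x n \<noteq> 0"
proof -
  have m: "{x :: nat \<Rightarrow> real. x n = 0} \<in> sets borel" by measurable
  have "(\<integral>\<^sup>+x. indicator {x. x n = 0} x \<partial>L (Suc n)) =
      (\<integral>\<^sup>+x. (\<integral>\<^sup>+h. indicator {x. x n = 0} (x(n := h)) \<partial>lborel) \<partial>L n)"
    by (rule nn_integral_L_Suc) (use m in measurable)
  also have "\<dots> = (\<integral>\<^sup>+x. (\<integral>\<^sup>+h. indicator {0} h \<partial>(lborel :: real measure)) \<partial>L n)"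
    by (intro nn_integral_cong) (auto simp: indicator_def)
  also have "\<dots> = 0" by simp
  finally have "emeasure (L (Suc n)) {x. x n = 0} = 0" using m by (simp add: sets_L)
  then show ?thesis
    by (intro AE_I'[of "{x. x n = 0}"]) (auto simp: null_sets_def sets_L m)
qed

lemma AE_L_nonzero: "n \<ge> 1 \<Longrightarrow> AE x in L n. eucl_norm n x \<noteq> 0"
proof -
  assume "n \<ge> 1"
  then obtain m where m: "n = Suc m" by (cases n) auto
  have "AE x in L n. x m \<noteq> 0" using AE_L_last_nonzero[of m] by (simp only: m)
  then show ?thesis
  proof eventually_elim
    case (elim x)
    then show ?case using abs_le_norm[of m n x] m by auto
  qed
qed

section \<open>The uniform measure on the sphere\<close>

text \<open>The cone measure before the restriction to the sphere; it lives on the whole Borel space, which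
  makes it easier to work with.\<close>

definition sph :: "nat \<Rightarrow> (nat \<Rightarrow> real) measure" where
  "sph n = distr (uniform_measure (L n) (unit_ball n)) borel (\<lambda>x. (1 / eucl_norm n x) *\<^sub>R x)"

lemma sets_sph [measurable_cong]: "sets (sph n) = sets borel"
  by (simp add: sph_def)

lemma space_sph [simp]: "space (sph n) = UNIV"
  by (simp add: sph_def)

lemma sphere_measure_sph: "sphere_measure n = restrict_space (sph n) (unit_sphere n)"
  by (simp add: sphere_measure_def sph_def)

lemma nn_integral_sph:
  assumes [measurable]: "f \<in> borel_measurable borel"
  shows "(\<integral>\<^sup>+x. f x \<partial>sph n) =
    (\<integral>\<^sup>+x. f ((1 / eucl_norm n x) *\<^sub>R x) * indicator (unit_ball n) x \<partial>L n) / ennreal (kap n)"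
  unfolding sph_def
  by (subst nn_integral_distr) (simp_all add: nn_integral_uniform_measure emeasure_unit_ball sets_L cong: measurable_cong_sets)

lemma prob_space_sph: "prob_space (sph n)"
  unfolding sph_def
  by (rule prob_space.prob_space_distr, rule prob_space_uniform_measure)
    (use kap_pos[of n] in \<open>auto simp: emeasure_unit_ball\<close>)

interpretation sph: prob_space "sph n" for n
  by (rule prob_space_sph)

lemma normalize_sphere:
  "x \<in> espace n \<Longrightarrow> eucl_norm n x \<noteq> 0 \<Longrightarrow> (1 / eucl_norm n x) *\<^sub>R x \<in> unit_sphere n"
  by (auto simp: unit_sphere_eq norm_scaleR intro: espace_scaleR)

lemma AE_sph: "n \<ge> 1 \<Longrightarrow> AE x in sph n. x \<in> unit_sphere n"
proof -
  assume n: "n \<ge> 1"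
  have "(\<integral>\<^sup>+x. indicator (- unit_sphere n) x \<partial>sph n) =
    (\<integral>\<^sup>+x. indicator (- unit_sphere n) ((1 / eucl_norm n x) *\<^sub>R x) * indicator (unit_ball n) x \<partial>L n) / ennreal (kap n)"
    by (rule nn_integral_sph) measurable
  also have "(\<integral>\<^sup>+x. indicator (- unit_sphere n) ((1 / eucl_norm n x) *\<^sub>R x) * indicator (unit_ball n) x \<partial>L n) = (\<integral>\<^sup>+x. 0 \<partial>L n)"
    using AE_L_nonzero[OF n] AE_L_espace[of n]
    by (intro nn_integral_cong_AE, eventually_elim) (auto dest: normalize_sphere)
  finally have "emeasure (sph n) (- unit_sphere n) = 0"
    by (simp add: sets_sph)
  then show ?thesis
    by (intro AE_I'[of "- unit_sphere n"]) (auto simp: null_sets_def sets_sph)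
qed

lemma nn_integral_sph_cong:
  "n \<ge> 1 \<Longrightarrow> (\<And>x. x \<in> unit_sphere n \<Longrightarrow> f x = g x) \<Longrightarrow> (\<integral>\<^sup>+x. f x \<partial>sph n) = (\<integral>\<^sup>+x. g x \<partial>sph n)"
  using AE_sph[of n] by (intro nn_integral_cong_AE) auto

lemma nn_integral_sph_refl:
  assumes [measurable]: "f \<in> borel_measurable borel" and u: "u \<in> unit_sphere (Suc n)"
  shows "(\<integral>\<^sup>+x. f (refl n u x) \<partial>sph (Suc n)) = (\<integral>\<^sup>+x. f x \<partial>sph (Suc n))"
proof -
  let ?g = "\<lambda>x. f ((1 / eucl_norm (Suc n) x) *\<^sub>R x) * indicator (espace (Suc n) \<inter> unit_ball (Suc n)) x"
  have eq: "espace n \<inter> unit_ball n = unit_ball n" for n by (auto simp: unit_ball_eq)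
  have "(\<integral>\<^sup>+x. f (refl n u ((1 / eucl_norm (Suc n) x) *\<^sub>R x)) * indicator (unit_ball (Suc n)) x \<partial>L (Suc n))
     = (\<integral>\<^sup>+x. ?g (refl n u x) \<partial>L (Suc n))"
    using u by (intro nn_integral_L_cong)
      (auto simp: norm_refl[OF u] refl_linear unit_ball_eq indicator_def unit_sphere_eq intro: refl_espace)
  also have "\<dots> = (\<integral>\<^sup>+x. ?g x \<partial>L (Suc n))"
    by (rule nn_integral_L_refl[OF u]) measurable
  finally show ?thesis
    by (subst (1 2) nn_integral_sph) (simp_all add: eq)
qed

lemma nn_integral_sph_uminus:
  assumes [measurable]: "f \<in> borel_measurable borel"
  shows "(\<integral>\<^sup>+x. f (- x) \<partial>sph n) = (\<integral>\<^sup>+x. f x \<partial>sph n)"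
proof -
  have "(\<integral>\<^sup>+x. f x * indicator (unit_ball n) x \<partial>L n) = (\<integral>\<^sup>+x. f (- x) * indicator (unit_ball n) x \<partial>L n)"
    if [measurable]: "f \<in> borel_measurable borel" for f :: "(nat \<Rightarrow> real) \<Rightarrow> ennreal"
    by (subst nn_integral_L_scale[where c = "-1"])
      (auto simp: unit_ball_eq norm_uminus indicator_def intro!: nn_integral_L_cong intro: espace_uminus)
  from this[of "\<lambda>x. f ((1 / eucl_norm n x) *\<^sub>R x)"] show ?thesis
    by (subst (1 2) nn_integral_sph) (simp_all add: norm_uminus)
qed

lemma measurable_fst_coord [measurable (raw)]:
  fixes f :: "'a \<Rightarrow> (nat \<Rightarrow> real) \<times> 'b"
  assumes "f \<in> measurable M (borel \<Otimes>\<^sub>M N)"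
  shows "(\<lambda>x. fst (f x) i) \<in> borel_measurable M"
  using assms by (intro borel_measurable_fun_coord) (rule measurable_fst')

lemma measurable_snd_coord [measurable (raw)]:
  fixes f :: "'a \<Rightarrow> 'b \<times> (nat \<Rightarrow> real)"
  assumes "f \<in> measurable M (N \<Otimes>\<^sub>M borel)"
  shows "(\<lambda>x. snd (f x) i) \<in> borel_measurable M"
  using assms by (intro borel_measurable_fun_coord) (rule measurable_snd')

lemma L0: "x \<in> espace n \<Longrightarrow> eucl_norm n x \<noteq> 0 \<Longrightarrow> 0 < eucl_norm n x"
  by (simp add: order.not_eq_order_implies_strict)

subsection \<open>Polar coordinates\<close>

text \<open>Polar coordinates up to a constant, without a one-dimensional radial integral. The
  direction is taken from an auxiliary point \<open>z\<close> of the ball; scaling \<open>z\<close>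
  by the norm of \<open>x\<close>, then \<open>x\<close> by the norm of \<open>z\<close>, and
  exchanging the integrals lets the two points trade roles.\<close>

lemma polar_aux:
  assumes f [measurable]: "f \<in> borel_measurable borel" and n: "n \<ge> 1"
  shows "ennreal (kap n) * (\<integral>\<^sup>+x. (\<integral>\<^sup>+v. f (eucl_norm n x *\<^sub>R v) \<partial>sph n) \<partial>L n) =
    (\<integral>\<^sup>+x. ennreal (inverse (eucl_norm n x) ^ n * inverse (eucl_norm n x) ^ n) *
       indicator {1..} (eucl_norm n x) \<partial>L n) * (\<integral>\<^sup>+x. f x \<partial>L n)"
proof -
  let ?N = "eucl_norm n"
  \<comment> \<open>\<open>F x z\<close> has the length of \<open>x\<close> and the direction of
    \<open>z\<close>; it does not change when \<open>z\<close> is scaled by a positive factor, which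
    drives the substitutions below.\<close>
  define F where "F x z = f ((?N x / ?N z) *\<^sub>R z)" for x z
  have F [measurable]: "case_prod F \<in> borel_measurable (borel \<Otimes>\<^sub>M borel)"
    unfolding F_def by measurable
  have k: "ennreal (kap n) \<noteq> 0" "ennreal (kap n) \<noteq> \<top>" using kap_pos[of n] by auto
  have "ennreal (kap n) * (\<integral>\<^sup>+x. (\<integral>\<^sup>+v. f (?N x *\<^sub>R v) \<partial>sph n) \<partial>L n) =
     (\<integral>\<^sup>+x. ennreal (kap n) * (\<integral>\<^sup>+v. f (?N x *\<^sub>R v) \<partial>sph n) \<partial>L n)"
    by (rule nn_integral_cmult[symmetric]) measurable
  also have "\<dots> = (\<integral>\<^sup>+x. (\<integral>\<^sup>+z. F x z * indicator {..1} (?N z) \<partial>L n) \<partial>L n)"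
  proof (rule nn_integral_cong)
    fix x
    have "(\<integral>\<^sup>+v. f (?N x *\<^sub>R v) \<partial>sph n) =
       (\<integral>\<^sup>+z. f (?N x *\<^sub>R (1 / ?N z) *\<^sub>R z) * indicator (unit_ball n) z \<partial>L n) / ennreal (kap n)"
      by (rule nn_integral_sph) measurable
    also have "(\<integral>\<^sup>+z. f (?N x *\<^sub>R (1 / ?N z) *\<^sub>R z) * indicator (unit_ball n) z \<partial>L n) =
      (\<integral>\<^sup>+z. F x z * indicator {..1} (?N z) \<partial>L n)"
      by (intro nn_integral_L_cong) (auto simp: F_def unit_ball_eq indicator_def)
    finally show "ennreal (kap n) * (\<integral>\<^sup>+v. f (?N x *\<^sub>R v) \<partial>sph n) = (\<integral>\<^sup>+z. F x z * indicator {..1} (?N z) \<partial>L n)"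
      using k by (simp add: ennreal_times_divide ennreal_mult_divide_eq mult.commute[of "ennreal (kap n)"])
  qed
  also have "\<dots> = (\<integral>\<^sup>+x. (\<integral>\<^sup>+z. ennreal (inverse (?N x) ^ n) * (F x z * indicator {..?N x} (?N z)) \<partial>L n) \<partial>L n)"
  proof (rule nn_integral_cong_AE)
    show "AE x in L n. (\<integral>\<^sup>+z. F x z * indicator {..1} (?N z) \<partial>L n) =
       (\<integral>\<^sup>+z. ennreal (inverse (?N x) ^ n) * (F x z * indicator {..?N x} (?N z)) \<partial>L n)"
      using AE_L_nonzero[OF n] AE_L_espace
    proof eventually_elim
      case (elim x)
      then have x: "0 < ?N x" by (simp add: L0)
      have "(\<integral>\<^sup>+z. F x z * indicator {..1} (?N z) \<partial>L n) = ennreal (\<bar>inverse (?N x)\<bar> ^ n) *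
         (\<integral>\<^sup>+z. F x (inverse (?N x) *\<^sub>R z) * indicator {..1} (?N (inverse (?N x) *\<^sub>R z)) \<partial>L n)"
        using x by (intro nn_integral_L_scale) (auto simp: F_def)
      also have "(\<lambda>z. F x (inverse (?N x) *\<^sub>R z) * indicator {..1} (?N (inverse (?N x) *\<^sub>R z))) =
         (\<lambda>z. F x z * indicator {..?N x} (?N z))"
        using x by (auto simp: F_def norm_scaleR fun_eq_iff indicator_def field_simps)
      finally show ?case using x by (simp add: nn_integral_cmult F_def)
    qed
  qed
  also have "\<dots> = (\<integral>\<^sup>+z. (\<integral>\<^sup>+x. ennreal (inverse (?N x) ^ n) * (F x z * indicator {..?N x} (?N z)) \<partial>L n) \<partial>L n)"
    by (rule LL.Fubini'[symmetric]) (simp add: indicator_def, measurable)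
  also have "\<dots> = (\<integral>\<^sup>+z. (\<integral>\<^sup>+x. ennreal (inverse (?N x) ^ n) * indicator {1..} (?N x) * f (?N x *\<^sub>R z) \<partial>L n) \<partial>L n)"
  proof (rule nn_integral_cong_AE)
    show "AE z in L n. (\<integral>\<^sup>+x. ennreal (inverse (?N x) ^ n) * (F x z * indicator {..?N x} (?N z)) \<partial>L n) =
       (\<integral>\<^sup>+x. ennreal (inverse (?N x) ^ n) * indicator {1..} (?N x) * f (?N x *\<^sub>R z) \<partial>L n)"
      using AE_L_nonzero[OF n] AE_L_espace
    proof eventually_elim
      case (elim z)
      then have z: "0 < ?N z" by (simp add: L0)
      have "(\<integral>\<^sup>+x. ennreal (inverse (?N x) ^ n) * (F x z * indicator {..?N x} (?N z)) \<partial>L n) =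
        ennreal (\<bar>?N z\<bar> ^ n) * (\<integral>\<^sup>+x. ennreal (inverse (?N (?N z *\<^sub>R x)) ^ n) *
            (F (?N z *\<^sub>R x) z * indicator {..?N (?N z *\<^sub>R x)} (?N z)) \<partial>L n)"
        using z by (intro nn_integral_L_scale) (auto simp: F_def indicator_def)
      also have "\<dots> = (\<integral>\<^sup>+x. ennreal (\<bar>?N z\<bar> ^ n) * (ennreal (inverse (?N (?N z *\<^sub>R x)) ^ n) *
            (F (?N z *\<^sub>R x) z * indicator {..?N (?N z *\<^sub>R x)} (?N z))) \<partial>L n)"
        by (rule nn_integral_cmult[symmetric]) (simp add: F_def indicator_def)
      also have "\<dots> = (\<integral>\<^sup>+x. ennreal (inverse (?N x) ^ n) * indicator {1..} (?N x) * f (?N x *\<^sub>R z) \<partial>L n)"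
      proof (rule nn_integral_cong)
        fix x
        have "ennreal (\<bar>?N z\<bar> ^ n) * ennreal (inverse (?N (?N z *\<^sub>R x)) ^ n) = ennreal (inverse (?N x) ^ n)"
          using z by (simp add: norm_scaleR ennreal_mult'[symmetric] power_mult_distrib[symmetric] mult.assoc[symmetric])
        moreover have "F (?N z *\<^sub>R x) z = f (?N x *\<^sub>R z)"
          using z by (simp add: F_def norm_scaleR)
        moreover have "indicator {..?N (?N z *\<^sub>R x)} (?N z) = (indicator {1..} (?N x) :: ennreal)"
          using z by (simp add: norm_scaleR indicator_def)
        ultimately show "ennreal (\<bar>?N z\<bar> ^ n) * (ennreal (inverse (?N (?N z *\<^sub>R x)) ^ n) *
            (F (?N z *\<^sub>R x) z * indicator {..?N (?N z *\<^sub>R x)} (?N z))) =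
            ennreal (inverse (?N x) ^ n) * indicator {1..} (?N x) * f (?N x *\<^sub>R z)"
          by (simp add: mult.assoc[symmetric]) (simp add: mult_ac)
      qed
      finally show ?case .
    qed
  qed
  also have "\<dots> = (\<integral>\<^sup>+x. (\<integral>\<^sup>+z. ennreal (inverse (?N x) ^ n) * indicator {1..} (?N x) * f (?N x *\<^sub>R z) \<partial>L n) \<partial>L n)"
    by (rule LL.Fubini') measurable
  also have "\<dots> = (\<integral>\<^sup>+x. ennreal (inverse (?N x) ^ n * inverse (?N x) ^ n) * indicator {1..} (?N x) *
       (\<integral>\<^sup>+z. f z \<partial>L n) \<partial>L n)"
  proof (rule nn_integral_cong)
    fix x
    show "(\<integral>\<^sup>+z. ennreal (inverse (?N x) ^ n) * indicator {1..} (?N x) * f (?N x *\<^sub>R z) \<partial>L n) =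
      ennreal (inverse (?N x) ^ n * inverse (?N x) ^ n) * indicator {1..} (?N x) * (\<integral>\<^sup>+z. f z \<partial>L n)"
    proof (cases "?N x \<ge> 1")
      case True
      then have x: "0 < ?N x" by simp
      have "(\<integral>\<^sup>+z. f z \<partial>L n) = ennreal (\<bar>?N x\<bar> ^ n) * (\<integral>\<^sup>+z. f (?N x *\<^sub>R z) \<partial>L n)"
        using x by (intro nn_integral_L_scale) auto
      then have "ennreal (inverse (?N x) ^ n) * (\<integral>\<^sup>+z. f z \<partial>L n) = (\<integral>\<^sup>+z. f (?N x *\<^sub>R z) \<partial>L n)"
        using x by (simp add: mult.assoc[symmetric] ennreal_mult'[symmetric] power_mult_distrib[symmetric])
      then show ?thesis
        using x by (subst nn_integral_cmult) (auto simp: ennreal_mult' mult.assoc indicator_def)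
    qed simp
  qed
  also have "\<dots> = (\<integral>\<^sup>+x. ennreal (inverse (?N x) ^ n * inverse (?N x) ^ n) * indicator {1..} (?N x) \<partial>L n) *
     (\<integral>\<^sup>+z. f z \<partial>L n)"
    by (rule nn_integral_multc) measurable
  finally show ?thesis .
qed

text \<open>The unknown constant of \<open>polar_aux\<close> does not depend on \<open>f\<close>, so
  it can be read off from the indicator of the unit ball.\<close>

lemma polar:
  assumes [measurable]: "f \<in> borel_measurable borel" and n: "n \<ge> 1"
  shows "(\<integral>\<^sup>+x. f x \<partial>L n) = (\<integral>\<^sup>+x. (\<integral>\<^sup>+v. f (eucl_norm n x *\<^sub>R v) \<partial>sph n) \<partial>L n)"
proof -
  let ?C = "\<integral>\<^sup>+x. ennreal (inverse (eucl_norm n x) ^ n * inverse (eucl_norm n x) ^ n) *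
       indicator {1..} (eucl_norm n x) \<partial>L n"
  have k: "ennreal (kap n) \<noteq> 0" "ennreal (kap n) \<noteq> \<top>" using kap_pos[of n] by auto
  have "(\<integral>\<^sup>+x. (\<integral>\<^sup>+v. indicator (unit_ball n) (eucl_norm n x *\<^sub>R v) \<partial>sph n) \<partial>L n) =
     (\<integral>\<^sup>+x. indicator (unit_ball n) x \<partial>L n)"
  proof (rule nn_integral_L_cong)
    fix x :: "nat \<Rightarrow> real" assume x: "x \<in> espace n"
    have "(\<integral>\<^sup>+v. indicator (unit_ball n) (eucl_norm n x *\<^sub>R v) \<partial>sph n) = (\<integral>\<^sup>+v. indicator (unit_ball n) x \<partial>sph n)"
      using n x by (intro nn_integral_sph_cong)
        (auto simp: unit_ball_eq unit_sphere_eq norm_scaleR indicator_def intro: espace_scaleR)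
    then show "(\<integral>\<^sup>+v. indicator (unit_ball n) (eucl_norm n x *\<^sub>R v) \<partial>sph n) = (indicator (unit_ball n) x :: ennreal)"
      using sph.emeasure_space_1[of n] by simp
  qed
  also have "\<dots> = ennreal (kap n)" by (simp add: emeasure_unit_ball sets_L)
  finally have "ennreal (kap n) * ennreal (kap n) = ?C * ennreal (kap n)"
    using polar_aux[of "indicator (unit_ball n)" n] n by (simp add: emeasure_unit_ball sets_L)
  then have "?C = ennreal (kap n)"
    using k by (simp add: mult.commute[of ?C] ennreal_mult_cancel_left)
  then have "ennreal (kap n) * (\<integral>\<^sup>+x. (\<integral>\<^sup>+v. f (eucl_norm n x *\<^sub>R v) \<partial>sph n) \<partial>L n) = ennreal (kap n) * (\<integral>\<^sup>+x. f x \<partial>L n)"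
    using polar_aux[of f n] n by simp
  then show ?thesis
    using k by (simp add: ennreal_mult_cancel_left)
qed

text \<open>A uniform point of the sphere, rotated about the last axis by an independent uniform direction,
  is again uniform.\<close>

lemma nn_integral_sph_Suc:
  assumes [measurable]: "f \<in> borel_measurable borel" and n: "n \<ge> 1"
  shows "(\<integral>\<^sup>+u. f u \<partial>sph (Suc n)) =
    (\<integral>\<^sup>+u. (\<integral>\<^sup>+v. f ((eucl_norm n u *\<^sub>R v)(n := u n)) \<partial>sph n) \<partial>sph (Suc n))"
proof -
  let ?N = "eucl_norm (Suc n)"
  define F where "F x = f ((1 / ?N x) *\<^sub>R x) * indicator (unit_ball (Suc n)) x" for x
  have [measurable]: "F \<in> borel_measurable borel"
    unfolding F_def by measurable
  have "(\<integral>\<^sup>+x. F x \<partial>L (Suc n)) = (\<integral>\<^sup>+h. (\<integral>\<^sup>+x. F (x(n := h)) \<partial>L n) \<partial>lborel)"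
    by (rule nn_integral_L_Suc') measurable
  also have "\<dots> = (\<integral>\<^sup>+h. (\<integral>\<^sup>+x. (\<integral>\<^sup>+v. F ((eucl_norm n x *\<^sub>R v)(n := h)) \<partial>sph n) \<partial>L n) \<partial>lborel)"
    by (intro nn_integral_cong polar n) measurable
  also have "\<dots> = (\<integral>\<^sup>+h. (\<integral>\<^sup>+x. (\<integral>\<^sup>+v. F ((eucl_norm n (x(n := h)) *\<^sub>R v)(n := (x(n := h)) n)) \<partial>sph n) \<partial>L n) \<partial>lborel)"
    by (simp add: norm_upd)
  also have "\<dots> = (\<integral>\<^sup>+x. (\<integral>\<^sup>+v. F ((eucl_norm n x *\<^sub>R v)(n := x n)) \<partial>sph n) \<partial>L (Suc n))"
    by (rule nn_integral_L_Suc'[symmetric,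
          where f = "\<lambda>x. \<integral>\<^sup>+v. F ((eucl_norm n x *\<^sub>R v)(n := x n)) \<partial>sph n"]) measurable
  also have "\<dots> = (\<integral>\<^sup>+x. (\<integral>\<^sup>+v. f ((eucl_norm n ((1 / ?N x) *\<^sub>R x) *\<^sub>R v)(n := ((1 / ?N x) *\<^sub>R x) n)) \<partial>sph n)
       * indicator (unit_ball (Suc n)) x \<partial>L (Suc n))"
  proof (rule nn_integral_L_cong)
    fix x :: "nat \<Rightarrow> real" assume x: "x \<in> espace (Suc n)"
    have "(\<integral>\<^sup>+v. F ((eucl_norm n x *\<^sub>R v)(n := x n)) \<partial>sph n) =
      (\<integral>\<^sup>+v. f ((eucl_norm n ((1 / ?N x) *\<^sub>R x) *\<^sub>R v)(n := ((1 / ?N x) *\<^sub>R x) n)) * indicator (unit_ball (Suc n)) x \<partial>sph n)"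
    proof (rule nn_integral_sph_cong[OF n])
      fix v assume v: "v \<in> unit_sphere n"
      let ?y = "(eucl_norm n x *\<^sub>R v)(n := x n)"
      have "?N ?y = sqrt ((eucl_norm n x)\<^sup>2 + (x n)\<^sup>2)"
        using v by (simp add: norm_Suc_upd norm_scaleR unit_sphere_eq)
      also have "\<dots> = ?N x" using norm_Suc_upd[of n x "x n"] by simp
      finally have N: "?N ?y = ?N x" .
      have "?y \<in> espace (Suc n)" using v by (auto simp: unit_sphere_eq intro!: espace_upd espace_scaleR)
      then have "?y \<in> unit_ball (Suc n) \<longleftrightarrow> x \<in> unit_ball (Suc n)" using x N by (simp add: unit_ball_eq)
      moreover have "(1 / ?N x) *\<^sub>R ?y = (eucl_norm n ((1 / ?N x) *\<^sub>R x) *\<^sub>R v)(n := ((1 / ?N x) *\<^sub>R x) n)"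
        by (simp add: norm_scaleR) (auto simp: fun_eq_iff fun_app)
      ultimately show "F ?y = f ((eucl_norm n ((1 / ?N x) *\<^sub>R x) *\<^sub>R v)(n := ((1 / ?N x) *\<^sub>R x) n)) * indicator (unit_ball (Suc n)) x"
        unfolding F_def N by (simp add: indicator_def)
    qed
    also have "\<dots> = (\<integral>\<^sup>+v. f ((eucl_norm n ((1 / ?N x) *\<^sub>R x) *\<^sub>R v)(n := ((1 / ?N x) *\<^sub>R x) n)) \<partial>sph n)
       * indicator (unit_ball (Suc n)) x"
      by (rule nn_integral_multc) measurable
    finally show "(\<integral>\<^sup>+v. F ((eucl_norm n x *\<^sub>R v)(n := x n)) \<partial>sph n) = \<dots>" .
  qed
  finally show ?thesis
    unfolding F_def
    by (subst (1 2) nn_integral_sph)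
      (simp, measurable)
qed

lemma emeasure_sph_UNIV [simp]: "emeasure (sph n) UNIV = 1"
  using sph.emeasure_space_1[of n] by simp

section \<open>Convex bodies and their parallel bodies\<close>

definition cc :: "nat \<Rightarrow> (nat \<Rightarrow> real) set \<Rightarrow> bool" where
  "cc n K \<longleftrightarrow> compact K \<and> convex K \<and> K \<noteq> {} \<and> K \<subseteq> espace n"

definition par :: "nat \<Rightarrow> (nat \<Rightarrow> real) set \<Rightarrow> real \<Rightarrow> (nat \<Rightarrow> real) set" where
  "par n K r = {x + r *\<^sub>R y | x y. x \<in> K \<and> y \<in> unit_ball n}"

definition proj :: "nat \<Rightarrow> (nat \<Rightarrow> real) \<Rightarrow> (nat \<Rightarrow> real)" where
  "proj n x = x(n := 0)"

lemma closed_espace: "closed (espace n)"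
  by (rule closedin_Euclidean_imp_closed[of n]) (simp flip: topspace_espace)

lemma compact_box: "compact {x :: nat \<Rightarrow> real. \<forall>i. x i \<in> (if i < n then {-r..r} else {0})}"
proof -
  have "compactin (product_topology (\<lambda>i. euclidean) UNIV) (PiE UNIV (\<lambda>i. if i < n then {-r..r} else {0::real}))"
    by (simp add: compactin_PiE)
  then show ?thesis
    by (simp add: euclidean_product_topology PiE_def Pi_def)
qed

lemma compact_bounded_closed:
  assumes "closed S" "S \<subseteq> espace n" "\<And>x. x \<in> S \<Longrightarrow> eucl_norm n x \<le> r"
  shows "compact S"
proof -
  have "S \<subseteq> {x. \<forall>i. x i \<in> (if i < n then {-r..r} else {0})}"
  proof safe
    fix x i assume "x \<in> S"
    then show "x i \<in> (if i < n then {-r..r} else {0})"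
      using assms(2) assms(3)[of x] abs_le_norm[of i n x] by (auto simp: espace_def abs_le_iff)
  qed
  then show ?thesis
    using compact_Int_closed[OF compact_box assms(1), of n r] by (simp add: Int_absorb1)
qed

lemma closed_norm_le: "closed {x. eucl_norm n x \<le> r}"
  by (intro closed_Collect_le continuous_on_eucl_norm continuous_on_id continuous_on_const)

lemma compact_unit_ball: "compact (unit_ball n)"
proof (rule compact_bounded_closed)
  show "closed (unit_ball n)"
    unfolding unit_ball_eq Collect_conj_eq using closed_Int[OF closed_espace closed_norm_le, of n n 1] by simp
qed (auto simp: unit_ball_eq)

lemma cc_unit_ball: "cc n (unit_ball n)"
proof -
  have "u *\<^sub>R x + v *\<^sub>R y \<in> unit_ball n"
    if "x \<in> unit_ball n" "y \<in> unit_ball n" "0 \<le> u" "0 \<le> v" "u + v = 1" for x y u v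
  proof -
    have "eucl_norm n (u *\<^sub>R x + v *\<^sub>R y) \<le> u * eucl_norm n x + v * eucl_norm n y"
      using norm_triangle[of n "u *\<^sub>R x" "v *\<^sub>R y"] that by (simp add: norm_scaleR)
    also have "\<dots> \<le> u * 1 + v * 1"
      using that by (intro add_mono mult_left_mono) (auto simp: unit_ball_eq)
    finally show ?thesis using that by (auto simp: unit_ball_eq intro: espace_add espace_scaleR)
  qed
  moreover have "0 \<in> unit_ball n" by (simp add: unit_ball_eq)
  then have "unit_ball n \<noteq> {}" by blast
  moreover have "unit_ball n \<subseteq> espace n" by (auto simp: unit_ball_eq)
  ultimately show ?thesis
    unfolding cc_def convex_def using compact_unit_ball by auto
qed

lemma closed_imp_borel: "compact (K :: (nat \<Rightarrow> real) set) \<Longrightarrow> K \<in> sets borel"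
  by (simp add: compact_imp_closed borel_closed)

lemma continuous_on_fst_snd:
  "continuous_on S (\<lambda>p. fst p)" "continuous_on S (\<lambda>p. snd p)"
  by (simp_all add: continuous_on_fst continuous_on_snd)

lemma compact_sums:
  assumes "compact A" "compact B"
  shows "compact {x + r *\<^sub>R y | x y. x \<in> A \<and> y \<in> (B :: (nat \<Rightarrow> real) set)}"
proof -
  have "{x + r *\<^sub>R y | x y. x \<in> A \<and> y \<in> B} = (\<lambda>p. fst p + r *\<^sub>R snd p) ` (A \<times> B)"
    by (auto simp: image_iff) blast+
  also have "compact \<dots>"
    by (intro compact_continuous_image continuous_on_fun_add continuous_on_fun_scaleR
        continuous_on_const continuous_on_fst_snd compact_Times assms)
  finally show ?thesis .
qed

lemma convex_sums:
  assumes "convex A" "convex B"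
  shows "convex {x + r *\<^sub>R y | x y. x \<in> A \<and> y \<in> (B :: (nat \<Rightarrow> real) set)}"
proof (rule convexI, safe)
  fix x y x' y' and u v :: real
  assume *: "x \<in> A" "y \<in> B" "x' \<in> A" "y' \<in> B" "0 \<le> u" "0 \<le> v" "u + v = 1"
  have "u *\<^sub>R (x + r *\<^sub>R y) + v *\<^sub>R (x' + r *\<^sub>R y') = (u *\<^sub>R x + v *\<^sub>R x') + r *\<^sub>R (u *\<^sub>R y + v *\<^sub>R y')"
    by (simp add: scaleR_add_right mult.commute)
  then show "\<exists>xa ya. u *\<^sub>R (x + r *\<^sub>R y) + v *\<^sub>R (x' + r *\<^sub>R y') = xa + r *\<^sub>R ya \<and> xa \<in> A \<and> ya \<in> B"
    using convexD[OF assms(1)] convexD[OF assms(2)] * by blast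
qed

lemma cc_par: "cc n K \<Longrightarrow> cc n (par n K r)"
  using cc_unit_ball[of n] unfolding cc_def par_def
  by (intro conjI compact_sums convex_sums) (auto intro: espace_add espace_scaleR)

lemma convex_linear_image_fun:
  fixes f :: "(nat \<Rightarrow> real) \<Rightarrow> (nat \<Rightarrow> real)"
  assumes "convex K" "\<And>x y. f (x + y) = f x + f y" "\<And>c x. f (c *\<^sub>R x) = c *\<^sub>R f x"
  shows "convex (f ` K)"
proof (rule convexI, safe)
  fix x y and u v :: real
  assume *: "x \<in> K" "y \<in> K" "0 \<le> u" "0 \<le> v" "u + v = 1"
  then have "u *\<^sub>R x + v *\<^sub>R y \<in> K" using assms(1) by (simp add: convexD)
  then show "u *\<^sub>R f x + v *\<^sub>R f y \<in> f ` K" by (intro image_eqI[of _ _ "u *\<^sub>R x + v *\<^sub>R y"]) (simp_all add: assms)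
qed

lemma proj_linear:
  "proj n (x + y) = proj n x + proj n y" "proj n (c *\<^sub>R x) = c *\<^sub>R proj n x" "proj n (x - y) = proj n x - proj n y"
  by (auto simp: proj_def fun_eq_iff fun_app)

lemma proj_espace: "x \<in> espace (Suc n) \<Longrightarrow> proj n x \<in> espace n"
  unfolding proj_def by (rule espace_upd0)

lemma norm_proj: "(eucl_norm n (proj n x))\<^sup>2 = (eucl_norm (Suc n) x)\<^sup>2 - (x n)\<^sup>2"
  unfolding proj_def norm_upd norm_sq ip_Suc by (simp add: power2_eq_square)

lemma norm_proj': "eucl_norm n (proj n x) = eucl_norm n x"
  by (simp add: proj_def norm_upd)

lemma norm_proj_le: "eucl_norm n (proj n x) \<le> eucl_norm (Suc n) x"
  by (rule power2_le_imp_le) (simp_all add: norm_proj)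

lemma borel_measurable_proj [measurable (raw)]:
  "f \<in> borel_measurable M \<Longrightarrow> (\<lambda>x. proj n (f x)) \<in> borel_measurable M"
  unfolding proj_def by (intro borel_measurable_fun_upd borel_measurable_const)

lemma continuous_on_proj: "continuous_on S f \<Longrightarrow> continuous_on S (\<lambda>x. proj n (f x))"
  unfolding proj_def by (intro continuous_on_fun_upd continuous_on_const)

lemma cc_proj: "cc (Suc n) K \<Longrightarrow> cc n (proj n ` K)"
  unfolding cc_def
  by (auto intro!: compact_continuous_image continuous_on_proj continuous_on_id convex_linear_image_fun proj_linear proj_espace)

lemma cc_refl: "cc (Suc n) K \<Longrightarrow> u \<in> espace (Suc n) \<Longrightarrow> cc (Suc n) (refl n u ` K)"
  unfolding cc_def
  by (auto intro!: compact_continuous_image continuous_on_refl continuous_on_id convex_linear_image_fun refl_linear refl_espace)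

lemma proj_unit_ball: "proj n ` unit_ball (Suc n) = unit_ball n"
proof safe
  fix x assume "x \<in> unit_ball (Suc n)"
  then show "proj n x \<in> unit_ball n"
    using norm_proj_le[of n x] by (auto simp: unit_ball_eq proj_espace)
next
  fix x assume x: "x \<in> unit_ball n"
  then have "x n = 0" by (simp add: unit_ball_eq espace_def)
  with x have "proj n x = x" "x \<in> unit_ball (Suc n)"
    using norm_Suc_upd[of n x 0] by (auto simp: proj_def unit_ball_eq fun_upd_idem espace_Suc_mono)
  then show "x \<in> proj n ` unit_ball (Suc n)" by (metis imageI)
qed

lemma refl_unit_ball:
  assumes "u \<in> unit_sphere (Suc n)"
  shows "refl n u ` unit_ball (Suc n) = unit_ball (Suc n)"
proof -
  have sub: "refl n u ` unit_ball (Suc n) \<subseteq> unit_ball (Suc n)"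
    using assms by (auto simp: unit_ball_eq norm_refl unit_sphere_eq intro: refl_espace)
  moreover have "unit_ball (Suc n) \<subseteq> refl n u ` unit_ball (Suc n)"
  proof
    fix x assume "x \<in> unit_ball (Suc n)"
    then have "refl n u x \<in> unit_ball (Suc n)" using sub by blast
    then show "x \<in> refl n u ` unit_ball (Suc n)" using refl_refl[OF assms, of x] by (metis imageI)
  qed
  ultimately show ?thesis by blast
qed

lemma image_sums:
  fixes f :: "(nat \<Rightarrow> real) \<Rightarrow> (nat \<Rightarrow> real)"
  assumes f: "\<And>x y. f (x + y) = f x + f y" "\<And>c x. f (c *\<^sub>R x) = c *\<^sub>R f x"
  shows "f ` {x + r *\<^sub>R y | x y. x \<in> A \<and> y \<in> B} = {x + r *\<^sub>R y | x y. x \<in> f ` A \<and> y \<in> f ` B}"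
proof (intro set_eqI iffI)
  fix z assume "z \<in> f ` {x + r *\<^sub>R y | x y. x \<in> A \<and> y \<in> B}"
  then obtain x y where xy: "z = f (x + r *\<^sub>R y)" "x \<in> A" "y \<in> B" by blast
  then have "z = f x + r *\<^sub>R f y" by (simp only: f)
  with xy show "z \<in> {x + r *\<^sub>R y | x y. x \<in> f ` A \<and> y \<in> f ` B}" by blast
next
  fix z assume "z \<in> {x + r *\<^sub>R y | x y. x \<in> f ` A \<and> y \<in> f ` B}"
  then obtain x y where xy: "z = f x + r *\<^sub>R f y" "x \<in> A" "y \<in> B" by blast
  then have "z = f (x + r *\<^sub>R y)" by (simp only: f)
  with xy show "z \<in> f ` {x + r *\<^sub>R y | x y. x \<in> A \<and> y \<in> B}" by blast
qed

lemma proj_par: "proj n ` par (Suc n) K r = par n (proj n ` K) r"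
  unfolding par_def by (subst image_sums) (simp_all only: proj_linear proj_unit_ball)

lemma refl_par:
  assumes "u \<in> unit_sphere (Suc n)"
  shows "refl n u ` par (Suc n) K r = par (Suc n) (refl n u ` K) r"
  unfolding par_def by (subst image_sums) (simp_all only: refl_linear refl_unit_ball[OF assms])

subsection \<open>The distance from a convex body\<close>

definition dst :: "nat \<Rightarrow> (nat \<Rightarrow> real) set \<Rightarrow> (nat \<Rightarrow> real) \<Rightarrow> real" where
  "dst n K y = (INF z\<in>K. eucl_norm n (y - z))"

lemma dst_attained:
  assumes "compact K" "K \<noteq> {}"
  obtains z where "z \<in> K" "dst n K y = eucl_norm n (y - z)" "\<And>k. k \<in> K \<Longrightarrow> eucl_norm n (y - z) \<le> eucl_norm n (y - k)"
proof -
  have "continuous_on K (\<lambda>z. eucl_norm n (y - z))"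
    by (intro continuous_on_eucl_norm continuous_on_fun_diff continuous_on_const continuous_on_id)
  from continuous_attains_inf[OF assms this] obtain z
    where z: "z \<in> K" "\<And>k. k \<in> K \<Longrightarrow> eucl_norm n (y - z) \<le> eucl_norm n (y - k)" by blast
  then have "dst n K y = eucl_norm n (y - z)"
    unfolding dst_def by (intro cInf_eq_minimum) auto
  with z show ?thesis by (intro that)
qed

lemma dst_le: "k \<in> K \<Longrightarrow> dst n K y \<le> eucl_norm n (y - k)"
  unfolding dst_def by (rule cINF_lower) (auto intro: bdd_belowI[of _ 0])

lemma dst_nonneg: "K \<noteq> {} \<Longrightarrow> 0 \<le> dst n K y"
  unfolding dst_def by (rule cINF_greatest) auto

text \<open>Turns membership in a parallel body into an inequality between functions whose
  measurability can be proved.\<close>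

lemma par_iff_dst:
  assumes "compact K" "K \<noteq> {}" "K \<subseteq> espace n" "0 \<le> r"
  shows "y \<in> par n K r \<longleftrightarrow> y \<in> espace n \<and> dst n K y \<le> r"
proof
  assume "y \<in> par n K r"
  then obtain x b where *: "y = x + r *\<^sub>R b" "x \<in> K" "b \<in> unit_ball n" by (auto simp: par_def)
  have "dst n K y \<le> eucl_norm n (y - x)" using * by (intro dst_le)
  also have "\<dots> = r * eucl_norm n b" using assms by (simp add: * norm_scaleR)
  also have "\<dots> \<le> r" using * assms by (simp add: unit_ball_eq mult_left_le)
  finally show "y \<in> espace n \<and> dst n K y \<le> r"
    using * assms by (auto simp: unit_ball_eq intro: espace_add espace_scaleR)
next
  assume y: "y \<in> espace n \<and> dst n K y \<le> r"
  obtain z where z: "z \<in> K" "dst n K y = eucl_norm n (y - z)"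
    using dst_attained[OF assms(1,2)] by metis
  have yz: "y - z \<in> espace n" using y z assms by (auto intro: espace_diff)
  show "y \<in> par n K r"
  proof (cases "r = 0")
    case True
    then have "eucl_norm n (y - z) = 0" using y z by (simp add: order_antisym)
    then have "y = z" using norm_eq_0[OF yz] by simp
    moreover have "0 \<in> unit_ball n" by (simp add: unit_ball_eq)
    ultimately show ?thesis using z True unfolding par_def by force
  next
    case False
    then have "(1 / r) *\<^sub>R (y - z) \<in> unit_ball n"
      using yz y z assms by (auto simp: unit_ball_eq norm_scaleR divide_le_eq intro: espace_scaleR)
    moreover have "y = z + r *\<^sub>R (1 / r) *\<^sub>R (y - z)" using False by simp
    ultimately show ?thesis using z unfolding par_def by blast
  qed
qed

lemma nearest_point:
  assumes "cc n K"
  obtains z where "z \<in> K" "dst n K y = eucl_norm n (y - z)" "\<And>k. k \<in> K \<Longrightarrow> ip n (k - z) (y - z) \<le> 0"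
proof -
  obtain z where z: "z \<in> K" "dst n K y = eucl_norm n (y - z)"
    "\<And>k. k \<in> K \<Longrightarrow> eucl_norm n (y - z) \<le> eucl_norm n (y - k)"
    using dst_attained[of K n y] assms unfolding cc_def by metis
  have "ip n (k - z) (y - z) \<le> 0" if k: "k \<in> K" for k
  proof (rule ccontr)
    define a where "a = ip n (k - z) (y - z)"
    define b where "b = ip n (k - z) (k - z)"
    assume "\<not> ip n (k - z) (y - z) \<le> 0"
    then have a: "0 < a" by (simp add: a_def)
    have b: "0 \<le> b" by (simp add: b_def)
    \<comment> \<open>A step of this size towards \<open>k\<close> makes the quadratic term smaller
      than the linear gain, contradicting minimality of \<open>z\<close>; the \<open>+ 1\<close>
      covers \<open>b = 0\<close>.\<close>
    define t where "t = min 1 (a / (b + 1))"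
    have t: "0 < t" "t \<le> 1" using a b by (auto simp: t_def)
    have "t * b \<le> a / (b + 1) * b" using b by (intro mult_right_mono) (auto simp: t_def)
    also have "\<dots> < a / (b + 1) * (b + 1)" using a b by (intro mult_strict_left_mono) auto
    finally have tb: "t * b < a" using b by simp
    let ?w = "(1 - t) *\<^sub>R z + t *\<^sub>R k"
    have "?w \<in> K" using assms z k t unfolding cc_def by (intro convexD) auto
    then have "ip n (y - z) (y - z) \<le> ip n (y - ?w) (y - ?w)"
      using z(3)[of ?w] by (simp add: norm_eq_ip)
    moreover have "y - ?w = (y - z) - t *\<^sub>R (k - z)"
      by (simp add: algebra_simps)
    then have "ip n (y - ?w) (y - ?w) = ip n (y - z) (y - z) - 2 * t * a + t * (t * b)"
      by (simp only: ip_simps(3,4,5,6)) (simp add: a_def b_def ip_simps ip_commute algebra_simps)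
    moreover have "t * (t * b) < t * a" using tb t by (intro mult_strict_left_mono)
    moreover have "0 < t * a" using t a by simp
    ultimately show False by (simp add: algebra_simps)
  qed
  with z show ?thesis using that by blast
qed

text \<open>Reduces an infimum over a compact index set to a countable one, as measurability
  requires.\<close>

lemma INF_dense_eq:
  fixes f :: "'a::topological_space \<Rightarrow> real"
  assumes "continuous_on Z f" "D \<subseteq> Z" "Z \<subseteq> closure D" "closed Z" "Z \<noteq> {}" "\<And>z. 0 \<le> f z"
  shows "(INF z\<in>Z. f z) = (INF z\<in>D. f z)"
proof (rule antisym)
  have D: "D \<noteq> {}" using assms by auto
  have bd: "bdd_below (f ` S)" for S using assms by (intro bdd_belowI[of _ 0]) auto
  show "(INF z\<in>Z. f z) \<le> (INF z\<in>D. f z)"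
    using assms D by (intro cINF_superset_mono bd) auto
  have cl: "closure D = Z" using assms by (simp add: closure_minimal subset_antisym)
  show "(INF z\<in>D. f z) \<le> (INF z\<in>Z. f z)"
  proof (rule cINF_greatest[OF assms(5)])
    fix z assume "z \<in> Z"
    then have z: "z \<in> closure D" using cl by simp
    have c: "continuous_on (closure D) f" using assms(1) cl by simp
    show "(INF z\<in>D. f z) \<le> f z"
      by (rule continuous_ge_on_closure[OF c z]) (rule cINF_lower[OF bd])
  qed
qed

lemma separable_subset:
  fixes Z :: "'a::{metric_space, second_countable_topology} set"
  obtains D where "countable D" "D \<subseteq> Z" "Z \<subseteq> closure D"
  using separable[of Z] by metis

text \<open>A body that varies with \<open>w\<close> is presented as the image of one fixed compact
  index set \<open>Z\<close>. All measurability statements about random or projected bodies use this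
  form, with no sigma-algebra on the space of bodies.\<close>

lemma borel_measurable_dst_image [measurable (raw)]:
  fixes Z :: "'z::{metric_space, second_countable_topology} set"
  assumes Z: "compact Z" "Z \<noteq> {}"
    and g: "\<And>w. w \<in> space M \<Longrightarrow> continuous_on Z (g w)" "\<And>z. z \<in> Z \<Longrightarrow> (\<lambda>w. g w z) \<in> borel_measurable M"
    and y [measurable]: "y \<in> borel_measurable M"
  shows "(\<lambda>w. dst n (g w ` Z) (y w)) \<in> borel_measurable M"
proof -
  obtain D where D: "countable D" "D \<subseteq> Z" "Z \<subseteq> closure D" using separable_subset by blast
  have "dst n (g w ` Z) (y w) = (INF z\<in>D. eucl_norm n (y w - g w z))" if "w \<in> space M" for w
    unfolding dst_def image_image
    using D Z that by (intro INF_dense_eq continuous_on_eucl_norm continuous_on_fun_diff continuous_on_const g)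
      (auto simp: compact_imp_closed)
  moreover have "(\<lambda>w. INF z\<in>D. eucl_norm n (y w - g w z)) \<in> borel_measurable M"
    using D g(2) by (intro borel_measurable_cINF_real borel_measurable_eucl_norm borel_measurable_fun_diff y) auto
  ultimately show ?thesis by (simp cong: measurable_cong)
qed

subsection \<open>Sweeping a convex body along a segment\<close>

text \<open>The Minkowski sum of \<open>K\<close> and the segment from \<open>0\<close> to
  \<open>t\<close> times \<open>u\<close>.\<close>

definition sweep :: "(nat \<Rightarrow> real) set \<Rightarrow> real \<Rightarrow> (nat \<Rightarrow> real) \<Rightarrow> (nat \<Rightarrow> real) set" where
  "sweep K t u = (\<lambda>p. fst p + snd p *\<^sub>R u) ` (K \<times> {0..t})"

lemma sweep_iff: "y \<in> sweep K t u \<longleftrightarrow> (\<exists>x\<in>K. \<exists>s\<in>{0..t}. y = x + s *\<^sub>R u)"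
  by (auto simp: sweep_def image_iff Bex_def)

lemma sweepI: "x \<in> K \<Longrightarrow> 0 \<le> s \<Longrightarrow> s \<le> t \<Longrightarrow> x + s *\<^sub>R u \<in> sweep K t u"
  unfolding sweep_iff by (intro bexI[of _ x] bexI[of _ s]) auto

lemma compact_sweep: "compact K \<Longrightarrow> compact (sweep K t u)"
  unfolding sweep_def
  by (intro compact_continuous_image continuous_on_fun_add continuous_on_fun_scaleR
      continuous_on_const continuous_on_fst_snd compact_Times compact_Icc)

lemma sweep_subset: "0 \<le> t \<Longrightarrow> K \<subseteq> sweep K t u"
  using sweepI[of _ K 0 t u] by auto

lemma par_sweep: "par n (sweep K t u) r = sweep (par n K r) t u"
proof (intro set_eqI iffI)
  fix z assume "z \<in> par n (sweep K t u) r"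
  then obtain x s y where "z = (x + s *\<^sub>R u) + r *\<^sub>R y" "x \<in> K" "s \<in> {0..t}" "y \<in> unit_ball n"
    unfolding par_def sweep_iff by blast
  then have "z = (x + r *\<^sub>R y) + s *\<^sub>R u" "x + r *\<^sub>R y \<in> par n K r" "s \<in> {0..t}"
    by (auto simp: add_ac par_def)
  then show "z \<in> sweep (par n K r) t u" unfolding sweep_iff by blast
next
  fix z assume "z \<in> sweep (par n K r) t u"
  then obtain x s y where *: "z = (x + r *\<^sub>R y) + s *\<^sub>R u" "x \<in> K" "s \<in> {0..t}" "y \<in> unit_ball n"
    unfolding par_def sweep_iff by blast
  then have "z = (x + s *\<^sub>R u) + r *\<^sub>R y" "x + s *\<^sub>R u \<in> sweep K t u"
    by (auto simp: add_ac intro: sweepI)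
  with * show "z \<in> par n (sweep K t u) r" unfolding par_def by blast
qed

lemma refl_sweep: "refl n u ` sweep K t v = sweep (refl n u ` K) t (refl n u v)"
proof (intro set_eqI iffI)
  fix z assume "z \<in> refl n u ` sweep K t v"
  then obtain x s where "z = refl n u (x + s *\<^sub>R v)" "x \<in> K" "s \<in> {0..t}" unfolding sweep_def by auto
  then show "z \<in> sweep (refl n u ` K) t (refl n u v)" by (auto simp: refl_linear intro: sweepI)
next
  fix z assume "z \<in> sweep (refl n u ` K) t (refl n u v)"
  then obtain x s where "z = refl n u x + s *\<^sub>R refl n u v" "x \<in> K" "s \<in> {0..t}" unfolding sweep_iff by blast
  then have "z = refl n u (x + s *\<^sub>R v)" "x + s *\<^sub>R v \<in> sweep K t v" by (auto simp: refl_linear intro: sweepI)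
  then show "z \<in> refl n u ` sweep K t v" by blast
qed

lemma upd_unitv: "(x(n := h)) + s *\<^sub>R unitv n = x(n := h + s)"
  by (auto simp: fun_eq_iff fun_app unitv_app)

lemma fibre_interval:
  assumes K: "cc (Suc n) K" and x: "x \<in> proj n ` K"
  obtains a b where "a \<le> b" "{h. x(n := h) \<in> K} = {a..b}"
proof -
  let ?F = "{h. x(n := h) \<in> K}"
  have xn: "x n = 0" using x by (auto simp: proj_def)
  have eq: "?F = (\<lambda>y. y n) ` (K \<inter> {y. proj n y = x})"
  proof (intro set_eqI iffI)
    fix h assume "h \<in> ?F"
    then show "h \<in> (\<lambda>y. y n) ` (K \<inter> {y. proj n y = x})"
      using xn by (intro image_eqI[of _ _ "x(n := h)"]) (auto simp: proj_def fun_eq_iff)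
  next
    fix h assume "h \<in> (\<lambda>y. y n) ` (K \<inter> {y. proj n y = x})"
    then obtain y where y: "y \<in> K" "proj n y = x" "h = y n" by blast
    then have "x(n := h) = y" by (auto simp: proj_def)
    with y show "h \<in> ?F" by simp
  qed
  have "closed {y. proj n y = x}"
    by (rule closed_Collect_eq) (intro continuous_on_proj continuous_on_id continuous_on_const)+
  then have "compact (K \<inter> {y. proj n y = x})" using K unfolding cc_def by (intro compact_Int_closed) auto
  then have "compact ?F"
    unfolding eq by (intro compact_continuous_image continuous_on_product_coordinates)
      (auto intro: continuous_on_subset continuous_on_product_coordinates)
  moreover have "convex ?F"
  proof (rule convexI, simp)
    fix a b u v :: real
    assume *: "x(n := a) \<in> K" "x(n := b) \<in> K" "0 \<le> u" "0 \<le> v" "u + v = 1"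
    then have "u *\<^sub>R x(n := a) + v *\<^sub>R x(n := b) \<in> K" using K unfolding cc_def by (simp add: convexD)
    moreover have "u *\<^sub>R x(n := a) + v *\<^sub>R x(n := b) = x(n := u * a + v * b)"
      using * by (auto simp: fun_eq_iff fun_app simp flip: distrib_right)
    ultimately show "x(n := u * a + v * b) \<in> K" by simp
  qed
  ultimately obtain a b where ab: "?F = {a..b}"
    using connected_compact_interval_1 convex_connected by metis
  moreover have "?F \<noteq> {}"
    unfolding eq using x by blast
  ultimately show ?thesis using that[of a b] by auto
qed

text \<open>Every vertical line over the shadow meets \<open>K\<close> in a nonempty compact
  interval, by convexity, and sweeping lengthens this interval by exactly \<open>t\<close>.
  Integration over the shadow gives the extra term.\<close>

lemma emeasure_sweep_unitv:
  assumes K: "cc (Suc n) K" and t: "0 \<le> t"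
  shows "emeasure (L (Suc n)) (sweep K t (unitv n)) =
    emeasure (L (Suc n)) K + ennreal t * emeasure (L n) (proj n ` K)"
proof -
  have m [measurable]: "K \<in> sets borel" "sweep K t (unitv n) \<in> sets borel" "proj n ` K \<in> sets borel"
    using K cc_proj[OF K] by (auto simp: cc_def closed_imp_borel compact_sweep)
  have "emeasure (L (Suc n)) (sweep K t (unitv n)) =
    (\<integral>\<^sup>+x. (\<integral>\<^sup>+h. indicator (sweep K t (unitv n)) (x(n := h)) \<partial>lborel) \<partial>L n)"
    by (subst nn_integral_L_Suc[symmetric]) (simp_all add: sets_L)
  also have "\<dots> = (\<integral>\<^sup>+x. (\<integral>\<^sup>+h. indicator K (x(n := h)) \<partial>lborel) + ennreal t * indicator (proj n ` K) x \<partial>L n)"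
  proof (rule nn_integral_L_cong)
    fix x :: "nat \<Rightarrow> real" assume "x \<in> espace n"
    then have xn: "x n = 0" by (simp add: espace_def)
    have eq: "x(n := h) \<in> sweep K t (unitv n) \<longleftrightarrow> (\<exists>s\<in>{0..t}. x(n := h - s) \<in> K)" for h
    proof
      assume "x(n := h) \<in> sweep K t (unitv n)"
      then obtain y s where y: "y \<in> K" "s \<in> {0..t}" "x(n := h) = y + s *\<^sub>R unitv n" unfolding sweep_iff by blast
      then have "y = x(n := h) + (- s) *\<^sub>R unitv n" by (simp add: scaleR_minus_left)
      then have "y = x(n := h - s)" unfolding upd_unitv by simp
      with y show "\<exists>s\<in>{0..t}. x(n := h - s) \<in> K" by blast
    next
      assume "\<exists>s\<in>{0..t}. x(n := h - s) \<in> K"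
      then obtain s where "s \<in> {0..t}" "x(n := h - s) \<in> K" by blast
      then show "x(n := h) \<in> sweep K t (unitv n)"
        unfolding sweep_iff by (intro bexI[of _ "x(n := h - s)"] bexI[of _ s]) (auto simp: upd_unitv)
    qed
    show "(\<integral>\<^sup>+h. indicator (sweep K t (unitv n)) (x(n := h)) \<partial>lborel) =
      (\<integral>\<^sup>+h. indicator K (x(n := h)) \<partial>lborel) + ennreal t * indicator (proj n ` K) x"
    proof (cases "x \<in> proj n ` K")
      case True
      then obtain a b where ab: "a \<le> b" "{h. x(n := h) \<in> K} = {a..b}" by (rule fibre_interval[OF K])
      then have iK: "x(n := h) \<in> K \<longleftrightarrow> h \<in> {a..b}" for h by blast
      \<comment> \<open>The witness is the smallest shift back that brings \<open>h\<close> down to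
        at most \<open>b\<close>.\<close>
      have "x(n := h) \<in> sweep K t (unitv n) \<longleftrightarrow> h \<in> {a..b + t}" for h
        unfolding eq iK using ab t by (auto intro!: bexI[of _ "max 0 (h - b)"])
      then have "(\<integral>\<^sup>+h. indicator (sweep K t (unitv n)) (x(n := h)) \<partial>lborel) = (\<integral>\<^sup>+h. indicator {a..b + t} h \<partial>lborel)"
        by (intro nn_integral_cong) (auto simp: indicator_def)
      also have "\<dots> = ennreal (b - a) + ennreal t" using ab t by (simp flip: ennreal_plus)
      also have "ennreal (b - a) = (\<integral>\<^sup>+h. indicator {a..b} h \<partial>lborel)" using ab by simp
      also have "\<dots> = (\<integral>\<^sup>+h. indicator K (x(n := h)) \<partial>lborel)"
        by (intro nn_integral_cong) (auto simp: indicator_def iK)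
      finally show ?thesis unfolding indicator_simps(1)[OF True] mult_1_right .
    next
      case False
      have "x(n := h) \<notin> K" for h
      proof
        assume "x(n := h) \<in> K"
        moreover have "proj n (x(n := h)) = x" using xn by (auto simp: proj_def)
        ultimately show False using False by (metis imageI)
      qed
      then show ?thesis using False by (simp add: eq indicator_def)
    qed
  qed
  also have "\<dots> = (\<integral>\<^sup>+x. (\<integral>\<^sup>+h. indicator K (x(n := h)) \<partial>lborel) \<partial>L n) +
     ennreal t * emeasure (L n) (proj n ` K)"
    by (subst nn_integral_add) (simp_all add: nn_integral_cmult sets_L)
  also have "(\<integral>\<^sup>+x. (\<integral>\<^sup>+h. indicator K (x(n := h)) \<partial>lborel) \<partial>L n) = emeasure (L (Suc n)) K"
    by (subst nn_integral_L_Suc[symmetric]) (simp_all add: sets_L)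
  finally show ?thesis .
qed

lemma emeasure_refl:
  assumes u: "u \<in> unit_sphere (Suc n)" and m: "A \<in> sets borel" "refl n u ` A \<in> sets borel"
  shows "emeasure (L (Suc n)) (refl n u ` A) = emeasure (L (Suc n)) A"
proof -
  note [measurable] = m
  have "x \<in> refl n u ` A \<longleftrightarrow> refl n u x \<in> A" for x
    using refl_refl[OF u] by (metis image_iff)
  then have eq: "indicator (refl n u ` A) x = (indicator A (refl n u x) :: ennreal)" for x
    by (simp add: indicator_def)
  have "emeasure (L (Suc n)) (refl n u ` A) = (\<integral>\<^sup>+x. indicator (refl n u ` A) x \<partial>L (Suc n))"
    by (simp add: sets_L m)
  also have "\<dots> = (\<integral>\<^sup>+x. indicator A (refl n u x) \<partial>L (Suc n))"
    by (simp only: eq)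
  also have "\<dots> = (\<integral>\<^sup>+x. indicator A x \<partial>L (Suc n))"
    by (rule nn_integral_L_refl[OF u]) measurable
  finally show ?thesis by (simp add: sets_L m)
qed

text \<open>Sweeping commutes with taking parallel bodies and with reflections, so the reflection
  that moves \<open>u\<close> to the last axis reduces the claim to a vertical sweep.\<close>

lemma emeasure_par_sweep:
  assumes K: "cc (Suc n) K" and t: "0 \<le> t" and u: "u \<in> unit_sphere (Suc n)"
  shows "emeasure (L (Suc n)) (par (Suc n) (sweep K t u) r) =
    emeasure (L (Suc n)) (par (Suc n) K r) + ennreal t * emeasure (L n) (par n ((\<lambda>x. proj n (refl n u x)) ` K) r)"
proof -
  let ?M = "refl n u ` par (Suc n) K r"
  have uE: "u \<in> espace (Suc n)" using u by (simp add: unit_sphere_eq)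
  have P: "cc (Suc n) (par (Suc n) K r)" by (rule cc_par[OF K])
  have M: "cc (Suc n) ?M" by (rule cc_refl[OF P uE])
  have S: "refl n u ` sweep (par (Suc n) K r) t u = sweep ?M t (unitv n)"
    by (simp add: refl_sweep refl_self[OF u])
  have "emeasure (L (Suc n)) (par (Suc n) (sweep K t u) r) =
     emeasure (L (Suc n)) (refl n u ` sweep (par (Suc n) K r) t u)"
    unfolding par_sweep
    by (rule emeasure_refl[OF u, symmetric]) (use P M in \<open>auto simp: S cc_def intro!: closed_imp_borel compact_sweep\<close>)
  also have "\<dots> = emeasure (L (Suc n)) ?M + ennreal t * emeasure (L n) (proj n ` ?M)"
    unfolding S by (rule emeasure_sweep_unitv[OF M t])
  also have "emeasure (L (Suc n)) ?M = emeasure (L (Suc n)) (par (Suc n) K r)"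
    by (rule emeasure_refl[OF u]) (use P M in \<open>auto simp: cc_def intro!: closed_imp_borel\<close>)
  also have "proj n ` ?M = par n ((\<lambda>x. proj n (refl n u x)) ` K) r"
    by (simp add: refl_par[OF u] proj_par image_image)
  finally show ?thesis .
qed

section \<open>Measurability of parallel bodies that depend on a parameter\<close>

lemma measurable_par_image [measurable (raw)]:
  fixes Z :: "'z::{metric_space, second_countable_topology} set"
  assumes Z: "compact Z" "Z \<noteq> {}"
    and g: "\<And>w. w \<in> space M \<Longrightarrow> continuous_on Z (g w)" "\<And>z. z \<in> Z \<Longrightarrow> (\<lambda>w. g w z) \<in> borel_measurable M"
      "\<And>w z. w \<in> space M \<Longrightarrow> z \<in> Z \<Longrightarrow> g w z \<in> espace n"
    and y [measurable]: "y \<in> borel_measurable M" and r [measurable]: "r \<in> borel_measurable M"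
    and r0: "\<And>w. w \<in> space M \<Longrightarrow> 0 \<le> r w"
  shows "Measurable.pred M (\<lambda>w. y w \<in> par n (g w ` Z) (r w))"
proof -
  have [measurable]: "(\<lambda>w. dst n (g w ` Z) (y w)) \<in> borel_measurable M"
    by (rule borel_measurable_dst_image) (use Z g in auto)
  have "y w \<in> par n (g w ` Z) (r w) \<longleftrightarrow> y w \<in> espace n \<and> dst n (g w ` Z) (y w) \<le> r w" if "w \<in> space M" for w
    using Z g that r0 by (intro par_iff_dst compact_continuous_image) auto
  moreover have "Measurable.pred M (\<lambda>w. y w \<in> espace n \<and> dst n (g w ` Z) (y w) \<le> r w)"
    by measurable
  ultimately show ?thesis by (simp cong: measurable_cong)
qed

lemma borel_measurable_emeasure_par [measurable (raw)]:
  fixes Z :: "'z::{metric_space, second_countable_topology} set"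
  assumes Z: "compact Z" "Z \<noteq> {}"
    and g: "\<And>w. w \<in> space M \<Longrightarrow> continuous_on Z (g w)" "\<And>z. z \<in> Z \<Longrightarrow> (\<lambda>w. g w z) \<in> borel_measurable M"
      "\<And>w z. w \<in> space M \<Longrightarrow> z \<in> Z \<Longrightarrow> g w z \<in> espace n"
    and r [measurable]: "r \<in> borel_measurable M"
    and r0: "\<And>w. w \<in> space M \<Longrightarrow> 0 \<le> r w"
  shows "(\<lambda>w. emeasure (L n) (par n (g w ` Z) (r w))) \<in> borel_measurable M"
proof -
  have *: "Measurable.pred (M \<Otimes>\<^sub>M L n) (\<lambda>p. snd p \<in> par n (g (fst p) ` Z) (r (fst p)))"
  proof (rule measurable_par_image[OF Z])
    fix z assume "z \<in> Z"
    from g(2)[OF this] show "(\<lambda>p. g (fst p) z) \<in> borel_measurable (M \<Otimes>\<^sub>M L n)"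
      by (rule measurable_compose[OF measurable_fst])
  qed (use g r0 in \<open>auto simp: space_pair_measure\<close>)
  have "(\<lambda>w. \<integral>\<^sup>+y. indicator {p. snd p \<in> par n (g (fst p) ` Z) (r (fst p))} (w, y) \<partial>L n) \<in> borel_measurable M"
    using * by (intro L.borel_measurable_nn_integral) (simp add: case_prod_unfold)
  moreover have "emeasure (L n) (par n (g w ` Z) (r w)) =
      (\<integral>\<^sup>+y. indicator {p. snd p \<in> par n (g (fst p) ` Z) (r (fst p))} (w, y) \<partial>L n)" if "w \<in> space M" for w
  proof -
    have "compact (g w ` Z)" using g(1)[OF that] Z by (intro compact_continuous_image)
    then have "par n (g w ` Z) (r w) \<in> sets (L n)"
      unfolding sets_L par_def by (intro closed_imp_borel compact_sums compact_unit_ball)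
    then have "emeasure (L n) (par n (g w ` Z) (r w)) = (\<integral>\<^sup>+y. indicator (par n (g w ` Z) (r w)) y \<partial>L n)"
      by simp
    also have "\<dots> = (\<integral>\<^sup>+y. indicator {p. snd p \<in> par n (g (fst p) ` Z) (r (fst p))} (w, y) \<partial>L n)"
      by (intro nn_integral_cong) (simp add: indicator_def)
    finally show ?thesis .
  qed
  ultimately show ?thesis by (simp cong: measurable_cong)
qed

section \<open>Cauchy's surface area formula\<close>

text \<open>Almost every point of \<open>sph (Suc n)\<close> is a unit vector; \<open>rho\<close> makes this true everywhere.\<close>

definition rho :: "nat \<Rightarrow> (nat \<Rightarrow> real) \<Rightarrow> (nat \<Rightarrow> real)" where
  "rho n u = (if u \<in> unit_sphere (Suc n) then u else unitv n)"

definition rproj :: "nat \<Rightarrow> (nat \<Rightarrow> real) \<Rightarrow> (nat \<Rightarrow> real) \<Rightarrow> (nat \<Rightarrow> real)" where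
  "rproj n u x = proj n (refl n (rho n u) x)"

lemma rho_sphere: "rho n u \<in> unit_sphere (Suc n)"
  by (simp add: rho_def unitv_sphere)

lemma rho_espace: "rho n u \<in> espace (Suc n)"
  using rho_sphere[of n u] by (simp add: unit_sphere_eq)

lemma borel_measurable_rho [measurable (raw)]:
  assumes [measurable]: "f \<in> borel_measurable M"
  shows "(\<lambda>x. rho n (f x)) \<in> borel_measurable M"
  unfolding rho_def by (rule measurable_If) (use assms in \<open>auto intro!: borel_measurable_const\<close>)

lemma borel_measurable_rproj [measurable (raw)]:
  assumes [measurable]: "f \<in> borel_measurable M" "g \<in> borel_measurable M"
  shows "(\<lambda>x. rproj n (f x) (g x)) \<in> borel_measurable M"
  unfolding rproj_def by measurable

lemma continuous_on_rproj: "continuous_on S (rproj n u)"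
  unfolding rproj_def by (intro continuous_on_proj continuous_on_refl continuous_on_id)

lemma rproj_espace: "x \<in> espace (Suc n) \<Longrightarrow> rproj n u x \<in> espace n"
  unfolding rproj_def by (intro proj_espace refl_espace rho_espace)

lemma rproj_linear:
  "rproj n u (x + y) = rproj n u x + rproj n u y" "rproj n u (c *\<^sub>R x) = c *\<^sub>R rproj n u x"
  by (simp_all add: rproj_def refl_linear proj_linear)

lemma rproj_unit_ball: "rproj n u ` unit_ball (Suc n) = unit_ball n"
  unfolding rproj_def image_image[symmetric] refl_unit_ball[OF rho_sphere] by (rule proj_unit_ball)

lemma cc_rproj: "cc (Suc n) K \<Longrightarrow> cc n (rproj n u ` K)"
  unfolding rproj_def image_image[symmetric] by (intro cc_proj cc_refl rho_espace)

definition Pc :: "nat \<Rightarrow> real \<Rightarrow> ennreal" where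
  "Pc n s = emeasure (sph (Suc n)) {u. s \<le> u n}"

text \<open>The mean of the positive part of a coordinate of a uniform unit vector, written as the
  integral of its tail; it is the constant in Cauchy's formula.\<close>

definition m1 :: "nat \<Rightarrow> ennreal" where
  "m1 n = (\<integral>\<^sup>+s. indicator {0..} s * Pc n s \<partial>lborel)"

text \<open>The mean shadow of the parallel body of radius \<open>r\<close>, since the shadow of a
  parallel body is the parallel body of the shadow.\<close>

definition Acau :: "nat \<Rightarrow> (nat \<Rightarrow> real) set \<Rightarrow> real \<Rightarrow> ennreal" where
  "Acau n K r = (\<integral>\<^sup>+u. emeasure (L n) (par n (rproj n u ` K) r) \<partial>sph (Suc n))"

lemma Pc_nn_integral: "Pc n s = (\<integral>\<^sup>+u. indicator {u. s \<le> u n} u \<partial>sph (Suc n))"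
  unfolding Pc_def by (simp add: sets_sph)

lemma borel_measurable_Pc [measurable]: "Pc n \<in> borel_measurable borel"
proof -
  have "(\<lambda>s. \<integral>\<^sup>+u. indicator {p. fst p \<le> snd p n} (s, u) \<partial>sph (Suc n)) \<in> borel_measurable borel"
    by (rule sph.borel_measurable_nn_integral) (simp add: indicator_def)
  also have "(\<lambda>s. \<integral>\<^sup>+u. indicator {p. fst p \<le> snd p n} (s, u) \<partial>sph (Suc n)) = Pc n"
    by (auto simp: Pc_nn_integral fun_eq_iff indicator_def intro!: nn_integral_cong)
  finally show ?thesis .
qed

lemma sphere_coord_le: "u \<in> unit_sphere (Suc n) \<Longrightarrow> u n \<le> 1"
  using abs_le_norm[of n "Suc n" u] by (auto simp: unit_sphere_eq)

lemma Pc_eq_0: "1 < s \<Longrightarrow> Pc n s = 0"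
  unfolding Pc_nn_integral
  by (subst nn_integral_sph_cong[where g = "\<lambda>_. 0"]) (auto simp: indicator_def dest: sphere_coord_le)

lemma Pc_le_1: "Pc n s \<le> 1"
  unfolding Pc_def by (rule sph.measure_le_1)

lemma Pc_direction:
  assumes v: "v \<in> unit_sphere (Suc n)"
  shows "emeasure (sph (Suc n)) {u. s \<le> ip (Suc n) (rho n u) v} = Pc n s"
proof -
  have "emeasure (sph (Suc n)) {u. s \<le> ip (Suc n) (rho n u) v} =
      (\<integral>\<^sup>+u. indicator {u. s \<le> ip (Suc n) (rho n u) v} u \<partial>sph (Suc n))"
    by (simp add: sets_sph)
  also have "\<dots> = (\<integral>\<^sup>+u. indicator {u. s \<le> u n} (refl n v u) \<partial>sph (Suc n))"
    by (rule nn_integral_sph_cong) (auto simp: rho_def refl_last[OF v] indicator_def)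
  also have "\<dots> = Pc n s"
    unfolding Pc_nn_integral by (rule nn_integral_sph_refl[OF _ v]) measurable
  finally show ?thesis .
qed

lemma emeasure_bounded_finite:
  assumes "compact S" "S \<subseteq> espace n"
  shows "emeasure (L n) S < \<infinity>"
proof (cases "S = {}")
  case False
  have "continuous_on S (eucl_norm n)" by (intro continuous_on_eucl_norm continuous_on_id)
  from continuous_attains_sup[OF assms(1) False this] obtain x
    where x: "x \<in> S" "\<And>y. y \<in> S \<Longrightarrow> eucl_norm n y \<le> eucl_norm n x" by blast
  have "emeasure (L n) S \<le> emeasure (L n) {y. \<forall>i<n. \<bar>y i\<bar> \<le> eucl_norm n x}"
    using x by (intro emeasure_mono) (auto simp: sets_L intro: order_trans[OF abs_le_norm])
  also have "\<dots> < \<infinity>" by (simp add: emeasure_L_cube power_less_top_ennreal)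
  finally show ?thesis .
qed simp

lemma par_finite: "cc n K \<Longrightarrow> emeasure (L n) (par n K r) < \<infinity>"
  using cc_par[of n K r] by (intro emeasure_bounded_finite) (auto simp: cc_def)

lemma par_borel: "cc n K \<Longrightarrow> par n K r \<in> sets borel"
  using cc_par[of n K r] by (auto simp: cc_def closed_imp_borel)

context
  fixes n :: nat and K :: "(nat \<Rightarrow> real) set"
  assumes K: "cc (Suc n) K"
begin

lemma borel_measurable_D [measurable (raw)]: "y \<in> borel_measurable M \<Longrightarrow> (\<lambda>w. dst (Suc n) K (y w)) \<in> borel_measurable M"
proof -
  assume "y \<in> borel_measurable M"
  then have "(\<lambda>w. dst (Suc n) ((\<lambda>z. z) ` K) (y w)) \<in> borel_measurable M"
    using K by (intro borel_measurable_dst_image[where g = "\<lambda>_ z. z"]) (auto simp: cc_def intro: continuous_on_id borel_measurable_const)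
  then show ?thesis by simp
qed

lemma par_D: "0 \<le> r \<Longrightarrow> y \<in> par (Suc n) K r \<longleftrightarrow> y \<in> espace (Suc n) \<and> dst (Suc n) K y \<le> r"
  using K unfolding cc_def by (intro par_iff_dst) auto

lemma measurable_swept:
  assumes "0 \<le> r" "0 \<le> t"
  shows "Measurable.pred (borel \<Otimes>\<^sub>M borel) (\<lambda>p. snd p \<in> par (Suc n) (sweep K t (rho n (fst p))) r)"
  unfolding sweep_def
proof (rule measurable_par_image[where r = "\<lambda>_. r" and y = snd and
        g = "\<lambda>w p. fst p + snd p *\<^sub>R rho n (fst w)"])
  show "compact (K \<times> {0..t})" using K by (auto simp: cc_def intro: compact_Times)
  show "K \<times> {0..t} \<noteq> {}" using K assms by (auto simp: cc_def)
next
  fix w :: "(nat \<Rightarrow> real) \<times> (nat \<Rightarrow> real)" and z :: "(nat \<Rightarrow> real) \<times> real"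
  assume "z \<in> K \<times> {0..t}"
  then show "fst z + snd z *\<^sub>R rho n (fst w) \<in> espace (Suc n)"
    using K by (auto simp: cc_def intro!: espace_add espace_scaleR rho_espace)
qed (auto simp: assms intro!: continuous_on_fun_add continuous_on_fun_scaleR continuous_on_fst_snd continuous_on_const
    borel_measurable_fun_add borel_measurable_fun_scaleR borel_measurable_const borel_measurable_rho)

text \<open>Both sides measure the pairs of a direction and a point that the sweep adds to the
  parallel body: the left side integrates over the points first, the right side over the directions
  first.\<close>

lemma swept_volume:
  assumes r: "0 \<le> r" and t: "0 \<le> t"
  shows "ennreal t * Acau n K r =
    (\<integral>\<^sup>+y. indicator {y \<in> espace (Suc n). r < dst (Suc n) K y} y *
       emeasure (sph (Suc n)) {u. y \<in> par (Suc n) (sweep K t (rho n u)) r} \<partial>L (Suc n))"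
proof -
  let ?S = "\<lambda>u. par (Suc n) (sweep K t (rho n u)) r"
  let ?P = "par (Suc n) K r"
  note pm [measurable] = measurable_swept[OF r t]
  have ind: "(\<lambda>p. indicator (- ?P) (snd p) * indicator (?S (fst p)) (snd p) :: ennreal) \<in> borel_measurable (borel \<Otimes>\<^sub>M borel)"
  proof -
    have [measurable]: "?P \<in> sets borel" by (rule par_borel[OF K])
    have "(\<lambda>p. indicator (?S (fst p)) (snd p) :: ennreal) = indicator {p. snd p \<in> ?S (fst p)}"
      by (auto simp: indicator_def)
    moreover have "{p. snd p \<in> ?S (fst p)} \<in> sets (borel \<Otimes>\<^sub>M borel)" using pm by (simp add: pred_def space_pair_measure)
    ultimately show ?thesis by simp
  qed
  have Sb: "?S u \<in> sets borel" for u
    using K unfolding par_def cc_def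
    by (intro closed_imp_borel compact_sums compact_sweep compact_unit_ball) auto
  have meq: "emeasure (L (Suc n)) (?S u - ?P) = ennreal t * emeasure (L n) (par n (rproj n u ` K) r)" for u
  proof -
    have sub: "?P \<subseteq> ?S u"
      using sweep_subset[OF t, of K "rho n u"] by (auto simp: par_def)
    have "emeasure (L (Suc n)) (?S u - ?P) = emeasure (L (Suc n)) (?S u) - emeasure (L (Suc n)) ?P"
      using par_finite[OF K, of r] par_borel[OF K, of r] Sb sub by (intro emeasure_Diff) (auto simp: sets_L)
    also have "emeasure (L (Suc n)) (?S u) = emeasure (L (Suc n)) ?P + ennreal t * emeasure (L n) (par n (rproj n u ` K) r)"
      unfolding rproj_def by (rule emeasure_par_sweep[OF K t rho_sphere])
    finally show ?thesis using par_finite[OF K, of r] by simp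
  qed
  have "ennreal t * Acau n K r = (\<integral>\<^sup>+u. ennreal t * emeasure (L n) (par n (rproj n u ` K) r) \<partial>sph (Suc n))"
    unfolding Acau_def
  proof (rule nn_integral_cmult[symmetric])
    show "(\<lambda>u. emeasure (L n) (par n (rproj n u ` K) r)) \<in> borel_measurable (sph (Suc n))"
      using K r by (intro borel_measurable_emeasure_par)
        (auto simp: cc_def intro: continuous_on_rproj rproj_espace borel_measurable_rproj borel_measurable_const)
  qed
  also have "\<dots> = (\<integral>\<^sup>+u. (\<integral>\<^sup>+y. indicator (- ?P) y * indicator (?S u) y \<partial>L (Suc n)) \<partial>sph (Suc n))"
  proof (rule nn_integral_cong)
    fix u
    have "(\<integral>\<^sup>+y. indicator (- ?P) y * indicator (?S u) y \<partial>L (Suc n)) = (\<integral>\<^sup>+y. indicator (?S u - ?P) y \<partial>L (Suc n))"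
      by (intro nn_integral_cong) (auto simp: indicator_def)
    also have "\<dots> = emeasure (L (Suc n)) (?S u - ?P)"
      using Sb par_borel[OF K] by (intro nn_integral_indicator) (auto simp: sets_L)
    finally show "ennreal t * emeasure (L n) (par n (rproj n u ` K) r) =
      (\<integral>\<^sup>+y. indicator (- ?P) y * indicator (?S u) y \<partial>L (Suc n))" by (simp add: meq)
  qed
  also have "\<dots> = (\<integral>\<^sup>+y. (\<integral>\<^sup>+u. indicator (- ?P) y * indicator (?S u) y \<partial>sph (Suc n)) \<partial>L (Suc n))"
  proof -
    interpret pair_sigma_finite "sph (Suc n)" "L (Suc n)" ..
    show ?thesis by (rule Fubini'[symmetric]) (use ind in \<open>simp add: case_prod_unfold cong: measurable_cong_sets\<close>)
  qed
  also have "\<dots> = (\<integral>\<^sup>+y. indicator {y \<in> espace (Suc n). r < dst (Suc n) K y} y *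
       emeasure (sph (Suc n)) {u. y \<in> ?S u} \<partial>L (Suc n))"
  proof (rule nn_integral_L_cong)
    fix y :: "nat \<Rightarrow> real" assume y: "y \<in> espace (Suc n)"
    have "Measurable.pred borel (\<lambda>u. y \<in> ?S u)"
      using measurable_compose[OF measurable_Pair2' pm, of y] by (simp add: comp_def)
    then have m: "{u. y \<in> ?S u} \<in> sets borel" by (simp add: pred_def)
    have "(\<integral>\<^sup>+u. indicator (- ?P) y * indicator (?S u) y \<partial>sph (Suc n)) =
      (\<integral>\<^sup>+u. indicator (- ?P) y * indicator {u. y \<in> ?S u} u \<partial>sph (Suc n))"
      by (intro nn_integral_cong) (auto simp: indicator_def)
    also have "\<dots> = indicator (- ?P) y * emeasure (sph (Suc n)) {u. y \<in> ?S u}"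
      using m by (simp add: nn_integral_cmult sets_sph)
    finally show "(\<integral>\<^sup>+u. indicator (- ?P) y * indicator (?S u) y \<partial>sph (Suc n)) =
       indicator {y \<in> espace (Suc n). r < dst (Suc n) K y} y * emeasure (sph (Suc n)) {u. y \<in> ?S u}"
      using y par_D[OF r, of y] by (simp add: indicator_def not_le)
  qed
  finally show ?thesis .
qed

lemma nearest_direction:
  assumes y: "y \<in> espace (Suc n)" "0 < dst (Suc n) K y"
  obtains z v where "z \<in> K" "v \<in> unit_sphere (Suc n)" "y = z + dst (Suc n) K y *\<^sub>R v"
    "\<And>k. k \<in> K \<Longrightarrow> ip (Suc n) (k - z) v \<le> 0"
proof -
  obtain z where z: "z \<in> K" "dst (Suc n) K y = eucl_norm (Suc n) (y - z)"
     "\<And>k. k \<in> K \<Longrightarrow> ip (Suc n) (k - z) (y - z) \<le> 0"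
    using nearest_point[OF K, of y] by metis
  have zE: "z \<in> espace (Suc n)" using z K by (auto simp: cc_def)
  define v where "v = (1 / dst (Suc n) K y) *\<^sub>R (y - z)"
  have "v \<in> unit_sphere (Suc n)"
    unfolding v_def unfolding z(2) using y z zE by (intro normalize_sphere espace_diff) auto
  moreover have "y = z + dst (Suc n) K y *\<^sub>R v" using y by (simp add: v_def)
  moreover have "ip (Suc n) (k - z) v \<le> 0" if "k \<in> K" for k
  proof -
    have "ip (Suc n) (k - z) v = 1 / dst (Suc n) K y * ip (Suc n) (k - z) (y - z)"
      unfolding v_def ip_simps(6) ..
    then show ?thesis using z(3)[OF that] y by (simp add: divide_le_0_iff)
  qed
  ultimately show ?thesis using that z by blast
qed

text \<open>The body lies behind the hyperplane through the point of \<open>K\<close> nearest to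
  \<open>y\<close> that is orthogonal to the outer direction \<open>v\<close>. To reach
  \<open>y\<close>, the segment must therefore advance by the missing distance in direction
  \<open>v\<close>.\<close>

lemma swept_upper:
  assumes y: "y \<in> espace (Suc n)" and r: "0 \<le> r" "r < dst (Suc n) K y" and e: "0 < e"
  shows "emeasure (sph (Suc n)) {u. y \<in> par (Suc n) (sweep K e (rho n u)) r} \<le> Pc n ((dst (Suc n) K y - r) / e)"
proof -
  have "0 < dst (Suc n) K y" using r by simp
  from nearest_direction[OF y this] obtain z v where z: "z \<in> K" "v \<in> unit_sphere (Suc n)" "y = z + dst (Suc n) K y *\<^sub>R v"
    "\<And>k. k \<in> K \<Longrightarrow> ip (Suc n) (k - z) v \<le> 0" by blast
  have vv: "ip (Suc n) v v = 1" by (rule sphere_ip[OF z(2)])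
  have "(dst (Suc n) K y - r) / e \<le> ip (Suc n) (rho n u) v" if "y \<in> par (Suc n) (sweep K e (rho n u)) r" for u
  proof -
    from that obtain k s b where *: "y = (k + s *\<^sub>R rho n u) + r *\<^sub>R b" "k \<in> K" "s \<in> {0..e}" "b \<in> unit_ball (Suc n)"
      unfolding par_def sweep_iff by blast
    have "dst (Suc n) K y *\<^sub>R v = (k - z) + s *\<^sub>R rho n u + r *\<^sub>R b"
      using z(3) *(1) by (simp add: algebra_simps)
    then have "ip (Suc n) (dst (Suc n) K y *\<^sub>R v) v = ip (Suc n) ((k - z) + s *\<^sub>R rho n u + r *\<^sub>R b) v" by simp
    then have eq: "dst (Suc n) K y = ip (Suc n) (k - z) v + s * ip (Suc n) (rho n u) v + r * ip (Suc n) b v"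
      by (simp only: ip_simps(1,5) vv)
    have "ip (Suc n) b v \<le> eucl_norm (Suc n) b * eucl_norm (Suc n) v" by (rule ip_le_norm)
    also have "\<dots> \<le> 1" using * z by (simp add: unit_ball_eq unit_sphere_eq)
    finally have "r * ip (Suc n) b v \<le> r" using r by (simp add: mult_left_le)
    then have 1: "dst (Suc n) K y - r \<le> s * ip (Suc n) (rho n u) v" using eq z(4)[OF *(2)] by linarith
    then have "0 < s * ip (Suc n) (rho n u) v" using r by linarith
    then have "0 < ip (Suc n) (rho n u) v" using * by (auto simp: zero_less_mult_iff)
    then have "s * ip (Suc n) (rho n u) v \<le> e * ip (Suc n) (rho n u) v"
      using * by (intro mult_right_mono) auto
    with 1 show ?thesis using e by (simp add: divide_le_eq mult.commute)
  qed
  then have "emeasure (sph (Suc n)) {u. y \<in> par (Suc n) (sweep K e (rho n u)) r} \<le>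
     emeasure (sph (Suc n)) {u. (dst (Suc n) K y - r) / e \<le> ip (Suc n) (rho n u) v}"
    by (intro emeasure_mono) (auto simp: sets_sph)
  then show ?thesis by (simp add: Pc_direction[OF z(2)])
qed

text \<open>A converse to \<open>swept_upper\<close> up to an error: moving the nearest point by
  \<open>e\<close> along the segment brings it within \<open>r\<close> of \<open>y\<close>. The term
  \<open>e / (2 * a)\<close> pays for the curvature of a ball of radius at least
  \<open>a\<close>.\<close>

lemma swept_lower:
  assumes y: "y \<in> espace (Suc n)" and r: "0 < a" "a \<le> r" "r < dst (Suc n) K y" and e: "0 < e"
  shows "Pc n ((dst (Suc n) K y - r) / e + e / (2 * a)) \<le> emeasure (sph (Suc n)) {u. y \<in> par (Suc n) (sweep K e (rho n u)) r}"
proof -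
  have D0: "0 < dst (Suc n) K y" using r by simp
  from nearest_direction[OF y this] obtain z v where z: "z \<in> K" "v \<in> unit_sphere (Suc n)" "y = z + dst (Suc n) K y *\<^sub>R v"
    by blast
  have zE: "z \<in> espace (Suc n)" using z K by (auto simp: cc_def)
  have vv: "ip (Suc n) v v = 1" by (rule sphere_ip[OF z(2)])
  have mem: "y \<in> par (Suc n) (sweep K e (rho n u)) r"
    if u: "(dst (Suc n) K y - r) / e + e / (2 * a) \<le> ip (Suc n) (rho n u) v" for u
  proof -
    let ?u = "rho n u"
    define p where "p = ip (Suc n) ?u v"
    let ?w = "dst (Suc n) K y *\<^sub>R v - e *\<^sub>R ?u"
    have uu: "ip (Suc n) ?u ?u = 1" by (rule sphere_ip[OF rho_sphere])
    have vE: "v \<in> espace (Suc n)" using z by (simp add: unit_sphere_eq)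
    have "ip (Suc n) ?w ?w = dst (Suc n) K y * dst (Suc n) K y - 2 * dst (Suc n) K y * e * p + e * e"
    proof -
      have vu: "ip (Suc n) v ?u = p" unfolding p_def by (rule ip_commute)
      have "ip (Suc n) ?w ?w = dst (Suc n) K y * (dst (Suc n) K y * 1 - e * p) - e * (dst (Suc n) K y * p - e * 1)"
        unfolding ip_simps vv uu vu p_def[symmetric] by (simp add: algebra_simps)
      then show ?thesis by (simp add: algebra_simps)
    qed
    also have "\<dots> \<le> r * r"
    proof -
      have "e * ((dst (Suc n) K y - r) / e + e / (2 * a)) \<le> e * p" using u e by (simp add: p_def)
      moreover have "e * ((dst (Suc n) K y - r) / e + e / (2 * a)) = dst (Suc n) K y - r + e * e / (2 * a)"
        using e by (simp add: distrib_left)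
      ultimately have "dst (Suc n) K y - r + e * e / (2 * a) \<le> e * p" by simp
      then have "2 * dst (Suc n) K y * (dst (Suc n) K y - r + e * e / (2 * a)) \<le> 2 * dst (Suc n) K y * (e * p)"
        using D0 by (intro mult_left_mono) auto
      moreover have "e * e \<le> 2 * dst (Suc n) K y * (e * e / (2 * a))"
      proof -
        have "e * e * a \<le> e * e * dst (Suc n) K y" using r by (intro mult_left_mono) auto
        then show ?thesis using r by (simp add: field_simps)
      qed
      moreover have "dst (Suc n) K y * dst (Suc n) K y - r * r \<le> 2 * dst (Suc n) K y * (dst (Suc n) K y - r)"
      proof -
        have "0 \<le> (dst (Suc n) K y - r) * (dst (Suc n) K y - r)" by simp
        then show ?thesis by (simp add: algebra_simps)
      qed
      ultimately show ?thesis by (simp add: algebra_simps)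
    qed
    finally have "eucl_norm (Suc n) ?w \<le> r"
      using r by (simp add: norm_eq_ip real_le_lsqrt power2_eq_square)
    then have b: "(1 / r) *\<^sub>R ?w \<in> unit_ball (Suc n)"
      using r vE by (auto simp: unit_ball_eq norm_scaleR divide_le_eq intro!: espace_scaleR espace_diff rho_espace)
    have "y = (z + e *\<^sub>R ?u) + r *\<^sub>R (1 / r) *\<^sub>R ?w"
      using r by (subst z(3)) simp
    moreover have "z + e *\<^sub>R ?u \<in> sweep K e ?u" using z e by (intro sweepI) auto
    ultimately show ?thesis using b unfolding par_def by blast
  qed
  have "Measurable.pred borel (\<lambda>u. y \<in> par (Suc n) (sweep K e (rho n u)) r)"
    using measurable_compose[OF measurable_Pair2' measurable_swept, of y] r e by (simp add: comp_def)
  then have "{u. y \<in> par (Suc n) (sweep K e (rho n u)) r} \<in> sets (sph (Suc n))"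
    by (simp add: pred_def sets_sph)
  then have "emeasure (sph (Suc n)) {u. (dst (Suc n) K y - r) / e + e / (2 * a) \<le> ip (Suc n) (rho n u) v} \<le>
     emeasure (sph (Suc n)) {u. y \<in> par (Suc n) (sweep K e (rho n u)) r}"
    using mem by (intro emeasure_mono) auto
  then show ?thesis by (simp add: Pc_direction[OF z(2)])
qed

end

interpretation lL: pair_sigma_finite "lborel :: real measure" "L n" for n ..

text \<open>Shifting the tail by \<open>d\<close> loses an interval of length \<open>d\<close>, on
  which the tail is at most one.\<close>

lemma m1_le:
  assumes d: "0 \<le> d"
  shows "m1 n \<le> (\<integral>\<^sup>+s. indicator {0<..1} s * Pc n (s + d) \<partial>lborel) + ennreal d"
proof -
  have "m1 n \<le> (\<integral>\<^sup>+s. indicator {0..d} s + indicator {d<..} s * Pc n s \<partial>lborel)"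
    unfolding m1_def using Pc_le_1 by (intro nn_integral_mono) (auto simp: indicator_def)
  also have "\<dots> = ennreal d + (\<integral>\<^sup>+s. indicator {d<..} s * Pc n s \<partial>lborel)"
    using d by (subst nn_integral_add) auto
  also have "(\<integral>\<^sup>+s. indicator {d<..} s * Pc n s \<partial>lborel) = (\<integral>\<^sup>+s. indicator {d<..} (d + s) * Pc n (d + s) \<partial>lborel)"
    by (subst nn_integral_lborel_affine[where c = 1 and t = d]) auto
  also have "\<dots> \<le> (\<integral>\<^sup>+s. indicator {0<..1} s * Pc n (s + d) \<partial>lborel)"
    using d by (intro nn_integral_mono) (auto simp: indicator_def add.commute Pc_eq_0 not_le)
  finally show ?thesis by (simp add: add.commute)
qed

lemma m1_finite: "m1 n < \<infinity>"
proof -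
  have "m1 n \<le> (\<integral>\<^sup>+s. indicator {0<..1} s * Pc n (s + 0) \<partial>lborel) + ennreal 0"
    by (rule m1_le) simp
  also have "\<dots> \<le> (\<integral>\<^sup>+s. indicator {0<..1::real} s \<partial>lborel) + ennreal 0"
    using Pc_le_1 by (intro add_right_mono nn_integral_mono) (auto simp: indicator_def)
  also have "\<dots> < \<infinity>" by simp
  finally show ?thesis .
qed

context
  fixes n :: nat and K :: "(nat \<Rightarrow> real) set"
  assumes K: "cc (Suc n) K"
begin

definition gap :: "real \<Rightarrow> real \<Rightarrow> ennreal" where
  "gap b R = emeasure (L (Suc n)) {y \<in> espace (Suc n). b < dst (Suc n) K y \<and> dst (Suc n) K y \<le> R}"

lemma D_meas [measurable (raw)]: "y \<in> borel_measurable M \<Longrightarrow> (\<lambda>w. dst (Suc n) K (y w)) \<in> borel_measurable M"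
  by (rule borel_measurable_D[OF K])

lemma gap_finite: "gap b R < \<infinity>"
proof (cases "R \<ge> 0")
  case True
  have "gap b R \<le> emeasure (L (Suc n)) (par (Suc n) K R)"
    unfolding gap_def using par_borel[OF K] par_D[OF K True]
    by (intro emeasure_mono) (auto simp: sets_L)
  then show ?thesis using par_finite[OF K, of R] by (rule order.strict_trans1)
next
  case False
  have "0 \<le> dst (Suc n) K y" for y using K by (intro dst_nonneg) (auto simp: cc_def)
  then have "{y \<in> espace (Suc n). b < dst (Suc n) K y \<and> dst (Suc n) K y \<le> R} = {}" using False by (smt (verit) Collect_empty_eq)
  then show ?thesis unfolding gap_def by (metis emeasure_empty infinity_ennreal_def ennreal_zero_less_top)
qed

lemma gap_nn: "gap b R = (\<integral>\<^sup>+y. indicator {y \<in> espace (Suc n). b < dst (Suc n) K y \<and> dst (Suc n) K y \<le> R} y \<partial>L (Suc n))"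
  unfolding gap_def by (simp add: sets_L)

lemma Acau_measurable: "(\<lambda>r. indicator {0..R} r * Acau n K r) \<in> borel_measurable borel"
proof -
  have *: "(\<lambda>p. emeasure (L n) (par n (rproj n (snd p) ` K) \<bar>fst p\<bar>)) \<in> borel_measurable (borel \<Otimes>\<^sub>M sph (Suc n))"
    using K by (intro borel_measurable_emeasure_par[where g = "\<lambda>p. rproj n (snd p)" and r = "\<lambda>p. \<bar>fst p\<bar>"])
      (auto simp: cc_def sets_sph intro: continuous_on_rproj rproj_espace borel_measurable_const cong: measurable_cong_sets
         intro!: borel_measurable_rproj)
  have "(\<lambda>r. indicator {0..R} r * (\<integral>\<^sup>+u. emeasure (L n) (par n (rproj n u ` K) \<bar>r\<bar>) \<partial>sph (Suc n))) \<in> borel_measurable borel"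
    using sph.borel_measurable_nn_integral[of "\<lambda>r u. emeasure (L n) (par n (rproj n u ` K) \<bar>r\<bar>)" borel "Suc n"] *
    by (simp add: case_prod_unfold)
  moreover have "(\<lambda>r. indicator {0..R} r * (\<integral>\<^sup>+u. emeasure (L n) (par n (rproj n u ` K) \<bar>r\<bar>) \<partial>sph (Suc n))) =
     (\<lambda>r. indicator {0..R} r * Acau n K r)"
    unfolding Acau_def by (auto simp: fun_eq_iff indicator_def)
  ultimately show ?thesis by simp
qed

text \<open>After exchanging the integrals, the inner one runs over the radii just below the
  distance of a fixed \<open>y\<close>; with unit \<open>e\<close> it becomes the tail integral
  \<open>m1\<close>. Only points at distance at most \<open>R + e\<close> can contribute.\<close>

lemma cauchy_upper:
  assumes R: "0 \<le> R" and e: "0 < e"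
  shows "(\<integral>\<^sup>+r. indicator {0..R} r * Acau n K r \<partial>lborel) \<le> m1 n * gap 0 (R + e)"
proof -
  let ?E = "espace (Suc n)"
  have D0: "0 \<le> dst (Suc n) K y" for y using K by (intro dst_nonneg) (auto simp: cc_def)
  have "ennreal e * (\<integral>\<^sup>+r. indicator {0..R} r * Acau n K r \<partial>lborel) =
     (\<integral>\<^sup>+r. ennreal e * (indicator {0..R} r * Acau n K r) \<partial>lborel)"
    by (rule nn_integral_cmult[symmetric]) (use Acau_measurable in simp)
  also have "\<dots> \<le> (\<integral>\<^sup>+r. (\<integral>\<^sup>+y. indicator {0..R} r * indicator ?E y * indicator {r<..} (dst (Suc n) K y) * Pc n ((dst (Suc n) K y - r) / e) \<partial>L (Suc n)) \<partial>lborel)"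
  proof (rule nn_integral_mono)
    fix r
    show "ennreal e * (indicator {0..R} r * Acau n K r) \<le>
      (\<integral>\<^sup>+y. indicator {0..R} r * indicator ?E y * indicator {r<..} (dst (Suc n) K y) * Pc n ((dst (Suc n) K y - r) / e) \<partial>L (Suc n))"
    proof (cases "r \<in> {0..R}")
      case True
      then have r: "0 \<le> r" by simp
      show ?thesis
        using True e swept_volume[OF K r, of e]
        by (auto simp: indicator_def intro!: nn_integral_mono swept_upper[OF K _ r])
    qed simp
  qed
  also have "\<dots> = (\<integral>\<^sup>+y. (\<integral>\<^sup>+r. indicator {0..R} r * indicator ?E y * indicator {r<..} (dst (Suc n) K y) * Pc n ((dst (Suc n) K y - r) / e) \<partial>lborel) \<partial>L (Suc n))"
    by (rule lL.Fubini'[symmetric]) (simp add: indicator_def, measurable)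
  also have "\<dots> \<le> (\<integral>\<^sup>+y. indicator {y \<in> ?E. 0 < dst (Suc n) K y \<and> dst (Suc n) K y \<le> R + e} y * (ennreal e * m1 n) \<partial>L (Suc n))"
  proof (rule nn_integral_mono)
    fix y
    let ?I = "\<integral>\<^sup>+r. indicator {0..R} r * indicator ?E y * indicator {r<..} (dst (Suc n) K y) * Pc n ((dst (Suc n) K y - r) / e) \<partial>lborel"
    show "?I \<le> indicator {y \<in> ?E. 0 < dst (Suc n) K y \<and> dst (Suc n) K y \<le> R + e} y * (ennreal e * m1 n)"
    proof (cases "y \<in> ?E \<and> 0 < dst (Suc n) K y \<and> dst (Suc n) K y \<le> R + e")
      case True
      have "?I \<le> (\<integral>\<^sup>+r. indicator {..<dst (Suc n) K y} r * Pc n ((dst (Suc n) K y - r) / e) \<partial>lborel)"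
        by (intro nn_integral_mono) (auto simp: indicator_def)
      also have "\<dots> = ennreal \<bar>- e\<bar> * (\<integral>\<^sup>+s. indicator {..<dst (Suc n) K y} (dst (Suc n) K y + (- e) * s) * Pc n ((dst (Suc n) K y - (dst (Suc n) K y + (- e) * s)) / e) \<partial>lborel)"
        using e by (intro nn_integral_lborel_affine) auto
      also have "\<dots> \<le> ennreal e * m1 n"
        unfolding m1_def using e by (intro mult_mono nn_integral_mono) (auto simp: indicator_def zero_less_mult_iff)
      finally show ?thesis using True by simp
    next
      case False
      have "indicator {0..R} r * indicator ?E y * indicator {r<..} (dst (Suc n) K y) * Pc n ((dst (Suc n) K y - r) / e) = 0" for r
      proof (cases "y \<in> ?E \<and> 0 \<le> r \<and> r \<le> R \<and> r < dst (Suc n) K y")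
        case True
        then have "R + e < dst (Suc n) K y" using False by auto
        then have "1 < (dst (Suc n) K y - r) / e" using True e by (simp add: less_divide_eq)
        then show ?thesis by (simp add: Pc_eq_0)
      qed (auto simp: indicator_def)
      then have "?I = 0" by (simp only: nn_integral_const mult_zero_left)
      then show ?thesis by simp
    qed
  qed
  also have "\<dots> = gap 0 (R + e) * (ennreal e * m1 n)"
    unfolding gap_nn by (rule nn_integral_multc) measurable
  also have "\<dots> = ennreal e * (m1 n * gap 0 (R + e))" by (simp add: mult_ac)
  finally show ?thesis
    using e by (subst (asm) ennreal_mult_le_mult_iff) auto
qed

text \<open>The same exchange for the lower estimate. Points beyond \<open>a + e\<close> are used so
  that every radius in the window of length \<open>e\<close> below their distance is at least
  \<open>a\<close>, where the curvature error is controlled.\<close>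

lemma cauchy_lower:
  assumes a: "0 < a" and e: "0 < e"
  shows "m1 n * gap (a + e) R \<le> (\<integral>\<^sup>+r. indicator {0..R} r * Acau n K r \<partial>lborel) + ennreal (e / (2 * a)) * gap 0 R"
proof -
  let ?E = "espace (Suc n)" and ?d = "e / (2 * a)"
  let ?J = "\<integral>\<^sup>+s. indicator {0<..1} s * Pc n (s + ?d) \<partial>lborel"
  have "gap (a + e) R * (ennreal e * ?J) =
     (\<integral>\<^sup>+y. indicator {y \<in> ?E. a + e < dst (Suc n) K y \<and> dst (Suc n) K y \<le> R} y * (ennreal e * ?J) \<partial>L (Suc n))"
    unfolding gap_nn by (rule nn_integral_multc[symmetric]) measurable
  also have "\<dots> = (\<integral>\<^sup>+y. (\<integral>\<^sup>+r. indicator {y \<in> ?E. a + e < dst (Suc n) K y \<and> dst (Suc n) K y \<le> R} y * indicator {r<..r+e} (dst (Suc n) K y) *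
        Pc n ((dst (Suc n) K y - r) / e + ?d) \<partial>lborel) \<partial>L (Suc n))"
  proof (rule nn_integral_cong)
    fix y
    have "(\<integral>\<^sup>+r. indicator {r<..r+e} (dst (Suc n) K y) * Pc n ((dst (Suc n) K y - r) / e + ?d) \<partial>lborel) =
      ennreal \<bar>- e\<bar> * (\<integral>\<^sup>+s. indicator {dst (Suc n) K y + (- e) * s<..dst (Suc n) K y + (- e) * s + e} (dst (Suc n) K y) * Pc n ((dst (Suc n) K y - (dst (Suc n) K y + (- e) * s)) / e + ?d) \<partial>lborel)"
      using e by (intro nn_integral_lborel_affine) (auto simp: indicator_def)
    also have "\<dots> = ennreal e * ?J"
      using e by (intro arg_cong2[where f = times] nn_integral_cong) (auto simp: indicator_def zero_less_mult_iff)
    finally show "indicator {y \<in> ?E. a + e < dst (Suc n) K y \<and> dst (Suc n) K y \<le> R} y * (ennreal e * ?J) =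
       (\<integral>\<^sup>+r. indicator {y \<in> ?E. a + e < dst (Suc n) K y \<and> dst (Suc n) K y \<le> R} y * indicator {r<..r+e} (dst (Suc n) K y) * Pc n ((dst (Suc n) K y - r) / e + ?d) \<partial>lborel)"
      by (simp add: indicator_def)
  qed
  also have "\<dots> = (\<integral>\<^sup>+r. (\<integral>\<^sup>+y. indicator {y \<in> ?E. a + e < dst (Suc n) K y \<and> dst (Suc n) K y \<le> R} y * indicator {r<..r+e} (dst (Suc n) K y) *
        Pc n ((dst (Suc n) K y - r) / e + ?d) \<partial>L (Suc n)) \<partial>lborel)"
    by (rule lL.Fubini') (simp add: indicator_def, measurable)
  also have "\<dots> \<le> (\<integral>\<^sup>+r. ennreal e * (indicator {0..R} r * Acau n K r) \<partial>lborel)"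
  proof (rule nn_integral_mono)
    fix r
    let ?I = "\<integral>\<^sup>+y. indicator {y \<in> ?E. a + e < dst (Suc n) K y \<and> dst (Suc n) K y \<le> R} y * indicator {r<..r+e} (dst (Suc n) K y) * Pc n ((dst (Suc n) K y - r) / e + ?d) \<partial>L (Suc n)"
    show "?I \<le> ennreal e * (indicator {0..R} r * Acau n K r)"
    proof (cases "a \<le> r \<and> r \<le> R")
      case True
      then have r: "0 \<le> r" using a by simp
      have e0: "0 \<le> e" using e by simp
      have "?I \<le> (\<integral>\<^sup>+y. indicator {y \<in> espace (Suc n). r < dst (Suc n) K y} y *
         emeasure (sph (Suc n)) {u. y \<in> par (Suc n) (sweep K e (rho n u)) r} \<partial>L (Suc n))"
        using True a e by (intro nn_integral_mono) (auto simp: indicator_def intro!: swept_lower[OF K])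
      also have "\<dots> = ennreal e * Acau n K r" by (rule swept_volume[OF K r e0, symmetric])
      finally show ?thesis using True r by simp
    next
      case False
      have "indicator {y \<in> ?E. a + e < dst (Suc n) K y \<and> dst (Suc n) K y \<le> R} y * indicator {r<..r+e} (dst (Suc n) K y) * Pc n ((dst (Suc n) K y - r) / e + ?d) = 0" for y
        using False by (auto simp: indicator_def)
      then have "?I = 0" by (simp only: nn_integral_const mult_zero_left)
      then show ?thesis by simp
    qed
  qed
  also have "\<dots> = ennreal e * (\<integral>\<^sup>+r. indicator {0..R} r * Acau n K r \<partial>lborel)"
    by (rule nn_integral_cmult) (use Acau_measurable in simp)
  finally have "ennreal e * (?J * gap (a + e) R) \<le> ennreal e * (\<integral>\<^sup>+r. indicator {0..R} r * Acau n K r \<partial>lborel)"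
    by (simp add: mult_ac)
  then have J: "?J * gap (a + e) R \<le> (\<integral>\<^sup>+r. indicator {0..R} r * Acau n K r \<partial>lborel)"
    using e by (subst (asm) ennreal_mult_le_mult_iff) auto
  have "m1 n * gap (a + e) R \<le> (?J + ennreal ?d) * gap (a + e) R"
    using a e by (intro mult_right_mono m1_le) auto
  also have "\<dots> = ?J * gap (a + e) R + ennreal ?d * gap (a + e) R" by (simp add: distrib_right)
  also have "\<dots> \<le> (\<integral>\<^sup>+r. indicator {0..R} r * Acau n K r \<partial>lborel) + ennreal ?d * gap 0 R"
  proof (intro add_mono J mult_left_mono)
    show "gap (a + e) R \<le> gap 0 R"
      unfolding gap_def using a e by (intro emeasure_mono) (auto simp: sets_L)
  qed simp
  finally show ?thesis .
qed

theorem cauchy_integrated: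
  assumes R: "0 \<le> R"
  shows "(\<integral>\<^sup>+r. indicator {0..R} r * Acau n K r \<partial>lborel) = m1 n * gap 0 R"
proof (rule antisym)
  let ?I = "\<integral>\<^sup>+r. indicator {0..R} r * Acau n K r \<partial>lborel"
  let ?S = "\<lambda>b R. {y \<in> espace (Suc n). b < dst (Suc n) K y \<and> dst (Suc n) K y \<le> R}"
  have fin: "m1 n \<noteq> \<top>" "gap b R \<noteq> \<top>" for b R using m1_finite[of n] gap_finite[of b R] by auto
  have "(\<lambda>k. gap 0 (R + 1 / Suc k)) \<longlonglongrightarrow> emeasure (L (Suc n)) (\<Inter>k. ?S 0 (R + 1 / Suc k))"
    unfolding gap_def
  proof (rule Lim_emeasure_decseq)
    show "decseq (\<lambda>k. ?S 0 (R + 1 / Suc k))"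
      unfolding decseq_def by (auto elim!: order_trans intro!: divide_left_mono)
  qed (use fin in \<open>auto simp: sets_L gap_def\<close>)
  also have "(\<Inter>k. ?S 0 (R + 1 / Suc k)) = ?S 0 R"
  proof safe
    fix y assume y: "y \<in> (\<Inter>k. ?S 0 (R + 1 / real (Suc k)))"
    then have "\<forall>k. dst (Suc n) K y \<le> R + 1 / real (Suc k)" by simp
    then show "dst (Suc n) K y \<le> R"
      by (metis add.commute field_le_epsilon less_eq_real_def nat_approx_posE order.trans add_left_mono)
  qed (auto intro: order_trans)
  finally have "(\<lambda>k. m1 n * gap 0 (R + 1 / Suc k)) \<longlonglongrightarrow> m1 n * gap 0 R"
    using fin by (intro ennreal_tendsto_cmult) (auto simp: gap_def less_top)
  then show "?I \<le> m1 n * gap 0 R"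
    by (rule LIMSEQ_le_const) (use cauchy_upper[OF R] in auto)
  define a where "a k = 1 / real (Suc k)" for k
  \<comment> \<open>The segment must shrink faster than the cutoff: both tend to zero, and so does
    the curvature error \<open>e k / (2 * a k)\<close>.\<close>
  define e where "e k = a k * a k" for k
  have ae: "0 < a k" "0 < e k" for k by (auto simp: a_def e_def)
  have "(\<lambda>k. gap (a k + e k) R) \<longlonglongrightarrow> emeasure (L (Suc n)) (\<Union>k. ?S (a k + e k) R)"
    unfolding gap_def
  proof (rule Lim_emeasure_incseq)
    have "a l \<le> a k" if "k \<le> l" for k l using that by (auto simp: a_def intro!: divide_left_mono)
    then have "a l + e l \<le> a k + e k" if "k \<le> l" for k l
      using that ae(1) unfolding e_def by (intro add_mono mult_mono) (auto simp: less_imp_le)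
    then show "incseq (\<lambda>k. ?S (a k + e k) R)"
      unfolding incseq_def by (auto intro: le_less_trans)
  qed (auto simp: sets_L)
  also have "(\<Union>k. ?S (a k + e k) R) = ?S 0 R"
  proof safe
    fix y assume y: "y \<in> espace (Suc n)" "0 < dst (Suc n) K y" "dst (Suc n) K y \<le> R"
    then obtain k where k: "1 / real (Suc k) < dst (Suc n) K y / 2" using nat_approx_posE[of "dst (Suc n) K y / 2"] by auto
    have "e k \<le> a k * 1" unfolding e_def using ae[of k] by (intro mult_left_mono) (auto simp: a_def)
    then have "a k + e k < dst (Suc n) K y" using k by (simp add: a_def)
    with y show "y \<in> (\<Union>k. ?S (a k + e k) R)" by auto
  next
    fix y k assume "a k + e k < dst (Suc n) K y" then show "0 < dst (Suc n) K y" using ae[of k] by linarith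
  qed
  finally have 1: "(\<lambda>k. m1 n * gap (a k + e k) R) \<longlonglongrightarrow> m1 n * gap 0 R"
    using fin by (intro ennreal_tendsto_cmult) (auto simp: gap_def less_top)
  have "(\<lambda>k. inverse (real (Suc k)) * (1 / 2)) \<longlonglongrightarrow> 0 * (1 / 2)"
    by (intro tendsto_mult LIMSEQ_inverse_real_of_nat tendsto_const)
  moreover have "e k / (2 * a k) = inverse (real (Suc k)) * (1 / 2)" for k
  proof -
    have "e k / (2 * a k) = a k * (1 / 2)" using ae(1)[of k] by (simp add: e_def)
    also have "\<dots> = inverse (real (Suc k)) * (1 / 2)" unfolding a_def inverse_eq_divide ..
    finally show ?thesis .
  qed
  ultimately have "(\<lambda>k. e k / (2 * a k)) \<longlonglongrightarrow> 0"
    by (simp only: mult_zero_left)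
  then have "(\<lambda>k. ennreal (e k / (2 * a k))) \<longlonglongrightarrow> ennreal 0"
    by (rule tendsto_ennrealI)
  then have "(\<lambda>k. gap 0 R * ennreal (e k / (2 * a k))) \<longlonglongrightarrow> gap 0 R * ennreal 0"
    using fin by (intro ennreal_tendsto_cmult) (auto simp: less_top)
  then have 2: "(\<lambda>k. ?I + ennreal (e k / (2 * a k)) * gap 0 R) \<longlonglongrightarrow> ?I + 0"
    by (intro tendsto_add tendsto_const) (simp add: mult.commute)
  show "m1 n * gap 0 R \<le> ?I"
    using LIMSEQ_le[OF 1 2] cauchy_lower ae by auto
qed

end

section \<open>Steiner's formula and intrinsic volumes\<close>

definition steiner :: "nat \<Rightarrow> (nat \<Rightarrow> real) set \<Rightarrow> (nat \<Rightarrow> real) \<Rightarrow> bool" where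
  "steiner n K V \<longleftrightarrow> (\<forall>i>n. V i = 0) \<and>
     (\<forall>r\<ge>0. volume n (par n K r) = (\<Sum>i\<le>n. r ^ i * kap i * V (n - i)))"

lemma intrinsic_volume_steiner: "intrinsic_volume n j K = (THE V. steiner n K V) j"
  by (simp add: intrinsic_volume_def steiner_def par_def kap_def)

lemma poly_coeffs_eq:
  fixes c d :: "nat \<Rightarrow> real"
  assumes "\<And>r. 0 \<le> r \<Longrightarrow> (\<Sum>i\<le>n. c i * r ^ i) = (\<Sum>i\<le>n. d i * r ^ i)" "i \<le> n"
  shows "c i = d i"
proof (rule ccontr)
  assume "c i \<noteq> d i"
  then have "finite {z. (\<Sum>i\<le>n. (c i - d i) * z ^ i) = 0}"
    using polyfun_finite_roots[of "\<lambda>i. c i - d i" n] assms(2) by (meson right_minus_eq)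
  moreover have "{0..1} \<subseteq> {z. (\<Sum>i\<le>n. (c i - d i) * z ^ i) = 0}"
  proof
    fix z :: real assume "z \<in> {0..1}"
    then have "(\<Sum>i\<le>n. c i * z ^ i) = (\<Sum>i\<le>n. d i * z ^ i)" by (intro assms(1)) simp
    then show "z \<in> {z. (\<Sum>i\<le>n. (c i - d i) * z ^ i) = 0}" by (simp add: left_diff_distrib sum_subtractf)
  qed
  ultimately have "finite {0..1::real}" by (rule finite_subset[rotated])
  then show False using infinite_Icc[of "0::real" 1] by simp
qed

lemma steiner_unique:
  assumes "steiner n K V" "steiner n K V'"
  shows "V = V'"
proof
  fix j
  show "V j = V' j"
  proof (cases "j \<le> n")
    case True
    have "kap (n - j) * V (n - (n - j)) = kap (n - j) * V' (n - (n - j))"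
      by (rule poly_coeffs_eq[where c = "\<lambda>i. kap i * V (n - i)" and d = "\<lambda>i. kap i * V' (n - i)" and n = n])
        (use assms in \<open>auto simp: steiner_def mult_ac\<close>)
    then show ?thesis using kap_pos[of "n - j"] True by simp
  qed (use assms in \<open>auto simp: steiner_def\<close>)
qed

text \<open>Nonnegativity is carried along because the induction averages these numbers as extended
  nonnegative reals.\<close>

definition steiner_exists :: "nat \<Rightarrow> bool" where
  "steiner_exists n \<longleftrightarrow> (\<forall>K. cc n K \<longrightarrow> (\<exists>V. steiner n K V \<and> (\<forall>i. 0 \<le> V i)))"

lemma steiner_intrinsic_volume:
  assumes "steiner_exists n" "cc n K"
  shows "steiner n K (\<lambda>j. intrinsic_volume n j K)" "0 \<le> intrinsic_volume n j K"
proof -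
  obtain V where V: "steiner n K V" "\<And>i. 0 \<le> V i" using assms by (auto simp: steiner_exists_def)
  then have "(THE V. steiner n K V) = V" using steiner_unique by (intro the_equality) auto
  then show "steiner n K (\<lambda>j. intrinsic_volume n j K)" "0 \<le> intrinsic_volume n j K"
    using V by (simp_all add: intrinsic_volume_steiner)
qed

text \<open>The constant coefficient is the limit of the values as \<open>r\<close> decreases to
  zero; subtracting it and dividing by \<open>r\<close> lowers the degree.\<close>

lemma borel_measurable_poly_coeff:
  fixes a :: "nat \<Rightarrow> 'a \<Rightarrow> real"
  assumes "\<And>r. 0 < r \<Longrightarrow> (\<lambda>w. \<Sum>i\<le>d. a i w * r ^ i) \<in> borel_measurable M" "i \<le> d"
  shows "a i \<in> borel_measurable M"
  using assms
proof (induction d arbitrary: a i)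
  case 0
  from 0(1)[of 1] 0(2) show ?case by simp
next
  case (Suc d)
  have 0: "a 0 \<in> borel_measurable M"
  proof (rule borel_measurable_LIMSEQ_real)
    show "(\<lambda>w. \<Sum>i\<le>Suc d. a i w * inverse (real (Suc k)) ^ i) \<in> borel_measurable M" for k
      by (rule Suc.prems(1)) simp
    fix w
    have "(\<lambda>k. \<Sum>i\<le>Suc d. a i w * inverse (real (Suc k)) ^ i) \<longlonglongrightarrow> (\<Sum>i\<le>Suc d. a i w * 0 ^ i)"
      by (intro tendsto_sum tendsto_mult tendsto_const tendsto_power LIMSEQ_inverse_real_of_nat)
    also have "(\<Sum>i\<le>Suc d. a i w * 0 ^ i) = a 0 w"
      by (subst sum.atMost_Suc_shift) simp
    finally show "(\<lambda>k. \<Sum>i\<le>Suc d. a i w * inverse (real (Suc k)) ^ i) \<longlonglongrightarrow> a 0 w" .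
  qed
  show ?case
  proof (cases i)
    case (Suc i')
    have "(\<lambda>i. a (Suc i)) i' \<in> borel_measurable M"
    proof (rule Suc.IH[where a = "\<lambda>i. a (Suc i)"])
      fix r :: real assume r: "0 < r"
      have "(\<lambda>w. ((\<Sum>i\<le>Suc d. a i w * r ^ i) - a 0 w) / r) \<in> borel_measurable M"
        using Suc.prems(1)[OF r] 0 by measurable
      moreover have "(\<lambda>w. ((\<Sum>i\<le>Suc d. a i w * r ^ i) - a 0 w) / r) = (\<lambda>w. \<Sum>i\<le>d. a (Suc i) w * r ^ i)"
        using r by (subst sum.atMost_Suc_shift) (simp add: sum_divide_distrib)
      ultimately show "(\<lambda>w. \<Sum>i\<le>d. a (Suc i) w * r ^ i) \<in> borel_measurable M" by (simp only:)
    qed (use Suc Suc.prems in auto)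
    then show ?thesis by (simp add: Suc)
  qed (use 0 in auto)
qed

lemma borel_measurable_intrinsic_volume_aux:
  fixes Z :: "'z::{metric_space, second_countable_topology} set"
  assumes SE: "steiner_exists n"
    and Z: "compact Z" "Z \<noteq> {}"
    and g: "\<And>w. w \<in> space M \<Longrightarrow> continuous_on Z (g w)" "\<And>z. z \<in> Z \<Longrightarrow> (\<lambda>w. g w z) \<in> borel_measurable M"
      "\<And>w z. w \<in> space M \<Longrightarrow> z \<in> Z \<Longrightarrow> g w z \<in> espace n"
      "\<And>w. w \<in> space M \<Longrightarrow> convex (g w ` Z)"
  shows "(\<lambda>w. intrinsic_volume n j (g w ` Z)) \<in> borel_measurable M"
proof -
  have cc: "cc n (g w ` Z)" if "w \<in> space M" for w
    using Z g that by (auto simp: cc_def intro!: compact_continuous_image)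
  have st: "steiner n (g w ` Z) (\<lambda>j. intrinsic_volume n j (g w ` Z))" if "w \<in> space M" for w
    by (rule steiner_intrinsic_volume[OF SE cc[OF that]])
  show ?thesis
  proof (cases "j \<le> n")
    case True
    let ?a = "\<lambda>i w. kap i * intrinsic_volume n (n - i) (g w ` Z)"
    have "?a (n - j) \<in> borel_measurable M"
    proof (rule borel_measurable_poly_coeff[where a = "?a" and d = n])
      fix r :: real assume r: "0 < r"
      have "(\<lambda>w. emeasure (L n) (par n (g w ` Z) r)) \<in> borel_measurable M"
        by (rule borel_measurable_emeasure_par[OF Z]) (use g r in auto)
      then have "(\<lambda>w. volume n (par n (g w ` Z) r)) \<in> borel_measurable M"
        unfolding volume_def measure_def by measurable
      moreover have "volume n (par n (g w ` Z) r) = (\<Sum>i\<le>n. ?a i w * r ^ i)" if "w \<in> space M" for w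
        using st[OF that] r by (simp add: steiner_def mult_ac)
      ultimately show "(\<lambda>w. \<Sum>i\<le>n. ?a i w * r ^ i) \<in> borel_measurable M" by (simp cong: measurable_cong)
    qed simp
    then have "(\<lambda>w. (1 / kap (n - j)) * ?a (n - j) w) \<in> borel_measurable M"
      by (rule borel_measurable_times[OF borel_measurable_const])
    moreover have "(\<lambda>w. (1 / kap (n - j)) * ?a (n - j) w) = (\<lambda>w. intrinsic_volume n j (g w ` Z))"
      using True kap_pos[of "n - j"] by (simp add: fun_eq_iff)
    ultimately show ?thesis by (simp only:)
  next
    case False
    then have "intrinsic_volume n j (g w ` Z) = 0" if "w \<in> space M" for w
      using st[OF that] by (simp add: steiner_def)
    then show ?thesis by (simp cong: measurable_cong)
  qed
qed

lemma emeasure_volume: "cc n K \<Longrightarrow> emeasure (L n) K = ennreal (volume n K)"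
  using emeasure_bounded_finite[of K n] by (simp add: volume_def cc_def emeasure_eq_ennreal_measure)

lemma volume_nonneg: "0 \<le> volume n K" by (simp add: volume_def)

lemma par_0: "K \<subseteq> espace n \<Longrightarrow> K \<noteq> {} \<Longrightarrow> par n K 0 = K"
proof -
  have "0 \<in> unit_ball n" by (simp add: unit_ball_eq)
  then show ?thesis by (auto simp: par_def)
qed

lemma subset_par: "0 \<le> r \<Longrightarrow> K \<subseteq> par n K r"
proof
  fix x assume "x \<in> K"
  moreover have "0 \<in> unit_ball n" "x = x + r *\<^sub>R 0" by (simp_all add: unit_ball_eq)
  ultimately show "x \<in> par n K r" unfolding par_def by blast
qed

text \<open>Test the integrated formula on the unit ball: the shadows of its parallel bodies contain
  the unit ball of one dimension less, so the left side is positive.\<close>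

lemma m1_pos: "0 < m1 n"
proof -
  let ?B = "unit_ball (Suc n)"
  have "ennreal (kap n) = (\<integral>\<^sup>+r. indicator {0..1::real} r * ennreal (kap n) \<partial>lborel)"
    by (subst nn_integral_multc) auto
  also have "\<dots> \<le> (\<integral>\<^sup>+r. indicator {0..1} r * Acau n ?B r \<partial>lborel)"
  proof (intro nn_integral_mono)
    fix r :: real
    have "ennreal (kap n) \<le> Acau n ?B r" if r: "0 \<le> r"
    proof -
      have "ennreal (kap n) = (\<integral>\<^sup>+u. ennreal (kap n) \<partial>sph (Suc n))" by simp
      also have "\<dots> \<le> Acau n ?B r"
        unfolding Acau_def rproj_unit_ball emeasure_unit_ball[symmetric]
        using subset_par[OF r, of "unit_ball n" n] par_borel[OF cc_unit_ball, of n r]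
        by (intro nn_integral_mono emeasure_mono) (auto simp: sets_L)
      finally show ?thesis .
    qed
    then show "indicator {0..1} r * ennreal (kap n) \<le> indicator {0..1} r * Acau n ?B r"
      by (auto simp: indicator_def)
  qed
  also have "\<dots> = m1 n * gap n ?B 0 1" by (rule cauchy_integrated[OF cc_unit_ball]) simp
  finally show ?thesis using kap_pos[of n] by (cases "m1 n = 0") (auto simp: zero_less_iff_neq_zero)
qed

text \<open>Obtained by comparing coefficients: the term of degree \<open>n - j\<close> of the mean
  shadow is integrated to degree \<open>n - j + 1\<close>, divided by \<open>m1\<close>, and matched
  with Steiner's formula in dimension \<open>n + 1\<close>.\<close>

definition Cst :: "nat \<Rightarrow> nat \<Rightarrow> real" where
  "Cst n j = kap (n - j) / (real (Suc (n - j)) * enn2real (m1 n) * kap (Suc (n - j)))"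

lemma Cst_pos: "0 < Cst n j"
  using m1_pos[of n] m1_finite[of n] kap_pos by (auto simp: Cst_def enn2real_positive_iff)

lemma nn_integral_power_Icc:
  assumes "0 \<le> R"
  shows "(\<integral>\<^sup>+r. indicator {0..R} r * ennreal (r ^ i) \<partial>lborel) = ennreal (R ^ Suc i / real (Suc i))"
proof -
  have "(\<integral>\<^sup>+r. ennreal (r ^ i) * indicator {0..R} r \<partial>lborel) = ennreal (R ^ Suc i / real (Suc i) - 0 ^ Suc i / real (Suc i))"
  proof (rule nn_integral_FTC_Icc)
    fix r :: real
    have "((\<lambda>r. r ^ Suc i / real (Suc i)) has_real_derivative real (Suc i) * r ^ (Suc i - Suc 0) / real (Suc i)) (at r)"
      by (intro DERIV_cdivide DERIV_pow)
    then show "((\<lambda>r. r ^ Suc i / real (Suc i)) has_real_derivative r ^ i) (at r)" 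
      by (simp only: diff_Suc_Suc diff_zero nonzero_mult_div_cancel_left of_nat_neq_0 not_False_eq_True)
  qed (use assms in auto)
  then show ?thesis by (simp add: mult.commute)
qed

text \<open>The induction hypothesis expands the volume of each shadow, and the integrated Cauchy
  formula turns the mean expansion into one for the shell around \<open>K\<close>.\<close>

lemma gap_polynomial:
  assumes SE: "steiner_exists n" and K: "cc (Suc n) K" and R: "0 \<le> R"
  defines "W \<equiv> \<lambda>j. \<integral>\<^sup>+u. ennreal (intrinsic_volume n j (rproj n u ` K)) \<partial>sph (Suc n)"
  shows "m1 n * gap n K 0 R = (\<Sum>i\<le>n. ennreal (kap i * R ^ Suc i / real (Suc i)) * W (n - i))"
proof -
  have st: "steiner n (rproj n u ` K) (\<lambda>j. intrinsic_volume n j (rproj n u ` K))"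
    and nn: "0 \<le> intrinsic_volume n j (rproj n u ` K)" for u j
    by (rule steiner_intrinsic_volume[OF SE cc_rproj[OF K]])+
  have meas: "(\<lambda>u. intrinsic_volume n j (rproj n u ` K)) \<in> borel_measurable (sph (Suc n))" for j
    using K by (intro borel_measurable_intrinsic_volume_aux[OF SE])
      (auto simp: cc_def intro: continuous_on_rproj rproj_espace borel_measurable_rproj
        intro!: convex_linear_image_fun rproj_linear borel_measurable_const)
  have A: "Acau n K r = (\<Sum>i\<le>n. ennreal (r ^ i) * (ennreal (kap i) * W (n - i)))" if r: "0 \<le> r" for r
  proof -
    have "emeasure (L n) (par n (rproj n u ` K) r) =
      (\<Sum>i\<le>n. ennreal (r ^ i * kap i) * ennreal (intrinsic_volume n (n - i) (rproj n u ` K)))" for u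
    proof -
      have "emeasure (L n) (par n (rproj n u ` K) r) = ennreal (volume n (par n (rproj n u ` K) r))"
        by (intro emeasure_volume cc_par cc_rproj K)
      also have "\<dots> = ennreal (\<Sum>i\<le>n. r ^ i * kap i * intrinsic_volume n (n - i) (rproj n u ` K))"
        using st r by (simp add: steiner_def)
      also have "\<dots> = (\<Sum>i\<le>n. ennreal (r ^ i * kap i * intrinsic_volume n (n - i) (rproj n u ` K)))"
        using r nn kap_pos by (intro sum_ennreal[symmetric]) (simp add: less_imp_le)
      finally show ?thesis using r nn kap_pos by (simp add: ennreal_mult less_imp_le)
    qed
    then have "Acau n K r = (\<Sum>i\<le>n. ennreal (r ^ i * kap i) * W (n - i))"
      unfolding Acau_def W_def using meas by (simp add: nn_integral_sum nn_integral_cmult)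
    then show ?thesis using r kap_pos by (simp add: ennreal_mult less_imp_le mult.assoc)
  qed
  have "m1 n * gap n K 0 R = (\<integral>\<^sup>+r. indicator {0..R} r * Acau n K r \<partial>lborel)"
    by (rule cauchy_integrated[OF K R, symmetric])
  also have "\<dots> = (\<integral>\<^sup>+r. (\<Sum>i\<le>n. (indicator {0..R} r * ennreal (r ^ i)) * (ennreal (kap i) * W (n - i))) \<partial>lborel)"
    by (intro nn_integral_cong) (auto simp: indicator_def A)
  also have "\<dots> = (\<Sum>i\<le>n. ennreal (R ^ Suc i / real (Suc i)) * (ennreal (kap i) * W (n - i)))"
    using R by (simp add: nn_integral_sum nn_integral_multc nn_integral_power_Icc del: power_Suc)
  also have "\<dots> = (\<Sum>i\<le>n. ennreal (kap i * R ^ Suc i / real (Suc i)) * W (n - i))"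
  proof (intro sum.cong refl)
    fix i
    have "ennreal (kap i * R ^ Suc i / real (Suc i)) = ennreal (R ^ Suc i / real (Suc i)) * ennreal (kap i)"
      using R kap_pos[of i] by (subst ennreal_mult[symmetric]) (auto simp: mult.commute)
    then show "ennreal (R ^ Suc i / real (Suc i)) * (ennreal (kap i) * W (n - i)) =
      ennreal (kap i * R ^ Suc i / real (Suc i)) * W (n - i)" by (simp only: mult.assoc)
  qed
  finally show ?thesis .
qed

lemma kap_0: "kap 0 = 1"
proof -
  have "emeasure (L 0) (unit_ball 0) = (\<integral>\<^sup>+x. indicator (unit_ball 0) x \<partial>L 0)" by (simp add: sets_L)
  also have "\<dots> = indicator (unit_ball 0) 0" by (rule nn_integral_L_0) measurable
  also have "\<dots> = 1" by (simp add: unit_ball_eq)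
  finally show ?thesis using kap_pos[of 0] by (simp add: emeasure_unit_ball)
qed

text \<open>The parallel body is \<open>K\<close> together with its shell. The volume of
  \<open>K\<close> is the coefficient of degree zero, and the shell supplies all higher degrees.
  Finiteness of the means is read off from the finite volume of one shell.\<close>

lemma steiner_Suc:
  assumes SE: "steiner_exists n" and K: "cc (Suc n) K"
  defines "W \<equiv> \<lambda>j. \<integral>\<^sup>+u. ennreal (intrinsic_volume n j (rproj n u ` K)) \<partial>sph (Suc n)"
  shows "j \<le> n \<Longrightarrow> W j < \<infinity>"
    and "steiner (Suc n) K (\<lambda>j. if j = Suc n then volume (Suc n) K else if j \<le> n then Cst n j * enn2real (W j) else 0)"
proof -
  have gp: "m1 n * gap n K 0 R = (\<Sum>i\<le>n. ennreal (kap i * R ^ Suc i / real (Suc i)) * W (n - i))"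
    if "0 \<le> R" for R unfolding W_def by (rule gap_polynomial[OF SE K that])
  have m: "m1 n \<noteq> 0" "m1 n \<noteq> \<top>" using m1_pos[of n] m1_finite[of n] by auto
  show fin: "W j < \<infinity>" if j: "j \<le> n" for j
  proof -
    have "ennreal (kap (n - j) * 1 ^ Suc (n - j) / real (Suc (n - j))) * W (n - (n - j)) \<le>
      (\<Sum>i\<le>n. ennreal (kap i * 1 ^ Suc i / real (Suc i)) * W (n - i))"
      by (rule member_le_sum) auto
    also have "\<dots> = m1 n * gap n K 0 1" by (rule gp[symmetric]) simp
    also have "\<dots> < \<infinity>" using m gap_finite[OF K, of 0 1] by (simp add: ennreal_mult_less_top less_top)
    finally show ?thesis using j kap_pos[of "n - j"] by (auto simp: ennreal_mult_less_top)
  qed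
  define V where "V = (\<lambda>j. if j = Suc n then volume (Suc n) K else if j \<le> n then Cst n j * enn2real (W j) else 0)"
  have "volume (Suc n) (par (Suc n) K R) = (\<Sum>i\<le>Suc n. R ^ i * kap i * V (Suc n - i))" if R: "0 \<le> R" for R
  proof -
    have "0 \<le> V j" for j
      using Cst_pos[of n j] by (simp add: V_def volume_nonneg)
    then have tn: "0 \<le> R ^ Suc i * kap (Suc i) * V (n - i)" for i
      using R kap_pos[of "Suc i"] by (simp add: less_imp_le)
    have sub: "{y \<in> espace (Suc n). 0 < dst (Suc n) K y \<and> dst (Suc n) K y \<le> R} = par (Suc n) K R - K"
      (is "?S = _")
    proof -
      have "y \<in> K \<longleftrightarrow> y \<in> espace (Suc n) \<and> dst (Suc n) K y \<le> 0" for y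
        using par_D[OF K, of 0 y] K by (simp add: par_0 cc_def)
      then show ?thesis using par_D[OF K R] R by (auto simp: not_le)
    qed
    have "K \<subseteq> par (Suc n) K R" by (rule subset_par[OF R])
    then have "emeasure (L (Suc n)) (par (Suc n) K R) = emeasure (L (Suc n)) K + gap n K 0 R"
      unfolding gap_def[OF K] sub using K par_borel[OF K, of R]
      by (subst plus_emeasure) (auto simp: sets_L cc_def closed_imp_borel Un_absorb1)
    moreover have "gap n K 0 R = ennreal (\<Sum>i\<le>n. R ^ Suc i * kap (Suc i) * V (n - i))"
    proof -
      have "m1 n * gap n K 0 R = (\<Sum>i\<le>n. m1 n * ennreal (R ^ Suc i * kap (Suc i) * V (n - i)))"
        unfolding gp[OF R]
      proof (intro sum.cong refl)
        fix i assume "i \<in> {..n}"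
        then have i: "i \<le> n" by simp
        have "kap i * R ^ Suc i / real (Suc i) * enn2real (W (n - i)) =
           enn2real (m1 n) * (R ^ Suc i * kap (Suc i) * V (n - i))"
        proof -
          have alg: "k * P / S * w = M * (P * k' * (k / (S * M * k') * w))"
            if "M \<noteq> 0" "k' \<noteq> 0" "S \<noteq> 0" for k P S w M k' :: real
            using that by simp
          have V1: "V (n - i) = Cst n (n - i) * enn2real (W (n - i))"
            unfolding V_def using i by auto
          have V2: "Cst n (n - i) = kap i / (real (Suc i) * enn2real (m1 n) * kap (Suc i))"
            using i by (simp add: Cst_def)
          have "enn2real (m1 n) \<noteq> 0" using m by (simp add: enn2real_eq_0_iff)
          then show ?thesis
            unfolding V1 V2 using kap_pos[of "Suc i"] by (intro alg) auto
        qed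
        then have "ennreal (kap i * R ^ Suc i / real (Suc i)) * ennreal (enn2real (W (n - i))) =
          ennreal (enn2real (m1 n)) * ennreal (R ^ Suc i * kap (Suc i) * V (n - i))"
          using R kap_pos[of i] by (simp add: ennreal_mult'[symmetric] ennreal_mult''[symmetric])
        then show "ennreal (kap i * R ^ Suc i / real (Suc i)) * W (n - i) = m1 n * ennreal (R ^ Suc i * kap (Suc i) * V (n - i))"
          using fin[of "n - i"] m by (simp add: less_top)
      qed
      also have "\<dots> = m1 n * ennreal (\<Sum>i\<le>n. R ^ Suc i * kap (Suc i) * V (n - i))"
        unfolding sum_distrib_left[symmetric] using tn by (subst sum_ennreal) auto
      finally show ?thesis using m by (simp add: ennreal_mult_cancel_left)
    qed
    ultimately have "ennreal (volume (Suc n) (par (Suc n) K R)) =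
      ennreal (volume (Suc n) K) + ennreal (\<Sum>i\<le>n. R ^ Suc i * kap (Suc i) * V (n - i))"
      by (simp add: emeasure_volume[OF K] emeasure_volume[OF cc_par[OF K]])
    also have "\<dots> = ennreal (volume (Suc n) K + (\<Sum>i\<le>n. R ^ Suc i * kap (Suc i) * V (n - i)))"
      using tn by (intro ennreal_plus[symmetric] sum_nonneg volume_nonneg)
    finally have "volume (Suc n) (par (Suc n) K R) = volume (Suc n) K + (\<Sum>i\<le>n. R ^ Suc i * kap (Suc i) * V (n - i))"
      using tn by (subst (asm) ennreal_inj) (auto intro!: add_nonneg_nonneg sum_nonneg volume_nonneg)
    also have "volume (Suc n) K = R ^ 0 * kap 0 * V (Suc n - 0)" by (simp add: V_def kap_0)
    finally show ?thesis by (subst sum.atMost_Suc_shift) simp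
  qed
  then show "steiner (Suc n) K V" by (simp add: steiner_def V_def)
qed

theorem steiner_formula: "steiner_exists n"
proof (induction n)
  case 0
  have "\<exists>V. steiner 0 K V \<and> (\<forall>i. 0 \<le> V i)" if K: "cc 0 K" for K
  proof -
    have par: "par 0 K r = {0}" for r
      using cc_par[OF K, of r] by (auto simp: cc_def espace_0 subset_singleton_iff)
    have "unit_ball 0 = {0}" by (auto simp: unit_ball_eq espace_0)
    then have "volume 0 {0} = 1" using kap_0 by (simp add: kap_def)
    then have "steiner 0 K (\<lambda>i. if i = 0 then 1 else 0)"
      by (simp add: steiner_def par kap_0)
    then show ?thesis by (intro exI[of _ "\<lambda>i. if i = 0 then 1 else 0"]) auto
  qed
  then show ?case by (simp add: steiner_exists_def)
next
  case (Suc n)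
  have "\<exists>V. steiner (Suc n) K V \<and> (\<forall>i. 0 \<le> V i)" if K: "cc (Suc n) K" for K
    using steiner_Suc(2)[OF Suc K] Cst_pos
    by (intro exI conjI) (assumption, auto simp: volume_nonneg less_imp_le)
  then show ?case by (simp add: steiner_exists_def)
qed

lemmas steiner_iv = steiner_intrinsic_volume(1)[OF steiner_formula]
lemmas iv_nonneg = steiner_intrinsic_volume(2)[OF steiner_formula]
lemmas borel_measurable_intrinsic_volume = borel_measurable_intrinsic_volume_aux[OF steiner_formula]

lemma iv_top: "cc n K \<Longrightarrow> intrinsic_volume n n K = volume n K"
proof -
  assume K: "cc n K"
  have "volume n (par n K 0) = (\<Sum>i\<le>n. 0 ^ i * kap i * intrinsic_volume n (n - i) K)"
    using steiner_iv[OF K] by (simp add: steiner_def)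
  also have "\<dots> = (\<Sum>i\<in>{0}. 0 ^ i * kap i * intrinsic_volume n (n - i) K)"
    by (rule sum.mono_neutral_right) auto
  finally show ?thesis using K by (simp add: kap_0 par_0 cc_def)
qed

lemma iv_Suc:
  assumes K: "cc (Suc n) K" and j: "j \<le> n"
  shows "ennreal (intrinsic_volume (Suc n) j K) =
    ennreal (Cst n j) * (\<integral>\<^sup>+u. ennreal (intrinsic_volume n j (rproj n u ` K)) \<partial>sph (Suc n))"
proof -
  let ?W = "\<integral>\<^sup>+u. ennreal (intrinsic_volume n j (rproj n u ` K)) \<partial>sph (Suc n)"
  have "intrinsic_volume (Suc n) j K = Cst n j * enn2real ?W"
    using steiner_unique[OF steiner_iv[OF K] steiner_Suc(2)[OF steiner_formula K], THEN fun_cong, of j] j by simp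
  then have "ennreal (intrinsic_volume (Suc n) j K) = ennreal (Cst n j) * ennreal (enn2real ?W)"
    using Cst_pos[of n j] by (simp add: ennreal_mult)
  also have "ennreal (enn2real ?W) = ?W" using steiner_Suc(1)[OF steiner_formula K j] by (simp add: less_top)
  finally show ?thesis .
qed

section \<open>Intrinsic volumes relative to the unit ball\<close>

definition nv :: "nat \<Rightarrow> nat \<Rightarrow> (nat \<Rightarrow> real) set \<Rightarrow> real" where
  "nv n j K = intrinsic_volume n j K / intrinsic_volume n j (unit_ball n)"

lemma iv_ball_Suc: "j \<le> n \<Longrightarrow> intrinsic_volume (Suc n) j (unit_ball (Suc n)) = Cst n j * intrinsic_volume n j (unit_ball n)"
  using iv_Suc[OF cc_unit_ball, of j n] Cst_pos[of n j] iv_nonneg[OF cc_unit_ball]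
  by (simp add: rproj_unit_ball ennreal_mult'[symmetric] less_imp_le)

lemma iv_ball_pos: "j \<le> n \<Longrightarrow> 0 < intrinsic_volume n j (unit_ball n)"
proof (induction n)
  case 0
  then show ?case using iv_top[OF cc_unit_ball, of 0] kap_pos[of 0] by (simp add: kap_def)
next
  case (Suc n)
  show ?case
  proof (cases "j = Suc n")
    case True
    then show ?thesis using iv_top[OF cc_unit_ball, of "Suc n"] kap_pos[of "Suc n"] by (simp add: kap_def)
  next
    case False
    then have "j \<le> n" using Suc by simp
    then show ?thesis using Suc.IH Cst_pos[of n j] by (simp add: iv_ball_Suc)
  qed
qed

lemma nv_nonneg: "cc n K \<Longrightarrow> j \<le> n \<Longrightarrow> 0 \<le> nv n j K"
  using iv_nonneg[of n K j] iv_ball_pos[of j n] by (simp add: nv_def)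

text \<open>The ball projects to the ball in every direction, so the constant of the recursion
  cancels in the quotient and a plain mean over projections remains.\<close>

lemma nv_Suc:
  assumes K: "cc (Suc n) K" and j: "j \<le> n"
  shows "ennreal (nv (Suc n) j K) = (\<integral>\<^sup>+u. ennreal (nv n j (rproj n u ` K)) \<partial>sph (Suc n))"
proof -
  let ?b = "intrinsic_volume n j (unit_ball n)"
  have b: "0 < ?b" by (rule iv_ball_pos[OF j])
  have eq: "intrinsic_volume n j M = ?b * nv n j M" for M using b by (simp add: nv_def)
  have meas: "(\<lambda>u. nv n j (rproj n u ` K)) \<in> borel_measurable (sph (Suc n))"
    unfolding nv_def using K
    by (intro borel_measurable_divide borel_measurable_const borel_measurable_intrinsic_volume)
      (auto simp: cc_def intro: continuous_on_rproj rproj_espace borel_measurable_rproj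
        intro!: convex_linear_image_fun rproj_linear borel_measurable_const)
  have "ennreal (Cst n j * ?b) * ennreal (nv (Suc n) j K) = ennreal (intrinsic_volume (Suc n) j K)"
    using Cst_pos[of n j] b iv_ball_Suc[OF j] by (subst ennreal_mult'[symmetric]) (simp_all add: nv_def)
  also have "\<dots> = ennreal (Cst n j) * (\<integral>\<^sup>+u. ennreal ?b * ennreal (nv n j (rproj n u ` K)) \<partial>sph (Suc n))"
  proof -
    have "ennreal (intrinsic_volume n j M) = ennreal ?b * ennreal (nv n j M)" for M
      unfolding eq[of M] using b by (intro ennreal_mult') simp
    then show ?thesis
      unfolding iv_Suc[OF K j] by (intro arg_cong2[where f = times] refl nn_integral_cong)
  qed
  also have "\<dots> = ennreal (Cst n j * ?b) * (\<integral>\<^sup>+u. ennreal (nv n j (rproj n u ` K)) \<partial>sph (Suc n))"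
    using meas Cst_pos[of n j] b by (simp add: nn_integral_cmult ennreal_mult' mult.assoc)
  finally show ?thesis
    using Cst_pos[of n j] b by (simp add: ennreal_mult_cancel_left)
qed

lemma nv_top: "cc n K \<Longrightarrow> nv n n K = volume n K / kap n"
  by (simp add: nv_def iv_top cc_unit_ball kap_def)

section \<open>Convex hulls of finitely many points\<close>

definition weights :: "nat \<Rightarrow> (nat \<Rightarrow> real) set" where
  "weights N = {l \<in> espace N. (\<forall>i. 0 \<le> l i) \<and> (\<Sum>i<N. l i) = 1}"

definition comb :: "nat \<Rightarrow> (nat \<Rightarrow> nat \<Rightarrow> real) \<Rightarrow> (nat \<Rightarrow> real) \<Rightarrow> (nat \<Rightarrow> real)" where
  "comb N X l = (\<Sum>i<N. l i *\<^sub>R X i)"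

text \<open>The convex hull as the image of a fixed simplex under a map that is linear in the
  weights. This provides the fixed compact index set for measurability and makes projections act on
  the points alone.\<close>

definition phull :: "nat \<Rightarrow> (nat \<Rightarrow> nat \<Rightarrow> real) \<Rightarrow> (nat \<Rightarrow> real) set" where
  "phull N X = comb N X ` weights N"

lemma convex_weights: "convex (weights N)"
proof (rule convexI)
  fix x y and u v :: real
  assume "x \<in> weights N" "y \<in> weights N" "0 \<le> u" "0 \<le> v" "u + v = 1"
  then show "u *\<^sub>R x + v *\<^sub>R y \<in> weights N"
    by (auto simp: weights_def fun_app sum.distrib sum_distrib_left[symmetric] intro: espace_add espace_scaleR)
qed

lemma compact_weights: "compact (weights N)"
proof (rule compact_bounded_closed)
  have c: "continuous_on UNIV (\<lambda>l :: nat \<Rightarrow> real. l i)" for i by (rule continuous_on_product_coordinates)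
  have "weights N = espace N \<inter> {l. \<forall>i. 0 \<le> l i} \<inter> {l. (\<Sum>i<N. l i) = 1}" by (auto simp: weights_def)
  also have "closed \<dots>"
    by (intro closed_Int closed_espace closed_Collect_all closed_Collect_le closed_Collect_eq
        continuous_on_const continuous_on_sum c)
  finally show "closed (weights N)" .
next
  fix l assume l: "l \<in> weights N"
  have "eucl_norm N l \<le> (\<Sum>i<N. \<bar>l i\<bar>)" by (simp add: eucl_norm_def L2_set_le_sum_abs)
  also have "\<dots> = 1" using l by (simp add: weights_def)
  finally show "eucl_norm N l \<le> 1" .
qed (auto simp: weights_def)

lemma unitv_weights: "i < N \<Longrightarrow> unitv i \<in> weights N"
  by (auto simp: weights_def espace_def unitv_app)

lemma weights_nonempty: "1 \<le> N \<Longrightarrow> weights N \<noteq> {}"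
  using unitv_weights[of 0 N] by auto

lemma comb_linear: "comb N X (k + l) = comb N X k + comb N X l" "comb N X (c *\<^sub>R l) = c *\<^sub>R comb N X l"
  by (simp_all add: comb_def fun_app scaleR_add_left sum.distrib scaleR_sum_right)

lemma comb_unitv: "i < N \<Longrightarrow> comb N X (unitv i) = X i"
  by (simp add: comb_def unitv_app if_distrib[of "\<lambda>a. a *\<^sub>R b" for b] cong: if_cong)

lemma convex_hull_eq_hull: "convex hull (X ` {..<N}) = phull N X"
proof (rule subset_antisym)
  show "convex hull (X ` {..<N}) \<subseteq> phull N X"
  proof (rule hull_minimal)
    show "X ` {..<N} \<subseteq> phull N X"
    proof safe
      fix i assume "i < N"
      then show "X i \<in> phull N X"
        unfolding phull_def using comb_unitv[of i N X] unitv_weights[of i N] by (metis imageI)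
    qed
    show "convex (phull N X)"
      unfolding phull_def by (intro convex_linear_image_fun convex_weights comb_linear)
  qed
  show "phull N X \<subseteq> convex hull (X ` {..<N})"
    unfolding phull_def comb_def
  proof safe
    fix l assume l: "l \<in> weights N"
    show "(\<Sum>i<N. l i *\<^sub>R X i) \<in> convex hull (X ` {..<N})"
      by (rule convex_sum[OF finite_lessThan convex_convex_hull])
        (use l in \<open>auto simp: weights_def intro: hull_inc\<close>)
  qed
qed

lemma comb_espace: "(\<And>i. i < N \<Longrightarrow> X i \<in> espace n) \<Longrightarrow> comb N X l \<in> espace n"
  by (simp add: comb_def espace_def sum_fun_apply fun_app)

lemma continuous_on_comb: "continuous_on S (comb N X)"
proof (rule continuous_on_coordinatewise_then_product)
  fix k
  have "continuous_on S (\<lambda>l. \<Sum>i<N. l i * X i k)"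
    by (intro continuous_on_sum continuous_on_mult continuous_on_const
        continuous_on_subset[OF continuous_on_product_coordinates]) auto
  then show "continuous_on S (\<lambda>l. comb N X l k)" by (simp add: comb_def sum_fun_apply fun_app)
qed

lemma borel_measurable_comb:
  assumes "\<And>i. i < N \<Longrightarrow> (\<lambda>w. X w i) \<in> borel_measurable M"
  shows "(\<lambda>w. comb N (X w) l) \<in> borel_measurable M"
  unfolding comb_def using assms
  by (intro borel_measurable_fun_sum borel_measurable_fun_scaleR borel_measurable_const) auto

lemma cc_hull: "1 \<le> N \<Longrightarrow> (\<And>i. i < N \<Longrightarrow> X i \<in> espace n) \<Longrightarrow> cc n (phull N X)"
  unfolding cc_def phull_def using weights_nonempty[of N]
  by (auto intro!: compact_continuous_image continuous_on_comb compact_weights convex_linear_image_fun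
      convex_weights comb_linear comb_espace)

lemma rproj_comb: "rproj n u (comb N X l) = comb N (\<lambda>i. rproj n u (X i)) l"
proof -
  have "rproj n u 0 = 0" using rproj_linear(2)[of n u 0 0] by simp
  then have "rproj n u (\<Sum>a\<in>A. f a) = (\<Sum>a\<in>A. rproj n u (f a))" for A :: "nat set" and f
    by (induction A rule: infinite_finite_induct) (simp_all add: rproj_linear)
  then show ?thesis by (simp add: comb_def rproj_linear)
qed

lemma rproj_hull: "rproj n u ` phull N X = phull N (\<lambda>i. rproj n u (X i))"
  by (simp add: phull_def image_image rproj_comb)

lemma hull_ip_le:
  assumes x: "x \<in> phull N X" and le: "\<And>i. i < N \<Longrightarrow> ip n (X i) v \<le> s"
  shows "ip n x v \<le> s"
proof -
  from x obtain l where l: "l \<in> weights N" "x = comb N X l" by (auto simp: phull_def)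
  have "ip n x v = (\<Sum>i<N. l i * ip n (X i) v)"
    by (simp add: l comb_def ip_sum_left ip_simps)
  also have "\<dots> \<le> (\<Sum>i<N. l i * s)"
    using l le by (intro sum_mono mult_left_mono) (auto simp: weights_def)
  also have "\<dots> = s" using l by (simp add: weights_def sum_distrib_right[symmetric])
  finally show ?thesis .
qed

section \<open>Polytopes with few vertices\<close>

text \<open>The share of directions in which the support function of the single point
  \<open>y\<close> exceeds \<open>s\<close>. For a vertex in the unit ball it is at most the measure
  of a cap of height \<open>s\<close>.\<close>

definition Qc :: "nat \<Rightarrow> real \<Rightarrow> (nat \<Rightarrow> real) \<Rightarrow> ennreal" where
  "Qc n s y = emeasure (sph n) {v. s < ip n y v}"

lemma Qc_nn: "Qc n s y = (\<integral>\<^sup>+v. indicator {v. s < ip n y v} v \<partial>sph n)"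
  unfolding Qc_def by (subst nn_integral_indicator) (simp_all add: sets_sph)

lemma borel_measurable_Qc:
  assumes h: "h \<in> borel_measurable M"
  shows "(\<lambda>w. Qc n s (h w)) \<in> borel_measurable M"
proof -
  have [measurable]: "Qc n s \<in> borel_measurable borel"
  proof -
    have "(\<lambda>y. \<integral>\<^sup>+v. indicator {p. s < ip n (fst p) (snd p)} (y, v) \<partial>sph n) \<in> borel_measurable borel"
      by (rule sph.borel_measurable_nn_integral) (simp add: indicator_def)
    moreover have "(\<lambda>y. \<integral>\<^sup>+v. indicator {p. s < ip n (fst p) (snd p)} (y, v) \<partial>sph n) = Qc n s"
      by (auto simp: Qc_nn fun_eq_iff indicator_def intro!: nn_integral_cong)
    ultimately show ?thesis by simp
  qed
  show ?thesis using h by measurable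
qed

lemma unit_decomp:
  assumes "y \<in> espace (Suc n)"
  obtains w where "w \<in> unit_sphere (Suc n)" "y = eucl_norm (Suc n) y *\<^sub>R w"
proof (cases "eucl_norm (Suc n) y = 0")
  case True
  then have "y = 0" using norm_eq_0[OF assms] by simp
  then show ?thesis using that[of "unitv n"] unitv_sphere by simp
next
  case False
  then show ?thesis
    using that[of "(1 / eucl_norm (Suc n) y) *\<^sub>R y"] normalize_sphere[OF assms] by simp
qed

lemma Qc_norm_unitv:
  assumes y: "y \<in> espace (Suc n)"
  shows "Qc (Suc n) s y = Qc (Suc n) s (eucl_norm (Suc n) y *\<^sub>R unitv n)"
proof -
  obtain w where w: "w \<in> unit_sphere (Suc n)" "y = eucl_norm (Suc n) y *\<^sub>R w" by (rule unit_decomp[OF y])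
  let ?t = "eucl_norm (Suc n) y"
  have "ip (Suc n) y v = ip (Suc n) (?t *\<^sub>R unitv n) (refl n w v)" for v
  proof -
    have "ip (Suc n) y v = ip (Suc n) (refl n w (?t *\<^sub>R w)) (refl n w v)"
      by (subst w(2)) (simp only: ip_refl[OF w(1)])
    then show ?thesis by (simp only: refl_linear refl_self[OF w(1)])
  qed
  then have "Qc (Suc n) s y = (\<integral>\<^sup>+v. indicator {v. s < ip (Suc n) (?t *\<^sub>R unitv n) v} (refl n w v) \<partial>sph (Suc n))"
    by (simp add: Qc_nn indicator_def)
  also have "\<dots> = Qc (Suc n) s (?t *\<^sub>R unitv n)"
    unfolding Qc_nn by (rule nn_integral_sph_refl[OF _ w(1)]) measurable
  finally show ?thesis .
qed

lemma Qc_norm: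
  assumes "y \<in> espace n" "y' \<in> espace n" "eucl_norm n y = eucl_norm n y'" "1 \<le> n"
  shows "Qc n s y = Qc n s y'"
proof -
  obtain k where k: "n = Suc k" using assms(4) by (cases n) auto
  show ?thesis
    using Qc_norm_unitv[of y k s] Qc_norm_unitv[of y' k s] assms by (simp add: k)
qed

lemma norm_rproj:
  "eucl_norm n (rproj n u y) = sqrt ((eucl_norm (Suc n) y)\<^sup>2 - (ip (Suc n) y (rho n u))\<^sup>2)"
proof -
  have "(eucl_norm n (rproj n u y))\<^sup>2 = (eucl_norm (Suc n) y)\<^sup>2 - (ip (Suc n) y (rho n u))\<^sup>2"
    unfolding rproj_def norm_proj norm_refl[OF rho_sphere] refl_last[OF rho_sphere] ..
  then show ?thesis by (metis norm_ge_0 real_sqrt_unique)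
qed

lemma norm_rproj_le: "eucl_norm n (rproj n u y) \<le> eucl_norm (Suc n) y"
  unfolding rproj_def using norm_proj_le[of n "refl n (rho n u) y"] by (simp add: norm_refl[OF rho_sphere])

text \<open>A uniform direction orthogonal to a uniform direction is itself uniform. Concretely,
  \<open>Qc\<close> sees only the norm, the random projection multiplies the norm of
  \<open>y\<close> by the length of the first \<open>n\<close> coordinates of a uniform unit vector,
  and \<open>nn_integral_sph_Suc\<close> reassembles that vector.\<close>

lemma Qc_rproj:
  assumes y: "y \<in> espace (Suc n)" and n: "1 \<le> n"
  shows "(\<integral>\<^sup>+u. Qc n s (rproj n u y) \<partial>sph (Suc n)) = Qc (Suc n) s y"
proof -
  obtain k where k: "n = Suc k" using n by (cases n) auto
  let ?t = "eucl_norm (Suc n) y"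
  let ?f = "\<lambda>u. Qc n s (sqrt (?t\<^sup>2 - (?t * u n)\<^sup>2) *\<^sub>R unitv k)"
  obtain w where w: "w \<in> unit_sphere (Suc n)" "y = ?t *\<^sub>R w" by (rule unit_decomp[OF y])
  have kE: "unitv k \<in> espace n" "unitv k \<in> espace (Suc n)"
    using unitv_espace[of k] espace_Suc_mono by (auto simp: k)
  have k1: "eucl_norm n (unitv k) = 1" "eucl_norm (Suc n) (unitv k) = 1"
    using unitv_sphere[of k] by (auto simp: k unit_sphere_eq norm_eq_ip ip_unitv unitv_app ip_Suc)
  have meas: "?f \<in> borel_measurable borel"
    by (rule borel_measurable_Qc) measurable
  have "(\<integral>\<^sup>+u. Qc n s (rproj n u y) \<partial>sph (Suc n)) = (\<integral>\<^sup>+u. ?f (refl n w u) \<partial>sph (Suc n))"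
  proof (rule nn_integral_sph_cong)
    fix u assume u: "u \<in> unit_sphere (Suc n)"
    have "ip (Suc n) y (rho n u) = ?t * refl n w u n"
      using u by (subst w(2)) (simp add: ip_simps rho_def refl_last[OF w(1)] ip_commute)
    then have "eucl_norm n (rproj n u y) = sqrt (?t\<^sup>2 - (?t * refl n w u n)\<^sup>2)" by (simp only: norm_rproj)
    then show "Qc n s (rproj n u y) = ?f (refl n w u)"
      using kE k1 n y by (intro Qc_norm)
        (auto simp: norm_scaleR intro: rproj_espace espace_scaleR, metis abs_of_nonneg norm_ge_0)
  qed simp
  also have "\<dots> = (\<integral>\<^sup>+u. ?f u \<partial>sph (Suc n))" by (rule nn_integral_sph_refl[OF meas w(1)])
  also have "\<dots> = (\<integral>\<^sup>+u. (\<integral>\<^sup>+v. indicator {v. s < ip (Suc n) (?t *\<^sub>R unitv k) v} ((eucl_norm n u *\<^sub>R v)(n := u n)) \<partial>sph n) \<partial>sph (Suc n))"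
  proof (rule nn_integral_sph_cong)
    fix u assume u: "u \<in> unit_sphere (Suc n)"
    have "(eucl_norm n u)\<^sup>2 = 1 - (u n)\<^sup>2"
      using norm_proj[of n u] u by (simp add: norm_proj' unit_sphere_eq)
    then have "(?t * eucl_norm n u)\<^sup>2 = ?t\<^sup>2 - (?t * u n)\<^sup>2"
      unfolding power_mult_distrib by (simp only: right_diff_distrib mult_1_right)
    then have eq: "sqrt (?t\<^sup>2 - (?t * u n)\<^sup>2) = ?t * eucl_norm n u" by (metis norm_ge_0 real_sqrt_unique mult_nonneg_nonneg)
    have "ip (Suc n) (?t *\<^sub>R unitv k) ((eucl_norm n u *\<^sub>R v)(n := u n)) = ip n ((?t * eucl_norm n u) *\<^sub>R unitv k) v" for v
      by (simp add: ip_Suc ip_upd ip_simps k ip_unitv unitv_app fun_app)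
    then show "?f u = (\<integral>\<^sup>+v. indicator {v. s < ip (Suc n) (?t *\<^sub>R unitv k) v} ((eucl_norm n u *\<^sub>R v)(n := u n)) \<partial>sph n)"
      unfolding eq Qc_nn by (intro nn_integral_cong) (simp add: indicator_def)
  qed simp
  also have "\<dots> = (\<integral>\<^sup>+u. indicator {v. s < ip (Suc n) (?t *\<^sub>R unitv k) v} u \<partial>sph (Suc n))"
    by (rule nn_integral_sph_Suc[symmetric, OF _ n]) measurable
  also have "\<dots> = Qc (Suc n) s (?t *\<^sub>R unitv k)" by (simp add: Qc_nn)
  also have "\<dots> = Qc (Suc n) s y"
    using kE k1 y by (intro Qc_norm) (auto simp: norm_scaleR intro: espace_scaleR)
  finally show ?thesis .
qed

lemma emeasure_small_ball:
  assumes "0 < s"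
  shows "emeasure (L n) {x \<in> espace n. eucl_norm n x \<le> s} = ennreal (s ^ n * kap n)"
proof -
  have "emeasure (L n) {x \<in> espace n. eucl_norm n x \<le> s} = (\<integral>\<^sup>+x. indicator {x \<in> espace n. eucl_norm n x \<le> s} x \<partial>L n)"
    by (simp add: sets_L)
  also have "\<dots> = ennreal (\<bar>s\<bar> ^ n) * (\<integral>\<^sup>+x. indicator {x \<in> espace n. eucl_norm n x \<le> s} (s *\<^sub>R x) \<partial>L n)"
    using assms by (intro nn_integral_L_scale) auto
  also have "(\<integral>\<^sup>+x. indicator {x \<in> espace n. eucl_norm n x \<le> s} (s *\<^sub>R x) \<partial>L n) = (\<integral>\<^sup>+x. indicator (unit_ball n) x \<partial>L n)"
    using assms by (intro nn_integral_L_cong) (auto simp: indicator_def unit_ball_eq norm_scaleR intro: espace_scaleR)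
  also have "\<dots> = ennreal (kap n)" by (simp add: sets_L emeasure_unit_ball)
  finally show ?thesis using assms kap_pos[of n] by (simp add: ennreal_mult less_imp_le)
qed

lemma emeasure_shell:
  assumes s: "0 < s" "s < 1" and n: "1 \<le> n"
  shows "emeasure (L n) {x. s < eucl_norm n x \<and> eucl_norm n x \<le> 1} = ennreal ((1 - s ^ n) * kap n)"
proof -
  have "emeasure (L n) {x. s < eucl_norm n x \<and> eucl_norm n x \<le> 1} =
      emeasure (L n) (unit_ball n - {x \<in> espace n. eucl_norm n x \<le> s})"
  proof (rule emeasure_eq_AE)
    show "AE x in L n. x \<in> {x. s < eucl_norm n x \<and> eucl_norm n x \<le> 1} \<longleftrightarrow>
       x \<in> unit_ball n - {x \<in> espace n. eucl_norm n x \<le> s}"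
      using AE_L_espace by eventually_elim (auto simp: unit_ball_eq)
  qed (auto simp: sets_L)
  also have "\<dots> = ennreal (kap n) - ennreal (s ^ n * kap n)"
    using s by (subst emeasure_Diff) (auto simp: emeasure_small_ball emeasure_unit_ball sets_L unit_ball_eq)
  also have "\<dots> = ennreal ((1 - s ^ n) * kap n)"
    using s kap_pos[of n] by (subst ennreal_minus) (auto simp: algebra_simps less_imp_le)
  finally show ?thesis .
qed

text \<open>A point of the hull at distance more than \<open>s\<close> from the origin forces some
  vertex to have inner product more than \<open>s\<close> with its direction. Outside the ball of
  radius \<open>s\<close> the hull thus lies in at most \<open>N\<close> pieces of the shell over
  caps, whose volumes polar coordinates compute.\<close>

lemma few_vertices_base:
  assumes n: "1 \<le> n" and N: "1 \<le> N" and y: "\<And>i. i < N \<Longrightarrow> y i \<in> espace n \<and> eucl_norm n (y i) \<le> 1"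
    and s: "0 < s" "s < 1"
  shows "ennreal (nv n n (phull N y)) \<le> ennreal (s ^ n) + ennreal (1 - s ^ n) * (\<Sum>i<N. Qc n s (y i))"
proof -
  let ?N = "eucl_norm n"
  define A where "A = {x \<in> espace n. ?N x \<le> s}"
  define S where "S i = {x. (s < ?N x \<and> ?N x \<le> 1) \<and> s < ip n (y i) ((1 / ?N x) *\<^sub>R x)}" for i
  have [measurable]: "A \<in> sets borel" unfolding A_def by measurable
  have Sm [measurable]: "S i \<in> sets borel" for i unfolding S_def by measurable
  have cc: "cc n (phull N y)" using N y by (intro cc_hull) auto
  have Si: "emeasure (L n) (S i) = ennreal ((1 - s ^ n) * kap n) * Qc n s (y i)" for i
  proof -
    let ?I = "indicator {r. s < r \<and> r \<le> 1}"
    have "emeasure (L n) (S i) = (\<integral>\<^sup>+x. indicator (S i) x \<partial>L n)" by (simp add: sets_L)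
    also have "\<dots> = (\<integral>\<^sup>+x. (\<integral>\<^sup>+v. indicator (S i) (?N x *\<^sub>R v) \<partial>sph n) \<partial>L n)"
      by (rule polar[OF _ n]) measurable
    also have "\<dots> = (\<integral>\<^sup>+x. ?I (?N x) * Qc n s (y i) \<partial>L n)"
    proof (rule nn_integral_cong)
      fix x
      have "(\<integral>\<^sup>+v. indicator (S i) (?N x *\<^sub>R v) \<partial>sph n) = (\<integral>\<^sup>+v. ?I (?N x) * indicator {v. s < ip n (y i) v} v \<partial>sph n)"
      proof (rule nn_integral_sph_cong[OF n])
        fix v assume v: "v \<in> unit_sphere n"
        show "indicator (S i) (?N x *\<^sub>R v) = (?I (?N x) * indicator {v. s < ip n (y i) v} v :: ennreal)"
          using v s by (cases "s < ?N x") (auto simp: S_def indicator_def norm_scaleR unit_sphere_eq)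
      qed
      also have "\<dots> = ?I (?N x) * Qc n s (y i)"
        unfolding Qc_nn by (rule nn_integral_cmult) measurable
      finally show "(\<integral>\<^sup>+v. indicator (S i) (?N x *\<^sub>R v) \<partial>sph n) = ?I (?N x) * Qc n s (y i)" .
    qed
    also have "\<dots> = (\<integral>\<^sup>+x. indicator {x. s < ?N x \<and> ?N x \<le> 1} x \<partial>L n) * Qc n s (y i)"
      by (subst nn_integral_multc[symmetric]) (auto simp: indicator_def intro!: nn_integral_cong)
    also have "(\<integral>\<^sup>+x. indicator {x. s < ?N x \<and> ?N x \<le> 1} x \<partial>L n) = ennreal ((1 - s ^ n) * kap n)"
      using emeasure_shell[OF s n] by (subst nn_integral_indicator) (auto simp: sets_L)
    finally show ?thesis .
  qed
  have "phull N y \<subseteq> A \<union> (\<Union>i<N. S i)"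
  proof
    fix x assume x: "x \<in> phull N y"
    have xE: "x \<in> espace n" using x cc by (auto simp: cc_def)
    show "x \<in> A \<union> (\<Union>i<N. S i)"
    proof (cases "?N x \<le> s")
      case False
      then have x0: "0 < ?N x" using s by simp
      let ?v = "(1 / ?N x) *\<^sub>R x"
      have "ip n x x = ?N x * ?N x" by (simp flip: norm_sq add: power2_eq_square)
      then have xv: "ip n x ?v = ?N x" using x0 by (simp add: ip_simps)
      have "\<exists>i<N. s < ip n (y i) ?v"
        using hull_ip_le[OF x, of n ?v s] xv False by (force simp: not_less)
      moreover have "?N x \<le> 1"
      proof -
        have v1: "?N ?v = 1" using x0 by (simp add: norm_scaleR)
        have "ip n (y i) ?v \<le> 1" if "i < N" for i
          using ip_le_norm[of n "y i" ?v] y[OF that] v1 by simp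
        from hull_ip_le[OF x this] xv show ?thesis by simp
      qed
      ultimately show ?thesis using False by (auto simp: S_def)
    qed (simp add: A_def xE)
  qed
  then have "emeasure (L n) (phull N y) \<le> emeasure (L n) (A \<union> (\<Union>i<N. S i))"
    by (intro emeasure_mono) (auto simp: sets_L)
  also have "\<dots> \<le> emeasure (L n) A + (\<Sum>i<N. emeasure (L n) (S i))"
    by (rule order_trans[OF emeasure_subadditive])
       (auto simp: sets_L intro!: add_left_mono emeasure_subadditive_finite)
  also have "emeasure (L n) A = ennreal (s ^ n * kap n)" unfolding A_def by (rule emeasure_small_ball[OF s(1)])
  finally have le: "ennreal (volume n (phull N y)) \<le> ennreal (s ^ n * kap n) + (\<Sum>i<N. ennreal ((1 - s ^ n) * kap n) * Qc n s (y i))"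
    by (simp add: emeasure_volume[OF cc] Si)
  have k: "0 < kap n" by (rule kap_pos)
  have sn: "0 \<le> 1 - s ^ n" using s by (simp add: power_le_one)
  have "ennreal (kap n) * ennreal (nv n n (phull N y)) = ennreal (volume n (phull N y))"
    using k by (subst ennreal_mult'[symmetric]) (auto simp: nv_top[OF cc])
  also note le
  also have "ennreal (s ^ n * kap n) + (\<Sum>i<N. ennreal ((1 - s ^ n) * kap n) * Qc n s (y i)) =
     ennreal (kap n) * (ennreal (s ^ n) + ennreal (1 - s ^ n) * (\<Sum>i<N. Qc n s (y i)))"
    using k s sn by (simp add: ennreal_mult distrib_left sum_distrib_left mult_ac)
  finally show ?thesis using k by (simp add: ennreal_mult_le_mult_iff)
qed

text \<open>Induction from dimension \<open>j\<close> upwards: the right side is affine in the cap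
  measures with coefficients that depend on \<open>j\<close> only, so averaging over projections
  reproduces it.\<close>

theorem few_vertices:
  assumes "j \<le> n" "1 \<le> j" "1 \<le> N" and "\<And>i. i < N \<Longrightarrow> y i \<in> espace n \<and> eucl_norm n (y i) \<le> 1"
    and s: "0 < s" "s < 1"
  shows "ennreal (nv n j (phull N y)) \<le> ennreal (s ^ j) + ennreal (1 - s ^ j) * (\<Sum>i<N. Qc n s (y i))"
  using assms(1,4)
proof (induction n arbitrary: y rule: dec_induct)
  case base
  then show ?case using assms by (intro few_vertices_base) auto
next
  case (step n)
  have y: "y i \<in> espace (Suc n)" "eucl_norm (Suc n) (y i) \<le> 1" if "i < N" for i using step.prems that by auto
  have n: "1 \<le> n" using step.hyps assms by simp
  have cc: "cc (Suc n) (phull N y)" using y assms by (intro cc_hull) auto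
  have m: "(\<lambda>u. Qc n s (rproj n u (y i))) \<in> borel_measurable (sph (Suc n))" for i
    by (intro borel_measurable_Qc borel_measurable_rproj borel_measurable_const) (simp add: sets_sph cong: measurable_cong_sets)
  have "ennreal (nv (Suc n) j (phull N y)) = (\<integral>\<^sup>+u. ennreal (nv n j (phull N (\<lambda>i. rproj n u (y i)))) \<partial>sph (Suc n))"
    using nv_Suc[OF cc] step.hyps by (simp add: rproj_hull)
  also have "\<dots> \<le> (\<integral>\<^sup>+u. ennreal (s ^ j) + ennreal (1 - s ^ j) * (\<Sum>i<N. Qc n s (rproj n u (y i))) \<partial>sph (Suc n))"
    using y by (intro nn_integral_mono step.IH) (auto intro: rproj_espace order_trans[OF norm_rproj_le])
  also have "\<dots> = ennreal (s ^ j) + ennreal (1 - s ^ j) * (\<Sum>i<N. \<integral>\<^sup>+u. Qc n s (rproj n u (y i)) \<partial>sph (Suc n))"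
    using m by (subst nn_integral_add) (auto simp: nn_integral_cmult nn_integral_sum)
  also have "(\<Sum>i<N. \<integral>\<^sup>+u. Qc n s (rproj n u (y i)) \<partial>sph (Suc n)) = (\<Sum>i<N. Qc (Suc n) s (y i))"
    using y n by (intro sum.cong Qc_rproj) auto
  finally show ?case .
qed

section \<open>Random polytopes\<close>

text \<open>Membership in the hull is membership in its parallel body of radius zero, which is known
  to be measurable.\<close>

lemma pred_hull:
  assumes "1 \<le> N" "\<And>w i. w \<in> space M \<Longrightarrow> i < N \<Longrightarrow> X w i \<in> espace n"
    "\<And>i. i < N \<Longrightarrow> (\<lambda>w. X w i) \<in> borel_measurable M" "y \<in> borel_measurable M"
  shows "Measurable.pred M (\<lambda>w. y w \<in> phull N (X w))"
proof -
  have "Measurable.pred M (\<lambda>w. y w \<in> par n (comb N (X w) ` weights N) 0)"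
    using assms weights_nonempty[of N] by (intro measurable_par_image)
      (auto intro: compact_weights weights_nonempty continuous_on_comb borel_measurable_comb comb_espace)
  moreover have "par n (comb N (X w) ` weights N) 0 = phull N (X w)" if "w \<in> space M" for w
    using cc_hull[of N "X w" n] assms(1,2) that by (auto simp: cc_def phull_def intro!: par_0)
  ultimately show ?thesis by (simp cong: measurable_cong)
qed

lemma borel_measurable_nv_hull:
  assumes "1 \<le> N" "\<And>w i. w \<in> space M \<Longrightarrow> i < N \<Longrightarrow> X w i \<in> espace n"
    "\<And>i. i < N \<Longrightarrow> (\<lambda>w. X w i) \<in> borel_measurable M"
  shows "(\<lambda>w. nv n j (phull N (X w))) \<in> borel_measurable M"
proof -
  have "(\<lambda>w. intrinsic_volume n j (comb N (X w) ` weights N)) \<in> borel_measurable M"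
    using assms weights_nonempty[of N] by (intro borel_measurable_intrinsic_volume)
      (auto intro: compact_weights continuous_on_comb borel_measurable_comb comb_espace
        convex_linear_image_fun convex_weights comb_linear)
  then show ?thesis unfolding nv_def phull_def by measurable
qed

text \<open>The covering hypothesis depends on the norm of a point only and is inherited by the
  projected sample, so the mean over projections reduces to dimension \<open>j\<close>, where
  Fubini's theorem expresses the mean volume through covering probabilities.\<close>

theorem random_polytope:
  fixes phi :: "real \<Rightarrow> ennreal"
  assumes "prob_space M" "j \<le> n" and N: "1 \<le> N" and phi [measurable]: "phi \<in> borel_measurable borel"
    and "\<And>w i. w \<in> space M \<Longrightarrow> i < N \<Longrightarrow> X w i \<in> espace n"
    and "\<And>i. i < N \<Longrightarrow> (\<lambda>w. X w i) \<in> borel_measurable M"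
    and "\<And>x. x \<in> espace n \<Longrightarrow> phi (eucl_norm n x) \<le> emeasure M {w \<in> space M. x \<in> phull N (X w)}"
  shows "(\<integral>\<^sup>+x. indicator (unit_ball j) x * phi (eucl_norm j x) \<partial>L j) \<le>
    ennreal (kap j) * (\<integral>\<^sup>+w. ennreal (nv n j (phull N (X w))) \<partial>M)"
  using assms(2,5,6,7)
proof (induction n arbitrary: X rule: dec_induct)
  case base
  interpret M: prob_space M by fact
  interpret MP: pair_sigma_finite M "L j" ..
  have k: "0 < kap j" by (rule kap_pos)
  have cc: "cc j (phull N (X w))" if "w \<in> space M" for w using that base N by (intro cc_hull) auto
  have p: "Measurable.pred (M \<Otimes>\<^sub>M L j) (\<lambda>p. snd p \<in> phull N (X (fst p)))"
    using base N by (intro pred_hull[where n = j])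
      (auto simp: space_pair_measure intro: measurable_compose[OF measurable_fst])
  have p1: "Measurable.pred M (\<lambda>w. x \<in> phull N (X w))" for x
    using base N by (intro pred_hull[where n = j]) auto
  have "(\<integral>\<^sup>+x. indicator (unit_ball j) x * phi (eucl_norm j x) \<partial>L j) \<le>
     (\<integral>\<^sup>+x. (\<integral>\<^sup>+w. indicator {p. snd p \<in> phull N (X (fst p))} (w, x) \<partial>M) \<partial>L j)"
  proof (rule nn_integral_mono)
    fix x
    have "(\<integral>\<^sup>+w. indicator {p. snd p \<in> phull N (X (fst p))} (w, x) \<partial>M) = (\<integral>\<^sup>+w. indicator {w \<in> space M. x \<in> phull N (X w)} w \<partial>M)"
      by (intro nn_integral_cong) (auto simp: indicator_def)
    also have "\<dots> = emeasure M {w \<in> space M. x \<in> phull N (X w)}"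
      using p1[of x] by (intro nn_integral_indicator) (simp add: pred_def)
    finally show "indicator (unit_ball j) x * phi (eucl_norm j x) \<le> (\<integral>\<^sup>+w. indicator {p. snd p \<in> phull N (X (fst p))} (w, x) \<partial>M)"
      using base(3)[of x] by (auto simp: indicator_def unit_ball_eq)
  qed
  also have "\<dots> = (\<integral>\<^sup>+w. (\<integral>\<^sup>+x. indicator {p. snd p \<in> phull N (X (fst p))} (w, x) \<partial>L j) \<partial>M)"
    by (rule MP.Fubini') (use p in \<open>simp add: case_prod_unfold\<close>)
  also have "\<dots> = (\<integral>\<^sup>+w. ennreal (kap j) * ennreal (nv j j (phull N (X w))) \<partial>M)"
  proof (rule nn_integral_cong)
    fix w assume w: "w \<in> space M"
    have "(\<integral>\<^sup>+x. indicator {p. snd p \<in> phull N (X (fst p))} (w, x) \<partial>L j) = (\<integral>\<^sup>+x. indicator (phull N (X w)) x \<partial>L j)"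
      by (intro nn_integral_cong) (auto simp: indicator_def)
    also have "\<dots> = emeasure (L j) (phull N (X w))"
      using cc[OF w] by (intro nn_integral_indicator) (auto simp: sets_L cc_def closed_imp_borel)
    finally show "(\<integral>\<^sup>+x. indicator {p. snd p \<in> phull N (X (fst p))} (w, x) \<partial>L j) = ennreal (kap j) * ennreal (nv j j (phull N (X w)))"
      using k by (subst ennreal_mult'[symmetric]) (auto simp: nv_top[OF cc[OF w]] emeasure_volume[OF cc[OF w]])
  qed
  also have "\<dots> = ennreal (kap j) * (\<integral>\<^sup>+w. ennreal (nv j j (phull N (X w))) \<partial>M)"
    using base N by (intro nn_integral_cmult measurable_compose[OF borel_measurable_nv_hull measurable_ennreal]) auto
  finally show ?case .
next
  case (step n)
  interpret M: prob_space M by fact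
  interpret MS: pair_sigma_finite M "sph (Suc n)" ..
  let ?I = "\<integral>\<^sup>+x. indicator (unit_ball j) x * phi (eucl_norm j x) \<partial>L j"
  have cc: "cc (Suc n) (phull N (X w))" if "w \<in> space M" for w using that step.prems N by (intro cc_hull) auto
  have meas: "(\<lambda>p. nv n j (phull N (\<lambda>i. rproj n (snd p) (X (fst p) i)))) \<in> borel_measurable (M \<Otimes>\<^sub>M sph (Suc n))"
  proof (rule borel_measurable_nv_hull[OF N])
    fix i assume i: "i < N"
    have "(\<lambda>p. X (fst p) i) \<in> borel_measurable (M \<Otimes>\<^sub>M sph (Suc n))"
      using step.prems(2)[OF i] by (rule measurable_compose[OF measurable_fst])
    moreover have "(\<lambda>p. snd p) \<in> borel_measurable (M \<Otimes>\<^sub>M sph (Suc n))"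
      by (simp cong: measurable_cong_sets)
    ultimately show "(\<lambda>p. rproj n (snd p) (X (fst p) i)) \<in> borel_measurable (M \<Otimes>\<^sub>M sph (Suc n))"
      by (intro borel_measurable_rproj)
  qed (use step.prems in \<open>auto simp: space_pair_measure intro: rproj_espace\<close>)
  have "?I = (\<integral>\<^sup>+u. ?I \<partial>sph (Suc n))" by simp
  also have "\<dots> \<le> (\<integral>\<^sup>+u. ennreal (kap j) * (\<integral>\<^sup>+w. ennreal (nv n j (phull N (\<lambda>i. rproj n u (X w i)))) \<partial>M) \<partial>sph (Suc n))"
  proof (intro nn_integral_mono step.IH)
    fix u x assume x: "x \<in> espace n"
    \<comment> \<open>The lift of \<open>x\<close> to the hyperplane along which the projection
      acts: it has the norm of \<open>x\<close> and projects to \<open>x\<close>, so covering it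
      suffices.\<close>
    let ?x = "refl n (rho n u) x"
    have xE: "x \<in> espace (Suc n)" by (rule espace_Suc_mono[OF x])
    have xn: "x n = 0" using x by (simp add: espace_def)
    have "eucl_norm (Suc n) ?x = eucl_norm n x"
      using norm_Suc_upd[of n x 0] xn by (simp add: norm_refl[OF rho_sphere] fun_upd_idem)
    then have "phi (eucl_norm n x) \<le> emeasure M {w \<in> space M. ?x \<in> phull N (X w)}"
      using step.prems(3)[of ?x] refl_espace[OF rho_espace xE] by simp
    also have "\<dots> \<le> emeasure M {w \<in> space M. x \<in> phull N (\<lambda>i. rproj n u (X w i))}"
    proof (rule emeasure_mono)
      have "rproj n u ?x = x"
        unfolding rproj_def refl_refl[OF rho_sphere] using xn by (simp add: proj_def fun_upd_idem)
      then have "x \<in> rproj n u ` phull N (X w)" if "?x \<in> phull N (X w)" for w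
        using that by (metis imageI)
      then show "{w \<in> space M. ?x \<in> phull N (X w)} \<subseteq> {w \<in> space M. x \<in> phull N (\<lambda>i. rproj n u (X w i))}"
        by (auto simp: rproj_hull)
      have "Measurable.pred M (\<lambda>w. x \<in> phull N (\<lambda>i. rproj n u (X w i)))"
        using step.prems N by (intro pred_hull[where n = n])
          (auto intro: rproj_espace borel_measurable_rproj borel_measurable_const)
      then show "{w \<in> space M. x \<in> phull N (\<lambda>i. rproj n u (X w i))} \<in> sets M" by (simp add: pred_def)
    qed
    finally show "phi (eucl_norm n x) \<le> emeasure M {w \<in> space M. x \<in> phull N (\<lambda>i. rproj n u (X w i))}" .
  qed (use step.prems in \<open>auto intro: rproj_espace borel_measurable_rproj borel_measurable_const\<close>)
  also have "\<dots> = ennreal (kap j) * (\<integral>\<^sup>+u. (\<integral>\<^sup>+w. ennreal (nv n j (phull N (\<lambda>i. rproj n u (X w i)))) \<partial>M) \<partial>sph (Suc n))"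
  proof (rule nn_integral_cmult)
    have "(\<lambda>p. ennreal (nv n j (phull N (\<lambda>i. rproj n (fst p) (X (snd p) i))))) \<in> borel_measurable (sph (Suc n) \<Otimes>\<^sub>M M)"
      using measurable_compose[OF measurable_pair_swap' meas] by (simp add: case_prod_unfold)
    then show "(\<lambda>u. \<integral>\<^sup>+w. ennreal (nv n j (phull N (\<lambda>i. rproj n u (X w i)))) \<partial>M) \<in> borel_measurable (sph (Suc n))"
      by (intro M.borel_measurable_nn_integral) (simp add: case_prod_unfold)
  qed
  also have "(\<integral>\<^sup>+u. (\<integral>\<^sup>+w. ennreal (nv n j (phull N (\<lambda>i. rproj n u (X w i)))) \<partial>M) \<partial>sph (Suc n)) =
     (\<integral>\<^sup>+w. (\<integral>\<^sup>+u. ennreal (nv n j (phull N (\<lambda>i. rproj n u (X w i)))) \<partial>sph (Suc n)) \<partial>M)"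
    by (rule MS.Fubini') (use meas in \<open>simp add: case_prod_unfold\<close>)
  also have "\<dots> = (\<integral>\<^sup>+w. ennreal (nv (Suc n) j (phull N (X w))) \<partial>M)"
    using nv_Suc[OF cc] step.hyps by (intro nn_integral_cong) (simp add: rproj_hull)
  finally show ?case .
qed

section \<open>Counting sign patterns\<close>

text \<open>\<open>label_sum\<close> is the expectation of a function of \<open>N\<close> independent labels that take the values
  \<open>1\<close>, \<open>-1\<close>, \<open>0\<close> with probabilities \<open>a\<close>, \<open>b\<close>, \<open>c\<close>.\<close>

fun label_sum :: "real \<Rightarrow> real \<Rightarrow> real \<Rightarrow> nat \<Rightarrow> ((nat \<Rightarrow> int) \<Rightarrow> real) \<Rightarrow> real" where
  "label_sum a b c 0 F = F (\<lambda>_. 0)"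
| "label_sum a b c (Suc N) F = label_sum a b c N (\<lambda>l. a * F (l(N := 1)) + b * F (l(N := - 1)) + c * F (l(N := 0)))"

text \<open>The column \<open>i\<close> of \<open>b\<close> is a vector with coordinates indexed by
  \<open>K\<close>. A pattern is realised if one linear form has the prescribed sign on every vector
  labelled \<open>1\<close> or \<open>- 1\<close>; the label \<open>0\<close> imposes
  nothing.\<close>

definition feas :: "nat \<Rightarrow> nat set \<Rightarrow> (nat \<Rightarrow> nat \<Rightarrow> real) \<Rightarrow> (nat \<Rightarrow> int) \<Rightarrow> bool" where
  "feas N K b l \<longleftrightarrow> (\<exists>a :: nat \<Rightarrow> real. \<forall>i<N. (l i = 1 \<longrightarrow> 0 < (\<Sum>k\<in>K. a k * b k i)) \<and> (l i = - 1 \<longrightarrow> (\<Sum>k\<in>K. a k * b k i) < 0))"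

lemma label_sum_mono:
  "0 \<le> a \<Longrightarrow> 0 \<le> b \<Longrightarrow> 0 \<le> c \<Longrightarrow> (\<And>l. F l \<le> G l) \<Longrightarrow> label_sum a b c N F \<le> label_sum a b c N G"
proof (induction N arbitrary: F G)
  case (Suc N)
  show ?case
    unfolding label_sum.simps
    by (rule Suc.IH[OF Suc.prems(1-3)]) (use Suc.prems in \<open>intro add_mono mult_left_mono; simp\<close>)
qed simp

lemma label_sum_linear: "label_sum a b c N (\<lambda>l. x * F l + y * G l) = x * label_sum a b c N F + y * label_sum a b c N G"
proof (induction N arbitrary: F G)
  case (Suc N)
  have eq: "(\<lambda>l. a * (x * F (l(N := 1)) + y * G (l(N := 1))) + b * (x * F (l(N := - 1)) + y * G (l(N := - 1))) +
     c * (x * F (l(N := 0)) + y * G (l(N := 0)))) =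
     (\<lambda>l. x * (a * F (l(N := 1)) + b * F (l(N := - 1)) + c * F (l(N := 0))) +
       y * (a * G (l(N := 1)) + b * G (l(N := - 1)) + c * G (l(N := 0))))"
    by (simp add: fun_eq_iff algebra_simps)
  show ?case by (simp only: label_sum.simps eq Suc.IH)
qed simp

text \<open>Two patterns that differ in the last sign only are both realised by vectors of the space, hence
  their common part is realised by a vector of the hyperplane where the last form vanishes.\<close>

lemma feas_both:
  assumes K: "finite K" and k0: "k0 \<in> K" "b k0 N \<noteq> 0"
    and pos: "feas (Suc N) K b (l(N := 1))" and neg: "feas (Suc N) K b (l(N := - 1))"
  shows "feas N (K - {k0}) (\<lambda>k i. b k i - b k N / b k0 N * b k0 i) l"
proof -
  define S where "S a i = (\<Sum>k\<in>K. a k * b k i)" for a :: "nat \<Rightarrow> real" and i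
  from pos obtain a where a: "\<And>i. i < Suc N \<Longrightarrow> ((l(N := 1)) i = 1 \<longrightarrow> 0 < S a i) \<and> ((l(N := 1)) i = - 1 \<longrightarrow> S a i < 0)"
    unfolding feas_def S_def by blast
  from neg obtain a' where a': "\<And>i. i < Suc N \<Longrightarrow> ((l(N := - 1)) i = 1 \<longrightarrow> 0 < S a' i) \<and> ((l(N := - 1)) i = - 1 \<longrightarrow> S a' i < 0)"
    unfolding feas_def S_def by blast
  define p where "p = - S a' N"
  define q where "q = S a N"
  have pq: "0 < p" "0 < q" using a[of N] a'[of N] by (auto simp: p_def q_def)
  define d where "d k = p * a k + q * a' k" for k
  have Sd: "S d i = p * S a i + q * S a' i" for i
    by (simp add: S_def d_def distrib_right sum.distrib sum_distrib_left mult.assoc)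
  have SN: "S d N = 0" by (simp add: Sd) (simp add: p_def q_def)
  have *: "(\<Sum>k\<in>K - {k0}. d k * (b k i - b k N / b k0 N * b k0 i)) = S d i" for i
  proof -
    have "(\<Sum>k\<in>K - {k0}. d k * b k N) = - d k0 * b k0 N"
      using SN sum.remove[OF K k0(1), of "\<lambda>k. d k * b k N"] by (simp add: S_def)
    moreover have "(\<Sum>k\<in>K - {k0}. d k * (b k i - b k N / b k0 N * b k0 i)) =
      (\<Sum>k\<in>K - {k0}. d k * b k i) - (\<Sum>k\<in>K - {k0}. d k * b k N) / b k0 N * b k0 i"
      by (simp add: right_diff_distrib sum_subtractf sum_divide_distrib sum_distrib_right mult.assoc)
    ultimately show ?thesis
      using k0(2) sum.remove[OF K k0(1), of "\<lambda>k. d k * b k i"] by (simp add: S_def)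
  qed
  show ?thesis
    unfolding feas_def *
  proof (intro exI[of _ d] allI impI)
    fix i assume i: "i < N"
    then show "(l i = 1 \<longrightarrow> 0 < (\<Sum>k\<in>K - {k0}. d k * (b k i - b k N / b k0 N * b k0 i))) \<and>
      (l i = - 1 \<longrightarrow> (\<Sum>k\<in>K - {k0}. d k * (b k i - b k N / b k0 N * b k0 i)) < 0)"
      unfolding * Sd using a[of i] a'[of i] pq
      by (auto intro!: add_pos_pos add_neg_neg mult_pos_pos mult_pos_neg)
  qed
qed

lemma feas_Suc_imp: "feas (Suc N) K b (l(N := x)) \<Longrightarrow> feas N K b l"
  unfolding feas_def by (elim exE, rule exI, intro allI impI, drule spec, drule mp, erule less_SucI) simp

lemma feas_Suc_0: "feas (Suc N) K b (l(N := 0)) \<longleftrightarrow> feas N K b l"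
  unfolding feas_def by (auto simp: less_Suc_eq)

text \<open>Wendel's recursion for arbitrary fixed vectors and random labels. A new vector either
  admits both signs, and then the old pattern is realised in one dimension less, or it rules out a
  sign that has probability at least \<mu>. The bound is stable under the recursion because
  \<open>(1 - \<mu>) + \<mu> / 2\<close> is \<open>1 - \<mu> / 2\<close>.\<close>

theorem sign_patterns:
  assumes "0 \<le> \<mu>" "\<mu> \<le> a" "\<mu> \<le> b" "a + b + c = 1" "0 \<le> c" "finite K"
  shows "label_sum a b c N (\<lambda>l. of_bool (feas N K B l)) \<le> 2 ^ card K * (1 - \<mu> / 2) ^ N"
  using assms(6)
proof (induction N arbitrary: K B)
  case (Suc N)
  have m: "0 \<le> 1 - \<mu> / 2" using assms by linarith
  have ab: "0 \<le> a" "0 \<le> b" "0 \<le> c" using assms by auto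
  let ?A = "\<lambda>x l. of_bool (feas (Suc N) K B (l(N := x))) :: real" and ?F = "\<lambda>l. of_bool (feas N K B l) :: real"
  have le: "?A x l \<le> ?F l" for x l using feas_Suc_imp[of N K B l x] by auto
  show ?case
  proof (cases "\<exists>k\<in>K. B k N \<noteq> 0")
    case True
    then obtain k0 where k0: "k0 \<in> K" "B k0 N \<noteq> 0" by blast
    let ?G = "\<lambda>l. of_bool (feas N (K - {k0}) (\<lambda>k i. B k i - B k N / B k0 N * B k0 i) l) :: real"
    \<comment> \<open>If both signs occur, both indicators on the right are one and the coefficients
      add up to one; otherwise at least one of the masses \<open>a\<close> and \<open>b\<close> is
      lost, and each is at least \<mu>.\<close>
    have "a * ?A 1 l + b * ?A (- 1) l + c * ?A 0 l \<le> (1 - \<mu>) * ?F l + \<mu> * ?G l" for l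
    proof (cases "feas (Suc N) K B (l(N := 1)) \<and> feas (Suc N) K B (l(N := - 1))")
      case both: True
      then have "?G l = 1" using feas_both[of K k0 B N l] Suc.prems k0 by simp
      moreover have "?F l = 1" using both feas_Suc_imp by auto
      ultimately show ?thesis using both assms feas_Suc_0[of N K B l] by auto
    next
      case False
      then have "a * ?A 1 l + b * ?A (- 1) l \<le> (1 - c - \<mu>) * ?F l"
        using le[where x = 1 and l = l] le[where x = "- 1" and l = l] assms ab by (auto split: if_splits)
      moreover have "0 \<le> \<mu> * ?G l" using assms by simp
      moreover have "c * ?A 0 l = c * ?F l" by (simp add: feas_Suc_0)
      ultimately show ?thesis by (simp only: left_diff_distrib)
    qed
    then have "label_sum a b c (Suc N) (\<lambda>l. of_bool (feas (Suc N) K B l)) \<le> label_sum a b c N (\<lambda>l. (1 - \<mu>) * ?F l + \<mu> * ?G l)"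
      by (simp only: label_sum.simps) (intro label_sum_mono ab)
    also have "\<dots> = (1 - \<mu>) * label_sum a b c N ?F + \<mu> * label_sum a b c N ?G" by (rule label_sum_linear)
    also have "\<dots> \<le> (1 - \<mu>) * (2 ^ card K * (1 - \<mu> / 2) ^ N) + \<mu> * (2 ^ card (K - {k0}) * (1 - \<mu> / 2) ^ N)"
      using assms Suc.prems by (intro add_mono mult_left_mono Suc.IH) auto
    also have "\<dots> = 2 ^ card K * (1 - \<mu> / 2) ^ Suc N"
    proof -
      have "card K = Suc (card (K - {k0}))" using Suc.prems k0 by (metis card.remove)
      then show ?thesis by (simp add: algebra_simps)
    qed
    finally show ?thesis .
  next
    case False
    \<comment> \<open>The new vector is zero, so no form is positive or negative on it and only the
      label \<open>0\<close> survives.\<close>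
    then have "(\<Sum>k\<in>K. d k * B k N) = 0" for d by (intro sum.neutral) auto
    then have A: "?A 1 l = 0" "?A (- 1) l = 0" for l
      by (auto simp: feas_def dest!: spec[of _ N])
    have c1: "c \<le> 1 - \<mu> / 2" using assms by simp
    have "a * ?A 1 l + b * ?A (- 1) l + c * ?A 0 l \<le> (1 - \<mu> / 2) * ?F l + 0 * ?F l" for l
      using c1 by (simp only: A) (simp add: feas_Suc_0)
    then have "label_sum a b c (Suc N) (\<lambda>l. of_bool (feas (Suc N) K B l)) \<le> label_sum a b c N (\<lambda>l. (1 - \<mu> / 2) * ?F l + 0 * ?F l)"
      by (simp only: label_sum.simps) (intro label_sum_mono ab)
    also have "\<dots> = (1 - \<mu> / 2) * label_sum a b c N ?F + 0 * label_sum a b c N ?F" by (rule label_sum_linear)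
    also have "\<dots> \<le> (1 - \<mu> / 2) * (2 ^ card K * (1 - \<mu> / 2) ^ N)"
      using m Suc by (simp add: mult_left_mono)
    finally show ?thesis by (simp add: mult_ac)
  qed
qed simp

section \<open>Labels of independent points\<close>

definition labels :: "('a \<Rightarrow> int) \<Rightarrow> nat \<Rightarrow> (nat \<Rightarrow> 'a) \<Rightarrow> nat \<Rightarrow> int" where
  "labels lab N u = (\<lambda>i. if i < N then lab (u i) else 0)"

lemma labels_Suc: "labels lab (Suc N) u = (labels lab N u)(N := lab (u N))"
  by (auto simp: labels_def fun_eq_iff less_Suc_eq)

lemma labels_upd: "labels lab N (u(N := x)) = labels lab N u"
  by (auto simp: labels_def fun_eq_iff)

lemma borel_measurable_labels:
  assumes NJ: "{..<N} \<subseteq> J"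
    and lab: "\<And>x. {w \<in> space P. lab w = x} \<in> sets P" "\<And>w. lab w \<in> {1, - 1, 0}"
  shows "(\<lambda>u. ennreal (F (labels lab N u))) \<in> borel_measurable (Pi\<^sub>M J (\<lambda>_. P))"
  using NJ
proof (induction N arbitrary: F)
  case 0
  then show ?case by (simp add: labels_def)
next
  case (Suc N)
  then have N: "N \<in> J" and NJ: "{..<N} \<subseteq> J" by auto
  have p: "Measurable.pred (Pi\<^sub>M J (\<lambda>_. P)) (\<lambda>u. lab (u N) = x)" for x
  proof -
    have "Measurable.pred P (\<lambda>w. lab w = x)" using lab(1)[of x] by (simp add: pred_def)
    from measurable_compose[OF measurable_component_singleton[OF N] this] show ?thesis .
  qed
  have "ennreal (F (labels lab (Suc N) u)) = (if lab (u N) = 1 then ennreal (F ((labels lab N u)(N := 1)))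
     else if lab (u N) = - 1 then ennreal (F ((labels lab N u)(N := - 1))) else ennreal (F ((labels lab N u)(N := 0))))" for u
    using lab(2)[of "u N"] by (auto simp: labels_Suc)
  moreover have "(\<lambda>u. (if lab (u N) = 1 then ennreal (F ((labels lab N u)(N := 1)))
     else if lab (u N) = - 1 then ennreal (F ((labels lab N u)(N := - 1))) else ennreal (F ((labels lab N u)(N := 0)))))
     \<in> borel_measurable (Pi\<^sub>M J (\<lambda>_. P))"
    using p[unfolded pred_def] Suc.IH[OF NJ] by (intro measurable_If) auto
  ultimately show ?case by simp
qed

lemma nn_integral_labels:
  fixes P :: "'a measure"
  assumes P: "prob_space P" and lab: "\<And>x. {w \<in> space P. lab w = x} \<in> sets P" "\<And>w. lab w \<in> {1, - 1, 0}"
    and F: "\<And>l. 0 \<le> F l"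
    and "a = measure P {w \<in> space P. lab w = 1}" "b = measure P {w \<in> space P. lab w = - 1}"
      "c = measure P {w \<in> space P. lab w = 0}"
  shows "(\<integral>\<^sup>+u. ennreal (F (labels lab N u)) \<partial>Pi\<^sub>M {..<N} (\<lambda>_. P)) = ennreal (label_sum a b c N F)"
proof -
  interpret P: prob_space P by (rule P)
  interpret PP: product_sigma_finite "\<lambda>_. P" by standard
  show ?thesis using F
  proof (induction N arbitrary: F)
    case 0
    then show ?case by (simp add: labels_def PiM_empty nn_integral_count_space_finite)
  next
    case (Suc N)
    let ?H = "\<lambda>l. a * F (l(N := 1)) + b * F (l(N := - 1)) + c * F (l(N := 0))"
    have "(\<integral>\<^sup>+u. ennreal (F (labels lab (Suc N) u)) \<partial>Pi\<^sub>M {..<Suc N} (\<lambda>_. P)) =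
       (\<integral>\<^sup>+u. (\<integral>\<^sup>+x. ennreal (F (labels lab (Suc N) (u(N := x)))) \<partial>P) \<partial>Pi\<^sub>M {..<N} (\<lambda>_. P))"
      using borel_measurable_labels[of "Suc N" "insert N {..<N}" P lab F] lab unfolding lessThan_Suc
      by (intro PP.product_nn_integral_insert) (auto simp: lessThan_Suc)
    also have "\<dots> = (\<integral>\<^sup>+u. ennreal (?H (labels lab N u)) \<partial>Pi\<^sub>M {..<N} (\<lambda>_. P))"
    proof (rule nn_integral_cong)
      fix u
      let ?l = "labels lab N u" and ?E = "\<lambda>x. {w \<in> space P. lab w = x}"
      have "(\<integral>\<^sup>+x. ennreal (F (labels lab (Suc N) (u(N := x)))) \<partial>P) =
        (\<integral>\<^sup>+x. ennreal (F (?l(N := 1))) * indicator (?E 1) x + ennreal (F (?l(N := - 1))) * indicator (?E (- 1)) x +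
           ennreal (F (?l(N := 0))) * indicator (?E 0) x \<partial>P)"
      proof (rule nn_integral_cong)
        fix x assume "x \<in> space P"
        then show "ennreal (F (labels lab (Suc N) (u(N := x)))) =
          ennreal (F (?l(N := 1))) * indicator (?E 1) x + ennreal (F (?l(N := - 1))) * indicator (?E (- 1)) x +
           ennreal (F (?l(N := 0))) * indicator (?E 0) x"
          using lab(2)[of x] by (auto simp: labels_Suc labels_upd indicator_def)
      qed
      also have "\<dots> = ennreal (F (?l(N := 1))) * emeasure P (?E 1) + ennreal (F (?l(N := - 1))) * emeasure P (?E (- 1)) +
           ennreal (F (?l(N := 0))) * emeasure P (?E 0)"
        using lab(1) by (simp add: nn_integral_add nn_integral_cmult)
      also have "\<dots> = ennreal (?H ?l)"
        using Suc.prems assms(5,6,7)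
        by (simp add: P.emeasure_eq_measure ennreal_mult[symmetric] ennreal_plus[symmetric] mult.commute del: ennreal_plus)
      finally show "(\<integral>\<^sup>+x. ennreal (F (labels lab (Suc N) (u(N := x)))) \<partial>P) = ennreal (?H ?l)" .
    qed
    also have "\<dots> = ennreal (label_sum a b c N ?H)"
      using Suc.prems assms(5,6,7) by (intro Suc.IH) auto
    finally show ?case by simp
  qed
qed

section \<open>The probability that a random polytope misses a point\<close>

text \<open>Directions are kept near both poles and reversed in the band between. The symmetry in
  \<open>h\<close> lets one construction serve separating half spaces of either orientation.\<close>

definition flip_sign :: "real \<Rightarrow> real \<Rightarrow> real" where
  "flip_sign h1 h = (if h1 < h \<or> h < - h1 then 1 else - 1)"

text \<open>A uniform point of the sphere is built from its height \<open>u d\<close> and an independent direction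
  \<open>om\<close> orthogonal to the axis. Since \<open>om\<close> and \<open>- om\<close> have the same law, the direction may be flipped
  depending on the height.\<close>

definition spin :: "nat \<Rightarrow> real \<Rightarrow> (nat \<Rightarrow> real) \<Rightarrow> (nat \<Rightarrow> real) \<Rightarrow> (nat \<Rightarrow> real)" where
  "spin k h1 u om = (let d = Suc k in
     ((flip_sign h1 (rho d u d) * eucl_norm d (rho d u)) *\<^sub>R rho k om)(d := rho d u d))"

lemma flip_sign_sq: "(flip_sign h1 h)\<^sup>2 = 1" "\<bar>flip_sign h1 h\<bar> = 1"
  by (auto simp: flip_sign_def)

lemma rho_norm: "eucl_norm (Suc n) (rho n u) = 1" "(eucl_norm n (rho n u))\<^sup>2 = 1 - (rho n u n)\<^sup>2"
  using rho_sphere[of n u] norm_proj[of n "rho n u"] by (auto simp: norm_proj' unit_sphere_eq)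

lemma spin_sphere: "spin k h1 u om \<in> unit_sphere (Suc (Suc k))"
proof -
  have "eucl_norm (Suc (Suc k)) (spin k h1 u om) = 1"
    unfolding spin_def Let_def norm_Suc_upd norm_scaleR rho_norm(1) abs_mult flip_sign_sq
    by (simp add: rho_norm)
  moreover have "spin k h1 u om \<in> espace (Suc (Suc k))"
    unfolding spin_def Let_def by (intro espace_upd espace_scaleR rho_espace)
  ultimately show ?thesis by (simp add: unit_sphere_eq)
qed

lemma borel_measurable_flip_sign [measurable]: "flip_sign h1 \<in> borel_measurable borel"
  unfolding flip_sign_def by measurable

lemma borel_measurable_spin:
  assumes "f \<in> borel_measurable M" "g \<in> borel_measurable M"
  shows "(\<lambda>x. spin k h1 (f x) (g x)) \<in> borel_measurable M"
proof -
  have r: "(\<lambda>x. rho (Suc k) (f x)) \<in> borel_measurable M" "(\<lambda>x. rho k (g x)) \<in> borel_measurable M"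
    using assms by (auto intro: borel_measurable_rho)
  have c: "(\<lambda>x. rho (Suc k) (f x) (Suc k)) \<in> borel_measurable M" by (rule borel_measurable_fun_coord[OF r(1)])
  have "(\<lambda>x. flip_sign h1 (rho (Suc k) (f x) (Suc k))) \<in> borel_measurable M"
    by (rule measurable_compose[OF c borel_measurable_flip_sign])
  then show ?thesis
    unfolding spin_def Let_def using r c
    by (intro borel_measurable_fun_upd borel_measurable_fun_scaleR borel_measurable_times borel_measurable_eucl_norm)
qed

text \<open>For a fixed height the flip is either the identity or the antipodal map of the
  direction, and both preserve its law; what remains is the decomposition of a uniform point into
  height and direction.\<close>

lemma nn_integral_spin:
  assumes f: "f \<in> borel_measurable borel" and w: "w \<in> unit_sphere (Suc (Suc k))"
  shows "(\<integral>\<^sup>+om. (\<integral>\<^sup>+u. f (refl (Suc k) w (spin k h1 u om)) \<partial>sph (Suc (Suc k))) \<partial>sph (Suc k)) =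
    (\<integral>\<^sup>+x. f x \<partial>sph (Suc (Suc k)))"
proof -
  let ?d = "Suc k"
  interpret SS: pair_sigma_finite "sph ?d" "sph (Suc ?d)" ..
  define g where "g x = f (refl ?d w x)" for x
  have g [measurable]: "g \<in> borel_measurable borel"
    unfolding g_def by (rule measurable_compose[OF _ f]) (intro borel_measurable_refl borel_measurable_const, simp)
  have "(\<lambda>p. spin k h1 (snd p) (fst p)) \<in> borel_measurable (sph ?d \<Otimes>\<^sub>M sph (Suc ?d))"
    by (rule borel_measurable_spin) (simp_all cong: measurable_cong_sets)
  then have m: "(\<lambda>p. g (spin k h1 (snd p) (fst p))) \<in> borel_measurable (sph ?d \<Otimes>\<^sub>M sph (Suc ?d))"
    by (rule measurable_compose[OF _ g])
  have "(\<integral>\<^sup>+om. (\<integral>\<^sup>+u. g (spin k h1 u om) \<partial>sph (Suc ?d)) \<partial>sph ?d) = (\<integral>\<^sup>+u. (\<integral>\<^sup>+om. g (spin k h1 u om) \<partial>sph ?d) \<partial>sph (Suc ?d))"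
    by (rule SS.Fubini'[symmetric]) (use m in \<open>simp add: case_prod_unfold\<close>)
  also have "\<dots> = (\<integral>\<^sup>+u. (\<integral>\<^sup>+v. g ((eucl_norm ?d u *\<^sub>R v)(?d := u ?d)) \<partial>sph ?d) \<partial>sph (Suc ?d))"
  proof (rule nn_integral_sph_cong)
    fix u assume u: "u \<in> unit_sphere (Suc ?d)"
    let ?s = "flip_sign h1 (u ?d)"
    let ?G = "\<lambda>v. g ((eucl_norm ?d u *\<^sub>R v)(?d := u ?d))"
    have G: "?G \<in> borel_measurable borel" by measurable
    have "(\<integral>\<^sup>+om. g (spin k h1 u om) \<partial>sph ?d) = (\<integral>\<^sup>+om. ?G (?s *\<^sub>R om) \<partial>sph ?d)"
      using u by (intro nn_integral_sph_cong) (auto simp: spin_def rho_def mult.commute)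
    also have "\<dots> = (\<integral>\<^sup>+om. ?G om \<partial>sph ?d)"
      using nn_integral_sph_uminus[OF G, of ?d] by (auto simp: flip_sign_def)
    finally show "(\<integral>\<^sup>+om. g (spin k h1 u om) \<partial>sph ?d) = (\<integral>\<^sup>+om. ?G om \<partial>sph ?d)" .
  qed simp
  also have "\<dots> = (\<integral>\<^sup>+u. g u \<partial>sph (Suc ?d))" by (rule nn_integral_sph_Suc[symmetric, OF g]) simp
  also have "\<dots> = (\<integral>\<^sup>+u. f u \<partial>sph (Suc ?d))"
    unfolding g_def by (rule nn_integral_sph_refl[OF f w])
  finally show ?thesis unfolding g_def .
qed

lemma sphere_measure_sets: "A \<in> sets (sphere_measure n) \<longleftrightarrow> A \<in> sets borel \<and> A \<subseteq> unit_sphere n"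
  unfolding sphere_measure_sph using measurable_unit_sphere[of n]
  by (subst sets_restrict_space_iff) (auto simp: sets_sph)

lemma sphere_measure_emeasure: "A \<in> sets (sphere_measure n) \<Longrightarrow> emeasure (sphere_measure n) A = emeasure (sph n) A"
  unfolding sphere_measure_sets unfolding sphere_measure_sph
  by (intro emeasure_restrict_space) (auto simp: sets_sph measurable_unit_sphere)

lemma space_sphere_measure [simp]: "space (sphere_measure n) = unit_sphere n"
  by (simp add: sphere_measure_sph space_restrict_space)

lemma measurable_sphere_measureI:
  assumes "f \<in> borel_measurable M" "\<And>x. x \<in> space M \<Longrightarrow> f x \<in> unit_sphere n"
  shows "f \<in> measurable M (sphere_measure n)"
  unfolding sphere_measure_sph using assms
  by (intro measurable_restrict_space2) (auto cong: measurable_cong_sets simp: sets_sph)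

lemma sphere_measure_borel: "(\<lambda>x. x) \<in> borel_measurable (sphere_measure n)"
  unfolding sphere_measure_sph by (intro measurable_restrict_space1) (simp cong: measurable_cong_sets)

lemma coord_sphere_measure:
  assumes "i < N"
  shows "(\<lambda>X. X i) \<in> borel_measurable (Pi\<^sub>M {..<N} (\<lambda>_. sphere_measure n))"
proof -
  have "(\<lambda>X. X i) \<in> measurable (Pi\<^sub>M {..<N} (\<lambda>_. sphere_measure n)) (sphere_measure n)"
    using assms by (intro measurable_component_singleton) simp
  from measurable_compose[OF this sphere_measure_borel] show ?thesis .
qed

lemma prob_space_sphere_measure: "1 \<le> n \<Longrightarrow> prob_space (sphere_measure n)"
proof
  assume n: "1 \<le> n"
  have "emeasure (sphere_measure n) (unit_sphere n) = emeasure (sph n) (unit_sphere n)"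
    by (rule sphere_measure_emeasure) (auto simp: sphere_measure_sets measurable_unit_sphere)
  also have "\<dots> = 1"
    using AE_sph[OF n] by (intro sph.emeasure_eq_1_AE) (auto simp: sets_sph measurable_unit_sphere)
  finally show "emeasure (sphere_measure n) (space (sphere_measure n)) = 1" by simp
qed

lemma prod_indicator_eq: "finite I \<Longrightarrow> (\<Prod>i\<in>I. indicator (A i) (x i) :: ennreal) = of_bool (\<forall>i\<in>I. x i \<in> A i)"
  by (induction I rule: finite_induct) (auto simp: indicator_def)

text \<open>Replaces the sample by independent heights and directions, so that the directions can be
  held fixed while only the heights are random. The two measures agree on boxes, where everything
  factorizes over the points.\<close>

lemma PiM_sphere_spin:
  fixes N :: nat and h1 :: real
  assumes w: "w \<in> unit_sphere (Suc (Suc k))"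
  defines "S \<equiv> sphere_measure (Suc (Suc k))"
  defines "\<Psi> \<equiv> \<lambda>p. \<lambda>i\<in>{..<N}. refl (Suc k) w (spin k h1 (snd p i) (fst p i))"
  defines "PP \<equiv> Pi\<^sub>M {..<N} (\<lambda>_. sph (Suc k)) \<Otimes>\<^sub>M Pi\<^sub>M {..<N} (\<lambda>_. sph (Suc (Suc k)))"
  shows "\<Psi> \<in> measurable PP (Pi\<^sub>M {..<N} (\<lambda>_. S))" "Pi\<^sub>M {..<N} (\<lambda>_. S) = distr PP (Pi\<^sub>M {..<N} (\<lambda>_. S)) \<Psi>"
proof -
  let ?I = "{..<N}" and ?d = "Suc k"
  interpret S: prob_space S unfolding S_def by (rule prob_space_sphere_measure) simp
  interpret PS: product_sigma_finite "\<lambda>_. S" by standard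
  interpret P1: product_sigma_finite "\<lambda>_::nat. sph ?d" by standard
  interpret P2: product_sigma_finite "\<lambda>_::nat. sph (Suc ?d)" by standard
  interpret F2: finite_product_prob_space "\<lambda>_::nat. sph (Suc ?d)" ?I by standard simp
  have mp: "(\<lambda>p. refl ?d w (spin k h1 (snd p) (fst p))) \<in> borel_measurable (sph ?d \<Otimes>\<^sub>M sph (Suc ?d))"
    by (intro borel_measurable_refl borel_measurable_const borel_measurable_spin) (simp_all cong: measurable_cong_sets)
  have sph: "refl ?d w (spin k h1 u om) \<in> unit_sphere (Suc ?d)" for u om
    using spin_sphere[of k h1 u om] w by (auto simp: unit_sphere_eq norm_refl[OF w] intro: refl_espace)
  have comp: "(\<lambda>p. refl ?d w (spin k h1 (snd p i) (fst p i))) \<in> borel_measurable PP" if "i \<in> ?I" for i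
    unfolding PP_def using that
    by (intro borel_measurable_refl borel_measurable_const borel_measurable_spin
        measurable_compose[OF measurable_snd] measurable_compose[OF measurable_fst])
       (auto intro!: measurable_component_singleton[of i ?I "\<lambda>_. sph (Suc ?d)", unfolded measurable_cong_sets[OF refl sets_sph]]
        measurable_component_singleton[of i ?I "\<lambda>_. sph ?d", unfolded measurable_cong_sets[OF refl sets_sph]])
  show \<Psi>: "\<Psi> \<in> measurable PP (Pi\<^sub>M ?I (\<lambda>_. S))"
    unfolding \<Psi>_def S_def using comp sph by (intro measurable_restrict measurable_sphere_measureI) auto
  show "Pi\<^sub>M ?I (\<lambda>_. S) = distr PP (Pi\<^sub>M ?I (\<lambda>_. S)) \<Psi>"
  proof (rule PS.PiM_eqI[symmetric])
    fix A assume "\<And>i. i \<in> ?I \<Longrightarrow> A i \<in> sets S"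
    then have A: "A i \<in> sets S" "A i \<in> sets borel" if "i \<in> ?I" for i
      using that by (auto simp: S_def sphere_measure_sets)
    have PA: "Pi\<^sub>E ?I A \<in> sets (Pi\<^sub>M ?I (\<lambda>_. S))" using A by (intro sets_PiM_I_finite) auto
    then have pre: "\<Psi> -` Pi\<^sub>E ?I A \<inter> space PP \<in> sets PP" by (rule measurable_sets[OF \<Psi>])
    let ?g = "\<lambda>i om. \<integral>\<^sup>+u. indicator (A i) (refl ?d w (spin k h1 u om)) \<partial>sph (Suc ?d)"
    have gm: "(\<lambda>p. indicator (A i) (refl ?d w (spin k h1 (snd p) (fst p))) :: ennreal) \<in> borel_measurable (sph ?d \<Otimes>\<^sub>M sph (Suc ?d))"
      if "i \<in> ?I" for i using A(2)[OF that] by (intro measurable_compose[OF mp]) simp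
    have "emeasure (distr PP (Pi\<^sub>M ?I (\<lambda>_. S)) \<Psi>) (Pi\<^sub>E ?I A) = emeasure PP (\<Psi> -` Pi\<^sub>E ?I A \<inter> space PP)"
      by (rule emeasure_distr[OF \<Psi> PA])
    also have "\<dots> = (\<integral>\<^sup>+om. (\<integral>\<^sup>+u. indicator (\<Psi> -` Pi\<^sub>E ?I A \<inter> space PP) (om, u) \<partial>Pi\<^sub>M ?I (\<lambda>_. sph (Suc ?d))) \<partial>Pi\<^sub>M ?I (\<lambda>_. sph ?d))"
      unfolding PP_def by (rule F2.emeasure_pair_measure) (use pre in \<open>simp add: PP_def\<close>)
    also have "\<dots> = (\<integral>\<^sup>+om. (\<integral>\<^sup>+u. (\<Prod>i\<in>?I. indicator (A i) (refl ?d w (spin k h1 (u i) (om i)))) \<partial>Pi\<^sub>M ?I (\<lambda>_. sph (Suc ?d))) \<partial>Pi\<^sub>M ?I (\<lambda>_. sph ?d))"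
      by (intro nn_integral_cong) (auto simp: prod_indicator_eq PP_def space_pair_measure \<Psi>_def indicator_def PiE_iff)
    also have "\<dots> = (\<integral>\<^sup>+om. (\<Prod>i\<in>?I. ?g i (om i)) \<partial>Pi\<^sub>M ?I (\<lambda>_. sph ?d))"
    proof (intro nn_integral_cong)
      fix om
      show "(\<integral>\<^sup>+u. (\<Prod>i\<in>?I. indicator (A i) (refl ?d w (spin k h1 (u i) (om i)))) \<partial>Pi\<^sub>M ?I (\<lambda>_. sph (Suc ?d))) = (\<Prod>i\<in>?I. ?g i (om i))"
      proof (rule P2.product_nn_integral_prod[OF finite_lessThan])
        fix i assume "i \<in> ?I"
        then show "(\<lambda>u. indicator (A i) (refl ?d w (spin k h1 u (om i))) :: ennreal) \<in> borel_measurable (sph (Suc ?d))"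
        proof -
          assume i: "i \<in> ?I"
          have "(\<lambda>u. (om i, u)) \<in> measurable (sph (Suc ?d)) (sph ?d \<Otimes>\<^sub>M sph (Suc ?d))"
            by (rule measurable_Pair1') simp
          from measurable_compose[OF this gm[OF i]] show ?thesis by simp
        qed
      qed
    qed
    also have "\<dots> = (\<Prod>i\<in>?I. \<integral>\<^sup>+om. ?g i om \<partial>sph ?d)"
    proof (rule P1.product_nn_integral_prod[OF finite_lessThan])
      fix i assume "i \<in> ?I"
      then show "?g i \<in> borel_measurable (sph ?d)"
        using gm by (intro sph.borel_measurable_nn_integral) (simp add: case_prod_unfold)
    qed
    also have "\<dots> = (\<Prod>i\<in>?I. emeasure S (A i))"
    proof (intro prod.cong refl)
      fix i assume i: "i \<in> ?I"
      have "(\<integral>\<^sup>+om. ?g i om \<partial>sph ?d) = (\<integral>\<^sup>+x. indicator (A i) x \<partial>sph (Suc ?d))"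
        by (rule nn_integral_spin[OF _ w]) (use A(2)[OF i] in simp)
      also have "\<dots> = emeasure S (A i)"
        using A[OF i] by (simp add: S_def sphere_measure_emeasure sets_sph)
      finally show "(\<integral>\<^sup>+om. ?g i om \<partial>sph ?d) = emeasure S (A i)" .
    qed
    finally show "emeasure (distr PP (Pi\<^sub>M ?I (\<lambda>_. S)) \<Psi>) (Pi\<^sub>E ?I A) = (\<Prod>i\<in>?I. emeasure S (A i))" .
  qed simp_all
qed

section \<open>A tilted chord of the circle and the sign patterns it forces\<close>

context
  fixes h1 h2 kk r :: real
  assumes h: "0 \<le> h2" "h2 < h1" "h1 < 1"
    and kk: "kk = (h1 - h2) / (sqrt (1 - h1\<^sup>2) + sqrt (1 - h2\<^sup>2))"
    and r: "0 \<le> r" "r \<le> h1 - kk * sqrt (1 - h1\<^sup>2)"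
begin

lemma kk_pos: "0 < kk" and s12: "0 < sqrt (1 - h1\<^sup>2)" "sqrt (1 - h1\<^sup>2) \<le> sqrt (1 - h2\<^sup>2)"
proof -
  have "h1\<^sup>2 < 1" using h by (simp add: power_less_one_iff abs_square_less_1)
  moreover have "h2\<^sup>2 \<le> h1\<^sup>2" using h by (intro power_mono) auto
  ultimately show s: "0 < sqrt (1 - h1\<^sup>2)" "sqrt (1 - h1\<^sup>2) \<le> sqrt (1 - h2\<^sup>2)" by auto
  then have "0 < sqrt (1 - h1\<^sup>2) + sqrt (1 - h2\<^sup>2)" by linarith
  then show "0 < kk" unfolding kk using h by simp
qed

text \<open>In the half turn spanned by the axis and a direction, let a chord join the circle point
  of height \<open>h1\<close> on the right to the one of height \<open>h2\<close> on the left. Its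
  slope is \<open>kk\<close>, and it meets the axis at height
  \<open>h1 - kk * sqrt (1 - h1^2)\<close>, which is at least \<open>r\<close>. Points higher than
  \<open>h1\<close>, placed on the right, lie above the line of slope \<open>kk\<close> through the
  axis point at height \<open>r\<close>.\<close>

lemma chord_top:
  assumes "h1 < x" "x\<^sup>2 \<le> 1"
  shows "kk * sqrt (1 - x\<^sup>2) \<le> x - r"
proof -
  have "h1\<^sup>2 \<le> x\<^sup>2" using assms h by (intro power_mono) auto
  then have "kk * sqrt (1 - x\<^sup>2) \<le> kk * sqrt (1 - h1\<^sup>2)" using kk_pos by (intro mult_left_mono) auto
  then show ?thesis using r assms by linarith
qed

text \<open>The left part of the same arc: points of height between \<open>h2\<close> and
  \<open>h1\<close>, placed on the left by the flip, also lie above this line, because an arc lies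
  above its chord. The computation compares slopes of two chords ending at height
  \<open>h2\<close>.\<close>

lemma chord_middle:
  assumes "h2 < x" "x \<le> h1"
  shows "- (kk * sqrt (1 - x\<^sup>2)) \<le> x - r"
proof -
  define s1 where "s1 = sqrt (1 - h1\<^sup>2)"
  define s2 where "s2 = sqrt (1 - h2\<^sup>2)"
  define s where "s = sqrt (1 - x\<^sup>2)"
  have s: "0 < s1" "s1 \<le> s2" unfolding s1_def s2_def by (rule s12)+
  have x1: "x\<^sup>2 \<le> h1\<^sup>2" using assms h by (intro power_mono) auto
  have h1: "h1\<^sup>2 < 1" using h by (simp add: power_less_one_iff abs_square_less_1)
  have h2: "h2\<^sup>2 \<le> h1\<^sup>2" using h by (intro power_mono) auto
  have sq: "s1 * s1 = 1 - h1 * h1" "s2 * s2 = 1 - h2 * h2" "s * s = 1 - x * x" "0 \<le> s"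
    using x1 h1 h2 by (auto simp: s1_def s2_def s_def power2_eq_square)
  have k: "kk * (s1 + s2) = h1 - h2" using s by (simp add: kk flip: s1_def s2_def)
  have "kk * (x + h2) * (s1 + s2) = (h1 - h2) * (x + h2)" by (simp add: k[symmetric] mult_ac)
  also have "\<dots> \<le> (h1 - h2) * (h1 + h2)" using assms h by (intro mult_left_mono) auto
  also have "\<dots> = (s2 - s1) * (s1 + s2)" using sq by (simp add: algebra_simps)
  finally have "kk * (x + h2) \<le> s2 - s1" using s by (simp add: mult_le_cancel_right)
  then have *: "kk * (x + h2) \<le> s2 + s" using s sq by linarith
  have "s2 * s2 - s * s = (x - h2) * (x + h2)" using sq by (simp add: algebra_simps)
  moreover have "(kk * (s2 - s)) * (s2 + s) = kk * (s2 * s2 - s * s)" by (simp add: algebra_simps)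
  ultimately have "(kk * (s2 - s)) * (s2 + s) = (x - h2) * (kk * (x + h2))" by simp
  also have "\<dots> \<le> (x - h2) * (s2 + s)" using * assms by (intro mult_left_mono) auto
  finally have "kk * (s2 - s) \<le> x - h2" using s sq by (simp add: mult_le_cancel_right)
  moreover have "r \<le> h2 + kk * s2" using r k by (simp add: algebra_simps flip: s1_def)
  ultimately show ?thesis by (simp add: algebra_simps flip: s_def)
qed

definition height_label :: "real \<Rightarrow> int" where
  "height_label x = (if h1 < x then - 1 else if h2 < x then 1 else 0)"

text \<open>Suppose a half space with the missed point on its boundary contains the sample point in
  its interior. Since kept points and flipped points lie above the same tilted line, the form
  \<open>v\<close> extended by the coordinate \<open>kk\<close> must be negative on the kept and
  positive on the flipped directions. The sign thus depends on the height alone. For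
  \<open>t < 0\<close> the heights are read from the opposite pole.\<close>

lemma separating_pattern:
  assumes v: "ip d om v * (flip_sign h1 x * s) + x * t < r * t" and s: "s = sqrt (1 - x\<^sup>2)" "x\<^sup>2 \<le> 1"
  shows "0 \<le> t \<Longrightarrow> height_label x = 1 \<Longrightarrow> 0 < ip d om v + kk * t"
    and "0 \<le> t \<Longrightarrow> height_label x = - 1 \<Longrightarrow> ip d om v + kk * t < 0"
    and "t < 0 \<Longrightarrow> height_label (- x) = 1 \<Longrightarrow> 0 < ip d om v - kk * t"
    and "t < 0 \<Longrightarrow> height_label (- x) = - 1 \<Longrightarrow> ip d om v - kk * t < 0"
proof -
  let ?e = "ip d om v"
  have s0: "0 \<le> s" using s by simp
  show "0 < ?e + kk * t" if t: "0 \<le> t" and l: "height_label x = 1"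
  proof -
    have x: "h2 < x" "x \<le> h1" using l by (auto simp: height_label_def split: if_splits)
    then have f: "flip_sign h1 x = - 1" using h by (simp add: flip_sign_def)
    have "- (kk * s) * t \<le> (x - r) * t" using chord_middle[OF x] t s by (intro mult_right_mono) auto
    then have "0 < s * (?e + kk * t)" using v by (simp add: f algebra_simps)
    then show ?thesis using s0 by (simp add: zero_less_mult_iff)
  qed
  show "?e + kk * t < 0" if t: "0 \<le> t" and l: "height_label x = - 1"
  proof -
    have x: "h1 < x" using l by (auto simp: height_label_def split: if_splits)
    then have f: "flip_sign h1 x = 1" by (simp add: flip_sign_def)
    have "(kk * s) * t \<le> (x - r) * t" using chord_top[OF x] t s by (intro mult_right_mono) auto
    then have "s * (?e + kk * t) < 0" using v by (simp add: f algebra_simps)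
    then show ?thesis using s0 by (simp add: mult_less_0_iff)
  qed
  show "0 < ?e - kk * t" if t: "t < 0" and l: "height_label (- x) = 1"
  proof -
    have x: "h2 < - x" "- x \<le> h1" using l by (auto simp: height_label_def split: if_splits)
    then have f: "flip_sign h1 x = - 1" using h by (simp add: flip_sign_def)
    have "- (kk * s) * (- t) \<le> (- x - r) * (- t)" using chord_middle[OF x] t s by (intro mult_right_mono) auto
    moreover have "r * t \<le> 0" using r t by (simp add: mult_nonneg_nonpos)
    ultimately have "0 < s * (?e - kk * t)" using v by (simp add: f algebra_simps)
    then show ?thesis using s0 by (simp add: zero_less_mult_iff)
  qed
  show "?e - kk * t < 0" if t: "t < 0" and l: "height_label (- x) = - 1"
  proof -
    have x: "h1 < - x" using l by (auto simp: height_label_def split: if_splits)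
    then have f: "flip_sign h1 x = 1" by (simp add: flip_sign_def)
    have "(kk * s) * (- t) \<le> (- x - r) * (- t)" using chord_top[OF x] t s by (intro mult_right_mono) auto
    moreover have "r * t \<le> 0" using r t by (simp add: mult_nonneg_nonpos)
    ultimately have "s * (?e - kk * t) < 0" using v by (simp add: f algebra_simps)
    then show ?thesis using s0 by (simp add: mult_less_0_iff)
  qed
qed

lemma outside_separated:
  assumes K: "cc n K" and y: "y \<in> espace n" "y \<notin> K"
  obtains v where "\<And>x. x \<in> K \<Longrightarrow> ip n x v < ip n y v"
proof -
  from nearest_point[OF K, of y] obtain z where z: "z \<in> K" "dst n K y = eucl_norm n (y - z)"
    "\<And>k. k \<in> K \<Longrightarrow> ip n (k - z) (y - z) \<le> 0" by metis
  have "y \<noteq> z" using y z by auto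
  then have "eucl_norm n (y - z) \<noteq> 0"
    using norm_eq_0[of "y - z" n] y z K by (auto simp: cc_def intro: espace_diff)
  then have "0 < ip n (y - z) (y - z)" by (simp add: norm_eq_ip order.not_eq_order_implies_strict)
  then have "ip n x (y - z) < ip n y (y - z)" if "x \<in> K" for x
    using z(3)[OF that] by (simp only: ip_simps(3))
  then show ?thesis using that by blast
qed

text \<open>Undo the rotation so that the missed point lies on the last axis and separate it from
  the hull. The separating vector itself realises the pattern of the heights on the vectors formed
  by the direction \<open>om i\<close> and the constant \<open>kk\<close>; its last coordinate
  changes sign in the second case.\<close>

lemma miss_pattern:
  fixes N :: nat
  assumes N: "1 \<le> N" and w: "w \<in> unit_sphere (Suc (Suc k))"
    and X: "\<And>i. i < N \<Longrightarrow> X i = refl (Suc k) w (spin k h1 (u i) (om i))"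
    and miss: "r *\<^sub>R w \<notin> phull N X"
  defines "b \<equiv> \<lambda>l i. if l = Suc k then kk else rho k (om i) l"
  shows "feas N {..Suc k} b (labels (\<lambda>u. height_label (rho (Suc k) u (Suc k))) N u) \<or>
    feas N {..Suc k} b (labels (\<lambda>u. height_label (- rho (Suc k) u (Suc k))) N u)"
proof -
  let ?d = "Suc k"
  define Y where "Y i = spin k h1 (u i) (om i)" for i
  have YE: "Y i \<in> espace (Suc ?d)" for i
    using spin_sphere[of k h1 "u i" "om i"] by (simp add: Y_def unit_sphere_eq)
  have cc: "cc (Suc ?d) (phull N Y)" using N YE by (intro cc_hull) auto
  have "r *\<^sub>R unitv ?d \<notin> phull N Y"
  proof
    assume "r *\<^sub>R unitv ?d \<in> phull N Y"
    then obtain l where l: "l \<in> weights N" "r *\<^sub>R unitv ?d = comb N Y l" by (auto simp: phull_def)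
    have "r *\<^sub>R w = refl ?d w (comb N Y l)" by (simp add: l(2)[symmetric] refl_linear refl_unitv[OF w])
    also have "\<dots> = comb N X l" by (simp add: comb_def refl_sum refl_linear X Y_def)
    finally show False using miss l by (auto simp: phull_def)
  qed
  from outside_separated[OF cc espace_scaleR[OF unitv_espace] this] obtain v
    where v: "\<And>x. x \<in> phull N Y \<Longrightarrow> ip (Suc ?d) x v < ip (Suc ?d) (r *\<^sub>R unitv ?d) v" by blast
  let ?x = "\<lambda>i. rho ?d (u i) ?d"
  have sep: "ip ?d (rho k (om i)) v * (flip_sign h1 (?x i) * sqrt (1 - (?x i)\<^sup>2)) + ?x i * v ?d < r * v ?d"
    and x1: "(?x i)\<^sup>2 \<le> 1" if i: "i < N" for i
  proof -
    have sq: "(eucl_norm ?d (rho ?d (u i)))\<^sup>2 = 1 - (?x i)\<^sup>2" by (rule rho_norm)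
    then show "(?x i)\<^sup>2 \<le> 1" by (metis diff_ge_0_iff_ge zero_le_power2)
    have nr: "eucl_norm ?d (rho ?d (u i)) = sqrt (1 - (?x i)\<^sup>2)" using sq by (metis norm_ge_0 real_sqrt_unique)
    have "Y i \<in> phull N Y"
      using comb_unitv[OF i, of Y] unitv_weights[OF i] unfolding phull_def by (metis imageI)
    from v[OF this] show "ip ?d (rho k (om i)) v * (flip_sign h1 (?x i) * sqrt (1 - (?x i)\<^sup>2)) + ?x i * v ?d < r * v ?d"
      by (simp add: Y_def spin_def Let_def ip_Suc[of ?d] ip_upd ip_simps ip_unitv nr mult_ac flip: ip_Suc[of k])
  qed
  have sum: "(\<Sum>l\<in>{..?d}. a l * b l i) = ip ?d (rho k (om i)) a + kk * a ?d" for a :: "nat \<Rightarrow> real" and i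
  proof -
    have "(\<Sum>l\<in>{..?d}. a l * b l i) = (\<Sum>l\<in>{..<?d}. a l * b l i) + a ?d * b ?d i"
      by (simp flip: lessThan_Suc_atMost)
    also have "(\<Sum>l\<in>{..<?d}. a l * b l i) = ip ?d (rho k (om i)) a"
      unfolding ip_def by (intro sum.cong) (auto simp: b_def)
    finally show ?thesis by (simp add: b_def)
  qed
  show ?thesis
  proof (cases "0 \<le> v ?d")
    case True
    have "feas N {..?d} b (labels (\<lambda>u. height_label (rho ?d u ?d)) N u)"
      unfolding feas_def sum
      using separating_pattern(1,2)[OF sep refl x1 True] by (intro exI[of _ v]) (simp add: labels_def)
    then show ?thesis ..
  next
    case False
    then have neg: "v ?d < 0" by simp
    define a where "a = v(?d := - v ?d)"
    have ipa: "ip ?d x a = ip ?d x v" "a ?d = - v ?d" for x by (simp_all add: a_def ip_upd(2))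
    have "feas N {..?d} b (labels (\<lambda>u. height_label (- rho ?d u ?d)) N u)"
      unfolding feas_def sum
      using separating_pattern(3,4)[OF sep refl x1 neg] by (intro exI[of _ a]) (simp add: labels_def ipa)
    then show ?thesis ..
  qed
qed

lemma height_label_range: "height_label x \<in> {1, - 1, 0}"
  by (auto simp: height_label_def)

lemma measure_height_label:
  "measure (sph (Suc d)) {u. height_label (rho d u d) = c} = measure (sph (Suc d)) {u. height_label (u d) = c}"
  "measure (sph (Suc d)) {u. height_label (- rho d u d) = c} = measure (sph (Suc d)) {u. height_label (u d) = c}"
  "{u. height_label (rho d u d) = c} \<in> sets (sph (Suc d))" "{u. height_label (- rho d u d) = c} \<in> sets (sph (Suc d))"
proof -
  have [measurable]: "(\<lambda>u. rho d u d) \<in> borel_measurable borel"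
    by (intro borel_measurable_fun_coord borel_measurable_rho) simp
  have mb: "{x. height_label x = c} \<in> sets borel"
    unfolding height_label_def by measurable
  have 1: "{u. height_label (rho d u d) = c} \<in> sets borel" "{u. height_label (- rho d u d) = c} \<in> sets borel"
    "{u :: nat \<Rightarrow> real. height_label (u d) = c} \<in> sets borel"
    unfolding height_label_def by measurable
  then show "{u. height_label (rho d u d) = c} \<in> sets (sph (Suc d))" "{u. height_label (- rho d u d) = c} \<in> sets (sph (Suc d))"
    by (auto simp: sets_sph)
  have e: "emeasure (sph (Suc d)) A = (\<integral>\<^sup>+u. indicator A u \<partial>sph (Suc d))" if "A \<in> sets borel" for A
    using that by (simp add: sets_sph)
  have "emeasure (sph (Suc d)) {u. height_label (rho d u d) = c} = emeasure (sph (Suc d)) {u. height_label (u d) = c}"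
    unfolding e[OF 1(1)] e[OF 1(3)] by (rule nn_integral_sph_cong) (auto simp: rho_def indicator_def)
  then show "measure (sph (Suc d)) {u. height_label (rho d u d) = c} = measure (sph (Suc d)) {u. height_label (u d) = c}"
    by (simp add: measure_def)
  have "emeasure (sph (Suc d)) {u. height_label (- rho d u d) = c} =
     (\<integral>\<^sup>+u. indicator {u. height_label (u d) = c} (- u) \<partial>sph (Suc d))"
    unfolding e[OF 1(2)] by (rule nn_integral_sph_cong) (auto simp: rho_def indicator_def fun_app)
  also have "\<dots> = emeasure (sph (Suc d)) {u. height_label (u d) = c}"
    unfolding e[OF 1(3)] by (rule nn_integral_sph_uminus) (use 1(3) in simp)
  finally show "measure (sph (Suc d)) {u. height_label (- rho d u d) = c} = measure (sph (Suc d)) {u. height_label (u d) = c}"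
    by (simp add: measure_def)
qed

text \<open>With the directions held fixed, the vectors of the sign pattern are fixed and the labels
  are independent functions of the heights, so \<open>sign_patterns\<close> applies in dimension
  \<open>Suc (Suc k)\<close>. The outer factor 2 counts the two orientations of the separating half
  space.\<close>

theorem miss_probability:
  fixes N :: nat
  assumes N: "1 \<le> N" and w: "w \<in> unit_sphere (Suc (Suc k))" and mu: "0 \<le> \<mu>"
    "\<mu> \<le> measure (sph (Suc (Suc k))) {u. h1 < u (Suc k)}"
    "\<mu> \<le> measure (sph (Suc (Suc k))) {u. h2 < u (Suc k) \<and> u (Suc k) \<le> h1}"
  defines "PS \<equiv> Pi\<^sub>M {..<N} (\<lambda>_. sphere_measure (Suc (Suc k)))"
  shows "emeasure PS {X \<in> space PS. r *\<^sub>R w \<notin> phull N X} \<le> ennreal (2 * (2 ^ Suc (Suc k) * (1 - \<mu> / 2) ^ N))"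
proof -
  let ?d = "Suc k" and ?I = "{..<N}"
  let ?P = "sph (Suc ?d)"
  let ?PU = "Pi\<^sub>M ?I (\<lambda>_. ?P)"
  let ?PP = "Pi\<^sub>M ?I (\<lambda>_. sph ?d) \<Otimes>\<^sub>M ?PU"
  let ?C = "2 ^ Suc ?d * (1 - \<mu> / 2) ^ N"
  define \<Psi> where "\<Psi> = (\<lambda>p. \<lambda>i\<in>?I. refl ?d w (spin k h1 (snd p i) (fst p i)))"
  note spin = PiM_sphere_spin[OF w, where N = N and ?h1.0 = h1, folded PS_def \<Psi>_def]
  interpret P1: prob_space "Pi\<^sub>M ?I (\<lambda>_. sph ?d)" by (rule prob_space_PiM) (rule prob_space_sph)
  interpret F2: finite_product_prob_space "\<lambda>_::nat. ?P" ?I by standard simp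
  define \<alpha> where "\<alpha> c = measure ?P {u. height_label (u ?d) = c}" for c
  define A where "A = {X \<in> space PS. r *\<^sub>R w \<notin> phull N X}"
  have A: "A \<in> sets PS"
  proof -
    have "Measurable.pred PS (\<lambda>X. r *\<^sub>R w \<in> phull N X)"
      unfolding PS_def
      by (rule pred_hull[OF N, where n = "Suc ?d"])
        (auto simp: space_PiM unit_sphere_eq PiE_iff intro!: coord_sphere_measure borel_measurable_const)
    then have "Measurable.pred PS (\<lambda>X. r *\<^sub>R w \<notin> phull N X)" by simp
    then show ?thesis unfolding A_def pred_def by simp
  qed
  have \<alpha>sum: "\<alpha> 1 + \<alpha> (- 1) + \<alpha> 0 = 1"
  proof -
    have m: "{u :: nat \<Rightarrow> real. height_label (u ?d) = c} \<in> sets ?P" for c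
      unfolding height_label_def sets_sph by measurable
    have "\<alpha> 1 + \<alpha> (- 1) = measure ?P ({u. height_label (u ?d) = 1} \<union> {u. height_label (u ?d) = - 1})"
      unfolding \<alpha>_def using m by (intro sph.finite_measure_Union[symmetric]) auto
    also have "\<dots> + \<alpha> 0 = measure ?P (({u. height_label (u ?d) = 1} \<union> {u. height_label (u ?d) = - 1}) \<union> {u. height_label (u ?d) = 0})"
      unfolding \<alpha>_def using m by (intro sph.finite_measure_Union[symmetric]) auto
    also have "({u. height_label (u ?d) = 1} \<union> {u. height_label (u ?d) = - 1}) \<union> {u. height_label (u ?d) = 0} = space ?P"
      using height_label_range by auto
    finally show ?thesis using sph.prob_space[of "Suc ?d"] by simp
  qed
  have "{u. height_label (u ?d) = - 1} = {u. h1 < u ?d}" "{u. height_label (u ?d) = 1} = {u. h2 < u ?d \<and> u ?d \<le> h1}"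
    using h by (auto simp: height_label_def)
  then have mu': "\<mu> \<le> \<alpha> (- 1)" "\<mu> \<le> \<alpha> 1" using mu by (simp_all add: \<alpha>_def)
  have bound: "(\<integral>\<^sup>+u. ennreal (of_bool (feas N {..?d} b (labels lab N u))) \<partial>?PU) \<le> ennreal ?C"
    if lab: "\<And>c. measure ?P {u. lab u = c} = \<alpha> c" "\<And>c. {u. lab u = c} \<in> sets ?P" "\<And>u. lab u \<in> {1, - 1, 0}" for lab b
  proof -
    have "(\<integral>\<^sup>+u. ennreal (of_bool (feas N {..?d} b (labels lab N u))) \<partial>?PU) =
       ennreal (label_sum (\<alpha> 1) (\<alpha> (- 1)) (\<alpha> 0) N (\<lambda>l. of_bool (feas N {..?d} b l)))"
      by (rule nn_integral_labels[OF prob_space_sph, where F = "\<lambda>l. of_bool (feas N {..?d} b l)"]) (use lab in simp_all)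
    also have "\<dots> \<le> ennreal (2 ^ card {..?d} * (1 - \<mu> / 2) ^ N)"
      using mu mu' \<alpha>sum by (intro ennreal_leI sign_patterns) (auto simp: \<alpha>_def)
    finally show ?thesis by simp
  qed
  have "emeasure PS A = emeasure (distr ?PP PS \<Psi>) A" using spin(2) by simp
  also have "\<dots> = emeasure ?PP (\<Psi> -` A \<inter> space ?PP)" by (rule emeasure_distr[OF spin(1) A])
  also have "\<dots> = (\<integral>\<^sup>+om. (\<integral>\<^sup>+u. indicator (\<Psi> -` A \<inter> space ?PP) (om, u) \<partial>?PU) \<partial>Pi\<^sub>M ?I (\<lambda>_. sph ?d))"
    by (rule F2.emeasure_pair_measure) (rule measurable_sets[OF spin(1) A])
  also have "\<dots> \<le> (\<integral>\<^sup>+om. ennreal ?C + ennreal ?C \<partial>Pi\<^sub>M ?I (\<lambda>_. sph ?d))"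
  proof (rule nn_integral_mono)
    fix om :: "nat \<Rightarrow> nat \<Rightarrow> real"
    let ?b = "\<lambda>l i. if l = ?d then kk else rho k (om i) l"
    let ?F = "\<lambda>lab u. ennreal (of_bool (feas N {..?d} ?b (labels lab N u)))"
    let ?l1 = "\<lambda>u. height_label (rho ?d u ?d)" and ?l2 = "\<lambda>u. height_label (- rho ?d u ?d)"
    have l1: "measure ?P {u. ?l1 u = c} = \<alpha> c" "measure ?P {u. ?l2 u = c} = \<alpha> c"
      "{u. ?l1 u = c} \<in> sets ?P" "{u. ?l2 u = c} \<in> sets ?P" for c
      unfolding \<alpha>_def by (rule measure_height_label)+
    have meas: "?F lab \<in> borel_measurable ?PU"
      if "\<And>c. {u. lab u = c} \<in> sets ?P" "\<And>u. lab u \<in> {1, - 1, 0}" for lab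
      by (rule borel_measurable_labels[OF order_refl]) (use that in simp_all)
    have "(\<integral>\<^sup>+u. indicator (\<Psi> -` A \<inter> space ?PP) (om, u) \<partial>?PU) \<le> (\<integral>\<^sup>+u. ?F ?l1 u + ?F ?l2 u \<partial>?PU)"
    proof (rule nn_integral_mono)
      fix u
      show "indicator (\<Psi> -` A \<inter> space ?PP) (om, u) \<le> ?F ?l1 u + ?F ?l2 u"
      proof (cases "\<Psi> (om, u) \<in> A")
        case True
        then have "r *\<^sub>R w \<notin> phull N (\<Psi> (om, u))" by (simp add: A_def)
        moreover have "\<And>i. i < N \<Longrightarrow> \<Psi> (om, u) i = refl ?d w (spin k h1 (u i) (om i))" by (simp add: \<Psi>_def)
        ultimately have "feas N {..?d} ?b (labels ?l1 N u) \<or> feas N {..?d} ?b (labels ?l2 N u)"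
          using miss_pattern[OF N w, of "\<Psi> (om, u)" u om] by blast
        then show ?thesis by (auto simp: indicator_def)
      qed (simp add: indicator_def)
    qed
    also have "\<dots> = (\<integral>\<^sup>+u. ?F ?l1 u \<partial>?PU) + (\<integral>\<^sup>+u. ?F ?l2 u \<partial>?PU)"
      by (rule nn_integral_add; rule meas; (rule l1 | rule height_label_range))
    also have "\<dots> \<le> ennreal ?C + ennreal ?C"
      by (intro add_mono bound l1) (rule height_label_range)+
    finally show "(\<integral>\<^sup>+u. indicator (\<Psi> -` A \<inter> space ?PP) (om, u) \<partial>?PU) \<le> ennreal ?C + ennreal ?C" .
  qed
  also have "\<dots> = ennreal (2 * ?C)"
  proof -
    have "\<alpha> (- 1) \<le> 1" unfolding \<alpha>_def by (rule sph.prob_le_1)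
    then have "0 \<le> ?C" using mu' by (intro mult_nonneg_nonneg zero_le_power) auto
    then show ?thesis using P1.emeasure_space_1 by (simp add: ennreal_plus[symmetric] del: ennreal_plus)
  qed
  finally show ?thesis unfolding A_def .
qed

end

section \<open>The measure of spherical caps\<close>

text \<open>The volume of a cone of height and slope one relative to the ball; it is the leading
  constant of the cap measure in terms of the tangent.\<close>

definition capc :: "nat \<Rightarrow> real" where
  "capc d = kap d / (real (Suc d) * kap (Suc d))"

lemma capc_pos: "0 < capc d"
  using kap_pos[of d] kap_pos[of "Suc d"] by (simp add: capc_def)

definition cap :: "nat \<Rightarrow> real \<Rightarrow> real" where
  "cap d h = measure (sph (Suc d)) {u. h < u d}"

text \<open>The cosine of the angle whose tangent is \<open>t\<close>. In the parameter
  \<open>t\<close> a cap is the trace of a cone, so its measure compares with \<open>t ^ d\<close>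
  without an integral over angles.\<close>

definition height :: "real \<Rightarrow> real" where
  "height t = 1 / sqrt (1 + t\<^sup>2)"

lemma height_bounds: "0 < height t" "height t \<le> 1" "0 < t \<Longrightarrow> height t < 1"
  by (auto simp: height_def add_pos_nonneg)

lemma height_sq: "(height t)\<^sup>2 * (1 + t\<^sup>2) = 1" "1 - (height t)\<^sup>2 = (t * height t)\<^sup>2"
proof -
  have p: "0 < 1 + t\<^sup>2" by (simp add: add_pos_nonneg)
  then have hs: "(height t)\<^sup>2 = 1 / (1 + t\<^sup>2)" by (simp add: height_def power_divide)
  show "(height t)\<^sup>2 * (1 + t\<^sup>2) = 1" using p by (simp add: hs)
  then show "1 - (height t)\<^sup>2 = (t * height t)\<^sup>2" by (simp add: power_mult_distrib algebra_simps)
qed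

lemma height_cone:
  assumes t: "0 < t" and N: "0 < N" "N\<^sup>2 = a\<^sup>2 + x\<^sup>2" and a: "0 \<le> a"
  shows "height t * N < x \<longleftrightarrow> 0 < x \<and> a < t * x"
proof -
  have h: "0 < height t" by (rule height_bounds)
  have eq: "(1 + t\<^sup>2) * ((height t * N)\<^sup>2 - x\<^sup>2) = a\<^sup>2 - (t * x)\<^sup>2"
  proof -
    have "(1 + t\<^sup>2) * ((height t * N)\<^sup>2 - x\<^sup>2) = ((height t)\<^sup>2 * (1 + t\<^sup>2)) * N\<^sup>2 - (1 + t\<^sup>2) * x\<^sup>2"
      by (simp add: power_mult_distrib algebra_simps)
    also have "\<dots> = a\<^sup>2 - (t * x)\<^sup>2" unfolding height_sq N(2) by (simp add: power_mult_distrib algebra_simps)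
    finally show ?thesis .
  qed
  have p: "0 < 1 + t\<^sup>2" by (simp add: add_pos_nonneg)
  have iff: "(height t * N)\<^sup>2 < x\<^sup>2 \<longleftrightarrow> a\<^sup>2 < (t * x)\<^sup>2"
  proof -
    have "(height t * N)\<^sup>2 - x\<^sup>2 < 0 \<longleftrightarrow> (1 + t\<^sup>2) * ((height t * N)\<^sup>2 - x\<^sup>2) < 0"
      using p by (simp add: mult_less_0_iff)
    then show ?thesis unfolding eq by simp
  qed
  show ?thesis
  proof
    assume l: "height t * N < x"
    have hN: "0 < height t * N" using h N by simp
    then have x: "0 < x" using l by linarith
    have "(height t * N)\<^sup>2 < x\<^sup>2" using l hN by (intro power_strict_mono) auto
    then have "a\<^sup>2 < (t * x)\<^sup>2" using iff by simp
    then show "0 < x \<and> a < t * x" using x t by (auto intro: power_less_imp_less_base)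
  next
    assume r: "0 < x \<and> a < t * x"
    then have "a\<^sup>2 < (t * x)\<^sup>2" using a by (intro power_strict_mono) auto
    then show "height t * N < x" using iff r by (auto intro: power_less_imp_less_base)
  qed
qed

lemma pred_cone [measurable]:
  "Measurable.pred borel (\<lambda>x :: nat \<Rightarrow> real. eucl_norm d x \<le> s * x d)"
  "Measurable.pred borel (\<lambda>x :: nat \<Rightarrow> real. eucl_norm d x < s * x d)"
proof -
  have c: "continuous_on UNIV (\<lambda>x :: nat \<Rightarrow> real. s * x d)" "continuous_on UNIV (\<lambda>x. eucl_norm d x)"
    by (intro continuous_on_mult continuous_on_const continuous_on_product_coordinates)
       (intro continuous_on_eucl_norm continuous_on_id)
  have "closed {x :: nat \<Rightarrow> real. eucl_norm d x \<le> s * x d}" by (rule closed_Collect_le[OF c(2,1)])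
  then show "Measurable.pred borel (\<lambda>x :: nat \<Rightarrow> real. eucl_norm d x \<le> s * x d)"
    by (simp add: pred_def borel_closed)
  have "open {x :: nat \<Rightarrow> real. eucl_norm d x < s * x d}" by (rule open_Collect_less[OF c(2,1)])
  then show "Measurable.pred borel (\<lambda>x :: nat \<Rightarrow> real. eucl_norm d x < s * x d)"
    by (simp add: pred_def borel_open)
qed

lemma emeasure_cone:
  assumes s: "0 < s" and r: "0 \<le> R" and d: "1 \<le> d"
  shows "emeasure (L (Suc d)) {x \<in> espace (Suc d). 0 \<le> x d \<and> x d \<le> R \<and> eucl_norm d x \<le> s * x d} =
    ennreal (s ^ d * kap d * (R ^ Suc d / real (Suc d)))" (is "emeasure _ ?S = _")
proof -
  have Sm: "?S \<in> sets borel" by measurable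
  have "emeasure (L (Suc d)) ?S = (\<integral>\<^sup>+x. indicator ?S x \<partial>L (Suc d))"
    by (rule nn_integral_indicator[symmetric]) (use Sm in \<open>simp add: sets_L\<close>)
  also have "\<dots> = (\<integral>\<^sup>+y. (\<integral>\<^sup>+x. indicator ?S (x(d := y)) \<partial>L d) \<partial>lborel)"
    by (rule nn_integral_L_Suc') (use Sm in measurable)
  also have "\<dots> = (\<integral>\<^sup>+y. indicator {0..R} y * ennreal (y ^ d) * ennreal (s ^ d * kap d) \<partial>lborel)"
  proof (rule nn_integral_cong)
    fix y :: real
    show "(\<integral>\<^sup>+x. indicator ?S (x(d := y)) \<partial>L d) = indicator {0..R} y * ennreal (y ^ d) * ennreal (s ^ d * kap d)"
    proof (cases "y \<in> {0..R}")
      case True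
      have "(\<integral>\<^sup>+x. indicator ?S (x(d := y)) \<partial>L d) = (\<integral>\<^sup>+x. indicator {x \<in> espace d. eucl_norm d x \<le> s * y} x \<partial>L d)"
        using True by (intro nn_integral_L_cong) (auto simp: indicator_def norm_upd intro: espace_upd)
      also have "\<dots> = emeasure (L d) {x \<in> espace d. eucl_norm d x \<le> s * y}" by (simp add: sets_L)
      also have "\<dots> = ennreal ((s * y) ^ d * kap d)"
      proof (cases "y = 0")
        case y0: True
        have "emeasure (L d) {x \<in> espace d. eucl_norm d x \<le> 0} = 0"
        proof -
          have "AE x in L d. x \<notin> {x \<in> espace d. eucl_norm d x \<le> 0}"
            using AE_L_nonzero[OF d] by eventually_elim (auto simp: order_antisym)
          moreover have "{x \<in> espace d. eucl_norm d x \<le> 0} \<in> sets (L d)" unfolding sets_L by measurable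
          ultimately show ?thesis by (simp add: AE_iff_measurable[OF _ refl])
        qed
        then show ?thesis using y0 d by (simp add: power_0_left)
      next
        case False
        then show ?thesis using True s by (intro emeasure_small_ball) auto
      qed
      also have "\<dots> = ennreal (y ^ d) * ennreal (s ^ d * kap d)"
        using True by (subst ennreal_mult'[symmetric]) (auto simp: power_mult_distrib mult_ac)
      finally show ?thesis using True by simp
    qed (auto simp: indicator_def)
  qed
  also have "\<dots> = ennreal (R ^ Suc d / real (Suc d)) * ennreal (s ^ d * kap d)"
    by (subst nn_integral_multc) (auto simp: nn_integral_power_Icc[OF r] simp del: power_Suc)
  also have "\<dots> = ennreal (s ^ d * kap d * (R ^ Suc d / real (Suc d)))"
    using r by (subst ennreal_mult'[symmetric]) (auto simp: mult.commute)
  finally show ?thesis .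
qed

lemma cap_cone:
  assumes t: "0 < t"
  shows "emeasure (L (Suc d)) {x \<in> unit_ball (Suc d). 0 < x d \<and> eucl_norm d x < t * x d} = ennreal (kap (Suc d) * cap d (height t))"
    (is "emeasure _ ?S = _")
proof -
  let ?N = "eucl_norm (Suc d)" and ?C = "{u :: nat \<Rightarrow> real. height t < u d}"
  have k: "0 < kap (Suc d)" by (rule kap_pos)
  have "ennreal (cap d (height t)) = (\<integral>\<^sup>+u. indicator ?C u \<partial>sph (Suc d))"
    by (simp add: cap_def sph.emeasure_eq_measure sets_sph)
  also have "\<dots> = (\<integral>\<^sup>+x. indicator ?C ((1 / ?N x) *\<^sub>R x) * indicator (unit_ball (Suc d)) x \<partial>L (Suc d)) / ennreal (kap (Suc d))"
    by (rule nn_integral_sph) measurable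
  also have "(\<integral>\<^sup>+x. indicator ?C ((1 / ?N x) *\<^sub>R x) * indicator (unit_ball (Suc d)) x \<partial>L (Suc d)) = (\<integral>\<^sup>+x. indicator ?S x \<partial>L (Suc d))"
  proof (rule nn_integral_cong_AE)
    show "AE x in L (Suc d). indicator ?C ((1 / ?N x) *\<^sub>R x) * indicator (unit_ball (Suc d)) x = (indicator ?S x :: ennreal)"
    proof -
      have "AE x in L (Suc d). ?N x \<noteq> 0" by (rule AE_L_nonzero) simp
      then show ?thesis
    proof eventually_elim
      case (elim x)
      have N: "0 < ?N x" using elim by (simp add: order.not_eq_order_implies_strict)
      have "(?N x)\<^sup>2 = (eucl_norm d x)\<^sup>2 + (x d)\<^sup>2" using norm_proj[of d x] by (simp add: norm_proj')
      from height_cone[OF t N this] have "height t < x d / ?N x \<longleftrightarrow> 0 < x d \<and> eucl_norm d x < t * x d"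
        using N by (simp add: less_divide_eq)
      then show ?case by (auto simp: indicator_def fun_app)
    qed
    qed
  qed
  also have "\<dots> = emeasure (L (Suc d)) ?S" by (subst nn_integral_indicator) (auto simp: sets_L)
  finally have "ennreal (cap d (height t)) * ennreal (kap (Suc d)) = emeasure (L (Suc d)) ?S"
    using k by (simp add: ennreal_divide_times ennreal_mult_divide_eq)
  then show ?thesis using k by (simp add: ennreal_mult' mult.commute)
qed

text \<open>The part of the ball over the cap lies in the cone of height one and slope
  \<open>t\<close>.\<close>

lemma cap_le:
  assumes t: "0 < t" and d: "1 \<le> d"
  shows "cap d (height t) \<le> capc d * t ^ d"
proof -
  have "ennreal (kap (Suc d) * cap d (height t)) \<le>
     emeasure (L (Suc d)) {x \<in> espace (Suc d). 0 \<le> x d \<and> x d \<le> 1 \<and> eucl_norm d x \<le> t * x d}"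
    unfolding cap_cone[OF t, symmetric]
  proof (rule emeasure_mono)
    show "{x \<in> unit_ball (Suc d). 0 < x d \<and> eucl_norm d x < t * x d} \<subseteq> {x \<in> espace (Suc d). 0 \<le> x d \<and> x d \<le> 1 \<and> eucl_norm d x \<le> t * x d}"
    proof safe
      fix x assume "x \<in> unit_ball (Suc d)"
      then show "x \<in> espace (Suc d)" "x d \<le> 1" using abs_le_norm[of d "Suc d" x] by (auto simp: unit_ball_eq)
    qed simp_all
  qed (simp add: sets_L)
  also have "\<dots> = ennreal (t ^ d * kap d * (1 ^ Suc d / real (Suc d)))" by (rule emeasure_cone[OF t _ d]) simp
  finally have "kap (Suc d) * cap d (height t) \<le> t ^ d * kap d / real (Suc d)"
    using t kap_pos[of d] by (subst (asm) ennreal_le_iff) (auto simp: less_imp_le)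
  moreover have "kap (Suc d) * (capc d * t ^ d) = t ^ d * kap d / real (Suc d)"
    using kap_pos[of "Suc d"] by (simp add: capc_def)
  ultimately show ?thesis using kap_pos[of "Suc d"] by (metis mult_le_cancel_left_pos)
qed

text \<open>The cone cut off at \<open>height t\<close> lies in the ball, since its rim has norm
  exactly one.\<close>

lemma cap_ge:
  assumes t: "0 < t" and d: "1 \<le> d"
  shows "height t ^ Suc d * (capc d * t ^ d) \<le> cap d (height t)"
proof -
  let ?h = "height t"
  have h: "0 < ?h" "?h\<^sup>2 * (1 + t\<^sup>2) = 1" by (rule height_bounds height_sq)+
  \<comment> \<open>The volume formula is for closed cones and the cap is open, so the slope is
    first reduced by a factor \<theta> and \<theta> then tends to one.\<close>
  have *: "?h ^ Suc d * (capc d * (\<theta> * t) ^ d) \<le> cap d ?h" if \<theta>: "0 < \<theta>" "\<theta> < 1" for \<theta>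
  proof -
    have "ennreal ((\<theta> * t) ^ d * kap d * (?h ^ Suc d / real (Suc d))) =
      emeasure (L (Suc d)) {x \<in> espace (Suc d). 0 \<le> x d \<and> x d \<le> ?h \<and> eucl_norm d x \<le> (\<theta> * t) * x d}"
      using \<theta> t h by (intro emeasure_cone[symmetric] d) auto
    also have "\<dots> \<le> emeasure (L (Suc d)) {x \<in> unit_ball (Suc d). 0 < x d \<and> eucl_norm d x < t * x d}"
    proof (rule emeasure_mono_AE)
      show "AE x in L (Suc d). x \<in> {x \<in> espace (Suc d). 0 \<le> x d \<and> x d \<le> ?h \<and> eucl_norm d x \<le> (\<theta> * t) * x d} \<longrightarrow>
         x \<in> {x \<in> unit_ball (Suc d). 0 < x d \<and> eucl_norm d x < t * x d}"
        using AE_L_last_nonzero[of d]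
      proof (eventually_elim, safe)
        fix x assume x: "x d \<noteq> 0" "x \<in> espace (Suc d)" "0 \<le> x d" "x d \<le> ?h" "eucl_norm d x \<le> (\<theta> * t) * x d"
        then show xd: "0 < x d" by simp
        have "\<theta> * t * x d < 1 * t * x d" using \<theta> t xd by (intro mult_strict_right_mono) auto
        then show l: "eucl_norm d x < t * x d" using x by simp
        have "(eucl_norm (Suc d) x)\<^sup>2 = (eucl_norm d x)\<^sup>2 + (x d)\<^sup>2" using norm_proj[of d x] by (simp add: norm_proj')
        also have "\<dots> \<le> (t * x d)\<^sup>2 + (x d)\<^sup>2" using l by (intro add_right_mono power_mono) auto
        also have "\<dots> = (x d)\<^sup>2 * (1 + t\<^sup>2)" by (simp add: power_mult_distrib algebra_simps)
        also have "\<dots> \<le> ?h\<^sup>2 * (1 + t\<^sup>2)" using x by (intro mult_right_mono power_mono) auto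
        finally have "(eucl_norm (Suc d) x)\<^sup>2 \<le> 1\<^sup>2" by (simp add: h)
        then have "eucl_norm (Suc d) x \<le> 1" by (rule power2_le_imp_le) simp
        then show "x \<in> unit_ball (Suc d)" using x by (simp add: unit_ball_eq)
      qed
    qed (simp add: sets_L)
    also have "\<dots> = ennreal (kap (Suc d) * cap d ?h)" by (rule cap_cone[OF t])
    finally have "(\<theta> * t) ^ d * kap d * (?h ^ Suc d / real (Suc d)) \<le> kap (Suc d) * cap d ?h"
      using kap_pos[of "Suc d"] by (subst (asm) ennreal_le_iff) (auto simp: cap_def less_imp_le)
    moreover have "kap (Suc d) * (?h ^ Suc d * (capc d * (\<theta> * t) ^ d)) = (\<theta> * t) ^ d * kap d * (?h ^ Suc d / real (Suc d))"
      using kap_pos[of "Suc d"] by (simp add: capc_def mult_ac)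
    ultimately show ?thesis using kap_pos[of "Suc d"] by (metis mult_le_cancel_left_pos)
  qed
  define \<theta> where "\<theta> k = 1 - inverse (real (Suc (Suc k)))" for k
  have "(\<lambda>k. inverse (real (Suc (Suc k)))) \<longlonglongrightarrow> 0"
    by (rule LIMSEQ_Suc[OF LIMSEQ_inverse_real_of_nat])
  then have "\<theta> \<longlonglongrightarrow> 1 - 0" unfolding \<theta>_def by (intro tendsto_diff tendsto_const)
  then have "(\<lambda>k. ?h ^ Suc d * (capc d * (\<theta> k * t) ^ d)) \<longlonglongrightarrow> ?h ^ Suc d * (capc d * ((1 - 0) * t) ^ d)"
    by (intro tendsto_mult tendsto_const tendsto_power)
  moreover have "?h ^ Suc d * (capc d * (\<theta> k * t) ^ d) \<le> cap d ?h" for k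
  proof (rule *)
    show "0 < \<theta> k" "\<theta> k < 1" unfolding \<theta>_def by (simp_all add: field_simps)
  qed
  ultimately have "?h ^ Suc d * (capc d * ((1 - 0) * t) ^ d) \<le> cap d ?h"
    by (intro LIMSEQ_le_const2) auto
  then show ?thesis by simp
qed

section \<open>Inscribed polytopes\<close>

text \<open>A generating set of least cardinality consists of extreme points: a generator inside a
  segment of the polytope could be expressed by the others and removed.\<close>

lemma polytope_extreme_points:
  fixes P :: "(nat \<Rightarrow> real) set"
  assumes "polytope P"
  obtains W where "finite W" "W \<subseteq> {x. x extreme_point_of P}" "P = convex hull W"
proof -
  obtain F where F: "finite F" "P = convex hull F" using assms by (auto simp: polytope_def)
  define C where "C = (\<lambda>W. finite W \<and> P = convex hull W)"
  define W where "W = arg_min card C"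
  have W: "C W" "\<And>W'. C W' \<Longrightarrow> card W \<le> card W'"
    unfolding W_def using arg_min_natI[of C F card] arg_min_nat_le[of C _ card] F by (auto simp: C_def)
  have fin: "finite W" and P: "P = convex hull W" using W by (auto simp: C_def)
  have "w extreme_point_of P" if w: "w \<in> W" for w
  proof -
    let ?W = "W - {w}"
    have ins: "insert w ?W = W" using w by auto
    have notin: "w \<notin> convex hull ?W"
    proof
      assume "w \<in> convex hull ?W"
      then have "convex hull (insert w ?W) = convex hull ?W" by (rule hull_redundant)
      then have "C ?W" using fin P ins by (simp add: C_def)
      then have "card W \<le> card ?W" by (rule W(2))
      then show False using card_Diff1_less[OF fin w] by simp
    qed
    have wP: "w \<in> P" unfolding P using w by (rule hull_inc)
    have "w \<notin> open_segment a b" if ab: "a \<in> P" "b \<in> P" for a b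
    proof
      assume "w \<in> open_segment a b"
      then obtain t where t: "a \<noteq> b" "0 < t" "t < 1" "w = (1 - t) *\<^sub>R a + t *\<^sub>R b" by (auto simp: in_segment)
      show False
      proof (cases "?W = {}")
        case True
        then have "W = {w}" using ins by auto
        then have "P = {w}" using P by simp
        then show False using ab t by simp
      next
        case False
        have "\<exists>u v c. 0 \<le> v \<and> u + v = 1 \<and> c \<in> convex hull ?W \<and> x = u *\<^sub>R w + v *\<^sub>R c" if "x \<in> P" for x
          using that convex_hull_insert[OF False, of w] unfolding P ins by blast
        from this[OF ab(1)] this[OF ab(2)] obtain u1 v1 c1 u2 v2 c2 where
          1: "0 \<le> v1" "u1 + v1 = 1" "c1 \<in> convex hull ?W" "a = u1 *\<^sub>R w + v1 *\<^sub>R c1" and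
          2: "0 \<le> v2" "u2 + v2 = 1" "c2 \<in> convex hull ?W" "b = u2 *\<^sub>R w + v2 *\<^sub>R c2" by metis
        \<comment> \<open>The total weight that the other generators carry in the representation of
          \<open>w\<close>. If it vanished, both ends of the segment would be \<open>w\<close>;
          otherwise the equation can be solved for \<open>w\<close>.\<close>
        define m where "m = (1 - t) * v1 + t * v2"
        have m0: "0 \<le> m" using t(2,3) 1(1) 2(1) by (simp add: m_def)
        have "m \<noteq> 0"
        proof
          assume m: "m = 0"
          have "0 \<le> (1 - t) * v1" "0 \<le> t * v2" using t(2,3) 1(1) 2(1) by auto
          then have "(1 - t) * v1 = 0" "t * v2 = 0" using m unfolding m_def by linarith+
          then have v: "v1 = 0" "v2 = 0" using t(2,3) by auto
          have "a = w" using 1(2) v(1) by (subst 1(4)) simp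
          moreover have "b = w" using 2(2) v(2) by (subst 2(4)) simp
          ultimately show False using t(1) by simp
        qed
        then have mp: "0 < m" using m0 by simp
        have u: "u1 = 1 - v1" "u2 = 1 - v2" using 1(2) 2(2) by auto
        have "m *\<^sub>R w = ((1 - t) * v1) *\<^sub>R c1 + (t * v2) *\<^sub>R c2"
        proof
          fix i
          have wi: "w i = (1 - t) * a i + t * b i"
            using fun_cong[OF t(4), of i] unfolding fun_app .
          have ai: "a i = (1 - v1) * w i + v1 * c1 i"
            using fun_cong[OF 1(4), of i] unfolding fun_app u .
          have bi: "b i = (1 - v2) * w i + v2 * c2 i"
            using fun_cong[OF 2(4), of i] unfolding fun_app u .
          show "(m *\<^sub>R w) i = (((1 - t) * v1) *\<^sub>R c1 + (t * v2) *\<^sub>R c2) i"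
            unfolding fun_app m_def using wi ai bi by algebra
        qed
        then have "(1 / m) *\<^sub>R (m *\<^sub>R w) = ((1 - t) * v1 / m) *\<^sub>R c1 + (t * v2 / m) *\<^sub>R c2"
          by (simp add: scaleR_add_right)
        then have "w = ((1 - t) * v1 / m) *\<^sub>R c1 + (t * v2 / m) *\<^sub>R c2" using mp by simp
        also have "\<dots> \<in> convex hull ?W"
        proof (rule convexD[OF convex_convex_hull 1(3) 2(3)])
          show "(1 - t) * v1 / m + t * v2 / m = 1" using mp by (simp add: m_def add_divide_distrib[symmetric])
        qed (use t(2,3) 1(1) 2(1) mp in auto)
        finally show False using notin by simp
      qed
    qed
    then show ?thesis using wP by (auto simp: extreme_point_of_def)
  qed
  then show ?thesis using that[OF fin _ P] by auto
qed

text \<open>Fewer than \<open>N\<close> vertices are padded by repeating one of them, so that the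
  bounds for exactly \<open>N\<close> listed points apply.\<close>

lemma inscribed_polytope_phull:
  assumes "P \<in> inscribed_polytopes n N"
  obtains y where "P = phull N y" "\<And>i. i < N \<Longrightarrow> y i \<in> espace n \<and> eucl_norm n (y i) \<le> 1" "1 \<le> N"
proof -
  from assms have P: "polytope P" "P \<noteq> {}" "P \<subseteq> unit_ball n" "card {v. v extreme_point_of P} \<le> N"
    by (auto simp: inscribed_polytopes_def)
  obtain W where W: "finite W" "W \<subseteq> {x. x extreme_point_of P}" "P = convex hull W"
    by (rule polytope_extreme_points[OF P(1)])
  have "finite {x. x extreme_point_of P}"
    using extreme_points_of_convex_hull[of W] W by (auto intro: finite_subset)
  then have cW: "card W \<le> N" using card_mono[OF _ W(2)] P(4) by simp
  have W0: "W \<noteq> {}" using P(2) W(3) by auto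
  then have cp: "0 < card W" using W(1) by (simp add: card_gt_0_iff)
  obtain f where f: "bij_betw f {0..<card W} W" using ex_bij_betw_nat_finite[OF W(1)] by blast
  define y where "y i = f (if i < card W then i else 0)" for i
  have "y ` {..<N} = W"
  proof
    show "y ` {..<N} \<subseteq> W" using f cp by (auto simp: y_def bij_betw_def)
    show "W \<subseteq> y ` {..<N}"
    proof
      fix w assume "w \<in> W"
      then have "w \<in> f ` {0..<card W}" using f by (simp add: bij_betw_def)
      then obtain i where "i < card W" "w = f i" by auto
      then show "w \<in> y ` {..<N}" using cW by (intro image_eqI[of _ _ i]) (auto simp: y_def)
    qed
  qed
  then have "P = phull N y" using W(3) convex_hull_eq_hull[of y N] by simp
  moreover have "y i \<in> unit_ball n" if "i < N" for i
  proof -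
    have "y i \<in> W" using \<open>y ` {..<N} = W\<close> that by blast
    then show ?thesis using P(3) W(3) hull_inc[of "y i" W convex] by auto
  qed
  ultimately show ?thesis using that cp cW by (auto simp: unit_ball_eq)
qed

lemma deviation_nv:
  assumes "P \<subseteq> unit_ball n" "j \<le> n"
  shows "deviation n j (unit_ball n) P = intrinsic_volume n j (unit_ball n) * (1 - nv n j P)"
proof -
  have "unit_ball n \<inter> P = P" using assms by auto
  then show ?thesis using iv_ball_pos[OF assms(2)] by (simp add: deviation_def nv_def field_simps)
qed

lemma Qc_le_cap:
  assumes y: "y \<in> espace (Suc d)" "eucl_norm (Suc d) y \<le> 1" and s: "0 < s"
  shows "Qc (Suc d) s y \<le> ennreal (cap d s)"
proof -
  have "Qc (Suc d) s y = emeasure (sph (Suc d)) {v. s < eucl_norm (Suc d) y * v d}"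
    by (subst Qc_norm_unitv[OF y(1)]) (simp add: Qc_def ip_simps ip_unitv)
  also have "\<dots> \<le> emeasure (sph (Suc d)) {v. s < v d}"
  proof (rule emeasure_mono)
    show "{v. s < eucl_norm (Suc d) y * v d} \<subseteq> {v :: nat \<Rightarrow> real. s < v d}"
    proof safe
      fix v :: "nat \<Rightarrow> real" assume l: "s < eucl_norm (Suc d) y * v d"
      then have "0 < eucl_norm (Suc d) y * v d" using s by linarith
      have "0 < v d"
      proof (rule ccontr)
        assume "\<not> 0 < v d"
        then have "eucl_norm (Suc d) y * v d \<le> 0" by (intro mult_nonneg_nonpos) auto
        with \<open>0 < eucl_norm (Suc d) y * v d\<close> show False by linarith
      qed
      then have "eucl_norm (Suc d) y * v d \<le> 1 * v d" using y by (intro mult_right_mono) auto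
      then show "s < v d" using l by simp
    qed
  qed (simp add: sets_sph)
  finally show ?thesis by (simp add: cap_def sph.emeasure_eq_measure)
qed

lemma nv_few_vertices:
  assumes "j \<le> Suc d" "1 \<le> j" "1 \<le> N" "\<And>i. i < N \<Longrightarrow> y i \<in> espace (Suc d) \<and> eucl_norm (Suc d) (y i) \<le> 1"
    and s: "0 < s" "s < 1"
  shows "(1 - s ^ j) * (1 - real N * cap d s) \<le> 1 - nv (Suc d) j (phull N y)"
proof -
  have sj: "0 \<le> s ^ j" "s ^ j \<le> 1" using s by (auto simp: power_le_one)
  have c0: "0 \<le> cap d s" by (simp add: cap_def)
  have "ennreal (nv (Suc d) j (phull N y)) \<le> ennreal (s ^ j) + ennreal (1 - s ^ j) * (\<Sum>i<N. Qc (Suc d) s (y i))"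
    by (rule few_vertices) (use assms in auto)
  also have "\<dots> \<le> ennreal (s ^ j) + ennreal (1 - s ^ j) * (\<Sum>i<N. ennreal (cap d s))"
    using assms by (intro add_left_mono mult_left_mono sum_mono Qc_le_cap) auto
  also have "\<dots> = ennreal (s ^ j + (1 - s ^ j) * (real N * cap d s))"
    using sj c0 by (simp add: ennreal_mult ennreal_of_nat_eq_real_of_nat)
  finally have "nv (Suc d) j (phull N y) \<le> s ^ j + (1 - s ^ j) * (real N * cap d s)"
    using sj c0 by (subst (asm) ennreal_le_iff) auto
  then show ?thesis by (simp add: algebra_simps)
qed

theorem best_deviation_ge:
  assumes "j \<le> Suc d" "1 \<le> j" "1 \<le> N" and s: "0 < s" "s < 1"
  shows "intrinsic_volume (Suc d) j (unit_ball (Suc d)) * ((1 - s ^ j) * (1 - real N * cap d s)) \<le> best_deviation (Suc d) j N"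
  unfolding best_deviation_def
proof (rule cINF_greatest)
  have "phull N (\<lambda>_. 0) \<in> inscribed_polytopes (Suc d) N"
  proof -
    have "(\<lambda>_. 0) ` {..<N} = {0 :: nat \<Rightarrow> real}"
      using assms(3) by (auto simp: image_constant_conv lessThan_empty_iff)
    then have "phull N (\<lambda>_. 0) = {0}" using convex_hull_eq_hull[of "\<lambda>_. 0" N] by simp
    moreover have "{v. v extreme_point_of {0 :: nat \<Rightarrow> real}} \<subseteq> {0}" by (auto simp: extreme_point_of_def)
    then have "card {v. v extreme_point_of {0 :: nat \<Rightarrow> real}} \<le> N"
      using card_mono[of "{0 :: nat \<Rightarrow> real}"] assms(3) by force
    moreover have "polytope {0 :: nat \<Rightarrow> real}"
      unfolding polytope_def by (intro exI[of _ "{0}"]) simp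
    ultimately show ?thesis by (auto simp: inscribed_polytopes_def unit_ball_eq)
  qed
  then show "inscribed_polytopes (Suc d) N \<noteq> {}" by blast
next
  fix P assume P: "P \<in> inscribed_polytopes (Suc d) N"
  from inscribed_polytope_phull[OF P] obtain y where
    y: "P = phull N y" "\<And>i. i < N \<Longrightarrow> y i \<in> espace (Suc d) \<and> eucl_norm (Suc d) (y i) \<le> 1" by metis
  have sub: "P \<subseteq> unit_ball (Suc d)" using P by (simp add: inscribed_polytopes_def)
  have "(1 - s ^ j) * (1 - real N * cap d s) \<le> 1 - nv (Suc d) j P"
    unfolding y(1) by (rule nv_few_vertices[OF assms(1-3) _ s]) (rule y(2))
  then show "intrinsic_volume (Suc d) j (unit_ball (Suc d)) * ((1 - s ^ j) * (1 - real N * cap d s)) \<le> deviation (Suc d) j (unit_ball (Suc d)) P"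
    unfolding deviation_nv[OF sub assms(1)] using iv_ball_pos[OF assms(1)] by (intro mult_left_mono) auto
qed

section \<open>The expected deviation\<close>

lemma phull_inscribed:
  assumes N: "1 \<le> N" and X: "\<And>i. i < N \<Longrightarrow> X i \<in> unit_ball n"
  shows "phull N X \<in> inscribed_polytopes n N"
proof -
  have eq: "phull N X = convex hull (X ` {..<N})" by (rule convex_hull_eq_hull[symmetric])
  have "{v. v extreme_point_of phull N X} \<subseteq> X ` {..<N}" unfolding eq by (rule extreme_points_of_convex_hull)
  then have "card {v. v extreme_point_of phull N X} \<le> card (X ` {..<N})" by (intro card_mono) auto
  also have "\<dots> \<le> N" using card_image_le[of "{..<N}" X] by simp
  finally have c: "card {v. v extreme_point_of phull N X} \<le> N" .
  have "phull N X \<subseteq> unit_ball n"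
    unfolding eq using X cc_unit_ball[of n] by (intro hull_minimal) (auto simp: cc_def)
  moreover have "polytope (phull N X)" unfolding polytope_def eq by (intro exI[of _ "X ` {..<N}"]) simp
  moreover have "phull N X \<noteq> {}" using N weights_nonempty[of N] by (auto simp: phull_def)
  ultimately show ?thesis using c by (simp add: inscribed_polytopes_def)
qed

text \<open>A crude bound that provides integrability and a lower bound for the deviations; the
  height \<open>1 / 2\<close> is an arbitrary choice.\<close>

lemma nv_upper:
  assumes "j \<le> Suc d" "1 \<le> j" "1 \<le> N" "\<And>i. i < N \<Longrightarrow> y i \<in> espace (Suc d) \<and> eucl_norm (Suc d) (y i) \<le> 1"
  shows "nv (Suc d) j (phull N y) \<le> 1 + real N"
proof -
  have c: "0 \<le> cap d (1/2)" "cap d (1/2) \<le> 1" by (auto simp: cap_def)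
  define p where "p = 1 - (1/2::real) ^ j"
  have p: "0 \<le> p" "p \<le> 1" by (auto simp: p_def power_le_one)
  have "p * real N \<le> 1 * real N" using p by (intro mult_right_mono) auto
  moreover have "real N * cap d (1/2) \<le> real N" using c by (simp add: mult_left_le)
  then have "p * (- real N) \<le> p * (1 - real N * cap d (1/2))" using p by (intro mult_left_mono) auto
  moreover have "p * (1 - real N * cap d (1/2)) \<le> 1 - nv (Suc d) j (phull N y)"
    unfolding p_def by (rule nv_few_vertices) (use assms in auto)
  ultimately show ?thesis by linarith
qed

context
  fixes k N j :: nat
  assumes N: "1 \<le> N" and j: "1 \<le> j" "j \<le> Suc (Suc k)"
begin

abbreviation (input) "PS \<equiv> Pi\<^sub>M {..<N} (\<lambda>_. sphere_measure (Suc (Suc k)))"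

abbreviation (input) "mean \<equiv> \<integral>X. nv (Suc (Suc k)) j (phull N X) \<partial>PS"

lemma prob_space_PS: "prob_space PS"
  by (rule prob_space_PiM) (rule prob_space_sphere_measure, simp)

lemma sample_sphere: "X \<in> space PS \<Longrightarrow> i < N \<Longrightarrow> X i \<in> unit_sphere (Suc (Suc k))"
  by (auto simp: space_PiM)

lemma sample_props: "X \<in> space PS \<Longrightarrow> i < N \<Longrightarrow> X i \<in> espace (Suc (Suc k)) \<and> eucl_norm (Suc (Suc k)) (X i) \<le> 1"
  using sample_sphere[of X i] by (auto simp: unit_sphere_eq)

lemma nv_measurable: "(\<lambda>X. nv (Suc (Suc k)) j (phull N X)) \<in> borel_measurable PS"
  using sample_props by (intro borel_measurable_nv_hull N coord_sphere_measure) auto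

lemma nv_sample: "X \<in> space PS \<Longrightarrow> 0 \<le> nv (Suc (Suc k)) j (phull N X) \<and> nv (Suc (Suc k)) j (phull N X) \<le> 1 + real N"
  using sample_props j N by (intro conjI nv_nonneg cc_hull nv_upper) auto

lemma nv_integrable: "integrable PS (\<lambda>X. nv (Suc (Suc k)) j (phull N X))"
proof -
  interpret P: prob_space PS by (rule prob_space_PS)
  show ?thesis
    using nv_sample nv_measurable
    by (intro P.integrable_const_bound[where B = "1 + real N"]) (auto intro!: AE_I2)
qed

lemma deviation_sample:
  assumes "X \<in> space PS"
  shows "deviation (Suc (Suc k)) j (unit_ball (Suc (Suc k))) (convex hull (X ` {..<N})) =
    intrinsic_volume (Suc (Suc k)) j (unit_ball (Suc (Suc k))) * (1 - nv (Suc (Suc k)) j (phull N X))"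
proof -
  have "phull N X \<in> inscribed_polytopes (Suc (Suc k)) N"
    using sample_props[OF assms] by (intro phull_inscribed N) (auto simp: unit_ball_eq)
  then have "phull N X \<subseteq> unit_ball (Suc (Suc k))" by (simp add: inscribed_polytopes_def)
  then show ?thesis unfolding convex_hull_eq_hull by (rule deviation_nv) (rule j)
qed

lemma expected_deviation_eq:
  "expected_deviation (Suc (Suc k)) j N = intrinsic_volume (Suc (Suc k)) j (unit_ball (Suc (Suc k))) * (1 - mean)"
proof -
  interpret P: prob_space PS by (rule prob_space_PS)
  have "expected_deviation (Suc (Suc k)) j N =
    (\<integral>X. intrinsic_volume (Suc (Suc k)) j (unit_ball (Suc (Suc k))) * (1 - nv (Suc (Suc k)) j (phull N X)) \<partial>PS)"
    unfolding expected_deviation_def by (rule Bochner_Integration.integral_cong[OF refl]) (rule deviation_sample)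
  also have "\<dots> = intrinsic_volume (Suc (Suc k)) j (unit_ball (Suc (Suc k))) * (1 - mean)"
    using nv_integrable by (simp add: P.prob_space)
  finally show ?thesis .
qed

lemma best_le_expected: "best_deviation (Suc (Suc k)) j N \<le> expected_deviation (Suc (Suc k)) j N"
proof -
  interpret P: prob_space PS by (rule prob_space_PS)
  let ?n = "Suc (Suc k)"
  let ?V = "intrinsic_volume ?n j (unit_ball ?n)"
  have V: "0 < ?V" by (rule iv_ball_pos[OF j(2)])
  have bdd: "bdd_below (deviation ?n j (unit_ball ?n) ` inscribed_polytopes ?n N)"
  proof (rule bdd_belowI2)
    fix P assume P: "P \<in> inscribed_polytopes ?n N"
    from inscribed_polytope_phull[OF P] obtain y where
      y: "P = phull N y" "\<And>i. i < N \<Longrightarrow> y i \<in> espace ?n \<and> eucl_norm ?n (y i) \<le> 1" by metis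
    have sub: "P \<subseteq> unit_ball ?n" using P by (simp add: inscribed_polytopes_def)
    have "nv ?n j P \<le> 1 + real N" unfolding y(1) by (rule nv_upper[OF j(2,1) N y(2)])
    then have "?V * (- real N) \<le> ?V * (1 - nv ?n j P)" using V by (intro mult_left_mono) auto
    then show "?V * (- real N) \<le> deviation ?n j (unit_ball ?n) P" by (simp add: deviation_nv[OF sub j(2)])
  qed
  have "best_deviation ?n j N \<le> (\<integral>X. ?V * (1 - nv ?n j (phull N X)) \<partial>PS)"
  proof (rule P.integral_ge_const)
    show "integrable PS (\<lambda>X. ?V * (1 - nv ?n j (phull N X)))" using nv_integrable by simp
    show "AE X in PS. best_deviation ?n j N \<le> ?V * (1 - nv ?n j (phull N X))"
    proof (rule AE_I2)
      fix X assume X: "X \<in> space PS"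
      have "phull N X \<in> inscribed_polytopes ?n N"
        using sample_props[OF X] by (intro phull_inscribed N) (auto simp: unit_ball_eq)
      then have "best_deviation ?n j N \<le> deviation ?n j (unit_ball ?n) (phull N X)"
        unfolding best_deviation_def by (rule cINF_lower[OF bdd])
      then show "best_deviation ?n j N \<le> ?V * (1 - nv ?n j (phull N X))"
        using deviation_sample[OF X] by (simp add: convex_hull_eq_hull)
    qed
  qed
  also have "\<dots> = expected_deviation ?n j N"
    using nv_integrable by (simp add: expected_deviation_eq P.prob_space)
  finally show ?thesis .
qed

text \<open>Splits the ball into shells at the depths \<open>D i\<close> below the sphere.\<close>

lemma one_minus_mean_le:
  fixes b D :: "nat \<Rightarrow> real"
  assumes miss: "\<And>i x. i \<le> K \<Longrightarrow> x \<in> espace (Suc (Suc k)) \<Longrightarrow> eucl_norm (Suc (Suc k)) x \<le> 1 - D i \<Longrightarrow>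
      emeasure PS {X \<in> space PS. x \<notin> phull N X} \<le> ennreal (b i)"
    and b: "\<And>i. i \<le> K \<Longrightarrow> 0 \<le> b i" and D: "\<And>i. i \<le> K \<Longrightarrow> 0 < D i \<and> D i < 1"
  shows "1 - mean \<le> real j * D 0 + (\<Sum>i<K. b i * (real j * D (Suc i))) + b K"
proof -
  interpret P: prob_space PS by (rule prob_space_PS)
  let ?n = "Suc (Suc k)"
  let ?I = "\<lambda>i \<rho>. indicator {1 - D i<..} \<rho> :: real"
  \<comment> \<open>A step function of the norm that majorizes the probability of missing a point:
    it is at least 1 at depth less than \<open>D 0\<close>, includes \<open>b i\<close> at depth
    less than \<open>D (Suc i)\<close>, and contains \<open>b K\<close> everywhere.\<close>
  define \<beta> where "\<beta> \<rho> = ?I 0 \<rho> + (\<Sum>i<K. b i * ?I (Suc i) \<rho>) + b K" for \<rho>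
  have \<beta>m [measurable]: "\<beta> \<in> borel_measurable borel" unfolding \<beta>_def by measurable
  have term0: "0 \<le> b i * ?I (Suc i) \<rho>" if "i < K" for i \<rho> using b[of i] that by simp
  have \<beta>0: "0 \<le> \<beta> \<rho>" for \<rho>
    unfolding \<beta>_def using b term0 by (intro add_nonneg_nonneg sum_nonneg) auto
  have prob_le: "P.prob {X \<in> space PS. x \<notin> phull N X} \<le> \<beta> (eucl_norm ?n x)" if x: "x \<in> espace ?n" for x
  proof -
    let ?\<rho> = "eucl_norm ?n x"
    have miss': "P.prob {X \<in> space PS. x \<notin> phull N X} \<le> b i" if "i \<le> K" "?\<rho> \<le> 1 - D i" for i
      using miss[OF that(1) x that(2)] b[OF that(1)] by (simp add: P.emeasure_eq_measure)
    have s0: "0 \<le> (\<Sum>i<K. b i * ?I (Suc i) ?\<rho>)" using term0 by (intro sum_nonneg) auto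
    show ?thesis
    proof (cases "?\<rho> \<le> 1 - D 0")
      case False
      have "P.prob {X \<in> space PS. x \<notin> phull N X} \<le> 1" by (rule P.prob_le_1)
      also have "1 \<le> \<beta> ?\<rho>" unfolding \<beta>_def using False s0 b[of K] by simp
      finally show ?thesis .
    next
      case True
      \<comment> \<open>The deepest level whose bound applies to the point. At the next level the
        point is too close to the sphere, so the term with \<open>b i\<close> is switched on in
        \<beta>.\<close>
      define i where "i = Max {i. i \<le> K \<and> ?\<rho> \<le> 1 - D i}"
      have fin: "finite {i. i \<le> K \<and> ?\<rho> \<le> 1 - D i}" by simp
      have "0 \<in> {i. i \<le> K \<and> ?\<rho> \<le> 1 - D i}" using True by simp
      then have i: "i \<le> K" "?\<rho> \<le> 1 - D i" using Max_in[OF fin] unfolding i_def by blast+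
      have "b i \<le> \<beta> ?\<rho>"
      proof (cases "i = K")
        case True
        then show ?thesis unfolding \<beta>_def using s0 by simp
      next
        case False
        then have iK: "i < K" using i by simp
        have "\<not> ?\<rho> \<le> 1 - D (Suc i)"
        proof
          assume "?\<rho> \<le> 1 - D (Suc i)"
          then have "Suc i \<le> i" unfolding i_def using iK fin i_def by (intro Max_ge) auto
          then show False by simp
        qed
        then have "b i = b i * ?I (Suc i) ?\<rho>" by simp
        also have "\<dots> \<le> (\<Sum>i<K. b i * ?I (Suc i) ?\<rho>)" using iK term0 by (intro member_le_sum) auto
        finally show ?thesis unfolding \<beta>_def using b[of K] by (simp add: indicator_def)
      qed
      with miss'[OF i] show ?thesis by simp
    qed
  qed
  have phi: "ennreal (1 - \<beta> (eucl_norm ?n x)) \<le> emeasure PS {X \<in> space PS. x \<in> phull N X}" if x: "x \<in> espace ?n" for x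
  proof -
    have "Measurable.pred PS (\<lambda>X. x \<in> phull N X)"
      using sample_props by (intro pred_hull[where n = ?n] N coord_sphere_measure) auto
    then have "{X \<in> space PS. x \<in> phull N X} \<in> sets PS" by (simp add: pred_def)
    then have "P.prob {X \<in> space PS. x \<notin> phull N X} = 1 - P.prob {X \<in> space PS. x \<in> phull N X}"
      by (rule P.prob_neg)
    then have "1 - \<beta> (eucl_norm ?n x) \<le> P.prob {X \<in> space PS. x \<in> phull N X}" using prob_le[OF x] by linarith
    then show ?thesis by (simp add: P.emeasure_eq_measure ennreal_leI)
  qed
  have E: "(\<integral>\<^sup>+X. ennreal (nv ?n j (phull N X)) \<partial>PS) = ennreal mean"
    using nv_sample by (intro nn_integral_eq_integral nv_integrable) (auto intro!: AE_I2)
  have E0: "0 \<le> mean" using nv_sample by (intro integral_nonneg_AE) (auto intro!: AE_I2)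
  have "(\<integral>\<^sup>+x. indicator (unit_ball j) x * ennreal (1 - \<beta> (eucl_norm j x)) \<partial>L j) \<le> ennreal (kap j) * (\<integral>\<^sup>+X. ennreal (nv ?n j (phull N X)) \<partial>PS)"
    by (rule random_polytope[OF prob_space_PS j(2) N, where phi = "\<lambda>\<rho>. ennreal (1 - \<beta> \<rho>)"])
      (use sample_props phi coord_sphere_measure in auto)
  then have A: "(\<integral>\<^sup>+x. indicator (unit_ball j) x * ennreal (1 - \<beta> (eucl_norm j x)) \<partial>L j) \<le> ennreal (kap j * mean)"
    using kap_pos[of j] E0 by (simp add: E ennreal_mult less_imp_le)
  have sh: "(\<integral>\<^sup>+x. indicator (unit_ball j) x * ennreal (?I i (eucl_norm j x)) \<partial>L j) \<le> ennreal (kap j * (real j * D i))"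
    if i: "i \<le> K" for i
  proof -
    have "(\<integral>\<^sup>+x. indicator (unit_ball j) x * ennreal (?I i (eucl_norm j x)) \<partial>L j) =
      (\<integral>\<^sup>+x. indicator {x. 1 - D i < eucl_norm j x \<and> eucl_norm j x \<le> 1} x \<partial>L j)"
      by (intro nn_integral_L_cong) (auto simp: indicator_def unit_ball_eq)
    also have "\<dots> = ennreal ((1 - (1 - D i) ^ j) * kap j)"
      using D[OF i] j emeasure_shell[of "1 - D i" j] by (subst nn_integral_indicator) (auto simp: sets_L)
    also have "\<dots> \<le> ennreal (kap j * (real j * D i))"
    proof (rule ennreal_leI)
      have "1 + real j * (- D i) \<le> (1 + (- D i)) ^ j" using D[OF i] by (intro Bernoulli_inequality) simp
      then have "(1 - (1 - D i) ^ j) * kap j \<le> (real j * D i) * kap j"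
        using kap_pos[of j] by (intro mult_right_mono) auto
      then show "(1 - (1 - D i) ^ j) * kap j \<le> kap j * (real j * D i)" by (simp add: mult.commute)
    qed
    finally show ?thesis .
  qed
  have "ennreal (kap j) = (\<integral>\<^sup>+x. indicator (unit_ball j) x \<partial>L j)" by (simp add: emeasure_unit_ball sets_L)
  \<comment> \<open>\<open>ennreal\<close> truncates \<open>1 - \<beta>\<close> at zero where
    \<beta> exceeds one, so only an inequality holds; it is the one required.\<close>
  also have "\<dots> \<le> (\<integral>\<^sup>+x. indicator (unit_ball j) x * ennreal (1 - \<beta> (eucl_norm j x)) + indicator (unit_ball j) x * ennreal (\<beta> (eucl_norm j x)) \<partial>L j)"
  proof (rule nn_integral_mono)
    fix x
    have "1 \<le> ennreal (1 - \<beta> (eucl_norm j x)) + ennreal (\<beta> (eucl_norm j x))"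
    proof (cases "\<beta> (eucl_norm j x) \<le> 1")
      case True
      then show ?thesis using \<beta>0 by (simp add: ennreal_plus[symmetric] del: ennreal_plus)
    next
      case False
      then have "1 \<le> ennreal (\<beta> (eucl_norm j x))" by simp
      then show ?thesis by (simp add: add_increasing)
    qed
    then show "indicator (unit_ball j) x \<le> indicator (unit_ball j) x * ennreal (1 - \<beta> (eucl_norm j x)) + indicator (unit_ball j) x * ennreal (\<beta> (eucl_norm j x))"
      by (simp add: indicator_def)
  qed
  also have "\<dots> = (\<integral>\<^sup>+x. indicator (unit_ball j) x * ennreal (1 - \<beta> (eucl_norm j x)) \<partial>L j) + (\<integral>\<^sup>+x. indicator (unit_ball j) x * ennreal (\<beta> (eucl_norm j x)) \<partial>L j)"
    by (rule nn_integral_add) measurable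
  finally have le0: "ennreal (kap j) \<le> (\<integral>\<^sup>+x. indicator (unit_ball j) x * ennreal (1 - \<beta> (eucl_norm j x)) \<partial>L j) + (\<integral>\<^sup>+x. indicator (unit_ball j) x * ennreal (\<beta> (eucl_norm j x)) \<partial>L j)" .
  have "(\<integral>\<^sup>+x. indicator (unit_ball j) x * ennreal (\<beta> (eucl_norm j x)) \<partial>L j) =
    (\<integral>\<^sup>+x. indicator (unit_ball j) x * ennreal (?I 0 (eucl_norm j x)) +
       (\<Sum>i<K. ennreal (b i) * (indicator (unit_ball j) x * ennreal (?I (Suc i) (eucl_norm j x)))) + ennreal (b K) * indicator (unit_ball j) x \<partial>L j)"
  proof (intro nn_integral_cong)
    fix x
    have "ennreal (\<beta> (eucl_norm j x)) = ennreal (?I 0 (eucl_norm j x)) + (\<Sum>i<K. ennreal (b i * ?I (Suc i) (eucl_norm j x))) + ennreal (b K)"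
    proof -
      have pl: "ennreal (x + y + z) = ennreal x + ennreal y + ennreal z" if "0 \<le> x" "0 \<le> y" "0 \<le> z" for x y z :: real
        using that by simp
      have "(\<Sum>i<K. ennreal (b i * ?I (Suc i) (eucl_norm j x))) = ennreal (\<Sum>i<K. b i * ?I (Suc i) (eucl_norm j x))"
        using term0 by (intro sum_ennreal) auto
      then show ?thesis
        unfolding \<beta>_def using term0 b[of K] by (simp only:) (intro pl sum_nonneg, auto)
    qed
    also have "(\<Sum>i<K. ennreal (b i * ?I (Suc i) (eucl_norm j x))) = (\<Sum>i<K. ennreal (b i) * ennreal (?I (Suc i) (eucl_norm j x)))"
      using b by (intro sum.cong refl ennreal_mult) auto
    finally show "indicator (unit_ball j) x * ennreal (\<beta> (eucl_norm j x)) = indicator (unit_ball j) x * ennreal (?I 0 (eucl_norm j x)) +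
       (\<Sum>i<K. ennreal (b i) * (indicator (unit_ball j) x * ennreal (?I (Suc i) (eucl_norm j x)))) + ennreal (b K) * indicator (unit_ball j) x"
      by (simp add: distrib_left sum_distrib_left mult_ac)
  qed
  also have "\<dots> = (\<integral>\<^sup>+x. indicator (unit_ball j) x * ennreal (?I 0 (eucl_norm j x)) \<partial>L j) +
       (\<Sum>i<K. ennreal (b i) * (\<integral>\<^sup>+x. indicator (unit_ball j) x * ennreal (?I (Suc i) (eucl_norm j x)) \<partial>L j)) + ennreal (b K) * ennreal (kap j)"
    by (simp add: nn_integral_add nn_integral_sum nn_integral_cmult emeasure_unit_ball sets_L)
  also have "\<dots> \<le> ennreal (kap j * (real j * D 0)) + (\<Sum>i<K. ennreal (b i) * ennreal (kap j * (real j * D (Suc i)))) + ennreal (b K) * ennreal (kap j)"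
    by (intro add_mono sum_mono mult_left_mono sh) auto
  also have "\<dots> = ennreal (kap j * (real j * D 0 + (\<Sum>i<K. b i * (real j * D (Suc i))) + b K))"
  proof -
    have k: "0 \<le> kap j" using kap_pos[of j] by simp
    have t: "0 \<le> b i * (kap j * (real j * D (Suc i)))" if "i < K" for i
      using b[of i] D[of "Suc i"] that k by (intro mult_nonneg_nonneg) auto
    have "(\<Sum>i<K. ennreal (b i) * ennreal (kap j * (real j * D (Suc i)))) = (\<Sum>i<K. ennreal (b i * (kap j * (real j * D (Suc i)))))"
      using b by (intro sum.cong refl ennreal_mult'[symmetric]) auto
    also have "\<dots> = ennreal (\<Sum>i<K. b i * (kap j * (real j * D (Suc i))))" using t by (intro sum_ennreal) auto
    finally have eq: "(\<Sum>i<K. ennreal (b i) * ennreal (kap j * (real j * D (Suc i)))) = ennreal (\<Sum>i<K. b i * (kap j * (real j * D (Suc i))))" .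
    have "ennreal (kap j * (real j * D 0)) + (\<Sum>i<K. ennreal (b i) * ennreal (kap j * (real j * D (Suc i)))) + ennreal (b K) * ennreal (kap j) =
      ennreal (kap j * (real j * D 0) + (\<Sum>i<K. b i * (kap j * (real j * D (Suc i)))) + b K * kap j)"
    proof -
      have pl: "ennreal (x + y + z) = ennreal x + ennreal y + ennreal z" if "0 \<le> x" "0 \<le> y" "0 \<le> z" for x y z :: real
        using that by simp
      have e: "ennreal (b K) * ennreal (kap j) = ennreal (b K * kap j)"
        using b[of K] by (intro ennreal_mult'[symmetric]) auto
      show ?thesis
        unfolding eq e using t b[of K] D[of 0] k
        by (intro pl[symmetric] sum_nonneg) (auto simp: t)
    qed
    also have "kap j * (real j * D 0) + (\<Sum>i<K. b i * (kap j * (real j * D (Suc i)))) + b K * kap j = kap j * (real j * D 0 + (\<Sum>i<K. b i * (real j * D (Suc i))) + b K)"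
      by (simp add: distrib_left sum_distrib_left mult_ac)
    finally show ?thesis .
  qed
  finally have le1: "(\<integral>\<^sup>+x. indicator (unit_ball j) x * ennreal (\<beta> (eucl_norm j x)) \<partial>L j) \<le> ennreal (kap j * (real j * D 0 + (\<Sum>i<K. b i * (real j * D (Suc i))) + b K))" .
  note le = order_trans[OF le0 add_mono[OF A le1]]
  have R0: "0 \<le> real j * D 0 + (\<Sum>i<K. b i * (real j * D (Suc i))) + b K"
    using b D by (intro add_nonneg_nonneg sum_nonneg mult_nonneg_nonneg) (auto simp: less_imp_le)
  have cancel: "x \<le> y + z" if "ennreal x \<le> ennreal y + ennreal z" "0 \<le> y" "0 \<le> z" for x y z :: real
    using that by (simp flip: ennreal_plus)
  have "kap j \<le> kap j * mean + kap j * (real j * D 0 + (\<Sum>i<K. b i * (real j * D (Suc i))) + b K)"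
    by (rule cancel[OF le mult_nonneg_nonneg[OF less_imp_le[OF kap_pos] E0] mult_nonneg_nonneg[OF less_imp_le[OF kap_pos] R0]])
  then have "kap j * 1 \<le> kap j * (mean + (real j * D 0 + (\<Sum>i<K. b i * (real j * D (Suc i))) + b K))"
    by (simp only: distrib_left mult_1_right)
  then show ?thesis using kap_pos[of j] by (simp add: mult_le_cancel_left_pos)
qed

end

text \<open>Makes the error from the deepest level negligible against the squared tangent, whose
  inverse grows at most quadratically in \<open>N\<close>.\<close>

lemma exp_decay_poly:
  fixes K C :: real
  assumes "0 < K" "0 < C"
  shows "(\<lambda>N. (1 + K * real N)\<^sup>2 * exp (- C * real N)) \<longlonglongrightarrow> 0"
proof -
  have lim: "filterlim (\<lambda>N. C * real N) at_top sequentially"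
    using assms by (intro filterlim_tendsto_pos_mult_at_top[OF tendsto_const] filterlim_real_sequentially) auto
  have p: "(\<lambda>N. (C * real N) ^ m / exp (C * real N)) \<longlonglongrightarrow> 0" for m
    by (rule filterlim_compose[OF tendsto_power_div_exp_0 lim])
  have "(\<lambda>N. (C * real N) ^ 0 / exp (C * real N) + 2 * K / C * ((C * real N) ^ 1 / exp (C * real N)) +
      (K / C)\<^sup>2 * ((C * real N) ^ 2 / exp (C * real N))) \<longlonglongrightarrow> 0 + 2 * K / C * 0 + (K / C)\<^sup>2 * 0"
    by (intro tendsto_add tendsto_mult tendsto_const p)
  moreover have "(C * real N) ^ 0 / exp (C * real N) + 2 * K / C * ((C * real N) ^ 1 / exp (C * real N)) +
      (K / C)\<^sup>2 * ((C * real N) ^ 2 / exp (C * real N)) = (1 + K * real N)\<^sup>2 * exp (- C * real N)" for N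
    using assms by (simp add: exp_minus field_simps power2_eq_square)
  ultimately show ?thesis by simp
qed

section \<open>Asymptotics\<close>

lemma height_strict_antimono: "0 \<le> a \<Longrightarrow> a < b \<Longrightarrow> height b < height a"
  unfolding height_def by (intro divide_strict_left_mono real_sqrt_less_mono mult_pos_pos real_sqrt_gt_zero)
    (auto simp: add_pos_nonneg power_strict_mono)

lemma height_antimono: "0 \<le> a \<Longrightarrow> a \<le> b \<Longrightarrow> height b \<le> height a"
  using height_strict_antimono[of a b] by (cases "a = b") auto

lemma sqrt_height: "0 \<le> t \<Longrightarrow> sqrt (1 - (height t)\<^sup>2) = t * height t"
  using height_bounds(1)[of t] by (simp add: height_sq(2))

lemma height_linear: "1 \<le> height t * (1 + t\<^sup>2 / 2)"
proof -
  have "1 + t\<^sup>2 \<le> (1 + t\<^sup>2 / 2)\<^sup>2" by (simp add: power2_sum power_divide)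
  then have "sqrt (1 + t\<^sup>2) \<le> 1 + t\<^sup>2 / 2" by (intro real_le_lsqrt) auto
  moreover have "0 < sqrt (1 + t\<^sup>2)" by (simp add: add_pos_nonneg)
  ultimately show ?thesis by (simp add: height_def le_divide_eq)
qed

text \<open>The chord meets the axis at the harmonic mean of \<open>h2\<close> and \<open>h1\<close>
  with weights \<open>1\<close> and \<mu>. The inverse of \<open>height\<close> is at most
  \<open>1 + t^2 / 2\<close>, and the weighted mean of these bounds for the tangents
  \<open>t\<close> and \<open>\<mu> * t\<close> is exactly
  \<open>1 + \<mu> * t^2 / 2\<close>.\<close>

lemma chord_height:
  assumes t: "0 < t" and lam: "1 < \<mu>"
  defines "h1 \<equiv> height t" and "h2 \<equiv> height (\<mu> * t)"
  shows "1 - \<mu> * t\<^sup>2 / 2 \<le> h1 - (h1 - h2) / (sqrt (1 - h1\<^sup>2) + sqrt (1 - h2\<^sup>2)) * sqrt (1 - h1\<^sup>2)"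
proof -
  define x where "x = \<mu> * t\<^sup>2 / 2"
  have x0: "0 \<le> x" using lam by (simp add: x_def)
  have h: "0 < h1" "0 < h2" unfolding h1_def h2_def by (rule height_bounds)+
  have s: "sqrt (1 - h1\<^sup>2) = t * h1" "sqrt (1 - h2\<^sup>2) = \<mu> * t * h2"
    unfolding h1_def h2_def using t lam by (auto intro!: sqrt_height)
  have d: "0 < h1 + \<mu> * h2" using h lam by (simp add: add_pos_pos)
  have q: "(h1 - h2) / (t * h1 + \<mu> * t * h2) * (t * h1) = (h1 - h2) * h1 / (h1 + \<mu> * h2)"
  proof -
    have "t * h1 + \<mu> * t * h2 = t * (h1 + \<mu> * h2)" by (simp add: algebra_simps)
    moreover have "X / (t * Y) * (t * Z) = X * Z / Y" for X Y Z using t by simp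
    ultimately show ?thesis by (simp only:)
  qed
  have eq: "h1 - (h1 - h2) / (t * h1 + \<mu> * t * h2) * (t * h1) = (1 + \<mu>) * h1 * h2 / (h1 + \<mu> * h2)"
    unfolding q using d by (simp add: divide_simps) (simp add: algebra_simps)?
  have 1: "1 \<le> h1 * (1 + t\<^sup>2 / 2)" "1 \<le> h2 * (1 + (\<mu> * t)\<^sup>2 / 2)" unfolding h1_def h2_def by (rule height_linear)+
  have "h1 * 1 + \<mu> * h2 * 1 \<le> h1 * (h2 * (1 + (\<mu> * t)\<^sup>2 / 2)) + \<mu> * h2 * (h1 * (1 + t\<^sup>2 / 2))"
    using 1 h lam by (intro add_mono mult_left_mono) auto
  also have "\<dots> = (1 + \<mu>) * h1 * h2 * (1 + x)" by (simp add: x_def power2_eq_square algebra_simps)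
  finally have "h1 + \<mu> * h2 \<le> (1 + \<mu>) * h1 * h2 * (1 + x)" by simp
  then have 2: "1 \<le> (1 + \<mu>) * h1 * h2 / (h1 + \<mu> * h2) * (1 + x)" using d by (simp add: le_divide_eq)
  have v0: "0 \<le> (1 + \<mu>) * h1 * h2 / (h1 + \<mu> * h2)" using d h lam by simp
  have "1 - x \<le> (1 + \<mu>) * h1 * h2 / (h1 + \<mu> * h2)"
  proof (rule ccontr)
    assume "\<not> ?thesis"
    then have "(1 + \<mu>) * h1 * h2 / (h1 + \<mu> * h2) * (1 + x) < (1 - x) * (1 + x)"
      using x0 by (intro mult_strict_right_mono) auto
    also have "\<dots> \<le> 1" by (simp add: algebra_simps)
    finally show False using 2 by simp
  qed
  then show ?thesis unfolding s eq x_def .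
qed

text \<open>With \<mu> to the power \<open>Suc k\<close> equal to 3, the lower cap has about three
  times the measure of the upper one, so the upper cap and the band between them both have measure
  at least half of \<open>capc (Suc k) * t ^ Suc k\<close>. The factor \<open>2 / 3\<close> leaves
  room for the error of \<open>cap_ge\<close>.\<close>

lemma miss_bound:
  fixes k N :: nat
  assumes N: "1 \<le> N" and t: "0 < t" and lam: "1 < \<mu>" "\<mu> ^ Suc k = 3"
    and h: "2 / 3 \<le> height (\<mu> * t) ^ Suc (Suc k)"
    and x: "x \<in> espace (Suc (Suc k))" "eucl_norm (Suc (Suc k)) x \<le> 1 - \<mu> * t\<^sup>2 / 2"
  shows "emeasure (PS k N) {X \<in> space (PS k N). x \<notin> phull N X} \<le> ennreal (2 * (2 ^ Suc (Suc k) * (1 - capc (Suc k) * t ^ Suc k / 4) ^ N))"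
    and "capc (Suc k) * t ^ Suc k / 4 \<le> 1"
proof -
  let ?d = "Suc k"
  let ?h1 = "height t" and ?h2 = "height (\<mu> * t)"
  let ?C = "capc ?d * t ^ ?d"
  have C0: "0 < ?C" using t capc_pos[of ?d] by simp
  have hh: "0 \<le> ?h2" "?h2 < ?h1" "?h1 < 1"
    using height_bounds[of "\<mu> * t"] height_bounds[of t] t lam by (auto intro!: height_strict_antimono)
  have "?h2 ^ Suc ?d \<le> ?h1 ^ Suc ?d" using hh by (intro power_mono) auto
  then have h1: "2 / 3 \<le> ?h1 ^ Suc ?d" using h by linarith
  have "2 / 3 * ?C \<le> ?h1 ^ Suc ?d * ?C" using h1 C0 by (intro mult_right_mono) auto
  also have "\<dots> \<le> cap ?d ?h1" by (rule cap_ge[OF t]) simp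
  finally have c1: "2 / 3 * ?C \<le> cap ?d ?h1" .
  have c1': "cap ?d ?h1 \<le> ?C" by (rule cap_le[OF t]) simp
  have "2 / 3 * (capc ?d * (\<mu> * t) ^ ?d) \<le> ?h2 ^ Suc ?d * (capc ?d * (\<mu> * t) ^ ?d)"
    using h t lam capc_pos[of ?d] by (intro mult_right_mono) auto
  also have "\<dots> \<le> cap ?d ?h2" using t lam by (intro cap_ge) auto
  also have "capc ?d * (\<mu> * t) ^ ?d = 3 * ?C" unfolding power_mult_distrib lam(2) by simp
  finally have c2: "2 * ?C \<le> cap ?d ?h2" by (simp add: mult_ac)
  have "measure (sph (Suc ?d)) {u. ?h2 < u ?d \<and> u ?d \<le> ?h1} = cap ?d ?h2 - cap ?d ?h1"
  proof -
    have "{u :: nat \<Rightarrow> real. ?h2 < u ?d \<and> u ?d \<le> ?h1} = {u. ?h2 < u ?d} - {u. ?h1 < u ?d}" by auto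
    moreover have "measure (sph (Suc ?d)) ({u. ?h2 < u ?d} - {u. ?h1 < u ?d}) = cap ?d ?h2 - cap ?d ?h1"
      unfolding cap_def using hh by (intro sph.finite_measure_Diff) (auto simp: sets_sph)
    ultimately show ?thesis by simp
  qed
  then have mid: "?C / 2 \<le> measure (sph (Suc ?d)) {u. ?h2 < u ?d \<and> u ?d \<le> ?h1}" using c1' c2 C0 by linarith
  have top: "?C / 2 \<le> measure (sph (Suc ?d)) {u. ?h1 < u ?d}" using c1 C0 unfolding cap_def by linarith
  have "cap ?d ?h1 \<le> 1" by (simp add: cap_def)
  then show "?C / 4 \<le> 1" using c1 C0 by linarith
  obtain w where w: "w \<in> unit_sphere (Suc ?d)" "x = eucl_norm (Suc ?d) x *\<^sub>R w" by (rule unit_decomp[OF x(1)])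
  have r: "eucl_norm (Suc ?d) x \<le> ?h1 - (?h1 - ?h2) / (sqrt (1 - ?h1\<^sup>2) + sqrt (1 - ?h2\<^sup>2)) * sqrt (1 - ?h1\<^sup>2)"
    using x(2) chord_height[OF t lam(1)] by linarith
  have "emeasure (PS k N) {X \<in> space (PS k N). eucl_norm (Suc ?d) x *\<^sub>R w \<notin> phull N X} \<le>
      ennreal (2 * (2 ^ Suc ?d * (1 - ?C / 2 / 2) ^ N))"
    by (rule miss_probability[OF hh refl norm_ge_0 r N w(1) _ top mid]) (use C0 in simp)
  then show "emeasure (PS k N) {X \<in> space (PS k N). x \<notin> phull N X} \<le> ennreal (2 * (2 ^ Suc ?d * (1 - ?C / 4) ^ N))"
    using w(2) by simp
qed

text \<open>By Bernoulli's inequality the power of \<open>height\<close> is at most the inverse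
  square root of \<open>1 + j t^2\<close>. The quotient form stays sharp to first order for small
  \<open>t\<close>.\<close>

lemma one_minus_height_power:
  assumes "0 < t" "1 \<le> j"
  shows "real j * t\<^sup>2 / (2 * (1 + real j * t\<^sup>2)) \<le> 1 - height t ^ j"
proof -
  define x where "x = real j * t\<^sup>2"
  define w where "w = sqrt (1 + x)"
  have x0: "0 \<le> x" by (simp add: x_def)
  have w: "1 \<le> w" "w\<^sup>2 = 1 + x" using x0 by (auto simp: w_def)
  have "(height t ^ j)\<^sup>2 * (1 + x) \<le> (height t ^ j)\<^sup>2 * (1 + t\<^sup>2) ^ j"
    unfolding x_def by (intro mult_left_mono Bernoulli_inequality) (auto intro: order_trans[OF _ zero_le_power2])
  also have "\<dots> = ((height t)\<^sup>2 * (1 + t\<^sup>2)) ^ j" by (simp add: power_mult_distrib power_mult[symmetric] mult.commute)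
  also have "\<dots> = 1" by (simp add: height_sq)
  finally have "(height t ^ j * w)\<^sup>2 \<le> 1\<^sup>2" by (simp add: power_mult_distrib w)
  then have "height t ^ j * w \<le> 1" by (rule power2_le_imp_le) simp
  then have hj: "height t ^ j \<le> 1 / w" using w by (simp add: le_divide_eq)
  have "x / (2 * (1 + x)) = (w - 1) * (w + 1) / (2 * (w * w))"
    using w(2) by (simp add: power2_eq_square algebra_simps)
  also have "\<dots> \<le> (w - 1) * (2 * w) / (2 * (w * w))"
    using w by (intro divide_right_mono mult_left_mono) auto
  also have "\<dots> = 1 - 1 / w" using w by (simp add: field_simps)
  finally show ?thesis using hj unfolding x_def by linarith
qed

lemma exp_minus_nat: "exp (- real m) \<le> (1 / 2) ^ m"
proof -
  have "2 \<le> exp (1::real)" using exp_ge_add_one_self[of 1] by simp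
  then have "2 ^ m \<le> exp (1::real) ^ m" by (intro power_mono) auto
  then have "2 ^ m \<le> exp (real m)" by (simp add: exp_of_nat_mult[symmetric])
  then show ?thesis by (simp add: exp_minus power_one_over inverse_eq_divide divide_left_mono)
qed

lemma sum_half_powers: "(\<Sum>i<K. (1 / 2 :: real) ^ i) \<le> 2"
proof -
  have "(\<Sum>i<K. (1 / 2 :: real) ^ i) = 2 - 2 * (1 / 2) ^ K" by (induction K) auto
  then show ?thesis by simp
qed

lemma power_le_exp: "0 \<le> 1 - x \<Longrightarrow> (1 - x) ^ N \<le> exp (- (real N * x))"
proof -
  assume "0 \<le> 1 - x"
  then have "(1 - x) ^ N \<le> exp (- x) ^ N" using exp_ge_add_one_self[of "- x"] by (intro power_mono) auto
  then show ?thesis by (simp add: exp_of_nat_mult[symmetric])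
qed

text \<open>At level \<open>i\<close> the exponent of the miss bound is \<open>4 n 2^(i d)\<close>.
  It absorbs the pattern count \<open>2 ^ n\<close> and the growth \<open>4 ^ Suc i\<close> of the
  depth of the next shell, and still leaves \<open>1 / n\<close> times a geometric series.\<close>

lemma level_bound:
  assumes n: "2 \<le> n" and d: "1 \<le> d"
  shows "2 * (2 ^ n * exp (- (4 * real n * 2 ^ (i * d)))) * 4 ^ Suc i \<le> 8 / real n * (1 / 2) ^ i"
proof -
  have "real (Suc i) \<le> 2 ^ i" using less_exp[of i] by (metis Suc_leI of_nat_le_iff of_nat_numeral of_nat_power)
  also have "(2::real) ^ i \<le> 2 ^ (i * d)" using d by (intro power_increasing) auto
  finally have "4 * real n * real (Suc i) \<le> 4 * real n * 2 ^ (i * d)" by (intro mult_left_mono) auto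
  then have "real (4 * n * Suc i) \<le> 4 * real n * 2 ^ (i * d)" by (simp only: of_nat_mult of_nat_numeral)
  then have "exp (- (4 * real n * 2 ^ (i * d))) \<le> exp (- real (4 * n * Suc i))" by simp
  also have "\<dots> \<le> (1 / 2) ^ (4 * n * Suc i)" by (rule exp_minus_nat)
  also have "\<dots> = (1 / 2) ^ n * (1 / 2) ^ (3 * n) * ((1 / 2) ^ (4 * n)) ^ i"
    by (simp add: power_add[symmetric] power_mult[symmetric] algebra_simps)
  finally have e: "exp (- (4 * real n * 2 ^ (i * d))) \<le> (1 / 2) ^ n * (1 / 2) ^ (3 * n) * ((1 / 2) ^ (4 * n)) ^ i" .
  have "(2::real) ^ n * exp (- (4 * real n * 2 ^ (i * d))) \<le> 2 ^ n * ((1 / 2) ^ n * (1 / 2) ^ (3 * n) * ((1 / 2) ^ (4 * n)) ^ i)"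
    by (intro mult_left_mono e) simp
  also have "\<dots> = (1 / 2) ^ (3 * n) * ((1 / 2) ^ (4 * n)) ^ i"
    by (simp add: mult.assoc[symmetric] power_mult_distrib[symmetric])
  also have "\<dots> \<le> 1 / real n * (1 / 8) ^ i"
  proof (intro mult_mono power_mono)
    have "(1 / 2 :: real) ^ (3 * n) \<le> (1 / 2) ^ n" by (intro power_decreasing) auto
    also have "\<dots> \<le> 1 / real n"
    proof -
      have "real n \<le> 2 ^ n" using less_exp[of n] by (metis less_imp_le of_nat_le_iff of_nat_numeral of_nat_power)
      then show ?thesis using n by (simp add: power_one_over divide_left_mono)
    qed
    finally show "(1 / 2 :: real) ^ (3 * n) \<le> 1 / real n" .
    have "(1 / 2 :: real) ^ (4 * n) \<le> (1 / 2) ^ 3" using n by (intro power_decreasing) auto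
    then show "(1 / 2 :: real) ^ (4 * n) \<le> 1 / 8" by (simp add: power_one_over)
  qed auto
  finally have "2 * (2 ^ n * exp (- (4 * real n * 2 ^ (i * d)))) * 4 ^ Suc i \<le> 2 * (1 / real n * (1 / 8) ^ i) * 4 ^ Suc i"
    by (intro mult_right_mono mult_left_mono) auto
  also have "\<dots> = 8 / real n * ((1 / 8) ^ i * 4 ^ i)" by simp
  also have "(1 / 8 :: real) ^ i * 4 ^ i = (1 / 2) ^ i" by (simp add: power_mult_distrib[symmetric])
  finally show ?thesis .
qed

lemma dyadic_level:
  assumes "0 < a" "a \<le> (b::real)"
  obtains K where "2 ^ K * a \<le> b" "b < 2 * (2 ^ K * a)"
proof -
  obtain m where m: "b / a < 2 ^ m" using real_arch_pow[of 2 "b / a"] by auto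
  define M where "M = (LEAST m. b / a < 2 ^ m)"
  have M: "b / a < 2 ^ M" unfolding M_def by (rule LeastI[of _ m]) (rule m)
  have "M \<noteq> 0"
  proof
    assume "M = 0"
    with M assms show False by (simp add: divide_less_eq)
  qed
  then obtain K where K: "M = Suc K" by (cases M) auto
  have "\<not> b / a < 2 ^ K" using not_less_Least[of K "\<lambda>m. b / a < 2 ^ m"] K unfolding M_def by simp
  then have "2 ^ K * a \<le> b" using assms by (simp add: divide_less_eq)
  moreover have "b < 2 * (2 ^ K * a)" using M assms unfolding K by (simp add: divide_less_eq)
  ultimately show ?thesis using that by blast
qed

lemma root_le_Suc: "1 \<le> d \<Longrightarrow> 0 \<le> y \<Longrightarrow> root d y \<le> 1 + y"
proof -
  assume d: "1 \<le> d" and y: "0 \<le> (y::real)"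
  have "y \<le> (1 + y) ^ 1" by simp
  also have "\<dots> \<le> (1 + y) ^ d" using d y by (intro power_increasing) auto
  finally have "root d y \<le> root d ((1 + y) ^ d)" using d by (intro real_root_le_mono) auto
  then show ?thesis using d y by (simp add: real_root_power_cancel)
qed

text \<open>The limit of the quotient of the two bounds: the roots compare the depths,
  \<open>16 / n\<close> is the total of the deeper shells, and \<open>1 - 1 / n\<close> is the share
  of directions left uncovered by the caps of the best polytope.\<close>

definition growth :: "nat \<Rightarrow> real" where
  "growth n = root (n - 1) 3 * (root (n - 1) (16 * (real n)\<^sup>2))\<^sup>2 * (1 + 16 / real n) / (1 - 1 / real n)"

lemma limsup_ratio:
  assumes j: "1 \<le> j" "j \<le> Suc (Suc k)"
  defines "n \<equiv> Suc (Suc k)"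
  defines "f \<equiv> \<lambda>N. ereal (expected_deviation n j N / best_deviation n j N)"
  shows "1 \<le> limsup f" "limsup f \<le> ereal (growth n)"
proof -
  let ?d = "Suc k" and ?V = "intrinsic_volume n j (unit_ball n)"
  define c where "c = capc ?d"
  define \<mu> where "\<mu> = root ?d 3"
  define \<zeta> where "\<zeta> = root ?d (16 * (real n)\<^sup>2)"
  have c: "0 < c" unfolding c_def by (rule capc_pos)
  have n: "2 \<le> n" by (simp add: n_def)
  have \<mu>: "1 < \<mu>" "\<mu> ^ ?d = 3" by (simp_all add: \<mu>_def real_root_gt_1_iff real_root_pow_pos2 del: power_Suc)
  have \<zeta>: "0 < \<zeta>" "\<zeta> ^ ?d = 16 * (real n)\<^sup>2" using n by (simp_all add: \<zeta>_def real_root_gt_zero real_root_pow_pos2 del: power_Suc)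
  have V: "0 < ?V" using j by (intro iv_ball_pos) (simp add: n_def)
  \<comment> \<open>A tangent that depends on the dimension but not on \<open>N\<close>, below which
    \<open>miss_bound\<close> applies and all depths stay below one.\<close>
  obtain T where T: "0 < T" "2 / 3 \<le> height (\<mu> * T) ^ n" "\<mu> * T\<^sup>2 / 2 < 1"
  proof -
    have "((\<lambda>t. height (\<mu> * t) ^ n) \<longlongrightarrow> (1 / sqrt (1 + (\<mu> * 0)\<^sup>2)) ^ n) (at_right 0)"
      unfolding height_def by (intro tendsto_intros) auto
    then have "\<forall>\<^sub>F t in at_right 0. 2 / 3 < height (\<mu> * t) ^ n" by (rule order_tendstoD(1)) simp
    moreover have "((\<lambda>t. \<mu> * t\<^sup>2 / 2) \<longlongrightarrow> \<mu> * 0\<^sup>2 / 2) (at_right 0)" by (intro tendsto_intros) auto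
    then have "\<forall>\<^sub>F t in at_right 0. \<mu> * t\<^sup>2 / 2 < 1" by (rule order_tendstoD(2)) simp
    ultimately have "\<forall>\<^sub>F t in at_right 0. 0 < t \<and> 2 / 3 \<le> height (\<mu> * t) ^ n \<and> \<mu> * t\<^sup>2 / 2 < 1"
      using eventually_at_right_less[of 0] by eventually_elim auto
    from eventually_happens'[OF trivial_limit_at_right_real this] show ?thesis using that by blast
  qed
  \<comment> \<open>Chosen so that a cap of tangent \<open>t N\<close> has measure at most
    \<open>1 / (n N)\<close>, by \<open>cap_le\<close>.\<close>
  define t where "t N = root ?d (1 / (real n * c * real N))" for N :: nat
  define B where "B N = 2 * (2 ^ n * exp (- (c * (T / 2) ^ ?d / 4) * real N))" for N :: nat
  \<comment> \<open>The quotient of the upper bound for the random polytope by the lower bound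
    \<open>LB\<close> for the best one, with the factors that tend to a limit kept apart.\<close>
  define U where "U N = (1 + real j * (t N)\<^sup>2) * (\<mu> * \<zeta>\<^sup>2 * (1 + 16 / real n) + 2 * (B N / (t N)\<^sup>2) / real j) / (1 - 1 / real n)" for N
  have tpos: "0 < t N" if "1 \<le> N" for N using that n c by (simp add: t_def real_root_gt_zero)
  have tpow: "t N ^ ?d = 1 / (real n * c * real N)" for N using c by (simp add: t_def real_root_pow_pos2 del: power_Suc)
  have "(\<lambda>N. 1 / (real n * c * real N)) \<longlonglongrightarrow> 0"
    using lim_const_over_n[of "1 / (real n * c)"] by (simp add: field_simps)
  then have t0: "t \<longlonglongrightarrow> 0"
    unfolding t_def using tendsto_real_root[of "\<lambda>N. 1 / (real n * c * real N)" 0 sequentially ?d] by simp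
  have main: "best_deviation n j N > 0 \<and> expected_deviation n j N / best_deviation n j N \<le> U N"
    if N: "1 \<le> N" and small: "\<zeta> * t N \<le> T" for N
  proof -
    let ?t = "t N" and ?PS = "Pi\<^sub>M {..<N} (\<lambda>_. sphere_measure n)"
    let ?mean = "\<integral>X. nv n j (phull N X) \<partial>?PS"
    have tp: "0 < ?t" by (rule tpos[OF N])
    have Ncd: "c * ?t ^ ?d = 1 / (real n * real N)" unfolding tpow using c by simp
    define LB where "LB = real j * ?t\<^sup>2 / (2 * (1 + real j * ?t\<^sup>2)) * (1 - 1 / real n)"
    have jt: "0 < real j * ?t\<^sup>2" using j tp by simp
    have n1: "0 < 1 - 1 / real n" using n by (simp add: divide_less_eq)
    have LB0: "0 < LB" unfolding LB_def
      by (rule mult_pos_pos[OF divide_pos_pos[OF jt mult_pos_pos[OF zero_less_numeral add_pos_pos[OF zero_less_one jt]]] n1])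
    have best: "?V * LB \<le> best_deviation n j N"
    proof -
      have "real N * cap ?d (height ?t) \<le> real N * (c * ?t ^ ?d)"
        unfolding c_def by (intro mult_left_mono cap_le tp) auto
      also have "\<dots> = 1 / real n" unfolding Ncd using N by simp
      finally have "1 - 1 / real n \<le> 1 - real N * cap ?d (height ?t)" by simp
      moreover have "0 \<le> real j * ?t\<^sup>2 / (2 * (1 + real j * ?t\<^sup>2))" by (intro divide_nonneg_nonneg) auto
      ultimately have "LB \<le> (1 - height ?t ^ j) * (1 - real N * cap ?d (height ?t))"
        unfolding LB_def using n1 one_minus_height_power[OF tp j(1)]
        by (intro mult_mono) linarith+
      then have "?V * LB \<le> ?V * ((1 - height ?t ^ j) * (1 - real N * cap ?d (height ?t)))"
        using V by (intro mult_left_mono) auto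
      also have "\<dots> \<le> best_deviation n j N"
        unfolding n_def using height_bounds(1)[of ?t] height_bounds(3)[OF tp]
        by (intro best_deviation_ge j N)
      finally show ?thesis .
    qed
    \<comment> \<open>Tangents double from level to level, so depths quadruple, starting at the
      smallest cap for which the miss bound is effective.\<close>
    define S where "S i = 2 ^ i * (\<zeta> * ?t)" for i
    define D where "D i = \<mu> * (S i)\<^sup>2 / 2" for i
    define b where "b i = 2 * (2 ^ n * (1 - c * S i ^ ?d / 4) ^ N)" for i
    have zt: "0 < \<zeta> * ?t" using \<zeta> tp by simp
    \<comment> \<open>The last level below \<open>T\<close> exceeds half of it. Its cap therefore
      has a measure bounded below independently of \<open>N\<close>, and the miss bound there decays
      exponentially in \<open>N\<close>.\<close>
    obtain K where K: "2 ^ K * (\<zeta> * ?t) \<le> T" "T < 2 * (2 ^ K * (\<zeta> * ?t))" by (rule dyadic_level[OF zt small])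
    have S0: "0 < S i" for i using zt by (simp add: S_def)
    have ST: "S i \<le> T" if "i \<le> K" for i
    proof -
      have "S i \<le> S K" unfolding S_def using that zt by (intro mult_right_mono power_increasing) auto
      then show ?thesis using K by (simp add: S_def)
    qed
    have hS: "2 / 3 \<le> height (\<mu> * S i) ^ n" if "i \<le> K" for i
    proof -
      have "height (\<mu> * T) \<le> height (\<mu> * S i)" using ST[OF that] S0[of i] \<mu> by (intro height_antimono) auto
      then have "height (\<mu> * T) ^ n \<le> height (\<mu> * S i) ^ n" using height_bounds(1) by (intro power_mono) (auto intro: less_imp_le)
      then show ?thesis using T by linarith
    qed
    have D: "0 < D i \<and> D i < 1" if "i \<le> K" for i
    proof -
      have "(S i)\<^sup>2 \<le> T\<^sup>2" using ST[OF that] S0[of i] by (intro power_mono) auto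
      then have "\<mu> * (S i)\<^sup>2 \<le> \<mu> * T\<^sup>2" using \<mu> by (intro mult_left_mono) auto
      moreover have "0 < \<mu> * (S i)\<^sup>2" using \<mu>(1) S0[of i] by (intro mult_pos_pos) auto
      ultimately show ?thesis unfolding D_def using T(3) by (intro conjI; linarith)
    qed
    have le1: "c * S i ^ ?d / 4 \<le> 1" if "i \<le> K" for i
      using miss_bound(2)[OF N S0 \<mu> hS[OF that, unfolded n_def], of 0] D[OF that] by (simp add: c_def D_def)
    have b0: "0 \<le> b i" if "i \<le> K" for i using le1[OF that] by (simp add: b_def)
    have mean: "1 - ?mean \<le> real j * D 0 + (\<Sum>i<K. b i * (real j * D (Suc i))) + b K"
      unfolding n_def
    proof (rule one_minus_mean_le[OF N j])
      fix i x assume i: "i \<le> K" "x \<in> espace (Suc (Suc k))" "eucl_norm (Suc (Suc k)) x \<le> 1 - D i"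
      show "emeasure (Pi\<^sub>M {..<N} (\<lambda>_. sphere_measure (Suc (Suc k)))) {X \<in> space (Pi\<^sub>M {..<N} (\<lambda>_. sphere_measure (Suc (Suc k)))). x \<notin> phull N X} \<le> ennreal (b i)"
        unfolding b_def n_def c_def
        by (rule miss_bound(1)[OF N S0 \<mu> hS[OF i(1), unfolded n_def] i(2)]) (use i(3) in \<open>simp add: D_def\<close>)
    qed (use b0 D in auto)
    have bexp: "b i \<le> 2 * (2 ^ n * exp (- (real N * (c * S i ^ ?d / 4))))" if "i \<le> K" for i
      unfolding b_def using le1[OF that] by (intro mult_left_mono power_le_exp) auto
    have NS: "real N * (c * S i ^ ?d / 4) = 4 * real n * 2 ^ (i * ?d)" for i
    proof -
      have "real N * (c * S i ^ ?d / 4) = 2 ^ (i * ?d) * \<zeta> ^ ?d * (real N * (c * ?t ^ ?d)) / 4"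
        unfolding S_def power_mult_distrib power_mult by (simp add: mult_ac del: power_Suc)
      also have "\<dots> = 4 * real n * 2 ^ (i * ?d)"
        unfolding \<zeta>(2) Ncd using N n by (simp add: power2_eq_square del: power_Suc)
      finally show ?thesis .
    qed
    have "(\<Sum>i<K. b i * (real j * D (Suc i))) \<le> (\<Sum>i<K. real j * D 0 * (8 / real n * (1 / 2) ^ i))"
    proof (rule sum_mono)
      fix i assume "i \<in> {..<K}"
      then have i: "i \<le> K" by simp
      have DS: "D (Suc i) = 4 ^ Suc i * D 0"
      proof -
        have "(2 ^ Suc i)\<^sup>2 = (4::real) ^ Suc i" by (simp add: power2_eq_square power_mult_distrib[symmetric] del: power_Suc)
        then show ?thesis unfolding D_def S_def power_mult_distrib by simp
      qed
      have "b i * 4 ^ Suc i \<le> 2 * (2 ^ n * exp (- (4 * real n * 2 ^ (i * ?d)))) * 4 ^ Suc i"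
        using bexp[OF i] unfolding NS by (intro mult_right_mono) auto
      also have "\<dots> \<le> 8 / real n * (1 / 2) ^ i" by (rule level_bound[OF n]) simp
      finally have "real j * D 0 * (b i * 4 ^ Suc i) \<le> real j * D 0 * (8 / real n * (1 / 2) ^ i)"
        using D[of 0] by (intro mult_left_mono) auto
      then show "b i * (real j * D (Suc i)) \<le> real j * D 0 * (8 / real n * (1 / 2) ^ i)"
        unfolding DS by (simp add: mult_ac del: power_Suc)
    qed
    also have "\<dots> = real j * D 0 * (8 / real n) * (\<Sum>i<K. (1 / 2) ^ i)"
      by (simp only: sum_distrib_left mult.assoc)
    also have "\<dots> \<le> real j * D 0 * (8 / real n) * 2"
      using D[of 0] by (intro mult_left_mono sum_half_powers) auto
    finally have sum: "(\<Sum>i<K. b i * (real j * D (Suc i))) \<le> real j * D 0 * (16 / real n)" by (simp add: mult_ac)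
    have bK: "b K \<le> B N"
    proof -
      have "(T / 2) ^ ?d \<le> S K ^ ?d" using K(2) T(1) by (intro power_mono) (auto simp: S_def)
      then have "c / 4 * real N * (T / 2) ^ ?d \<le> c / 4 * real N * S K ^ ?d"
        using c by (intro mult_left_mono) auto
      then have "c * (T / 2) ^ ?d / 4 * real N \<le> real N * (c * S K ^ ?d / 4)"
        by (simp only: times_divide_eq_left times_divide_eq_right mult_ac)
      then have "exp (- (real N * (c * S K ^ ?d / 4))) \<le> exp (- (c * (T / 2) ^ ?d / 4) * real N)"
        by (simp del: power_Suc)
      then show ?thesis unfolding B_def by (intro order_trans[OF bexp[OF order_refl]] mult_left_mono) auto
    qed
    have D0: "D 0 = \<mu> * \<zeta>\<^sup>2 / 2 * ?t\<^sup>2" by (simp add: D_def S_def power_mult_distrib)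
    have "1 - ?mean \<le> real j * D 0 * (1 + 16 / real n) + B N"
      using mean sum bK by (simp add: distrib_left)
    also have "\<dots> = U N * LB"
    proof -
      have t2: "?t\<^sup>2 \<noteq> 0" and j0: "real j \<noteq> 0" and nn: "1 - 1 / real n \<noteq> 0"
        using tp j n1 by auto
      have j1: "1 + real j * ?t\<^sup>2 \<noteq> 0" using jt by linarith
      have cancel: "P * X / r * (Y / (2 * P) * r) = X * (Y / 2)" if "P \<noteq> 0" "r \<noteq> 0" for P X Y r :: real
        using that by simp
      have alg: "J * (A / 2 * q) * m + b = (1 + J * q) * (A * m + 2 * (b / q) / J) / r * (J * q / (2 * (1 + J * q)) * r)"
        if "q \<noteq> 0" "J \<noteq> 0" "1 + J * q \<noteq> 0" "r \<noteq> 0" for J A q m b r :: real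
      proof -
        have "(1 + J * q) * (A * m + 2 * (b / q) / J) / r * (J * q / (2 * (1 + J * q)) * r) =
          (A * m + 2 * (b / q) / J) * (J * q / 2)" by (rule cancel[OF that(3,4)])
        also have "\<dots> = J * (A / 2 * q) * m + b" using that by (simp add: distrib_right)
        finally show ?thesis by simp
      qed
      show ?thesis unfolding D0 U_def LB_def by (rule alg[OF t2 j0 j1 nn])
    qed
    finally have "1 - ?mean \<le> U N * LB" .
    then have "expected_deviation n j N \<le> ?V * (U N * LB)"
      using V expected_deviation_eq[OF N j] unfolding n_def by (simp add: mult_left_mono)
    moreover have bp: "0 < best_deviation n j N" using best V LB0 by (smt (verit) mult_pos_pos)
    moreover have "?V * (U N * LB) \<le> U N * best_deviation n j N"
    proof -
      have "0 \<le> B N" by (simp add: B_def)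
      then have "0 \<le> U N" unfolding U_def using n j(1) n1 \<mu>(1) jt tp
        by (intro divide_nonneg_pos mult_nonneg_nonneg add_nonneg_nonneg) auto
      then show ?thesis using mult_left_mono[OF best, of "U N"] by (simp add: mult_ac)
    qed
    ultimately show ?thesis by (simp add: divide_le_eq)
  qed
  have "(\<lambda>N. \<zeta> * t N) \<longlonglongrightarrow> \<zeta> * 0" by (intro tendsto_mult tendsto_const t0)
  then have "\<forall>\<^sub>F N in sequentially. \<zeta> * t N < T" using T(1) by (intro order_tendstoD(2)) auto
  then have ev: "\<forall>\<^sub>F N in sequentially. 1 \<le> N \<and> \<zeta> * t N \<le> T"
    using eventually_ge_at_top[of "1::nat"] by eventually_elim auto
  have "\<forall>\<^sub>F N in sequentially. 1 \<le> f N"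
    using ev
  proof eventually_elim
    case (elim N)
    then have "best_deviation n j N \<le> expected_deviation n j N"
      unfolding n_def by (intro best_le_expected j) auto
    then show ?case using main[of N] elim by (simp add: f_def le_divide_eq)
  qed
  then show "1 \<le> limsup f" by (intro le_Limsup) auto
  have B0: "(\<lambda>N. B N / (t N)\<^sup>2) \<longlonglongrightarrow> 0"
  proof (rule tendsto_sandwich[where f = "\<lambda>_. 0"])
    let ?g = "\<lambda>N. 2 * 2 ^ n * ((1 + real n * c * real N)\<^sup>2 * exp (- (c * (T / 2) ^ ?d / 4) * real N))"
    have "?g \<longlonglongrightarrow> 2 * 2 ^ n * 0"
      by (rule tendsto_mult[OF tendsto_const exp_decay_poly]) (use n c T(1) in auto)
    then show "?g \<longlonglongrightarrow> 0" by simp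
    show "\<forall>\<^sub>F N in sequentially. 0 \<le> B N / (t N)\<^sup>2" by (simp add: B_def)
    show "\<forall>\<^sub>F N in sequentially. B N / (t N)\<^sup>2 \<le> ?g N"
      using eventually_ge_at_top[of "1::nat"]
    proof eventually_elim
      case (elim N)
      have "inverse (t N) = root ?d (real n * c * real N)"
        unfolding t_def by (simp add: real_root_divide)
      also have "\<dots> \<le> 1 + real n * c * real N" using c by (intro root_le_Suc) auto
      finally have "(inverse (t N))\<^sup>2 \<le> (1 + real n * c * real N)\<^sup>2"
        using tpos[OF elim] by (intro power_mono) auto
      then have "B N * (inverse (t N))\<^sup>2 \<le> B N * (1 + real n * c * real N)\<^sup>2"
        by (intro mult_left_mono) (auto simp: B_def)
      then show ?case by (simp only: B_def divide_inverse power_inverse mult_ac)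
    qed
  qed simp
  have "U \<longlonglongrightarrow> (1 + real j * 0\<^sup>2) * (\<mu> * \<zeta>\<^sup>2 * (1 + 16 / real n) + 2 * 0 / real j) / (1 - 1 / real n)"
    unfolding U_def using j n by (intro tendsto_intros t0 B0) auto
  also have "(1 + real j * 0\<^sup>2) * (\<mu> * \<zeta>\<^sup>2 * (1 + 16 / real n) + 2 * 0 / real j) / (1 - 1 / real n) = growth n"
    by (simp add: growth_def \<mu>_def \<zeta>_def n_def)
  finally have "(\<lambda>N. ereal (U N)) \<longlonglongrightarrow> ereal (growth n)" by simp
  then have "limsup (\<lambda>N. ereal (U N)) = ereal (growth n)" by (rule lim_imp_Limsup[rotated]) simp
  moreover have "limsup f \<le> limsup (\<lambda>N. ereal (U N))"
  proof (rule Limsup_mono)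
    show "\<forall>\<^sub>F N in sequentially. f N \<le> ereal (U N)"
      using ev by eventually_elim (use main in \<open>auto simp: f_def\<close>)
  qed
  ultimately show "limsup f \<le> ereal (growth n)" by simp
qed

text \<open>For \<open>y\<close> between 0 and 1 every higher power is at most \<open>y\<close>, so
  the product of the three error factors is again linear in \<open>y\<close>.\<close>

lemma product_linear_bound:
  fixes a b c y :: real
  assumes "0 \<le> a" "0 \<le> b" "0 \<le> c" "0 \<le> y" "y \<le> 1"
  shows "(1 + a * y) * (1 + b * y) * (1 + c * y) \<le> 1 + (1 + a) * (1 + b) * (1 + c) * y"
proof -
  have y2: "y * y \<le> y" "y * y * y \<le> y" using assms by (auto simp: mult_left_le mult_le_one intro: order_trans[OF mult_left_le])
  have "(1 + a * y) * (1 + b * y) * (1 + c * y) = 1 + (a + b + c) * y + (a * b + b * c + c * a) * (y * y) + a * b * c * (y * y * y)"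
    by (simp add: algebra_simps)
  also have "\<dots> \<le> 1 + (a + b + c) * y + (a * b + b * c + c * a) * y + a * b * c * y"
    using assms y2 by (intro add_mono mult_left_mono order_refl) auto
  also have "\<dots> \<le> 1 + (1 + a) * (1 + b) * (1 + c) * y"
    using assms by (simp add: algebra_simps)
  finally show ?thesis .
qed

lemma growth_le:
  assumes n: "2 \<le> n"
  shows "growth n \<le> 1 + (1 + 28 * exp 28) * 33 * 5 * (ln (real n) / real n)"
proof -
  define y where "y = ln (real n) / real n"
  define d where "d = n - 1"
  have d: "1 \<le> d" "real d = real n - 1" "0 < d" using n by (auto simp: d_def)
  have ln2: "1 / 2 \<le> ln (real n)"
  proof -
    have "1 / 2 \<le> ln (2::real)" using ln2_ge_two_thirds by linarith
    also have "\<dots> \<le> ln (real n)" using n by simp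
    finally show ?thesis .
  qed
  have y: "0 \<le> y" "y \<le> 1" using n ln2 ln_le_minus_one[of "real n"] by (auto simp: y_def divide_le_eq)
  have inv: "1 / real n \<le> 2 * y" using n ln2 by (simp add: y_def field_simps)
  have pos: "0 < 768 * real n ^ 4" using n by simp
  \<comment> \<open>The constant 768 is 3 times the square of 16.\<close>
  have "root d 3 * (root d (16 * (real n)\<^sup>2))\<^sup>2 = root d (768 * real n ^ 4)"
  proof -
    have "(root d (16 * (real n)\<^sup>2))\<^sup>2 = root d ((16 * (real n)\<^sup>2)\<^sup>2)"
      by (rule real_root_power[OF d(3), symmetric])
    then show ?thesis using d by (simp add: real_root_mult[symmetric] power_mult_distrib power_mult[symmetric])
  qed
  also have "\<dots> = exp (ln (768 * real n ^ 4) / real d)"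
    using d pos by (simp add: root_powr_inverse powr_def)
  also have "\<dots> \<le> exp (28 * y)"
  proof -
    \<comment> \<open>As 768 is below \<open>2 ^ 10\<close> and \<open>n\<close> is at least 2, the
      logarithm is at most 10 + 4 = 14 times \<open>ln n\<close>; replacing \<open>d\<close> by the
      smaller \<open>n / 2\<close> doubles this to 28.\<close>
    have "ln (768::real) \<le> ln (2 ^ 10)" by (subst ln_le_cancel_iff) auto
    also have "\<dots> = 10 * ln 2" by (subst ln_realpow) auto
    also have "\<dots> \<le> 10 * ln (real n)" using n by simp
    finally have "ln (768 * real n ^ 4) \<le> 14 * ln (real n)" using n by (simp add: ln_mult ln_realpow)
    then have "ln (768 * real n ^ 4) / real d \<le> 14 * ln (real n) / real d" using d by (intro divide_right_mono) auto
    also have "\<dots> \<le> 14 * ln (real n) / (real n / 2)" using d n ln2 by (intro divide_left_mono) auto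
    finally show ?thesis by (simp add: y_def)
  qed
  also have "\<dots> \<le> 1 + 28 * exp 28 * y"
  proof -
    have "(1 - 28 * y) * exp (28 * y) \<le> exp (- (28 * y)) * exp (28 * y)"
      using exp_ge_add_one_self[of "- (28 * y)"] by (intro mult_right_mono) auto
    then have "exp (28 * y) \<le> 1 + 28 * y * exp (28 * y)" by (simp add: algebra_simps flip: exp_add)
    also have "\<dots> \<le> 1 + 28 * y * exp 28" using y by (intro add_left_mono mult_left_mono) auto
    finally show ?thesis by (simp add: mult_ac)
  qed
  finally have A: "root d 3 * (root d (16 * (real n)\<^sup>2))\<^sup>2 \<le> 1 + 28 * exp 28 * y" .
  have B: "1 + 16 / real n \<le> 1 + 32 * y" using inv by (simp add: field_simps)
  have C: "1 / (1 - 1 / real n) \<le> 1 + 4 * y"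
  proof -
    have "1 / (1 - 1 / real n) = 1 + 1 / (real n - 1)" using n by (simp add: field_simps)
    also have "1 / (real n - 1) \<le> 2 * (1 / real n)" using n by (simp add: field_simps)
    also have "\<dots> \<le> 4 * y" using inv by simp
    finally show ?thesis by simp
  qed
  have "growth n = (root d 3 * (root d (16 * (real n)\<^sup>2))\<^sup>2) * (1 + 16 / real n) * (1 / (1 - 1 / real n))"
    by (simp add: growth_def d_def)
  also have "\<dots> \<le> (1 + 28 * exp 28 * y) * (1 + 32 * y) * (1 + 4 * y)"
    using n y d by (intro mult_mono A B C mult_nonneg_nonneg add_nonneg_nonneg) auto
  also have "\<dots> \<le> 1 + (1 + 28 * exp 28) * (1 + 32) * (1 + 4) * y"
    by (rule product_linear_bound) (use y in auto)
  finally show ?thesis by (simp add: y_def)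
qed

theorem corollary14:
  shows "\<exists>C::real. \<forall>n::nat. n \<ge> 2 \<longrightarrow> (\<forall>j\<in>{1..n}.
           \<bar>limsup (\<lambda>N. ereal (expected_deviation n j N / best_deviation n j N)) - 1\<bar>
             \<le> ereal (C * (ln (real n) / real n)))"
proof (intro exI allI impI ballI)
  fix n j :: nat
  assume n: "n \<ge> 2" and j: "j \<in> {1..n}"
  let ?l = "limsup (\<lambda>N. ereal (expected_deviation n j N / best_deviation n j N))"
  obtain k where k: "n = Suc (Suc k)" using n by (metis Suc_le_D numeral_2_eq_2 Suc_le_mono)
  have l: "1 \<le> ?l" "?l \<le> ereal (growth n)"
    using limsup_ratio[of j k] j unfolding k by auto
  have "growth n \<le> 1 + (1 + 28 * exp 28) * 33 * 5 * (ln (real n) / real n)" by (rule growth_le[OF n])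
  with l show "\<bar>?l - 1\<bar> \<le> ereal ((1 + 28 * exp 28) * 33 * 5 * (ln (real n) / real n))"
    by (cases ?l) (auto simp: one_ereal_def)
qed

end
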